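(* Let $K$ be the universal Knaster continuum and let $\mathrm{Homeo}^1(K)$ be the group of degree-one homeomorphisms of $K$, with the topology of uniform convergence. Then $\mathrm{Homeo}^1(K)$ has a comeager conjugacy class; that is, there is $u\in \mathrm{Homeo}^1(K)$ such that $\{h^{-1}uh : h\in \mathrm{Homeo}^1(K)\}$ is comeager in $\mathrm{Homeo}^1(K)$.
   Context: $\mathbb{N}=\{0,1,2,\dots\}$. For an integer $d\ge 1$, the standard degree-$d$ tent map $T_d:[0,1]\to[0,1]$ is defined by $T_d(x)=dx-m$ if $x\in[\frac{m}{d},\frac{m+1}{d}]$ with $m$ even, and $T_d(x)=1+m-dx$ if $x\in[\frac{m}{d},\frac{m+1}{d}]$ with $m$ odd ($0\le m\le d-1$). Fix a sequence of primes $(p_n)_{n\ge 1}$ in which every prime number appears infinitely many times. The universal Knaster continuum is the inverse limit $K=\varprojlim(I_n,T_{p_n})$, where $I_n=[0,1]$ for each $n\in\mathbb{N}$ and $T_{p_n}:I_n\to I_{n-1}$ for $n\ge1$; $\pi_n:K\to I_n$ is the $n$th coordinate projection. Degree of an open interval map: for a continuous open map $g:[0,1]\to[0,1]$, $\deg(g)$ is the minimal $k\in\mathbb{N}$ such that there exist $0=i_0<i_1<\dots<i_k=1$ with $g$ monotone on each $[i_j,i_{j+1}]$, $0\le j\le k-1$. Degree of a homeomorphism of $K$: by a theorem of Dębski, for each $f\in\mathrm{Homeo}(K)$ there are continuous open maps $f_n:I_n\to[0,1]$ with $\sup_{x\in K}|f_n(\pi_n(x))-\pi_0(f(x))|\to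 0$ as $n\to\infty$; one sets $\deg(f)=\lim_{n\to\infty}\deg(f_n)/\prod_{i=1}^n p_i$. This is well defined (the sequence is eventually constant) and $\deg$ is a continuous group homomorphism from $\mathrm{Homeo}(K)$ (uniform-convergence topology) onto the multiplicative group of positive rationals with the discrete topology. $\mathrm{Homeo}^1(K)=\ker(\deg)$ is the resulting open normal subgroup; it is a Polish group. *)

theory Defs
  imports
    "HOL-Analysis.Analysis"
    "HOL-Computational_Algebra.Primes"
    "HOL-Algebra.Bij"
begin

text \<open>The piece containing \<open>x\<close> has index \<open>m = \<lfloor>d x\<rfloor>\<close>, except that \<open>x = 1\<close> gets \<open>m = d\<close>
  instead of \<open>d - 1\<close>; both indices give the same value there, and the pieces agree at all
  break points, see \<open>tent_map_even\<close> and \<open>tent_map_odd\<close>.\<close>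
definition tent_map :: "nat \<Rightarrow> real \<Rightarrow> real" where
  "tent_map d x =
     (let m = \<lfloor>real d * x\<rfloor>
      in if even m then real d * x - of_int m else 1 + of_int m - real d * x)"

lemma floor_piece_cases:
  assumes "d \<ge> 1" "x \<in> {real m / real d .. (real m + 1) / real d}"
  obtains "\<lfloor>real d * x\<rfloor> = int m" | "real d * x = real m + 1" "\<lfloor>real d * x\<rfloor> = int m + 1"
proof -
  have lo: "real m \<le> real d * x" and hi: "real d * x \<le> real m + 1"
    using assms by (auto simp: field_simps)
  show ?thesis
  proof (cases "real d * x = real m + 1")
    case True
    then have "\<lfloor>real d * x\<rfloor> = int m + 1" by linarith
    with True that(2) show ?thesis by blast
  next
    case False
    with lo hi have "\<lfloor>real d * x\<rfloor> = int m" by linarith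
    with that(1) show ?thesis by blast
  qed
qed

lemma tent_map_even:
  assumes "d \<ge> 1" "even m" "x \<in> {real m / real d .. (real m + 1) / real d}"
  shows "tent_map d x = real d * x - real m"
  using assms(1,3) by (rule floor_piece_cases) (use assms(2) in \<open>auto simp: tent_map_def\<close>)

lemma tent_map_odd:
  assumes "d \<ge> 1" "odd m" "x \<in> {real m / real d .. (real m + 1) / real d}"
  shows "tent_map d x = 1 + real m - real d * x"
  using assms(1,3) by (rule floor_piece_cases) (use assms(2) in \<open>auto simp: tent_map_def\<close>)

text \<open>Only the terms \<open>p n\<close> with \<open>n \<ge> 1\<close> are used.\<close>
definition universal_prime_sequence :: "(nat \<Rightarrow> nat) \<Rightarrow> bool" where
  "universal_prime_sequence p \<longleftrightarrow>
     (\<forall>n\<ge>1. prime (p n)) \<and> (\<forall>q. prime q \<longrightarrow> infinite {n. n \<ge> 1 \<and> p n = q})"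

text \<open>The inverse limit, as a subspace of the product space \<^typ>\<open>nat \<Rightarrow> real\<close>; the projection
  \<open>\<pi>\<^sub>n\<close> is \<open>\<lambda>x. x n\<close>.\<close>
definition knaster :: "(nat \<Rightarrow> nat) \<Rightarrow> (nat \<Rightarrow> real) set" where
  "knaster p = {x. (\<forall>n. x n \<in> {0..1}) \<and> (\<forall>n\<ge>1. tent_map (p n) (x n) = x (n - 1))}"

definition open_interval_map :: "(real \<Rightarrow> real) \<Rightarrow> bool" where
  "open_interval_map g \<longleftrightarrow>
     continuous_map (top_of_set {0..1}) (top_of_set {0..1}) g \<and>
     open_map (top_of_set {0..1}) (top_of_set {0..1}) g"

definition interval_degree :: "(real \<Rightarrow> real) \<Rightarrow> nat" where
  "interval_degree g =
     (LEAST k. \<exists>i :: nat \<Rightarrow> real. i 0 = 0 \<and> i k = 1 \<and>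
        (\<forall>j<k. i j < i (Suc j) \<and>
               (mono_on {i j .. i (Suc j)} g \<or> antimono_on {i j .. i (Suc j)} g)))"

text \<open>Self-maps of \<open>K = knaster p\<close> are represented by functions that are \<^const>\<open>undefined\<close> outside
  \<open>K\<close>, as in \<^const>\<open>Bij\<close>; the group operation is that of \<^const>\<open>BijGroup\<close>, i.e. composition.\<close>
definition knaster_homeos :: "(nat \<Rightarrow> nat) \<Rightarrow> ((nat \<Rightarrow> real) \<Rightarrow> (nat \<Rightarrow> real)) set" where
  "knaster_homeos p =
     {f \<in> Bij (knaster p). homeomorphic_map (top_of_set (knaster p)) (top_of_set (knaster p)) f}"

definition has_knaster_degree ::
    "(nat \<Rightarrow> nat) \<Rightarrow> ((nat \<Rightarrow> real) \<Rightarrow> (nat \<Rightarrow> real)) \<Rightarrow> real \<Rightarrow> bool" where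
  "has_knaster_degree p f q \<longleftrightarrow>
     (\<exists>g :: nat \<Rightarrow> real \<Rightarrow> real.
        (\<forall>n. open_interval_map (g n)) \<and>
        (\<lambda>n. SUP x\<in>knaster p. \<bar>g n (x n) - f x 0\<bar>) \<longlonglongrightarrow> 0 \<and>
        (\<lambda>n. real (interval_degree (g n)) / real (\<Prod>i=1..n. p i)) \<longlonglongrightarrow> q)"

text \<open>By a theorem of Debski every homeomorphism of the universal Knaster continuum has exactly
  one degree, and it is positive. The value 0 is only a default that makes the definition total.\<close>
definition knaster_degree ::
    "(nat \<Rightarrow> nat) \<Rightarrow> ((nat \<Rightarrow> real) \<Rightarrow> (nat \<Rightarrow> real)) \<Rightarrow> real" where
  "knaster_degree p f =
     (if \<exists>q. has_knaster_degree p f q then THE q. has_knaster_degree p f q else 0)"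

definition knaster_homeos1 :: "(nat \<Rightarrow> nat) \<Rightarrow> ((nat \<Rightarrow> real) \<Rightarrow> (nat \<Rightarrow> real)) set" where
  "knaster_homeos1 p = {f \<in> knaster_homeos p. knaster_degree p f = 1}"

text \<open>The topology of uniform convergence: \<^const>\<open>cfunspace\<close> carries the supremum metric, here over
  the metric of \<^typ>\<open>nat \<Rightarrow> real\<close>, which induces the product topology. As \<open>K\<close> is compact, another
  compatible metric would give the same topology.\<close>
definition knaster_homeos1_topology ::
    "(nat \<Rightarrow> nat) \<Rightarrow> ((nat \<Rightarrow> real) \<Rightarrow> (nat \<Rightarrow> real)) topology" where
  "knaster_homeos1_topology p =
     subtopology (mtopology_of (cfunspace (top_of_set (knaster p)) euclidean_metric))
       (knaster_homeos1 p)"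

lemma topspace_knaster_homeos1_topology:
  "topspace (knaster_homeos1_topology p) = knaster_homeos1 p"
proof -
  have "f \<in> mspace (cfunspace (top_of_set (knaster p)) euclidean_metric)"
    if "f \<in> knaster_homeos1 p" for f
  proof -
    have f: "f ` knaster p = knaster p" "f \<in> extensional (knaster p)"
      using that by (auto simp: knaster_homeos1_def knaster_homeos_def Bij_def bij_betw_def)
    have cont: "continuous_map (top_of_set (knaster p)) (top_of_set (knaster p)) f"
      using that unfolding knaster_homeos1_def knaster_homeos_def
      by (blast intro: homeomorphic_imp_continuous_map)
    have "compactin (product_topology (\<lambda>_. euclidean) UNIV) (PiE UNIV (\<lambda>_::nat. {0..1::real}))"
      by (simp add: compactin_PiE)
    then have "compact (PiE UNIV (\<lambda>_::nat. {0..1::real}))"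
      by (simp add: euclidean_product_topology)
    then have "bounded (knaster p)"
      by (rule bounded_subset[OF compact_imp_bounded]) (auto simp: knaster_def)
    then have "bounded (f ` knaster p)" using f by simp
    then show ?thesis
      using f cont by (auto simp: continuous_map_in_subtopology)
  qed
  then show ?thesis
    by (auto simp: knaster_homeos1_topology_def)
qed

definition nowhere_dense_in :: "'a topology \<Rightarrow> 'a set \<Rightarrow> bool" where
  "nowhere_dense_in X S \<longleftrightarrow> S \<subseteq> topspace X \<and> X interior_of (X closure_of S) = {}"

definition meager_in :: "'a topology \<Rightarrow> 'a set \<Rightarrow> bool" where
  "meager_in X S \<longleftrightarrow> (\<exists>\<N>. countable \<N> \<and> (\<forall>N\<in>\<N>. nowhere_dense_in X N) \<and> S = \<Union>\<N>)"

definition comeager_in :: "'a topology \<Rightarrow> 'a set \<Rightarrow> bool" where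
  "comeager_in X S \<longleftrightarrow> S \<subseteq> topspace X \<and> meager_in X (topspace X - S)"

end

theory Submission
  imports Defs
begin

text \<open>Let \<open>zig\<close> be the periodic extension of the tent map to the real line and \<open>P\<^sub>n = p\<^sub>1 \<cdots> p\<^sub>n\<close>. The map
  \<open>\<phi>(t) = (zig (t / P\<^sub>n))\<^sub>n\<close> sends the half-line bijectively onto the dense arc component of the end
  point \<open>\<phi>(0)\<close> of \<open>K\<close>. A homeomorphism of \<open>K\<close> fixes the end point and preserves its arc component, so
  it lifts to an odd increasing homeomorphism \<open>F\<close> of the line, and it has degree one iff \<open>F\<close> and its
  inverse are uniform limits of homeomorphisms that commute with the translation by some \<open>2 P\<^sub>n\<close>.

  In this group of lifts a comeager conjugacy class is obtained by a Baire category and back-and-forth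
  argument from two transitivity properties: any two open sets contain conjugate elements,
  and near a dense set of maps \<open>F\<^sub>0\<close> any two open sets contain elements that are conjugate by a map
  close to the identity. For the first, two homeomorphisms of an interval become conjugate after each is
  extended by a tiny copy of the other. For the second, choose \<open>F\<^sub>0\<close> without fixed points on a fine grid.
  A map close to \<open>F\<^sub>0\<close> can be perturbed to be the identity on an interval in each cell in which the sign of
  \<open>F\<^sub>0 x - x\<close> changes. Between these cells it is conjugate to a translation, and shadowing shows that the
  conjugating maps stay close to the identity; inside the cells the first construction applies.\<close>

text \<open>On the half-line the sup metric of \<open>K\<close> becomes the sup metric on lifts:
  \<open>\<phi>\<close> is Lipschitz, and the coordinate 0 of \<open>\<phi> (F t)\<close> is
  \<open>zig (F t)\<close>, which for monotone \<open>F\<close> determines \<open>F\<close> up to a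
  uniform error. Conjugacy can therefore be studied on increasing maps of the line. Two obstacles
  shape the argument. A uniform limit of increasing homeomorphisms need not be injective, so limits
  are taken together with the inverses. And the maps near a given \<open>F\<^sub>0\<close> of period
  \<open>2 P\<^sub>n\<close> are approximated by maps of much larger period
  \<open>2 P\<^sub>m\<close>, while the neighbourhood of \<open>F\<^sub>0\<close> has to be chosen
  before \<open>m\<close> is known. All constants are therefore read off from
  \<open>F\<^sub>0\<close> on one of its own periods. What keeps them finite is oddness: reflection
  in a multiple of \<open>P\<^sub>n\<close> reverses the direction in which \<open>F\<^sub>0\<close>
  moves a point, so a run of cells without change of sign is shorter than \<open>P\<^sub>n\<close>,
  and orbits cross it in a bounded number of steps.\<close>

definition zig :: "real \<Rightarrow> real" where
  "zig t = (let m = \<lfloor>t\<rfloor> in if even m then t - of_int m else 1 + of_int m - t)"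

lemma tent_map_zig: "tent_map d x = zig (real d * x)"
  by (simp add: tent_map_def zig_def)

lemma zig_nonneg [simp]: "0 \<le> zig t" and zig_le_1 [simp]: "zig t \<le> 1"
  unfolding zig_def Let_def by auto linarith+

lemma zig_shift [simp]: "zig (t + 2 * of_int k) = zig t"
proof -
  have "\<lfloor>t + 2 * of_int k\<rfloor> = \<lfloor>t\<rfloor> + 2 * k"
    by (metis floor_add_int of_int_mult of_int_numeral)
  then show ?thesis
    by (simp add: zig_def Let_def)
qed

lemma zig_ident: "zig t = t" if "0 \<le> t" "t \<le> 1"
  proof (cases "t = 1")
  case False
  then have "\<lfloor>t\<rfloor> = 0" using that by linarith
  then show ?thesis by (simp add: zig_def)
qed (simp add: zig_def)

lemma zig_decomp: obtains k :: int where "t = 2 * of_int k + zig t" | k :: int where "t = 2 * of_int k - zig t"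
proof (cases "even \<lfloor>t\<rfloor>")
  case True
  then obtain k where "\<lfloor>t\<rfloor> = 2 * k" by blast
  then show ?thesis using that(1)[of k] by (simp add: zig_def)
next
  case False
  then obtain k where "\<lfloor>t\<rfloor> = 2 * k + 1" using oddE by blast
  then show ?thesis using that(2)[of "k+1"] by (simp add: zig_def)
qed

lemma zig_minus [simp]: "zig (- t) = zig t"
proof -
  define m where "m = \<lfloor>t\<rfloor>"
  show ?thesis
  proof (cases "t = of_int m")
    case True
    then show ?thesis by (simp add: zig_def)
  next
    case False
    then have "\<lfloor>- t\<rfloor> = - m - 1" unfolding m_def by linarith
    then show ?thesis by (simp add: zig_def Let_def m_def)
  qed
qed

lemma zig_reflect [simp]: "zig (2 * of_int k - t) = zig t"
  using zig_shift[of "- t" k] by (simp add: algebra_simps)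

lemma zig_of_int: "zig (of_int k) = (if even k then 0 else 1)"
  by (simp add: zig_def)

lemma zig_of_nat: "zig (of_nat k) = (if even k then 0 else 1)"
  using zig_of_int[of "int k"] by simp

lemma zig_0 [simp]: "zig 0 = 0" and zig_1 [simp]: "zig 1 = 1"
  using zig_ident[of 0] zig_ident[of 1] by auto

lemma zig_mult: "zig (real d * zig t) = zig (real d * t)"
proof (cases rule: zig_decomp[of t])
  case (1 k)
  have "zig (real d * t) = zig (real d * zig t + 2 * of_int (int d * k))"
    by (subst 1) (simp add: algebra_simps)
  then show ?thesis by (simp only: zig_shift)
next
  case (2 k)
  have "zig (real d * t) = zig (2 * of_int (int d * k) - real d * zig t)"
    by (subst 2) (simp add: algebra_simps)
  then show ?thesis by (simp only: zig_reflect)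
qed

text \<open>The fibres of \<open>zig\<close> are the orbits of the group generated by
  \<open>t \<mapsto> - t\<close> and \<open>t \<mapsto> t + 2\<close>. Moving \<open>a\<close> and
  \<open>b\<close> within their orbits into the unit interval turns the difference of the values
  into a difference or a sum of the arguments.\<close>

lemma zig_close:
  assumes "\<bar>zig a - zig b\<bar> \<le> e"
  obtains k :: int where "\<bar>a - b - 2 * of_int k\<bar> \<le> e" | k :: int where "\<bar>a + b - 2 * of_int k\<bar> \<le> e"
proof -
  have "(\<exists>k::int. \<bar>a - b - 2 * of_int k\<bar> \<le> e) \<or> (\<exists>k::int. \<bar>a + b - 2 * of_int k\<bar> \<le> e)"
  proof (cases rule: zig_decomp[of a]; cases rule: zig_decomp[of b])
    fix k l :: int assume *: "a = 2 * of_int k + zig a" "b = 2 * of_int l + zig b"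
    then have "\<bar>a - b - 2 * of_int (k - l)\<bar> \<le> e" using assms by simp
    then show ?thesis by blast
  next
    fix k l :: int assume *: "a = 2 * of_int k + zig a" "b = 2 * of_int l - zig b"
    then have "\<bar>a + b - 2 * of_int (k + l)\<bar> \<le> e" using assms by simp
    then show ?thesis by blast
  next
    fix k l :: int assume *: "a = 2 * of_int k - zig a" "b = 2 * of_int l + zig b"
    then have "\<bar>a + b - 2 * of_int (k + l)\<bar> \<le> e" using assms by simp
    then show ?thesis by blast
  next
    fix k l :: int assume *: "a = 2 * of_int k - zig a" "b = 2 * of_int l - zig b"
    then have "\<bar>a - b - 2 * of_int (k - l)\<bar> \<le> e" using assms by simp
    then show ?thesis by blast
  qed
  then show ?thesis using that by blast
qed

lemma zig_eq_cases:
  assumes "zig a = zig b"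
  obtains k :: int where "a = b + 2 * of_int k" | k :: int where "a = 2 * of_int k - b"
proof -
  have "\<bar>zig a - zig b\<bar> \<le> 0" using assms by simp
  then show ?thesis
    by (cases rule: zig_close) (use that in \<open>auto simp: algebra_simps\<close>)
qed

section \<open>Metric properties of \<open>zig\<close>, and recovering a map from its composition
  with \<open>zig\<close>\<close>

lemma zig_le_dist_even: "zig t \<le> \<bar>t - 2 * of_int k\<bar>"
proof (cases "\<bar>t - 2 * of_int k\<bar> \<le> 1")
  case True
  have "zig t = zig (t + 2 * of_int (-k))" by (rule zig_shift[symmetric])
  also have "\<dots> = zig \<bar>t - 2 * of_int k\<bar>" by (auto simp: abs_if simp flip: zig_minus[of "t - _"])
  also have "\<dots> = \<bar>t - 2 * of_int k\<bar>" using True by (simp add: zig_ident)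
  finally show ?thesis by simp
next
  case False
  then show ?thesis using zig_le_1[of t] by linarith
qed

lemma zig_lipschitz: "\<bar>zig s - zig t\<bar> \<le> \<bar>s - t\<bar>"
proof -
  have "zig s \<le> zig t + \<bar>s - t\<bar>" for s t
  proof (cases rule: zig_decomp[of t])
    case (1 k)
    have "zig s \<le> \<bar>s - 2 * of_int k\<bar>" by (rule zig_le_dist_even)
    also have "\<dots> \<le> \<bar>s - t\<bar> + zig t" using 1 zig_nonneg[of t] by linarith
    finally show ?thesis by simp
  next
    case (2 k)
    have "zig s \<le> \<bar>s - 2 * of_int k\<bar>" by (rule zig_le_dist_even)
    also have "\<dots> \<le> \<bar>s - t\<bar> + zig t" using 2 zig_nonneg[of t] by linarith
    finally show ?thesis by simp
  qed
  from this[of s t] this[of t s] show ?thesis by linarith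
qed

lemma continuous_on_zig [continuous_intros]:
  assumes "continuous_on A f" shows "continuous_on A (\<lambda>x. zig (f x))"
proof -
  have "isCont zig t" for t
  proof -
    have "(\<lambda>s. zig s - zig t) \<midarrow>t\<rightarrow> 0"
      by (rule Lim_null_comparison[where g = "\<lambda>s. \<bar>s - t\<bar>"])
        (auto intro!: always_eventually zig_lipschitz tendsto_eq_intros)
    then show ?thesis by (simp add: isCont_def LIM_zero_iff)
  qed
  then have "continuous_on UNIV zig" by (simp add: continuous_on_eq_continuous_at)
  then show ?thesis using assms continuous_on_compose2 by blast
qed

text \<open>Leads from uniform continuity on \<open>K\<close>, which sees only \<open>zig\<close>,
  to uniform continuity on the line. A point \<open>w\<close> at a distance between \<open>e\<close>
  and 1 from \<open>a\<close> can have a value near \<open>zig a\<close> only if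
  \<open>w + a\<close> is near an even integer; two such points at a distance between
  \<open>2 * e\<close> and 1 contradict each other.\<close>

lemma zig_small_variation:
  assumes "e < 1/4" and ab: "a \<le> b" and osc: "\<And>x. x \<in> {a..b} \<Longrightarrow> \<bar>zig x - zig a\<bar> \<le> e"
  shows "b - a \<le> 4 * e"
proof (rule ccontr)
  assume "\<not> b - a \<le> 4 * e"
  define x where "x = a + min 1 (b - a)"
  have e0: "0 \<le> e" using osc[of a] ab by simp
  have x: "x \<in> {a..b}" "x - a \<le> 1" "x - a > 4 * e" unfolding x_def using assms \<open>\<not> b - a \<le> 4 * e\<close> by auto
  have s: "\<exists>k::int. \<bar>w + a - 2 * of_int k\<bar> \<le> e" if "w \<in> {a..x}" "w - a > e" for w
  proof -
    have "\<bar>zig w - zig a\<bar> \<le> e" using that x osc[of w] by auto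
    moreover have "\<not> \<bar>w - a - 2 * of_int k\<bar> \<le> e" for k :: int
    proof
      assume *: "\<bar>w - a - 2 * of_int k\<bar> \<le> e"
      have "w \<le> x" using that by simp
      then have "real_of_int k < 1" "real_of_int k > -1" using * that(2) x by linarith+
      then show False using * that by simp
    qed
    ultimately show ?thesis
      by (cases rule: zig_close) auto
  qed
  \<comment> \<open>One third of the way is far enough from both ends: \<open>x - a > 4 * e\<close>
    gives \<open>v - a > e\<close> and \<open>x - v > 2 * e\<close>.\<close>
  define v where "v = a + (x - a) / 3"
  have v: "v \<in> {a..x}" "v - a > e" "x - v > 2 * e" "x - v \<le> 1" using x by (auto simp: v_def field_simps)
  obtain k l :: int where kl: "\<bar>v + a - 2 * of_int k\<bar> \<le> e" "\<bar>x + a - 2 * of_int l\<bar> \<le> e"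
    using s[of v] s[of x] v by auto
  then have "\<bar>real_of_int l - real_of_int k\<bar> < 1" using v by linarith
  then have "l = k" by linarith
  then show False using kl v by linarith
qed

text \<open>While \<open>\<bar>F - G\<bar>\<close> lies strictly between \<open>e\<close> and 1,
  \<open>F - G\<close> is not within \<open>e\<close> of an even integer, so \<open>F + G\<close>
  must be; by continuity \<open>F + G\<close> then grows by at most \<open>2 * e\<close>. As both
  maps increase, this growth bounds that of \<open>\<bar>F - G\<bar>\<close>. Counted from the last
  point where \<open>\<bar>F - G\<bar> \<le> e\<close>, this gives \<open>e + 2 * e\<close>.
  Monotonicity excludes a pair in which one map turns back where the other goes on.\<close>

lemma monotone_zig_close:
  fixes F G :: "real \<Rightarrow> real"
  assumes F: "continuous_on {a..b} F" "mono_on {a..b} F" and G: "continuous_on {a..b} G" "mono_on {a..b} G"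
    and "F a = G a" and e: "e < 1/4" and close: "\<And>x. x \<in> {a..b} \<Longrightarrow> \<bar>zig (F x) - zig (G x)\<bar> \<le> e"
    and z: "z \<in> {a..b}"
  shows "\<bar>F z - G z\<bar> \<le> 3 * e"
proof (rule ccontr)
  assume neg: "\<not> \<bar>F z - G z\<bar> \<le> 3 * e"
  have e0: "0 \<le> e" using close[OF z] by linarith
  define E where "E = (\<lambda>x. \<bar>F x - G x\<bar>)"
  have contE: "continuous_on {a..b} E" unfolding E_def by (intro continuous_intros F G)
  obtain c where c: "3 * e < c" "c \<le> E z" "c < 1" 
  proof -
    have "\<exists>c. 3 * e < c \<and> c \<le> E z \<and> c < 1"
      using neg e unfolding E_def by (intro exI[of _ "min \<bar>F z - G z\<bar> ((3*e+1)/2)"]) (auto simp: min_def)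
    then show ?thesis using that by blast
  qed
  \<comment> \<open>Only the first point where the level \<open>c\<close> is reached is used: up to
    there \<open>E\<close> is at most \<open>c < 1\<close>.\<close>
  define X where "X = {x \<in> {a..b}. E x = c}"
  have "\<exists>x\<ge>a. x \<le> z \<and> E x = c"
    by (rule IVT') (use c z e0 \<open>F a = G a\<close> in \<open>auto simp: E_def intro!: continuous_on_subset[OF contE, unfolded E_def]\<close>)
  then obtain x where "a \<le> x" "x \<le> z" "E x = c" by blast
  then have "x \<in> X" using z by (auto simp: X_def)
  then have "X \<noteq> {}" by blast
  have "closed X" unfolding X_def by (rule continuous_closed_preimage_constant[OF contE]) simp
  moreover have "X \<subseteq> {a..b}" by (auto simp: X_def)
  ultimately have "compact X" by (metis compact_Icc closed_Int_compact inf.absorb_iff1)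
  then obtain x where x: "x \<in> X" "\<And>y. y \<in> X \<Longrightarrow> x \<le> y"
    using compact_attains_inf \<open>X \<noteq> {}\<close> by metis
  have xab: "a \<le> x" "x \<le> b" "E x = c" using x by (auto simp: X_def)
  have below: "E y \<le> c" if "y \<in> {a..x}" for y
  proof (rule ccontr)
    assume "\<not> E y \<le> c"
    moreover have "continuous_on {a..y} E" by (rule continuous_on_subset[OF contE]) (use that xab in auto)
    moreover have "E a \<le> c" using e0 c \<open>F a = G a\<close> by (simp add: E_def)
    ultimately have "\<exists>w\<ge>a. w \<le> y \<and> E w = c" using that by (intro IVT') auto
    then obtain w where "a \<le> w" "w \<le> y" "E w = c" by blast
    then have "w \<in> X" using that xab by (auto simp: X_def)
    then have "w = x" using x(2)[of w] \<open>w \<le> y\<close> that by auto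
    then show False using \<open>w \<le> y\<close> that \<open>\<not> E y \<le> c\<close> \<open>E w = c\<close> by auto
  qed
  define Y where "Y = {y \<in> {a..x}. E y \<le> e}"
  have contEx: "continuous_on {a..x} E" by (rule continuous_on_subset[OF contE]) (use xab in auto)
  have "closed Y" unfolding Y_def
    using continuous_closed_preimage[OF contEx _ closed_atMost[of e]] by (simp add: Int_def)
  moreover have "Y \<subseteq> {a..x}" by (auto simp: Y_def)
  ultimately have "compact Y" by (metis compact_Icc closed_Int_compact inf.absorb_iff1)
  moreover have "a \<in> Y" using xab e0 \<open>F a = G a\<close> by (auto simp: Y_def E_def)
  ultimately obtain y where y: "y \<in> Y" "\<And>w. w \<in> Y \<Longrightarrow> w \<le> y"
    using compact_attains_sup by (metis empty_iff)
  have yx: "a \<le> y" "y < x" "E y \<le> e" using y xab c e0 by (auto simp: Y_def less_le)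
  define S where "S = (\<lambda>x. F x + G x)"
  have contS: "continuous_on {y..x} S" unfolding S_def
    by (intro continuous_intros continuous_on_subset[OF F(1)] continuous_on_subset[OF G(1)]) (use yx xab in auto)
  have S_near: "\<exists>k::int. \<bar>S w - 2 * of_int k\<bar> \<le> e" if "y < w" "w \<le> x" for w
  proof -
    have w: "w \<in> {a..b}" "e < E w" "E w \<le> c" using that y(2)[of w] yx xab below[of w] by (auto simp: Y_def not_le[symmetric])
    have no: "\<not> \<bar>F w - G w - 2 * of_int k\<bar> \<le> e" for k :: int
    proof
      assume *: "\<bar>F w - G w - 2 * of_int k\<bar> \<le> e"
      have "k = 0"
      proof -
        have "\<bar>2 * real_of_int k\<bar> < 2" using * w c unfolding E_def by linarith
        then show ?thesis by linarith
      qed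
      then show False using * w by (simp add: E_def)
    qed
    from close[OF w(1)] show ?thesis
      by (cases rule: zig_close) (use no in \<open>auto simp: S_def\<close>)
  qed
  have "S x - S y \<le> 2 * e"
  proof (rule ccontr)
    assume *: "\<not> S x - S y \<le> 2 * e"
    obtain l :: int where l: "\<bar>S x - 2 * of_int l\<bar> \<le> e" using S_near[of x] yx by auto
    \<comment> \<open>A value between \<open>S y\<close> and \<open>S x\<close> that is farther than
      \<open>e\<close> from all even integers: it lies below \<open>2 * l - e\<close>, and
      \<open>2 * l - 1\<close> exceeds \<open>2 * (l - 1) + e\<close>.\<close>
    define v where "v = max ((S y + 2 * of_int l - e) / 2) (2 * of_int l - 1)"
    have v: "S y < v" "v < 2 * of_int l - e" "2 * of_int l - 1 \<le> v" using * l e unfolding v_def by (auto simp: max_def)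
    then obtain w where w: "y \<le> w" "w \<le> x" "S w = v" using IVT'[of S y v x] contS yx l by force
    then have "y < w" using v by (cases "y = w") auto
    then obtain k :: int where k: "\<bar>v - 2 * of_int k\<bar> \<le> e" using S_near[of w] w by auto
    have "real_of_int k < real_of_int l" "real_of_int k > real_of_int l - 1" using k v by linarith+
    then have "k < l" "l - 1 < k" by linarith+
    then show False by linarith
  qed
  moreover have "F y \<le> F x" "G y \<le> G x"
    using F(2) G(2) yx xab by (auto simp: mono_on_def)
  ultimately have "E x \<le> E y + 2 * e" unfolding E_def S_def by linarith
  then show False using yx xab c by linarith
qed


lemma strict_mono_surj_continuous:
  fixes F :: "real \<Rightarrow> real"
  assumes "strict_mono F" "surj F" shows "continuous_on A F"
proof -
  have "continuous_on UNIV F"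
    by (rule continuous_onI_mono) (use assms in \<open>auto simp: strict_mono_less_eq\<close>)
  then show ?thesis by (rule continuous_on_subset) simp
qed

subsection \<open>Increasing homeomorphisms of intervals\<close>

text \<open>Order and image instead of continuity: compositions, inverses and glued maps are then
  handled by order arguments alone, and continuity is recovered once, in
  \<open>ihomeo_continuous\<close>.\<close>

definition ihomeo :: "(real \<Rightarrow> real) \<Rightarrow> real \<Rightarrow> real \<Rightarrow> real \<Rightarrow> real \<Rightarrow> bool" where
  "ihomeo h u v u' v' \<longleftrightarrow> strict_mono_on {u..v} h \<and> h ` {u..v} = {u'..v'}"

lemma ihomeo_less: "ihomeo h u v u' v' \<Longrightarrow> x \<in> {u..v} \<Longrightarrow> y \<in> {u..v} \<Longrightarrow> x < y \<Longrightarrow> h x < h y"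
  by (auto simp: ihomeo_def strict_mono_on_def)

lemma ihomeo_le: "ihomeo h u v u' v' \<Longrightarrow> x \<in> {u..v} \<Longrightarrow> y \<in> {u..v} \<Longrightarrow> x \<le> y \<Longrightarrow> h x \<le> h y"
  using ihomeo_less by (metis order_le_less)

lemma ihomeo_in: "ihomeo h u v u' v' \<Longrightarrow> x \<in> {u..v} \<Longrightarrow> h x \<in> {u'..v'}"
  by (auto simp: ihomeo_def)

lemma ihomeo_bounds: "ihomeo h u v u' v' \<Longrightarrow> u \<le> x \<Longrightarrow> x \<le> v \<Longrightarrow> u' \<le> h x \<and> h x \<le> v'"
  using ihomeo_in[of h u v u' v' x] by auto

lemma ihomeo_obtain:
  assumes "ihomeo h u v u' v'" "u' \<le> y" "y \<le> v'" obtains x where "u \<le> x" "x \<le> v" "h x = y"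
proof -
  have "y \<in> h ` {u..v}" using assms by (auto simp: ihomeo_def)
  then show ?thesis using that by auto
qed

lemma ihomeo_order:
  assumes "ihomeo h u v u' v'" "u \<le> v" shows "u' \<le> v'"
  using ihomeo_bounds[OF assms(1), of u] assms(2) by simp

lemma ihomeo_left:
  assumes "ihomeo h u v u' v'" "u \<le> v" shows "h u = u'"
proof -
  obtain x where "u \<le> x" "x \<le> v" "h x = u'"
    using ihomeo_obtain[OF assms(1), of u'] ihomeo_order[OF assms] by auto
  then show ?thesis using ihomeo_le[OF assms(1), of u x] ihomeo_bounds[OF assms(1), of u] by simp
qed

lemma ihomeo_right:
  assumes "ihomeo h u v u' v'" "u \<le> v" shows "h v = v'"
proof -
  obtain x where "u \<le> x" "x \<le> v" "h x = v'"
    using ihomeo_obtain[OF assms(1), of v'] ihomeo_order[OF assms] by auto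
  then show ?thesis using ihomeo_le[OF assms(1), of x v] ihomeo_bounds[OF assms(1), of v] by simp
qed

lemma ihomeo_less_iff:
  assumes "ihomeo h u v u' v'" "x \<in> {u..v}" "y \<in> {u..v}" shows "h x < h y \<longleftrightarrow> x < y"
  using assms ihomeo_less ihomeo_le by (metis not_le)

lemma ihomeo_inj: "ihomeo h u v u' v' \<Longrightarrow> inj_on h {u..v}"
  by (auto simp: ihomeo_def intro: strict_mono_on_imp_inj_on)

lemma ihomeoI:
  assumes "strict_mono_on {u..v} h" "continuous_on {u..v} h" "u \<le> v" "h u = u'" "h v = v'"
  shows "ihomeo h u v u' v'"
proof -
  have "mono_on {u..v} h" using assms(1) by (rule strict_mono_on_imp_mono_on)
  moreover have "\<exists>x. u \<le> x \<and> x \<le> v \<and> h x = y" if "u' \<le> y" "y \<le> v'" for y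
    using IVT'[of h u y v] assms that by auto
  ultimately have "h ` {u..v} = {u'..v'}"
    using assms(3-5) by (fastforce simp: mono_on_def)
  then show ?thesis using assms(1) by (simp add: ihomeo_def)
qed

lemma ihomeo_restrict:
  assumes "strict_mono F" "surj F" "u \<le> v" "F u = u'" "F v = v'" shows "ihomeo F u v u' v'"
  by (rule ihomeoI) (use assms strict_mono_surj_continuous in \<open>auto simp: strict_mono_on_def\<close>)

lemma ihomeo_cong: "(\<And>x. u \<le> x \<Longrightarrow> x \<le> v \<Longrightarrow> h x = k x) \<Longrightarrow> ihomeo h u v u' v' \<longleftrightarrow> ihomeo k u v u' v'"
  by (auto simp: ihomeo_def strict_mono_on_def)

lemma ihomeo_comp:
  "ihomeo g u' v' u'' v'' \<Longrightarrow> ihomeo h u v u' v' \<Longrightarrow> ihomeo (\<lambda>x. g (h x)) u v u'' v''"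
  unfolding ihomeo_def strict_mono_on_def image_image[symmetric] by (metis image_eqI)

lemma ihomeo_glue:
  assumes h: "ihomeo h u v u' v'" and k: "ihomeo k v w v' w'" and "u \<le> v" "v \<le> w"
  shows "ihomeo (\<lambda>x. if x \<le> v then h x else k x) u w u' w'"
proof -
  have "k v = v'" using ihomeo_left[OF k] assms by simp
  have "strict_mono_on {u..w} (\<lambda>x. if x \<le> v then h x else k x)"
  proof (rule strict_mono_onI)
    fix x y assume xy: "x \<in> {u..w}" "y \<in> {u..w}" "x < y"
    show "(if x \<le> v then h x else k x) < (if y \<le> v then h y else k y)"
    proof (cases "x \<le> v \<and> y > v")
      case True
      have "h x \<le> v'" using ihomeo_bounds[OF h, of x] True xy by simp
      moreover have "k v < k y" using ihomeo_less[OF k, of v y] True xy by simp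
      ultimately show ?thesis using True \<open>k v = v'\<close> by simp
    next
      case False
      then show ?thesis using xy ihomeo_less[OF h, of x y] ihomeo_less[OF k, of x y] by auto
    qed
  qed
  moreover have "(\<lambda>x. if x \<le> v then h x else k x) ` {u..w} = {u'..w'}"
  proof -
    have o: "u' \<le> v'" "v' \<le> w'" using assms ihomeo_order by blast+
    have "(if x \<le> v then h x else k x) \<in> {u'..w'}" if "x \<in> {u..w}" for x
      using ihomeo_bounds[OF h, of x] ihomeo_bounds[OF k, of x] o that by auto
    moreover have "\<exists>x\<in>{u..w}. y = (if x \<le> v then h x else k x)" if yw: "y \<in> {u'..w'}" for y
    proof (cases "y \<le> v'")
      case True
      then obtain x where "u \<le> x" "x \<le> v" "h x = y" using ihomeo_obtain[OF h, of y] yw by auto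
      then show ?thesis using \<open>v \<le> w\<close> by (intro bexI[of _ x]) auto
    next
      case False
      then obtain x where x: "v \<le> x" "x \<le> w" "k x = y" using ihomeo_obtain[OF k, of y] yw by auto
      then have "x \<noteq> v" using False \<open>k v = v'\<close> by auto
      then show ?thesis using \<open>u \<le> v\<close> x by (intro bexI[of _ x]) auto
    qed
    ultimately show ?thesis by blast
  qed
  ultimately show ?thesis by (simp add: ihomeo_def)
qed

text \<open>The extension \<open>H\<close> by translations outside \<open>{u..v}\<close> is a
  strictly increasing surjection of the line, and such a map is continuous.\<close>

lemma ihomeo_continuous:
  assumes h: "ihomeo h u v u' v'" shows "continuous_on {u..v} h"
proof (cases "u \<le> v")
  case True
  define H where "H = (\<lambda>x. if x \<le> u then x - u + u' else if x \<le> v then h x else x - v + v')"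
  have ends: "h u = u'" "h v = v'" "u' \<le> v'" using ihomeo_left ihomeo_right ihomeo_order h True by auto
  have "strict_mono H"
  proof (rule strict_monoI)
    fix x y :: real assume "x < y"
    then show "H x < H y"
      using ihomeo_less[OF h, of x y] ihomeo_less[OF h, of u y] ends
        ihomeo_bounds[OF h, of x] ihomeo_bounds[OF h, of y]
      unfolding H_def by auto
  qed
  moreover have "surj H"
  proof -
    have "\<exists>x. H x = y" for y
    proof -
      consider "y \<le> u'" | "u' < y" "y \<le> v'" | "v' < y" by linarith
      then show ?thesis
      proof cases
        case 1 then show ?thesis by (intro exI[of _ "y - u' + u"]) (simp add: H_def)
      next
        case 2
        then obtain x where "u \<le> x" "x \<le> v" "h x = y" using ihomeo_obtain[OF h, of y] by auto
        then show ?thesis using ends by (intro exI[of _ x]) (auto simp: H_def)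
      next
        case 3
        then show ?thesis using True by (intro exI[of _ "y - v' + v"]) (auto simp: H_def)
      qed
    qed
    then show ?thesis by (metis surjI)
  qed
  ultimately have "continuous_on {u..v} H" by (rule strict_mono_surj_continuous)
  moreover have "H x = h x" if "x \<in> {u..v}" for x using that ends by (auto simp: H_def)
  ultimately show ?thesis by (rule continuous_on_eq)
qed simp

lemma ihomeo_inv:
  assumes h: "ihomeo h u v u' v'"
  shows "ihomeo (inv_into {u..v} h) u' v' u v"
    and "\<And>x. u \<le> x \<Longrightarrow> x \<le> v \<Longrightarrow> inv_into {u..v} h (h x) = x"
    and "\<And>y. u' \<le> y \<Longrightarrow> y \<le> v' \<Longrightarrow> h (inv_into {u..v} h y) = y"
proof -
  have inj: "inj_on h {u..v}" and img: "h ` {u..v} = {u'..v'}" using h ihomeo_inj[OF h] by (auto simp: ihomeo_def)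
  show 1: "inv_into {u..v} h (h x) = x" if "u \<le> x" "x \<le> v" for x
    using inj that by simp
  show 2: "h (inv_into {u..v} h y) = y" if "u' \<le> y" "y \<le> v'" for y
    using img that by (intro f_inv_into_f) auto
  have "inv_into {u..v} h ` {u'..v'} = {u..v}"
    using inv_into_image_cancel[OF inj, of "{u..v}"] img by simp
  moreover have "strict_mono_on {u'..v'} (inv_into {u..v} h)"
  proof (rule strict_mono_onI)
    fix x y assume xy: "x \<in> {u'..v'}" "y \<in> {u'..v'}" "x < y"
    have "inv_into {u..v} h x \<in> {u..v}" "inv_into {u..v} h y \<in> {u..v}"
      using xy img by (metis inv_into_into)+
    then show "inv_into {u..v} h x < inv_into {u..v} h y"
      using ihomeo_less_iff[OF h] 2 xy by (metis atLeastAtMost_iff)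
  qed
  ultimately show "ihomeo (inv_into {u..v} h) u' v' u v" by (simp add: ihomeo_def)
qed

definition stretch :: "real \<Rightarrow> real \<Rightarrow> real \<Rightarrow> real \<Rightarrow> real \<Rightarrow> real" where
  "stretch u v u' v' x = u' + (x - u) * ((v' - u') / (v - u))"

lemma ihomeo_stretch:
  assumes "u < v" "u' < v'" shows "ihomeo (stretch u v u' v') u v u' v'"
  unfolding stretch_def
  by (rule ihomeoI) (use assms in \<open>auto intro!: continuous_intros strict_mono_onI divide_strict_right_mono\<close>)

section \<open>Odd increasing homeomorphisms of the line that respect a translation\<close>

definition per_homeo :: "real \<Rightarrow> real \<Rightarrow> (real \<Rightarrow> real) \<Rightarrow> bool" where
  "per_homeo L M F \<longleftrightarrow> strict_mono F \<and> surj F \<and> (\<forall>t. F (- t) = - F t) \<and> (\<forall>t. F (t + 2 * L) = F t + 2 * M)"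

lemma cell_obtain:
  fixes L :: real assumes "L > 0" obtains k :: int where "t \<in> {of_int k * L..of_int (k + 1) * L}" "t < of_int (k + 1) * L"
proof -
  define k where "k = \<lfloor>t / L\<rfloor>"
  have "of_int k \<le> t / L" "t / L < of_int k + 1" unfolding k_def by linarith+
  then have "of_int k * L \<le> t" "t < of_int (k + 1) * L" using assms by (auto simp: field_simps)
  then show ?thesis using that[of k] by auto
qed

text \<open>Oddness and the translation by \<open>2 * L\<close> generate the reflections in all
  multiples of \<open>L\<close>, so \<open>{0..L}\<close> is a fundamental domain. In
  \<open>c\<close> the even cells carry translates of \<open>h\<close>, and the odd cells translates
  of its image under a half turn. \<open>L\<close> and \<open>M\<close> are kept apart because open
  maps of arbitrary degree are lifted too.\<close>

lemma per_homeo_ext: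
  assumes "L > 0" "M > 0" and h: "ihomeo h 0 L 0 M"
  obtains F where "per_homeo L M F" "\<And>t. t \<in> {0..L} \<Longrightarrow> F t = h t"
proof -
  define c where "c = (\<lambda>k::int. \<lambda>t. if even k then of_int k * M + h (t - of_int k * L) else of_int (k + 1) * M - h
    (of_int (k + 1) * L - t))"
  define F where "F = (\<lambda>t. c \<lfloor>t / L\<rfloor> t)"
  have h0: "h 0 = 0" "h L = M" using ihomeo_left[OF h] ihomeo_right[OF h] assms by auto
  have F: "F t = c k t" if "t \<in> {of_int k * L..of_int (k + 1) * L}" for k t
  proof (cases "t = of_int (k + 1) * L")
    case True
    then have "\<lfloor>t / L\<rfloor> = k + 1" using assms by simp
    then show ?thesis using True h0 by (auto simp: F_def c_def algebra_simps)
  next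
    case False
    then have "of_int k \<le> t / L" "t / L < of_int k + 1" using that by (auto simp: field_simps)
    then have "\<lfloor>t / L\<rfloor> = k" by linarith
    then show ?thesis by (simp add: F_def)
  qed
  have hc: "ihomeo F (of_int k * L) (of_int (k + 1) * L) (of_int k * M) (of_int (k + 1) * M)" for k
  proof (rule iffD2[OF ihomeo_cong])
    show "F t = c k t" if "of_int k * L \<le> t" "t \<le> of_int (k + 1) * L" for t using F that by auto
    have hcont: "continuous_on {0..L} h" by (rule ihomeo_continuous[OF h])
    show "ihomeo (c k) (of_int k * L) (of_int (k + 1) * L) (of_int k * M) (of_int (k + 1) * M)"
    proof (cases "even k")
      case True
      show ?thesis
      proof (rule ihomeoI)
        show "continuous_on {of_int k * L..of_int (k + 1) * L} (c k)"
          unfolding c_def using True by (auto intro!: continuous_intros continuous_on_compose2[OF hcont] simp: algebra_simps)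
        show "strict_mono_on {of_int k * L..of_int (k + 1) * L} (c k)"
          unfolding c_def by (auto intro!: strict_mono_onI ihomeo_less[OF h] simp: algebra_simps)
      qed (use h0 assms in \<open>auto simp: c_def algebra_simps\<close>)
    next
      case False
      show ?thesis
      proof (rule ihomeoI)
        show "continuous_on {of_int k * L..of_int (k + 1) * L} (c k)"
          unfolding c_def using False by (auto intro!: continuous_intros continuous_on_compose2[OF hcont] simp: algebra_simps)
        show "strict_mono_on {of_int k * L..of_int (k + 1) * L} (c k)"
          unfolding c_def by (auto intro!: strict_mono_onI ihomeo_less[OF h] simp: algebra_simps)
      qed (use h0 assms in \<open>auto simp: c_def algebra_simps\<close>)
    qed
  qed
  have ord: "of_int k * L \<le> of_int (k + 1) * L" for k using assms by auto
  have "strict_mono F"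
  proof (rule strict_monoI)
    fix x y :: real assume "x < y"
    obtain k where k: "x \<in> {of_int k * L..of_int (k + 1) * L}" "x < of_int (k + 1) * L" using cell_obtain[OF \<open>L > 0\<close>] by metis
    obtain l where l: "y \<in> {of_int l * L..of_int (l + 1) * L}" "y < of_int (l + 1) * L" using cell_obtain[OF \<open>L > 0\<close>] by metis
    have "of_int k * L < of_int (l + 1) * L" using k l \<open>x < y\<close> by auto
    then have "real_of_int k < of_int (l + 1)" using \<open>L > 0\<close> mult_less_cancel_right_pos by blast
    then have "k \<le> l" by linarith
    show "F x < F y"
    proof (cases "k = l")
      case True
      then show ?thesis using ihomeo_less[OF hc[of k]] k l \<open>x < y\<close> by blast
    next
      case False
      then have "k + 1 \<le> l" using \<open>k \<le> l\<close> by simp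
      have "F x < F (of_int (k + 1) * L)" using ihomeo_less[OF hc[of k], of x "of_int (k + 1) * L"] k by auto
      also have "\<dots> = of_int (k + 1) * M" using ihomeo_right[OF hc ord] .
      also have "\<dots> \<le> of_int l * M" using \<open>k + 1 \<le> l\<close> \<open>M > 0\<close> by (intro mult_right_mono of_int_le_iff[THEN iffD2]) auto
      also have "\<dots> \<le> F y" using ihomeo_bounds[OF hc[of l], of y] l by auto
      finally show ?thesis .
    qed
  qed
  moreover have "surj F"
  proof -
    have "\<exists>x. F x = y" for y
    proof -
      obtain k where k: "y \<in> {of_int k * M..of_int (k + 1) * M}" using cell_obtain[OF \<open>M > 0\<close>] by metis
      then show ?thesis using ihomeo_obtain[OF hc[of k], of y] by (metis atLeastAtMost_iff)
    qed
    then show ?thesis by (metis surjI)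
  qed
  moreover have "F (- t) = - F t" for t
  proof -
    obtain k where k: "t \<in> {of_int k * L..of_int (k + 1) * L}" using cell_obtain[OF \<open>L > 0\<close>] by metis
    then show ?thesis using F[OF k] F[of "-t" "-k-1"] by (auto simp: c_def algebra_simps)
  qed
  moreover have "F (t + 2 * L) = F t + 2 * M" for t
  proof -
    obtain k where k: "t \<in> {of_int k * L..of_int (k + 1) * L}" using cell_obtain[OF \<open>L > 0\<close>] by metis
    then show ?thesis using F[OF k] F[of "t + 2 * L" "k + 2"] by (auto simp: c_def algebra_simps)
  qed
  ultimately have "per_homeo L M F" unfolding per_homeo_def by blast
  moreover have "F t = h t" if "t \<in> {0..L}" for t using F[of t 0] that by (simp add: c_def)
  ultimately show ?thesis using that by blast
qed

lemma per_homeo_shift: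
  assumes "per_homeo L M F" shows "F (t + of_int k * (2 * L)) = F t + of_int k * (2 * M)"
proof -
  have *: "F (t + of_nat k * (2 * L)) = F t + of_nat k * (2 * M)" for t k
  proof (induction k)
    case (Suc k)
    have "F (t + of_nat (Suc k) * (2 * L)) = F ((t + of_nat k * (2 * L)) + 2 * L)" by (simp add: algebra_simps)
    also have "\<dots> = F (t + of_nat k * (2 * L)) + 2 * M" using assms by (simp only: per_homeo_def)
    finally show ?case using Suc by (simp add: algebra_simps)
  qed simp
  show ?thesis
  proof (cases "k \<ge> 0")
    case True
    then show ?thesis using *[of t "nat k"] by simp
  next
    case False
    then show ?thesis using *[of "t + of_int k * (2 * L)" "nat (-k)"] by (simp add: algebra_simps)
  qed
qed

lemma fold_obtain:
  fixes L t :: real assumes "L > 0"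
  obtains k :: int and s where "s \<in> {0..L}" "t = s + of_int k * (2 * L)" | k :: int and s where "s \<in> {0..L}"
    "t = - s + of_int k * (2 * L)"
proof (cases rule: zig_decomp[of "t / L"])
  case (1 k)
  have "t = zig (t/L) * L + of_int k * (2 * L)" using arg_cong[OF 1, of "\<lambda>x. x * L"] assms by (simp add: algebra_simps)
  then show ?thesis using that(1)[of "zig (t/L) * L" k] assms by simp
next
  case (2 k)
  have "t = - (zig (t/L) * L) + of_int k * (2 * L)" using arg_cong[OF 2, of "\<lambda>x. x * L"] assms by (simp add: algebra_simps)
  then show ?thesis using that(2)[of "zig (t/L) * L" k] assms by simp
qed

lemma per_homeo_fold:
  assumes "per_homeo L M F"
  shows "F (s + of_int k * (2 * L)) = F s + of_int k * (2 * M)" "F (- s + of_int k * (2 * L)) = - F s + of_int k * (2 * M)"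
  using per_homeo_shift[OF assms, of s k] per_homeo_shift[OF assms, of "- s" k] assms by (simp_all add: per_homeo_def)

subsection \<open>Uniform limits of periodic homeomorphisms\<close>

abbreviation rinv :: "(real \<Rightarrow> real) \<Rightarrow> real \<Rightarrow> real" where "rinv F \<equiv> inv_into UNIV F"

definition close :: "real \<Rightarrow> (real \<Rightarrow> real) \<Rightarrow> (real \<Rightarrow> real) \<Rightarrow> bool" where
  "close r F G \<longleftrightarrow> (\<forall>t. \<bar>F t - G t\<bar> \<le> r)"

lemma closeD: "close r F G \<Longrightarrow> \<bar>F t - G t\<bar> \<le> r" by (simp add: close_def)

lemma close_refl: "0 \<le> r \<Longrightarrow> close r F F" by (simp add: close_def)

lemma close_sym: "close r F G \<Longrightarrow> close r G F" by (simp add: close_def abs_minus_commute)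

lemma close_trans:
  assumes "close r F G" "close s G H" shows "close (r + s) F H"
  unfolding close_def
proof
  fix t show "\<bar>F t - H t\<bar> \<le> r + s"
    using closeD[OF assms(1), of t] closeD[OF assms(2), of t] by linarith
qed

lemma close_mono: "close r F G \<Longrightarrow> r \<le> s \<Longrightarrow> close s F G"
  unfolding close_def using order_trans by blast

definition unif_cont :: "(real \<Rightarrow> real) \<Rightarrow> bool" where
  "unif_cont F \<longleftrightarrow> (\<forall>e>0. \<exists>d>0. \<forall>x y. \<bar>x - y\<bar> \<le> d \<longrightarrow> \<bar>F x - F y\<bar> \<le> e)"

lemma unif_contE:
  assumes "unif_cont F" "e > 0" obtains d where "d > 0" "\<And>x y. \<bar>x - y\<bar> \<le> d \<Longrightarrow> \<bar>F x - F y\<bar> \<le> e"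
  using assms unfolding unif_cont_def by blast

lemma unif_cont_approx:
  assumes "\<And>e. e > 0 \<Longrightarrow> \<exists>G. unif_cont G \<and> close e F G"
  shows "unif_cont F"
  unfolding unif_cont_def
proof (intro allI impI)
  fix e :: real assume "e > 0"
  then obtain G where G: "unif_cont G" "close (e/3) F G" using assms[of "e/3"] by auto
  obtain d where "d > 0" and d: "\<And>x y. \<bar>x - y\<bar> \<le> d \<Longrightarrow> \<bar>G x - G y\<bar> \<le> e/3" using unif_contE[OF G(1), of "e/3"] \<open>e > 0\<close> by auto
  have "\<bar>F x - F y\<bar> \<le> e" if "\<bar>x - y\<bar> \<le> d" for x y
    using d[OF that] closeD[OF G(2), of x] closeD[OF G(2), of y] by linarith
  then show "\<exists>d>0. \<forall>x y. \<bar>x - y\<bar> \<le> d \<longrightarrow> \<bar>F x - F y\<bar> \<le> e" using \<open>d > 0\<close> by blast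
qed

lemma unif_cont_continuous: "unif_cont F \<Longrightarrow> continuous_on A F"
  unfolding unif_cont_def continuous_on_iff dist_real_def
  by (meson dense less_imp_le order_le_less_trans)

lemma per_homeo_unif_cont:
  assumes F: "per_homeo L M F" and "L > 0" shows "unif_cont F"
  unfolding unif_cont_def
proof (intro allI impI)
  fix e :: real assume "e > 0"
  have "continuous_on {-L..3*L} F" using F strict_mono_surj_continuous by (auto simp: per_homeo_def)
  then have "uniformly_continuous_on {-L..3*L} F" by (simp add: compact_uniformly_continuous)
  then obtain d where d: "d > 0" "\<And>x y. x \<in> {-L..3*L} \<Longrightarrow> y \<in> {-L..3*L} \<Longrightarrow> dist y x < d \<Longrightarrow> dist (F y) (F x) < e"
    using \<open>e > 0\<close> unfolding uniformly_continuous_on_def by metis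
  have "\<bar>F x - F y\<bar> \<le> e" if "\<bar>x - y\<bar> \<le> min (d/2) L" for x y
  proof -
    obtain k where k: "x \<in> {of_int k * (2*L)..of_int (k + 1) * (2*L)}" using cell_obtain[of "2*L" x] \<open>L > 0\<close>
      by (metis mult_pos_pos zero_less_numeral)
    define x' y' where "x' = x + of_int (-k) * (2*L)" and "y' = y + of_int (-k) * (2*L)"
    have "x' \<in> {0..2*L}" "\<bar>x' - y'\<bar> \<le> d/2" "\<bar>x' - y'\<bar> \<le> L"
      using k that unfolding x'_def y'_def by (auto simp: algebra_simps)
    then have "x' \<in> {-L..3*L}" "y' \<in> {-L..3*L}" "dist y' x' < d"
      using d(1) unfolding dist_real_def by (auto simp: abs_if split: if_splits)
    then have "dist (F y') (F x') < e" using d(2) by blast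
    moreover have "F y' - F x' = F y - F x" unfolding x'_def y'_def per_homeo_shift[OF F] by simp
    ultimately show ?thesis by (simp add: dist_real_def)
  qed
  moreover have "min (d/2) L > 0" using d \<open>L > 0\<close> by simp
  ultimately show "\<exists>d>0. \<forall>x y. \<bar>x - y\<bar> \<le> d \<longrightarrow> \<bar>F x - F y\<bar> \<le> e" by blast
qed

definition cj :: "(real \<Rightarrow> real) \<Rightarrow> (real \<Rightarrow> real) \<Rightarrow> real \<Rightarrow> real" where
  "cj g x = g \<circ> x \<circ> rinv g"

text \<open>Divisibility makes every map of level \<open>n\<close> a map of level \<open>m\<close>
  for \<open>n \<le> m\<close>, so that finitely many approximants can be brought to a common
  level.\<close>

locale period_chain =
  fixes L :: "nat \<Rightarrow> real"
  assumes L_pos: "L n > 0"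
    and L_mult: "n \<le> m \<Longrightarrow> \<exists>k::nat. L m = real k * L n"
begin

abbreviation ph :: "nat \<Rightarrow> (real \<Rightarrow> real) \<Rightarrow> bool" where "ph n F \<equiv> per_homeo (L n) (L n) F"

text \<open>For \<open>L n = p 1 * \<dots> * p n\<close> these are the lifts of the degree-one homeomorphisms, see \<open>homeos1_lift\<close>
  and \<open>lp_homeos1\<close> below.\<close>
definition lp :: "(real \<Rightarrow> real) \<Rightarrow> bool" where
  "lp F \<longleftrightarrow> strict_mono F \<and> surj F \<and>
     (\<forall>e>0. \<exists>n G. ph n G \<and> close e F G \<and> close e (rinv F) (rinv G))"

lemma ph_level: assumes "n \<le> m" "ph n F" shows "ph m F"
proof -
  obtain k :: nat where k: "L m = real k * L n" using L_mult assms by blast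
  have "F (t + 2 * L m) = F t + 2 * L m" for t
    using per_homeo_shift[OF assms(2), of t "int k"] by (simp add: k algebra_simps)
  then show ?thesis using assms(2) by (auto simp: per_homeo_def)
qed

lemma ph_comp: "ph n F \<Longrightarrow> ph n G \<Longrightarrow> ph n (F \<circ> G)"
  unfolding per_homeo_def using comp_surj[of G F] by (auto simp: strict_mono_def)

lemma strict_mono_bij: "strict_mono F \<Longrightarrow> surj F \<Longrightarrow> bij (F::real \<Rightarrow> real)"
  by (simp add: bij_def strict_mono_imp_inj_on)

lemma strict_mono_rinv: 
  assumes "strict_mono F" "surj (F::real\<Rightarrow>real)" shows "strict_mono (rinv F)"
  using assms by (intro strict_monoI) (metis surj_f_inv_f strict_mono_less)

lemma surj_rinv: "strict_mono F \<Longrightarrow> surj F \<Longrightarrow> surj (rinv (F::real \<Rightarrow> real))"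
  by (simp add: bij_imp_bij_inv bij_is_surj strict_mono_bij)

lemma ph_inv: assumes "ph n F" shows "ph n (rinv F)"
proof -
  have F: "strict_mono F" "surj F" using assms by (auto simp: per_homeo_def)
  have inj: "inj F" using F strict_mono_imp_inj_on by blast
  have FF: "F (rinv F t) = t" for t using F by (simp add: surj_f_inv_f)
  have "F (- rinv F t) = - t" for t using assms FF by (simp add: per_homeo_def)
  then have "rinv F (- t) = - rinv F t" for t using inj by (metis inv_f_eq)
  moreover have "F (rinv F t + 2 * L n) = t + 2 * L n" for t using assms FF by (simp add: per_homeo_def)
  then have "rinv F (t + 2 * L n) = rinv F t + 2 * L n" for t using inj by (metis inv_f_eq)
  ultimately show ?thesis using F strict_mono_rinv surj_rinv by (auto simp: per_homeo_def)
qed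

lemma ph_unif_cont: "ph n F \<Longrightarrow> unif_cont F"
  using per_homeo_unif_cont L_pos by blast

lemma ph_lp: "ph n F \<Longrightarrow> lp F"
  unfolding lp_def by (auto simp: per_homeo_def intro!: close_refl exI)

lemma lpD:
  assumes "lp F" shows "strict_mono F" "surj F" "bij F" "\<And>t. F (rinv F t) = t" "\<And>t. rinv F (F t) = t"
  using assms unfolding lp_def
  by (auto simp: strict_mono_bij surj_f_inv_f strict_mono_imp_inj_on)

lemma lpE:
  assumes "lp F" "e > 0" obtains n G where "ph n G" "close e F G" "close e (rinv F) (rinv G)"
  using assms unfolding lp_def by blast

lemma lp_unif_cont: assumes "lp F" shows "unif_cont F" "unif_cont (rinv F)"
  by (rule unif_cont_approx, metis assms lpE ph_unif_cont ph_inv)+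

lemma lp_inv: assumes "lp F" shows "lp (rinv F)"
proof -
  have "rinv (rinv F) = F" using lpD(3)[OF assms] by (rule inv_inv_eq)
  moreover have "rinv (rinv G) = G" if "ph n G" for n G
    using that by (intro inv_inv_eq strict_mono_bij) (auto simp: per_homeo_def)
  ultimately show ?thesis
    using assms unfolding lp_def by (metis strict_mono_rinv surj_rinv ph_inv)
qed

lemma lp_comp: assumes F: "lp F" and G: "lp G" shows "lp (F \<circ> G)"
proof -
  \<comment> \<open>Stated for arbitrary maps because it is applied twice: to the composition, and
    to the inverses in reversed order.\<close>
  have half: "\<exists>d>0. \<forall>n F1 G1. ph n F1 \<longrightarrow> ph n G1 \<longrightarrow> close d F F1 \<longrightarrow> close d G G1 \<longrightarrow> close e (F \<circ> G) (F1 \<circ> G1)"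
    if uc: "unif_cont F" and e: "e > 0" for e F G
  proof -
    obtain d where d: "d > 0" "\<And>x y. \<bar>x - y\<bar> \<le> d \<Longrightarrow> \<bar>F x - F y\<bar> \<le> e/2" using unif_contE[OF uc, of "e/2"] e by auto
    have "close e (F \<circ> G) (F1 \<circ> G1)" if "close (min d (e/2)) F F1" "close (min d (e/2)) G G1" for F1 G1
      unfolding close_def
    proof
      fix t
      have "\<bar>G t - G1 t\<bar> \<le> d" "\<bar>F (G1 t) - F1 (G1 t)\<bar> \<le> e/2" using closeD[OF that(1), of "G1 t"] closeD[OF that(2), of t] by auto
      then show "\<bar>(F \<circ> G) t - (F1 \<circ> G1) t\<bar> \<le> e" using d(2)[of "G t" "G1 t"] by (simp, linarith)
    qed
    then show ?thesis using d(1) \<open>e > 0\<close> by (intro exI[of _ "min d (e/2)"]) auto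
  qed
  have "\<exists>n H. ph n H \<and> close e (F \<circ> G) H \<and> close e (rinv (F \<circ> G)) (rinv H)" if "e > 0" for e
  proof -
    obtain d1 where d1: "d1 > 0" "\<And>n F1 G1. ph n F1 \<Longrightarrow> ph n G1 \<Longrightarrow> close d1 F F1 \<Longrightarrow> close d1 G G1 \<Longrightarrow> close e (F \<circ> G) (F1 \<circ> G1)"
      using half[OF lp_unif_cont(1)[OF F] \<open>e > 0\<close>, of G] by blast
    obtain d2 where d2: "d2 > 0" "\<And>n F1 G1. ph n F1 \<Longrightarrow> ph n G1 \<Longrightarrow> close d2 (rinv G) F1 \<Longrightarrow> close d2 (rinv F) G1 \<Longrightarrow>
      close e (rinv G \<circ> rinv F) (F1 \<circ> G1)"
      using half[OF lp_unif_cont(2)[OF G] \<open>e > 0\<close>, of "rinv F"] by blast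
    define d where "d = min d1 d2"
    have "d > 0" "d \<le> d1" "d \<le> d2" using d1 d2 by (auto simp: d_def)
    obtain n1 F1 where F1: "ph n1 F1" "close d F F1" "close d (rinv F) (rinv F1)" using lpE[OF F \<open>d > 0\<close>] by metis
    obtain n2 G1 where G1: "ph n2 G1" "close d G G1" "close d (rinv G) (rinv G1)" using lpE[OF G \<open>d > 0\<close>] by metis
    define n where "n = max n1 n2"
    have ph: "ph n F1" "ph n G1" using F1(1) G1(1) ph_level unfolding n_def by (meson max.cobounded1 max.cobounded2)+
    have "close e (F \<circ> G) (F1 \<circ> G1)" using d1(2)[OF ph] F1 G1 close_mono \<open>d \<le> d1\<close> by blast
    moreover have "close e (rinv G \<circ> rinv F) (rinv G1 \<circ> rinv F1)"
      using d2(2)[OF ph_inv[OF ph(2)] ph_inv[OF ph(1)]] F1 G1 close_mono \<open>d \<le> d2\<close> by blast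
    moreover have "rinv (F \<circ> G) = rinv G \<circ> rinv F" using lpD(3) F G by (simp add: o_inv_distrib)
    moreover have "rinv (F1 \<circ> G1) = rinv G1 \<circ> rinv F1" using lpD(3)[OF ph_lp[OF ph(1)]] lpD(3)[OF ph_lp[OF ph(2)]]
      by (simp add: o_inv_distrib)
    ultimately show ?thesis using ph_comp[OF ph] by metis
  qed
  moreover have "strict_mono (F \<circ> G)" using lpD(1)[OF F] lpD(1)[OF G] by (simp add: strict_mono_def)
  moreover have "surj (F \<circ> G)" by (rule comp_surj[OF lpD(2)[OF G] lpD(2)[OF F]])
  ultimately show ?thesis unfolding lp_def by blast
qed

lemma lp_id: "lp (\<lambda>x. x)"
  by (rule ph_lp[of 0]) (auto simp: per_homeo_def strict_mono_def)

lemma lp_odd: assumes "lp F" shows "F (- t) = - F t"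
proof -
  have "\<bar>F (- t) + F t\<bar> \<le> 0"
  proof (rule field_le_epsilon)
    fix e :: real assume "e > 0"
    then obtain n G where G: "ph n G" "close (e/2) F G" using lpE[OF assms, of "e/2"] by (metis half_gt_zero)
    then have "G (- t) = - G t" by (simp add: per_homeo_def)
    then show "\<bar>F (- t) + F t\<bar> \<le> 0 + e" using closeD[OF G(2), of t] closeD[OF G(2), of "-t"] by linarith
  qed
  then show ?thesis by simp
qed

lemma lp_0: "lp F \<Longrightarrow> F 0 = 0" using lp_odd[of F 0] by simp

lemma lp_continuous: "lp F \<Longrightarrow> continuous_on A F"
  using lpD strict_mono_surj_continuous by blast

text \<open>The radius comes from the modulus of \<open>rinv F\<close> alone, since
  \<open>rinv F t\<close> and \<open>rinv G t\<close> are \<open>rinv F\<close> applied to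
  \<open>t\<close> and to \<open>F (rinv G t)\<close>.\<close>

lemma close_inv:
  assumes "lp F" "e > 0" obtains d where "d > 0" "\<And>G. lp G \<Longrightarrow> close d F G \<Longrightarrow> close e (rinv F) (rinv G)"
proof -
  obtain d where d: "d > 0" "\<And>x y. \<bar>x - y\<bar> \<le> d \<Longrightarrow> \<bar>rinv F x - rinv F y\<bar> \<le> e"
    using unif_contE[OF lp_unif_cont(2)[OF assms(1)] assms(2)] by metis
  have "close e (rinv F) (rinv G)" if "lp G" "close d F G" for G
    unfolding close_def
  proof
    fix t
    have "\<bar>t - F (rinv G t)\<bar> \<le> d" using closeD[OF that(2), of "rinv G t"] lpD(4)[OF that(1)] by (simp add: abs_minus_commute)
    then show "\<bar>rinv F t - rinv G t\<bar> \<le> e" using d(2) lpD(5)[OF assms(1)] by metis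
  qed
  then show ?thesis using that d(1) by blast
qed

text \<open>The inverses have to converge as well, because a uniform limit of increasing
  homeomorphisms can be constant on an interval. With both limits at hand, each is the inverse of
  the other.\<close>

lemma lp_limit:
  assumes A: "\<And>n. lp (A n)" and c: "\<And>n. close ((1/2)^n) (A n) (A (Suc n))" "\<And>n. close ((1/2)^n) (rinv (A n)) (rinv (A (Suc n)))"
  obtains F where "lp F" "\<And>n. close (2 * (1/2)^n) F (A n)" "\<And>n. close (2 * (1/2)^n) (rinv F) (rinv (A n))"
proof -
  have lim: "\<exists>F. (\<forall>n. close (2 * (1/2)^n) F (B n)) \<and> mono F \<and> continuous_on UNIV F"
    if B: "\<And>n. lp (B n)" and cB: "\<And>n. close ((1/2)^n) (B n) (B (Suc n))" for B
  proof -
    have est: "\<bar>B n t - B (n + k) t\<bar> \<le> 2 * (1/2)^n - 2 * (1/2)^(n+k)" for n k t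
    proof (induction k)
      case (Suc k)
      have "\<bar>B (n + k) t - B (n + Suc k) t\<bar> \<le> (1/2)^(n+k)" using closeD[OF cB[of "n+k"], of t] by simp
      moreover have "(1/2::real)^(n + Suc k) = (1/2)^(n+k) / 2" by simp
      ultimately show ?case using Suc by linarith
    qed simp
    have est': "\<bar>B n t - B (n + k) t\<bar> \<le> 2 * (1/2)^n" for n k t
    proof -
      have "0 \<le> 2 * (1/2::real)^(n+k)" by simp
      then show ?thesis using est[of n t k] by linarith
    qed
    have "Cauchy (\<lambda>n. B n t)" for t
    proof (rule CauchyI')
      fix e :: real assume "e > 0"
      then obtain N where N: "(1/2::real)^N < e / 2" using real_arch_pow_inv[of "e/2" "1/2"] by auto
      have "dist (B m t) (B n t) < e" if "m \<ge> N" "m < n" for m n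
      proof -
        have "\<bar>B m t - B (m + (n - m)) t\<bar> \<le> 2 * (1/2)^m" by (rule est')
        moreover have "(1/2::real)^m \<le> (1/2)^N" using that by (intro power_decreasing) auto
        moreover have mn: "m + (n - m) = n" using that by simp
        ultimately have "\<bar>B m t - B n t\<bar> < e" using N unfolding mn by linarith
        then show ?thesis by (simp add: dist_real_def)
      qed
      then show "\<exists>M. \<forall>m\<ge>M. \<forall>n>m. dist (B m t) (B n t) < e" by blast
    qed
    then have "\<exists>l. (\<lambda>n. B n t) \<longlonglongrightarrow> l" for t by (simp add: Cauchy_convergent_iff convergent_def)
    then obtain F where F: "\<And>t. (\<lambda>n. B n t) \<longlonglongrightarrow> F t" by metis
    have cF: "close (2 * (1/2)^n) F (B n)" for n
      unfolding close_def
    proof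
      fix t
      have "(\<lambda>k. \<bar>B n t - B (k + n) t\<bar>) \<longlonglongrightarrow> \<bar>B n t - F t\<bar>"
        by (intro tendsto_intros LIMSEQ_ignore_initial_segment F)
      moreover have "\<forall>k. \<bar>B n t - B (k + n) t\<bar> \<le> 2 * (1/2)^n" using est' by (metis add.commute)
      ultimately have "\<bar>B n t - F t\<bar> \<le> 2 * (1/2)^n" by (intro LIMSEQ_le_const2) auto
      then show "\<bar>F t - B n t\<bar> \<le> 2 * (1/2)^n" by (simp add: abs_minus_commute)
    qed
    have "mono F"
    proof (rule monoI)
      fix x y :: real assume "x \<le> y"
      then have "B n x \<le> B n y" for n using lpD(1)[OF B[of n]] by (simp add: strict_mono_less_eq)
      then show "F x \<le> F y" using LIMSEQ_le[OF F F] by blast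
    qed
    moreover have "unif_cont F"
    proof (rule unif_cont_approx)
      fix e :: real assume "e > 0"
      then obtain N where N: "(1/2::real)^N < e / 2" using real_arch_pow_inv[of "e/2" "1/2"] by auto
      then have "close e F (B N)" by (intro close_mono[OF cF]) auto
      then show "\<exists>G. unif_cont G \<and> close e F G" using lp_unif_cont(1)[OF B] by blast
    qed
    then have "continuous_on UNIV F" by (rule unif_cont_continuous)
    ultimately show ?thesis using cF by blast
  qed
  obtain F where F: "\<And>n. close (2 * (1/2)^n) F (A n)" "mono F" "continuous_on UNIV F" using lim[OF A c(1)] by blast
  obtain G where G: "\<And>n. close (2 * (1/2)^n) G (rinv (A n))" "mono G" "continuous_on UNIV G" using lim[OF lp_inv[OF A] c(2)]
    by blast
  have half0: "(\<lambda>n. 2 * (1/2::real)^n) \<longlonglongrightarrow> 0" by (rule tendsto_mult_right_zero, rule LIMSEQ_realpow_zero) auto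
  have conv: "(\<lambda>n. B n (y n)) \<longlonglongrightarrow> H z" if "\<And>n. close (2 * (1/2)^n) H (B n)" "continuous_on UNIV H" "y \<longlonglongrightarrow> z" for H B y z
  proof -
    have "(\<lambda>n. B n (y n) - H (y n)) \<longlonglongrightarrow> 0"
      by (rule Lim_null_comparison[OF _ half0]) (use that(1) in \<open>auto simp: close_def abs_minus_commute\<close>)
    moreover have "(\<lambda>n. H (y n)) \<longlonglongrightarrow> H z"
      using that(2,3) by (auto simp: continuous_on_eq_continuous_at isCont_tendsto_compose)
    ultimately have "(\<lambda>n. (B n (y n) - H (y n)) + H (y n)) \<longlonglongrightarrow> 0 + H z" by (rule tendsto_add)
    then show ?thesis by simp
  qed
  have Alim: "(\<lambda>n. A n t) \<longlonglongrightarrow> F t" and Ilim: "(\<lambda>n. rinv (A n) t) \<longlonglongrightarrow> G t" for t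
    using conv[OF F(1) F(3), of "\<lambda>_. t"] conv[OF G(1) G(3), of "\<lambda>_. t"] by auto
  have FG: "F (G t) = t" for t
  proof -
    have "(\<lambda>n. A n (rinv (A n) t)) \<longlonglongrightarrow> F (G t)" by (rule conv[OF F(1) F(3) Ilim])
    then show ?thesis using lpD(4)[OF A] by (simp add: LIMSEQ_const_iff)
  qed
  have GF: "G (F t) = t" for t
  proof -
    have "(\<lambda>n. rinv (A n) (A n t)) \<longlonglongrightarrow> G (F t)" by (rule conv[OF G(1) G(3) Alim])
    then show ?thesis using lpD(5)[OF A] by (simp add: LIMSEQ_const_iff)
  qed
  have "inj F" using GF by (metis injI)
  then have sm: "strict_mono F" using F(2) by (simp add: strict_mono_iff_mono)
  have sj: "surj F" using FG by (metis surjI)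
  have iF: "rinv F = G" using GF FG by (metis inv_unique_comp comp_apply id_apply ext)
  have "\<exists>n H. ph n H \<and> close e F H \<and> close e (rinv F) (rinv H)" if "e > 0" for e
  proof -
    obtain N where N: "(1/2::real)^N < e / 4" using real_arch_pow_inv[of "e/4" "1/2"] \<open>e > 0\<close> by auto
    obtain n H where H: "ph n H" "close (e/2) (A N) H" "close (e/2) (rinv (A N)) (rinv H)" using lpE[OF A, of "e/2" N] \<open>e > 0\<close>
      by (metis half_gt_zero)
    have "close (2 * (1/2)^N + e/2) F H" "close (2 * (1/2)^N + e/2) (rinv F) (rinv H)"
      using close_trans[OF F(1) H(2)] close_trans[OF G(1) H(3)] iF by auto
    moreover have "2 * (1/2)^N + e/2 \<le> e" using N by simp
    ultimately show ?thesis using H(1) close_mono by blast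
  qed
  then have "lp F" using sm sj unfolding lp_def by blast
  then show ?thesis using that F(1) G(1) iF by simp
qed

lemma lp_cj: "lp g \<Longrightarrow> lp x \<Longrightarrow> lp (cj g x)"
  unfolding cj_def by (intro lp_comp lp_inv)

lemma cj_comp: assumes "lp g" "lp h" shows "cj (g \<circ> h) x = cj g (cj h x)"
  unfolding cj_def using o_inv_distrib[OF lpD(3)[OF assms(1)] lpD(3)[OF assms(2)]] by (simp add: o_assoc)

lemma cj_id: "cj (\<lambda>x. x) x = x"
proof -
  have "rinv (\<lambda>x::real. x) = (\<lambda>x. x)" by (rule inv_id[unfolded id_def])
  then show ?thesis by (simp add: cj_def o_def)
qed

lemma cj_inv: assumes "lp g" shows "cj (rinv g) (cj g x) = x" "cj g (cj (rinv g) x) = x"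
  using inv_inv_eq[OF lpD(3)[OF assms]] lpD(4,5)[OF assms] by (auto simp: cj_def)

text \<open>\<open>d\<close> serves all pairs at once: conjugation shifts the argument by
  \<open>rinv g\<close> and then applies the uniformly continuous \<open>g\<close>.\<close>

lemma cj_close:
  assumes "lp g" "e > 0" obtains d where "d > 0" "\<And>x y. close d x y \<Longrightarrow> close e (cj g x) (cj g y)"
proof -
  obtain d where d: "d > 0" "\<And>x y. \<bar>x - y\<bar> \<le> d \<Longrightarrow> \<bar>g x - g y\<bar> \<le> e" using unif_contE[OF lp_unif_cont(1)[OF assms(1)] assms(2)]
    by metis
  then show ?thesis using that by (metis (no_types, lifting) cj_def closeD close_def comp_apply)
qed

subsection \<open>Conjugacy by back and forth\<close>

definition near_id :: "real \<Rightarrow> (real \<Rightarrow> real) \<Rightarrow> bool" where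
  "near_id e H \<longleftrightarrow> lp H \<and> close e H (\<lambda>x. x)"

text \<open>The local form of a dense orbit. A dense orbit alone may be meager; this condition
  provides conjugators that are small, so that successive corrections converge.\<close>

definition loc_dense :: "(real \<Rightarrow> real) \<Rightarrow> bool" where
  "loc_dense x \<longleftrightarrow> (\<forall>e>0. \<exists>r>0. \<forall>y. lp y \<longrightarrow> close r x y \<longrightarrow> (\<forall>s>0. \<exists>H. near_id e H \<and> close s (cj H x) y))"

definition orb_dense :: "(real \<Rightarrow> real) \<Rightarrow> bool" where
  "orb_dense x \<longleftrightarrow> (\<forall>y. lp y \<longrightarrow> (\<forall>s>0. \<exists>H. lp H \<and> close s (cj H x) y))"

text \<open>\<open>cj a\<close> turns a conjugator \<open>H\<close> of \<open>x\<close> into a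
  conjugator of \<open>cj a x\<close>, which stays near the identity by the uniform continuity of
  \<open>a\<close>. Hence the condition is available at every stage of the back and forth.\<close>

lemma loc_dense_cj:
  assumes a: "lp a" and x: "lp x" and P: "loc_dense x" shows "loc_dense (cj a x)"
  unfolding loc_dense_def
proof (intro allI impI)
  fix e :: real assume "e > 0"
  obtain e' where e': "e' > 0" "\<And>x y. \<bar>x - y\<bar> \<le> e' \<Longrightarrow> \<bar>a x - a y\<bar> \<le> e" using unif_contE[OF lp_unif_cont(1)[OF a] \<open>e > 0\<close>] by metis
  obtain r where r: "r > 0" "\<And>y s. lp y \<Longrightarrow> close r x y \<Longrightarrow> s > 0 \<Longrightarrow> \<exists>H. near_id e' H \<and> close s (cj H x) y"
    using P e'(1) unfolding loc_dense_def by metis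
  obtain r' where r': "r' > 0" "\<And>x y. close r' x y \<Longrightarrow> close r (cj (rinv a) x) (cj (rinv a) y)"
    using cj_close[OF lp_inv[OF a] r(1)] by metis
  have "\<exists>H. near_id e H \<and> close s (cj H (cj a x)) w" if w: "lp w" "close r' (cj a x) w" "s > 0" for w s
  proof -
    obtain s' where s': "s' > 0" "\<And>x y. close s' x y \<Longrightarrow> close s (cj a x) (cj a y)" using cj_close[OF a \<open>s > 0\<close>] by metis
    have "close r x (cj (rinv a) w)" using r'(2)[OF w(2)] cj_inv[OF a] by simp
    then obtain H where H: "near_id e' H" "close s' (cj H x) (cj (rinv a) w)"
      using r(2)[of "cj (rinv a) w" s'] lp_cj[OF lp_inv[OF a] w(1)] s'(1) by auto
    have lH: "lp H" "close e' H (\<lambda>x. x)" using H by (auto simp: near_id_def)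
    have "close s (cj a (cj H x)) w" using s'(2)[OF H(2)] cj_inv[OF a] by simp
    moreover have "cj (cj a H) (cj a x) = cj a (cj H x)"
    proof -
      have "cj a (cj H x) = cj (a \<circ> H) x" using cj_comp a lH by simp
      moreover have "a \<circ> H = cj a H \<circ> a" using lpD(5)[OF a] by (auto simp: cj_def)
      ultimately show ?thesis using cj_comp[OF lp_cj[OF a lH(1)] a] by simp
    qed
    moreover have "close e (cj a H) (\<lambda>x. x)"
      unfolding close_def
    proof
      fix t
      have "\<bar>H (rinv a t) - rinv a t\<bar> \<le> e'" using closeD[OF lH(2), of "rinv a t"] .
      then have "\<bar>a (H (rinv a t)) - a (rinv a t)\<bar> \<le> e" by (rule e'(2))
      then show "\<bar>cj a H t - t\<bar> \<le> e" using lpD(4)[OF a] by (simp add: cj_def)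
    qed
    ultimately show ?thesis using lp_cj[OF a lH(1)] unfolding near_id_def by metis
  qed
  then show "\<exists>r>0. \<forall>y. lp y \<longrightarrow> close r (cj a x) y \<longrightarrow> (\<forall>s>0. \<exists>H. near_id e H \<and> close s (cj H (cj a x)) y)" using r'(1) by blast
qed


text \<open>Measures a correction \<open>H \<circ> a\<close> of the conjugator \<open>a\<close>. It
  moves \<open>a\<close> by at most \<open>e\<close> in any case, but how far it moves the inverse
  depends on the modulus of \<open>rinv a\<close>; so \<open>e\<close> can be fixed only after
  \<open>a\<close>.\<close>

definition tight :: "real \<Rightarrow> real \<Rightarrow> (real \<Rightarrow> real) \<Rightarrow> bool" where
  "tight e d a \<longleftrightarrow> 0 < e \<and> e \<le> d \<and> (\<forall>H. near_id e H \<longrightarrow> close d (rinv a) (rinv (H \<circ> a)))"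

lemma tight_ex: assumes a: "lp a" and "d > 0" shows "\<exists>e. tight e d a"
proof -
  obtain e where e: "e > 0" "\<And>x y. \<bar>x - y\<bar> \<le> e \<Longrightarrow> \<bar>rinv a x - rinv a y\<bar> \<le> d" using unif_contE[OF lp_unif_cont(2)[OF a] \<open>d > 0\<close>]
    by metis
  have "close d (rinv a) (rinv (H \<circ> a))" if H: "near_id (min e d) H" for H
    unfolding close_def
  proof
    fix t
    have lH: "lp H" "close (min e d) H (\<lambda>x. x)" using H by (auto simp: near_id_def)
    have "\<bar>H (rinv H t) - rinv H t\<bar> \<le> min e d" using closeD[OF lH(2), of "rinv H t"] .
    then have "\<bar>t - rinv H t\<bar> \<le> e" using lpD(4)[OF lH(1)] by simp
    then have "\<bar>rinv a t - rinv a (rinv H t)\<bar> \<le> d" by (rule e(2))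
    then show "\<bar>rinv a t - rinv (H \<circ> a) t\<bar> \<le> d"
      using o_inv_distrib[OF lpD(3)[OF lH(1)] lpD(3)[OF a]] by simp
  qed
  then show ?thesis using e(1) \<open>d > 0\<close> by (intro exI[of _ "min e d"]) (auto simp: tight_def)
qed

definition dense_near :: "real \<Rightarrow> (real \<Rightarrow> real) \<Rightarrow> (real \<Rightarrow> real) \<Rightarrow> bool" where
  "dense_near e y x \<longleftrightarrow> (\<exists>r>0. \<forall>w. lp w \<longrightarrow> close r x w \<longrightarrow> (\<forall>s>0. \<exists>H. near_id e H \<and> close s (cj H y) w))"

text \<open>One step of the back-and-forth: \<open>b\<close> is corrected by an element close to the identity, so that
  \<open>cj b' y\<close> comes close to \<open>cj a x\<close>; afterwards the roles of \<open>a, x\<close> and \<open>b, y\<close> are exchanged.\<close>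
lemma back_and_forth_step:
  assumes a: "lp a" and b: "lp b" and x: "lp x" and y: "lp y" and P: "loc_dense x"
    and d: "d > 0" "d' > 0" and fb: "tight e d b" and near: "dense_near e (cj b y) (cj a x)"
  shows "\<exists>b' e'. lp b' \<and> tight e' d' a \<and> dense_near e' (cj a x) (cj b' y) \<and>
     close d b b' \<and> close d (rinv b) (rinv b') \<and> close d (cj a x) (cj b' y)"
proof -
  obtain e' where e': "tight e' d' a" using tight_ex[OF a d(2)] by blast
  then have "e' > 0" by (simp add: tight_def)
  then obtain r' where r': "r' > 0" "\<And>w s. lp w \<Longrightarrow> close r' (cj a x) w \<Longrightarrow> s > 0 \<Longrightarrow> \<exists>H. near_id e' H \<and> close s (cj H (cj a x)) w"
    using loc_dense_cj[OF a x P] unfolding loc_dense_def by metis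
  \<comment> \<open>Half of \<open>r'\<close> is kept in reserve, so that the ball of radius
    \<open>r' / 2\<close> around the new \<open>cj b' y\<close> stays inside the ball around
    \<open>cj a x\<close> where density is known.\<close>
  define s where "s = min (r'/2) d"
  have s: "s > 0" "s \<le> r'/2" "s \<le> d" using r' d by (auto simp: s_def)
  have lx: "lp (cj a x)" using lp_cj[OF a x] .
  obtain r where r: "r > 0" "\<And>w s. lp w \<Longrightarrow> close r (cj a x) w \<Longrightarrow> s > 0 \<Longrightarrow> \<exists>H. near_id e H \<and> close s (cj H (cj b y)) w"
    using near unfolding dense_near_def by metis
  obtain H where H: "near_id e H" "close s (cj H (cj b y)) (cj a x)"
    using r(2)[OF lx close_refl s(1)] r(1) by auto
  have lH: "lp H" "close e H (\<lambda>x. x)" using H by (auto simp: near_id_def)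
  define b' where "b' = H \<circ> b"
  have lb: "lp b'" unfolding b'_def by (rule lp_comp[OF lH(1) b])
  have c: "close s (cj b' y) (cj a x)" using H(2) cj_comp[OF lH(1) b] by (simp add: b'_def)
  have "dense_near e' (cj a x) (cj b' y)"
    unfolding dense_near_def
  proof (intro exI[of _ "r'/2"] conjI allI impI)
    fix w t :: "_" assume w: "lp w" "close (r'/2) (cj b' y) w" and t: "(0::real) < t"
    have "close r' (cj a x) w" using close_mono[OF close_trans[OF close_sym[OF c] w(2)]] s by simp
    then show "\<exists>H. near_id e' H \<and> close t (cj H (cj a x)) w" using r'(2) w t by blast
  qed (use r' in simp)
  moreover have "close d b b'"
    using closeD[OF lH(2)] fb order_trans by (fastforce simp: close_def b'_def tight_def abs_minus_commute)
  moreover have "close d (rinv b) (rinv b')" using fb H(1) by (simp add: tight_def b'_def)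
  moreover have "close d (cj a x) (cj b' y)" using close_mono[OF close_sym[OF c] s(3)] .
  ultimately show ?thesis using lb e' by blast
qed

text \<open>The radius in which the next correction of a conjugator is small is known only once this
  conjugator is fixed. Alternating the sides resolves the circularity: while \<open>a\<close> rests,
  \<open>b\<close> is corrected so that \<open>cj b y\<close> enters the radius belonging to
  \<open>a\<close>. The corrections are summable, also on the inverses, and in the limit
  \<open>cj U x = cj V y\<close>.\<close>

lemma conjugate_if_dense:
  assumes x: "lp x" "loc_dense x" "orb_dense x" and y: "lp y" "loc_dense y"
  obtains g where "lp g" "cj g x = y"
proof -
  define Z where "Z = (\<lambda>n::nat. if even n then x else y)"
  have Z: "lp (Z n)" "loc_dense (Z n)" for n using x y by (auto simp: Z_def)
  \<comment> \<open>In a state \<open>(a, b, e)\<close> the conjugator \<open>a\<close> belongs to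
    \<open>Z n\<close> and rests, while \<open>b\<close> belongs to \<open>Z (Suc n)\<close> and is
    corrected next by an \<open>e\<close>-small map.\<close>
  define St where "St = (\<lambda>n (a, b, e). lp a \<and> lp b \<and> tight e ((1/2)^n) b \<and> dense_near e (cj b (Z (Suc n))) (cj a (Z n)))"
  define Tr where "Tr = (\<lambda>n (a, b, e::real) (a', b', e'::real). b' = a \<and> close ((1/2)^n) b a' \<and>
    close ((1/2)^n) (rinv b) (rinv a') \<and> close ((1/2)^n) (cj a (Z n)) (cj a' (Z (Suc n))))"
  have "\<exists>f. \<forall>n. St n (f n) \<and> Tr n (f n) (f (Suc n))"
  proof (rule dependent_nat_choice)
    have fid: "tight 1 1 (\<lambda>x. x)"
    proof -
      have "close 1 (rinv (\<lambda>x. x)) (rinv (H \<circ> (\<lambda>x. x)))" if H: "near_id 1 H" for H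
        unfolding close_def
      proof
        fix t
        have lH: "lp H" "close 1 H (\<lambda>x. x)" using H by (auto simp: near_id_def)
        have "H \<circ> (\<lambda>x. x) = H" by (simp add: comp_def)
        moreover have "rinv (\<lambda>x::real. x) = (\<lambda>x. x)" by (rule inv_id[unfolded id_def])
        ultimately show "\<bar>rinv (\<lambda>x. x) t - rinv (H \<circ> (\<lambda>x. x)) t\<bar> \<le> 1"
          using closeD[OF lH(2), of "rinv H t"] lpD(4)[OF lH(1)] by simp
      qed
      then show ?thesis by (simp add: tight_def)
    qed
    obtain r where r: "r > 0" "\<And>w s. lp w \<Longrightarrow> close r y w \<Longrightarrow> s > 0 \<Longrightarrow> \<exists>H. near_id 1 H \<and> close s (cj H y) w"
      using y(2) unfolding loc_dense_def by (metis zero_less_one)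
    obtain a where a: "lp a" "close (r/2) (cj a x) y" using x(3) y(1) r(1) unfolding orb_dense_def by (metis half_gt_zero)
    have "dense_near 1 y (cj a x)"
      unfolding dense_near_def
    proof (intro exI[of _ "r/2"] conjI allI impI)
      fix w t assume w: "lp w" "close (r/2) (cj a x) w" and t: "(0::real) < t"
      have "close r y w" using close_trans[OF close_sym[OF a(2)] w(2)] by simp
      then show "\<exists>H. near_id 1 H \<and> close t (cj H y) w" using r(2) w t by blast
    qed (use r in simp)
    then have "St 0 (a, (\<lambda>x. x), 1)" using a(1) fid lp_id by (simp add: St_def Z_def cj_id)
    then show "\<exists>s. St 0 s" by blast
  next
    fix st n assume "St n st"
    then obtain a b e where st: "st = (a, b, e)" "lp a" "lp b" "tight e ((1/2)^n) b"
      "dense_near e (cj b (Z (Suc n))) (cj a (Z n))"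
      by (auto simp: St_def)
    have "\<exists>b' e'. lp b' \<and> tight e' ((1/2)^Suc n) a \<and> dense_near e' (cj a (Z n)) (cj b' (Z (Suc n))) \<and>
     close ((1/2)^n) b b' \<and> close ((1/2)^n) (rinv b) (rinv b') \<and> close ((1/2)^n) (cj a (Z n)) (cj b' (Z (Suc n)))"
      by (rule back_and_forth_step[OF st(2,3) Z(1) Z(1) Z(2) _ _ st(4,5)]) auto
    then obtain b' e' where n: "lp b'" "tight e' ((1/2)^Suc n) a" "dense_near e' (cj a (Z n)) (cj b' (Z (Suc n)))"
     "close ((1/2)^n) b b'" "close ((1/2)^n) (rinv b) (rinv b')" "close ((1/2)^n) (cj a (Z n)) (cj b' (Z (Suc n)))" by blast
    moreover have "Z (Suc (Suc n)) = Z n" by (simp add: Z_def)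
    ultimately show "\<exists>st'. St (Suc n) st' \<and> Tr n st st'" using st
      by (intro exI[of _ "(b', a, e')"]) (simp add: St_def Tr_def)
  qed
  then obtain f where f: "\<And>n. St n (f n)" "\<And>n. Tr n (f n) (f (Suc n))" by blast
  define a where "a = (\<lambda>n. fst (f n))"
  have la: "lp (a n)" for n using f(1)[of n] by (auto simp: St_def a_def split: prod.splits)
  have sn: "fst (snd (f (Suc n))) = a n" for n using f(2)[of n] by (auto simp: Tr_def a_def split: prod.splits)
  have ca: "close ((1/2)^Suc n) (a n) (a (Suc (Suc n)))" "close ((1/2)^Suc n) (rinv (a n)) (rinv (a (Suc (Suc n))))" for n
    using f(2)[of "Suc n"] sn[of n] by (auto simp: Tr_def a_def split: prod.splits)
  have cc: "close ((1/2)^n) (cj (a n) (Z n)) (cj (a (Suc n)) (Z (Suc n)))" for n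
    using f(2)[of n] by (auto simp: Tr_def a_def split: prod.splits)
  have pw: "(1/2::real)^m \<le> (1/2)^n" if "n \<le> m" for m n using that by (intro power_decreasing) auto
  \<comment> \<open>The corrected \<open>b\<close> becomes the new \<open>a\<close>, so the even
    indices give the conjugators of \<open>x\<close> and the odd ones those of
    \<open>y\<close>.\<close>
  have sub: "\<exists>U. lp U \<and> (\<forall>n. close (2 * (1/2)^n) U (a (2 * n + i))) \<and> (\<forall>n. close (2 * (1/2)^n) (rinv U) (rinv (a (2 * n + i))))"
    for i
  proof -
    have "close ((1/2)^n) (a (2 * n + i)) (a (2 * Suc n + i))"
      "close ((1/2)^n) (rinv (a (2 * n + i))) (rinv (a (2 * Suc n + i)))" for n
      using close_mono[OF ca(1)[of "2*n+i"] pw[of n]] close_mono[OF ca(2)[of "2*n+i"] pw[of n]] by auto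
    then show ?thesis using lp_limit[of "\<lambda>n. a (2 * n + i)"] la by metis
  qed
  obtain U where U: "lp U" "\<And>n. close (2 * (1/2)^n) U (a (2 * n + 0))" "\<And>n. close (2 * (1/2)^n) (rinv U) (rinv (a (2 * n + 0)))"
    using sub[of 0] by blast
  obtain V where V: "lp V" "\<And>n. close (2 * (1/2)^n) V (a (2 * n + 1))" "\<And>n. close (2 * (1/2)^n) (rinv V) (rinv (a (2 * n + 1)))"
    using sub[of 1] by blast
  have half0: "(\<lambda>n. 2 * (1/2::real)^n) \<longlonglongrightarrow> 0" by (rule tendsto_mult_right_zero, rule LIMSEQ_realpow_zero) auto
  have lim: "(\<lambda>n. cj (a (2 * n + i)) z t) \<longlonglongrightarrow> cj W z t"
    if W: "lp W" "\<And>n. close (2 * (1/2)^n) W (a (2 * n + i))" "\<And>n. close (2 * (1/2)^n) (rinv W) (rinv (a (2 * n + i)))" and z: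
      "lp z" for W i z t
  proof -
    have 1: "(\<lambda>n. rinv (a (2 * n + i)) t) \<longlonglongrightarrow> rinv W t"
    proof -
      have "(\<lambda>n. rinv (a (2 * n + i)) t - rinv W t) \<longlonglongrightarrow> 0"
        by (rule Lim_null_comparison[OF _ half0]) (use W(3) in \<open>auto simp: close_def abs_minus_commute\<close>)
      then show ?thesis by (simp add: LIM_zero_iff)
    qed
    have "continuous_on UNIV (\<lambda>u. W (z u))" using lp_continuous[OF lp_comp[OF W(1) z], of UNIV] by (simp add: comp_def)
    then have 2: "(\<lambda>n. W (z (rinv (a (2 * n + i)) t))) \<longlonglongrightarrow> W (z (rinv W t))"
      using isCont_tendsto_compose[of "rinv W t" "\<lambda>u. W (z u)"] 1 by (simp add: continuous_on_eq_continuous_at)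
    have 3: "(\<lambda>n. a (2 * n + i) (z (rinv (a (2 * n + i)) t)) - W (z (rinv (a (2 * n + i)) t))) \<longlonglongrightarrow> 0"
      by (rule Lim_null_comparison[OF _ half0]) (use W(2) in \<open>auto simp: close_def abs_minus_commute\<close>)
    from tendsto_add[OF 3 2] show ?thesis by (simp add: cj_def)
  qed
  have "cj U x t = cj V y t" for t
  proof -
    have "(\<lambda>n. cj (a (2 * n + 0)) x t - cj (a (2 * n + 1)) y t) \<longlonglongrightarrow> cj U x t - cj V y t"
      by (intro tendsto_diff lim U V x y)
    moreover have "(\<lambda>n. cj (a (2 * n + 0)) x t - cj (a (2 * n + 1)) y t) \<longlonglongrightarrow> 0"
    proof (rule Lim_null_comparison[OF _ half0], rule always_eventually, rule allI)
      fix n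
      have "close ((1/2)^(2*n)) (cj (a (2*n)) x) (cj (a (2*n+1)) y)" using cc[of "2*n"] by (simp add: Z_def)
      then have "\<bar>cj (a (2*n)) x t - cj (a (2*n+1)) y t\<bar> \<le> (1/2)^(2*n)" by (rule closeD)
      moreover have "(1/2::real)^(2*n) \<le> (1/2)^n" by (rule pw) simp
      ultimately show "norm (cj (a (2 * n + 0)) x t - cj (a (2 * n + 1)) y t) \<le> 2 * (1/2)^n" unfolding real_norm_def
        by (simp only: add_0_right)
    qed
    ultimately have "cj U x t - cj V y t = 0" by (rule LIMSEQ_unique)
    then show ?thesis by simp
  qed
  then have "cj U x = cj V y" by blast
  then have "cj (rinv V \<circ> U) x = y" using cj_comp[OF lp_inv[OF V(1)] U(1)] cj_inv[OF V(1)] by simp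
  moreover have "lp (rinv V \<circ> U)" using lp_comp[OF lp_inv[OF V(1)] U(1)] .
  ultimately show ?thesis using that by blast
qed


subsection \<open>Generic maps\<close>

definition sampled :: "nat \<Rightarrow> nat \<Rightarrow> real \<Rightarrow> (real \<Rightarrow> real) \<Rightarrow> bool" where
  "sampled n N e G \<longleftrightarrow> ph n G \<and> N > 0 \<and> 1 / real N \<le> e \<and>
     (\<forall>x y. \<bar>x - y\<bar> \<le> L n / real N \<longrightarrow> \<bar>G x - G y\<bar> \<le> e)"

text \<open>A finite code for a map of level \<open>n\<close>; as there are only countably many
  codes, this is the source of separability. The modulus of continuity is part of
  \<open>sampled\<close>, since the code does not show it.\<close>

definition sample :: "nat \<Rightarrow> nat \<Rightarrow> (real \<Rightarrow> real) \<Rightarrow> int list" where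
  "sample n N G = map (\<lambda>i. \<lfloor>G (real i * L n / real N) * real N\<rfloor>) [0..<Suc N]"

text \<open>Equal codes bound the difference at the nodes by \<open>1 / N \<le> e\<close>; between
  two nodes both maps are monotone and vary by at most \<open>e\<close>.\<close>

lemma sample_close:
  assumes G: "sampled n N e G" and G': "sampled n N e G'" and eq: "sample n N G = sample n N G'"
  shows "close (2 * e) G G'"
proof -
  define q where "q = (\<lambda>i::nat. real i * L n / real N)"
  have N: "N > 0" and e: "1 / real N \<le> e" and ph: "ph n G" "ph n G'" using G G' by (auto simp: sampled_def)
  have osc: "\<bar>F x - F y\<bar> \<le> e" if "F = G \<or> F = G'" "\<bar>x - y\<bar> \<le> L n / real N" for F x y
    using G G' that by (auto simp: sampled_def)
  have node: "\<bar>G (q i) - G' (q i)\<bar> \<le> 1 / real N" if "i \<le> N" for i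
  proof -
    have "sample n N G ! i = sample n N G' ! i" using eq by simp
    moreover have "[0..<Suc N] ! i = i" using that by (subst nth_upt) auto
    ultimately have "\<lfloor>G (q i) * real N\<rfloor> = \<lfloor>G' (q i) * real N\<rfloor>" using that unfolding sample_def q_def
      by (simp del: upt_Suc)
    then have "\<bar>G (q i) * real N - G' (q i) * real N\<bar> \<le> 1" by linarith
    then have "\<bar>G (q i) - G' (q i)\<bar> * real N \<le> 1" by (simp add: left_diff_distrib[symmetric])
    then show ?thesis using N by (simp add: field_simps)
  qed
  have base: "\<bar>G t - G' t\<bar> \<le> 2 * e" if t: "t \<in> {0..L n}" for t
  proof -
    \<comment> \<open>The right end point is assigned to the last cell; the floor would give
      \<open>N\<close>.\<close>
    define i where "i = (if t = L n then N - 1 else nat \<lfloor>t * real N / L n\<rfloor>)"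
    have i: "i < N" "q i \<le> t" "t \<le> q (Suc i)"
    proof -
      have "i < N \<and> q i \<le> t \<and> t \<le> q (Suc i)"
      proof (cases "t = L n")
        case True
        then show ?thesis using N L_pos[of n] by (auto simp: i_def q_def field_simps)
      next
        case False
        then have t': "0 \<le> t" "t < L n" using t by auto
        define u where "u = t * real N / L n"
        have "0 \<le> u" "u < real N" using t' N by (auto simp: u_def field_simps)
        then have "real (nat \<lfloor>u\<rfloor>) \<le> u" "u \<le> real (Suc (nat \<lfloor>u\<rfloor>))" "nat \<lfloor>u\<rfloor> < N" by linarith+
        moreover have "i = nat \<lfloor>u\<rfloor>" using False by (simp add: i_def u_def)
        ultimately have "real i \<le> u" "u \<le> real (Suc i)" "i < N" by auto
        then show ?thesis using L_pos[of n] unfolding q_def u_def by (simp add: field_simps)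
      qed
      then show "i < N" "q i \<le> t" "t \<le> q (Suc i)" by auto
    qed
    have step: "q (Suc i) - q i = L n / real N" by (simp add: q_def add_divide_distrib distrib_right)
    have m: "F (q i) \<le> F t" "F t \<le> F (q (Suc i))" if "F = G \<or> F = G'" for F
      using ph that i by (auto simp: per_homeo_def strict_mono_less_eq)
    have "\<bar>q (Suc i) - q i\<bar> \<le> L n / real N" using step L_pos[of n] by simp
    then have "\<bar>F (q (Suc i)) - F (q i)\<bar> \<le> e" if "F = G \<or> F = G'" for F
      using osc[OF that] by blast
    then have o: "\<bar>G (q (Suc i)) - G (q i)\<bar> \<le> e" "\<bar>G' (q (Suc i)) - G' (q i)\<bar> \<le> e" by auto
    have "\<bar>G (q i) - G' (q i)\<bar> \<le> e" "\<bar>G (q (Suc i)) - G' (q (Suc i))\<bar> \<le> e" using node[of i] node[of "Suc i"] i e by auto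
    moreover have "G (q i) \<le> G t" "G t \<le> G (q (Suc i))" "G' (q i) \<le> G' t" "G' t \<le> G' (q (Suc i))" using m by auto
    ultimately show ?thesis using o by linarith
  qed
  show ?thesis
    unfolding close_def
  proof
    fix t
    show "\<bar>G t - G' t\<bar> \<le> 2 * e"
    proof (cases rule: fold_obtain[OF L_pos[of n], where t = t])
      case (1 k s)
      then show ?thesis using base[OF 1(1)] per_homeo_fold[OF ph(1)] per_homeo_fold[OF ph(2)] by simp
    next
      case (2 k s)
      then show ?thesis using base[OF 2(1)] per_homeo_fold[OF ph(1)] per_homeo_fold[OF ph(2)] by (simp add: abs_minus_commute)
    qed
  qed
qed

text \<open>One representative is chosen for every code that occurs, so no interpolating map has to
  be constructed.\<close>

lemma countable_net:
  obtains Q where "countable Q" "\<And>q. q \<in> Q \<Longrightarrow> lp q" "\<And>x s. lp x \<Longrightarrow> s > 0 \<Longrightarrow> \<exists>q\<in>Q. close s x q"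
proof -
  define ok where "ok = (\<lambda>(n, N, k, c) q. sampled n N (1 / real (Suc k)) q \<and> sample n N q = c)"
  define Q where "Q = (\<lambda>z. SOME q. ok z q) ` {z. \<exists>q. ok z q}"
  have "countable Q" unfolding Q_def by (rule countable_image) (rule countableI_type)
  moreover have "lp q" if qQ: "q \<in> Q" for q
  proof -
    obtain z where "q = (SOME q. ok z q)" "\<exists>q. ok z q" using qQ unfolding Q_def by blast
    then have "ok z q" using someI_ex[of "ok z"] by simp
    then show ?thesis using ph_lp by (auto simp: ok_def sampled_def split: prod.splits)
  qed
  moreover have "\<exists>q\<in>Q. close s x q" if "lp x" "s > 0" for x s
  proof -
    obtain n G where G: "ph n G" "close (s/2) x G" using lpE[OF \<open>lp x\<close>, of "s/2"] \<open>s > 0\<close> by (metis half_gt_zero)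
    obtain k where k: "1 / real (Suc k) < s / 4" using nat_approx_posE[of "s/4"] \<open>s > 0\<close>
      by (metis divide_pos_pos of_nat_0_less_iff zero_less_numeral)
    obtain d where d: "d > 0" "\<And>x y. \<bar>x - y\<bar> \<le> d \<Longrightarrow> \<bar>G x - G y\<bar> \<le> 1 / real (Suc k)"
      using unif_contE[OF ph_unif_cont[OF G(1)], of "1 / real (Suc k)"]
        by (metis of_nat_0_less_iff zero_less_Suc zero_less_divide_1_iff)
    obtain N where N: "max (real (Suc k)) (L n / d) < real N" using reals_Archimedean2 by blast
    then have "real N > 0" "N > 0" by (auto simp del: of_nat_Suc)
    have "1 / real N \<le> 1 / real (Suc k)" using N by (intro divide_left_mono) auto
    moreover have "L n / real N \<le> d" using N d(1) by (auto simp: field_simps)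
    ultimately have sG: "sampled n N (1 / real (Suc k)) G" unfolding sampled_def using G(1) \<open>N > 0\<close> d(2) by auto
    define z where "z = (n, N, k, sample n N G)"
    define q where "q = (SOME q. ok z q)"
    have "ok z G" using sG by (simp add: ok_def z_def)
    then have "ok z q" "q \<in> Q" unfolding q_def Q_def using someI[of "ok z" G] by blast+
    then have "sampled n N (1 / real (Suc k)) q" "sample n N G = sample n N q" by (auto simp: ok_def z_def)
    then have "close (2 * (1 / real (Suc k))) G q" by (rule sample_close[OF sG])
    then have "close (s/2 + 2 * (1 / real (Suc k))) x q" by (rule close_trans[OF G(2)])
    moreover have "s/2 + 2 * (1 / real (Suc k)) \<le> s" using k by linarith
    ultimately show ?thesis using close_mono \<open>q \<in> Q\<close> by blast
  qed
  ultimately show ?thesis using that by blast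
qed

definition open_pred :: "((real \<Rightarrow> real) \<Rightarrow> bool) \<Rightarrow> bool" where
  "open_pred A \<longleftrightarrow> (\<forall>x. lp x \<longrightarrow> A x \<longrightarrow> (\<exists>r>0. \<forall>y. lp y \<longrightarrow> close r x y \<longrightarrow> A y))"

definition dense_pred :: "((real \<Rightarrow> real) \<Rightarrow> bool) \<Rightarrow> bool" where
  "dense_pred A \<longleftrightarrow> (\<forall>x. lp x \<longrightarrow> (\<forall>r>0. \<exists>y. lp y \<and> close r x y \<and> A y))"

text \<open>The union of a set with the interior of its complement. For open \<open>A\<close> it is
  open and dense, and a generic map either satisfies \<open>A\<close> or is separated from it by a
  whole neighbourhood.\<close>

definition decided :: "((real \<Rightarrow> real) \<Rightarrow> bool) \<Rightarrow> (real \<Rightarrow> real) \<Rightarrow> bool" where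
  "decided A x \<longleftrightarrow> A x \<or> (\<exists>r>0. \<forall>y. lp y \<longrightarrow> close r x y \<longrightarrow> \<not> A y)"

lemma open_pred_decided: assumes "open_pred A" shows "open_pred (decided A)"
  unfolding open_pred_def
proof (intro allI impI)
  fix x assume x: "lp x" "decided A x"
  show "\<exists>r>0. \<forall>y. lp y \<longrightarrow> close r x y \<longrightarrow> decided A y"
  proof (cases "A x")
    case True
    then obtain r where "r > 0" "\<And>y. lp y \<Longrightarrow> close r x y \<Longrightarrow> A y" using assms x(1) unfolding open_pred_def by metis
    then show ?thesis unfolding decided_def by metis
  next
    case False
    then obtain r where r: "r > 0" "\<And>y. lp y \<Longrightarrow> close r x y \<Longrightarrow> \<not> A y" using x by (auto simp: decided_def)
    have "decided A y" if "lp y" "close (r/2) x y" for y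
    proof -
      have "\<not> A z" if "lp z" "close (r/2) y z" for z
        using r(2)[OF that(1)] close_trans[OF \<open>close (r/2) x y\<close> that(2)] by simp
      then show ?thesis using r(1) unfolding decided_def by (metis half_gt_zero)
    qed
    then show ?thesis using r(1) by (intro exI[of _ "r/2"]) auto
  qed
qed

lemma dense_pred_decided: "dense_pred (decided A)"
  unfolding dense_pred_def
proof (intro allI impI)
  fix x and r :: real assume x: "lp x" "r > 0"
  show "\<exists>y. lp y \<and> close r x y \<and> decided A y"
  proof (cases "\<exists>y. lp y \<and> close r x y \<and> A y")
    case True then show ?thesis by (auto simp: decided_def)
  next
    case False
    then have "decided A x" using x unfolding decided_def by blast
    then show ?thesis using x close_refl[of r x] by auto
  qed
qed

text \<open>The sup distance has Cauchy sequences of homeomorphisms without a limit homeomorphism;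
  it becomes complete when the inverses are measured too. So each step also controls the inverse,
  for which \<open>close_inv\<close> shrinks the radius.\<close>

lemma baire_point:
  assumes "countable \<S>" and S: "\<And>A. A \<in> \<S> \<Longrightarrow> open_pred A \<and> dense_pred A"
  obtains x where "lp x" "\<And>A. A \<in> \<S> \<Longrightarrow> A x"
proof (cases "\<S> = {}")
  case True
  then show ?thesis using that lp_id by blast
next
  case False
  define A where "A = from_nat_into \<S>"
  have A: "open_pred (A n)" "dense_pred (A n)" for n using S from_nat_into[OF False] by (auto simp: A_def)
  define St where "St = (\<lambda>n::nat. \<lambda>(x, r). lp x \<and> (r::real) > 0)"
  define Tr where "Tr = (\<lambda>n (x, r) (x', r'). close ((1/2)^n) x x' \<and> close ((1/2)^n) (rinv x) (rinv x') \<and>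
     (\<forall>y. lp y \<longrightarrow> close r' x' y \<longrightarrow> close (r::real) x y \<and> A n y))"
  have "\<exists>f. \<forall>n. St n (f n) \<and> Tr n (f n) (f (Suc n))"
  proof (rule dependent_nat_choice)
    show "\<exists>s. St 0 s" using lp_id by (auto simp: St_def intro!: exI[of _ 1])
  next
    fix st n assume "St n st"
    then obtain x r where st: "st = (x, r)" "lp x" "r > 0" by (auto simp: St_def)
    obtain d where d: "d > 0" "\<And>G. lp G \<Longrightarrow> close d x G \<Longrightarrow> close ((1/2)^n) (rinv x) (rinv G)"
      using close_inv[OF st(2), of "(1/2)^n"] by auto
    define t where "t = min (r/2) (min d ((1/2)^n))"
    have t: "t > 0" "t \<le> r/2" "t \<le> d" "t \<le> (1/2)^n" using st d by (auto simp: t_def)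
    obtain y where y: "lp y" "close t x y" "A n y" using A(2)[of n] st(2) t(1) unfolding dense_pred_def by blast
    obtain r' where r': "r' > 0" "\<And>z. lp z \<Longrightarrow> close r' y z \<Longrightarrow> A n z" using A(1)[of n] y unfolding open_pred_def by metis
    have "close r x z" if "close (min r' (r/2)) y z" for z
      using close_mono[OF close_trans[OF y(2) that]] t by auto
    moreover have "close r' y z" if "close (min r' (r/2)) y z" for z using close_mono[OF that] by simp
    ultimately have "Tr n st (y, min r' (r/2))"
      unfolding Tr_def st(1) using r'(2) close_mono[OF y(2) t(4)] d(2)[OF y(1) close_mono[OF y(2) t(3)]] by auto
    moreover have "St (Suc n) (y, min r' (r/2))" using y r' st by (auto simp: St_def)
    ultimately show "\<exists>st'. St (Suc n) st' \<and> Tr n st st'" by blast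
  qed
  then obtain f where f: "\<And>n. St n (f n)" "\<And>n. Tr n (f n) (f (Suc n))" by blast
  define x r where "x = (\<lambda>n. fst (f n))" and "r = (\<lambda>n. snd (f n))"
  have lx: "lp (x n)" "r n > 0" for n using f(1)[of n] by (auto simp: St_def x_def r_def split: prod.splits)
  have tr: "close ((1/2)^n) (x n) (x (Suc n))" "close ((1/2)^n) (rinv (x n)) (rinv (x (Suc n)))"
     "\<And>y. lp y \<Longrightarrow> close (r (Suc n)) (x (Suc n)) y \<Longrightarrow> close (r n) (x n) y \<and> A n y" for n
    using f(2)[of n] by (auto simp: Tr_def x_def r_def split: prod.splits)
  obtain F where F: "lp F" "\<And>n. close (2 * (1/2)^n) F (x n)" using lp_limit[of x, OF lx(1) tr(1) tr(2)] by metis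
  have nest: "close (r n) (x n) y" if "lp y" "close (r (n + k)) (x (n + k)) y" for n k y
    using that(2)
  proof (induction k)
    case (Suc k)
    then show ?case using tr(3)[OF that(1), of "n + k"] by simp
  qed simp
  have "A n F" for n
  proof -
    \<comment> \<open>All later centres lie in this closed ball, hence so does their limit.\<close>
    have "close (r (Suc n)) (x (Suc n)) F"
      unfolding close_def
    proof
      fix t
      have half0: "(\<lambda>n. 2 * (1/2::real)^n) \<longlonglongrightarrow> 0" by (rule tendsto_mult_right_zero, rule LIMSEQ_realpow_zero) auto
      have "(\<lambda>n. x n t - F t) \<longlonglongrightarrow> 0"
        by (rule Lim_null_comparison[OF _ half0]) (use F(2) in \<open>auto simp: close_def abs_minus_commute\<close>)
      then have "(\<lambda>n. x n t) \<longlonglongrightarrow> F t" by (simp add: LIM_zero_iff)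
      then have "(\<lambda>k. \<bar>x (Suc n) t - x (k + Suc n) t\<bar>) \<longlonglongrightarrow> \<bar>x (Suc n) t - F t\<bar>"
        by (intro tendsto_intros LIMSEQ_ignore_initial_segment)
      moreover have "\<bar>x (Suc n) t - x (k + Suc n) t\<bar> \<le> r (Suc n)" for k
        using closeD[OF nest[OF lx(1) close_refl[OF less_imp_le[OF lx(2)]], of "Suc n" k]] by (metis add.commute)
      ultimately show "\<bar>x (Suc n) t - F t\<bar> \<le> r (Suc n)" by (intro LIMSEQ_le_const2) auto
    qed
    then show ?thesis using tr(3) F(1) by blast
  qed
  then have "B F" if "B \<in> \<S>" for B
    using from_nat_into_to_nat_on[OF \<open>countable \<S>\<close> that] unfolding A_def by metis
  then show ?thesis using that F(1) by blast
qed

text \<open>An amalgamation property. In contrast to \<open>loc_dense\<close>, the map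
  \<open>F\<close> may be perturbed before it is conjugated, so the condition can be checked around
  specially constructed maps; genericity then removes the perturbation.\<close>

definition locally_transitive :: "real \<Rightarrow> (real \<Rightarrow> real) \<Rightarrow> real \<Rightarrow> bool" where
  "locally_transitive e x r \<longleftrightarrow> (\<forall>F F' s. lp F \<longrightarrow> lp F' \<longrightarrow> close r x F \<longrightarrow> close r x F' \<longrightarrow> s > 0 \<longrightarrow>
     (\<exists>H F1. near_id e H \<and> lp F1 \<and> close s F F1 \<and> close s (cj H F1) F'))"

text \<open>The strict margin \<open>s' < s\<close> makes this an open condition on
  \<open>x\<close>. The parameter \<open>B\<close> stands for small conjugators in the local case
  and for all of them in the global case.\<close>

definition hits :: "((real \<Rightarrow> real) \<Rightarrow> bool) \<Rightarrow> (real \<Rightarrow> real) \<Rightarrow> real \<Rightarrow> (real \<Rightarrow> real) \<Rightarrow> bool" where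
  "hits B q s x \<longleftrightarrow> (\<exists>H s'. B H \<and> lp H \<and> s' < s \<and> close s' (cj H x) q)"

lemma open_pred_hits: "open_pred (hits B q s)"
  unfolding open_pred_def
proof (intro allI impI)
  fix x assume "hits B q s x"
  then obtain H s' where H: "B H" "lp H" "s' < s" "close s' (cj H x) q" by (auto simp: hits_def)
  obtain d where d: "d > 0" "\<And>x y. close d x y \<Longrightarrow> close ((s - s') / 2) (cj H x) (cj H y)"
    using cj_close[OF H(2), of "(s - s') / 2"] H(3) by auto
  have "hits B q s y" if "close d x y" for y
  proof -
    have "close ((s - s') / 2 + s') (cj H y) q" using close_trans[OF close_sym[OF d(2)[OF that]] H(4)] .
    moreover have "(s - s') / 2 + s' < s" using H(3) by (simp add: field_simps)
    ultimately show ?thesis using H unfolding hits_def by blast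
  qed
  then show "\<exists>r>0. \<forall>y. lp y \<longrightarrow> close r x y \<longrightarrow> hits B q s y" using d(1) by blast
qed

text \<open>A generic \<open>x\<close> either satisfies \<open>hits B q s\<close> or has a
  neighbourhood in which this fails. Transitivity puts maps that satisfy it arbitrarily close to
  \<open>x\<close>, so the second case is impossible. The whole family is returned, not one generic
  map, because comeagerness concerns all maps that satisfy it.\<close>

lemma generic_family:
  assumes loc: "\<And>F r e. lp F \<Longrightarrow> r > 0 \<Longrightarrow> e > 0 \<Longrightarrow> \<exists>F0 d. lp F0 \<and> d > 0 \<and> close r F F0 \<and> locally_transitive e F0 d"
    and glob: "\<And>F F' s. lp F \<Longrightarrow> lp F' \<Longrightarrow> s > 0 \<Longrightarrow> \<exists>H F1. lp H \<and> lp F1 \<and> close s F F1 \<and> close s (cj H F1) F'"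
  obtains \<S> where "countable \<S>" "\<And>A. A \<in> \<S> \<Longrightarrow> open_pred A \<and> dense_pred A"
    "\<And>x. lp x \<Longrightarrow> (\<And>A. A \<in> \<S> \<Longrightarrow> A x) \<Longrightarrow> loc_dense x \<and> orb_dense x"
proof -
  obtain Q where Q: "countable Q" "\<And>q. q \<in> Q \<Longrightarrow> lp q" "\<And>x s. lp x \<Longrightarrow> s > 0 \<Longrightarrow> \<exists>q\<in>Q. close s x q" using countable_net by metis
  define A1 where "A1 = (\<lambda>(j::nat, i::nat, q). decided (hits (near_id (1 / real (Suc j))) q (1 / real (Suc i))))"
  define A2 where "A2 = (\<lambda>(i::nat, q). decided (hits (\<lambda>_. True) q (1 / real (Suc i))))"
  define A3 where "A3 = (\<lambda>(j::nat) x. \<exists>r>0. locally_transitive (1 / real (Suc j)) x r)"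
  define \<S> where "\<S> = A1 ` (UNIV \<times> UNIV \<times> Q) \<union> A2 ` (UNIV \<times> Q) \<union> range A3"
  have od3: "open_pred (A3 j) \<and> dense_pred (A3 j)" for j
  proof
    show "open_pred (A3 j)"
      unfolding open_pred_def
    proof (intro allI impI)
      fix x assume "lp x" "A3 j x"
      then obtain r where r: "r > 0" "locally_transitive (1 / real (Suc j)) x r" by (auto simp: A3_def)
      have "A3 j y" if y: "lp y" "close (r/2) x y" for y
      proof -
        have "close r x F" if "close (r/2) y F" for F using close_trans[OF y(2) that] by simp
        then have "locally_transitive (1 / real (Suc j)) y (r/2)" using r(2) unfolding locally_transitive_def by blast
        then show ?thesis using r(1) unfolding A3_def by (metis half_gt_zero)
      qed
      then show "\<exists>r>0. \<forall>y. lp y \<longrightarrow> close r x y \<longrightarrow> A3 j y" using r(1) by (intro exI[of _ "r/2"]) auto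
    qed
    show "dense_pred (A3 j)"
      unfolding dense_pred_def
    proof (intro allI impI)
      fix x and r :: real assume "lp x" "r > 0"
      then obtain F0 d where "lp F0" "d > 0" "close r x F0" "locally_transitive (1 / real (Suc j)) F0 d"
        using loc[of x r "1 / real (Suc j)"] by auto
      then show "\<exists>y. lp y \<and> close r x y \<and> A3 j y" unfolding A3_def by blast
    qed
  qed
  have "countable \<S>" unfolding \<S>_def using Q(1) by auto
  moreover have "open_pred A \<and> dense_pred A" if "A \<in> \<S>" for A
    using that od3 open_pred_decided[OF open_pred_hits] dense_pred_decided unfolding \<S>_def A1_def A2_def by auto
  moreover have "loc_dense x \<and> orb_dense x" if x: "lp x" and all: "\<And>A. A \<in> \<S> \<Longrightarrow> A x" for x
  proof
    have main: "\<exists>H. B H \<and> lp H \<and> close s (cj H x) y"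
      if y: "lp y" and s: "s > 0" and dec: "\<And>i q. q \<in> Q \<Longrightarrow> decided (hits B q (1 / real (Suc i))) x"
        and c: "c > 0" and ap: "\<And>q t. lp q \<Longrightarrow> close c y q \<Longrightarrow> t > 0 \<Longrightarrow> \<exists>H F1. B H \<and> lp H \<and> lp F1 \<and> close t x F1 \<and>
          close t (cj H F1) q" for y s B c
    proof -
      obtain i where i: "1 / real (Suc i) < s / 2" using nat_approx_posE[of "s/2"] s by (metis half_gt_zero)
      obtain q where q: "q \<in> Q" "close (min (s/2) c) y q" using Q(3)[OF y, of "min (s/2) c"] s c by auto
      then have qc: "close (s/2) y q" "close c y q" using close_mono[OF q(2)] by auto
      have "hits B q (1 / real (Suc i)) x"
      proof (rule ccontr)
        assume "\<not> hits B q (1 / real (Suc i)) x"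
        then obtain r where r: "r > 0" "\<And>y. lp y \<Longrightarrow> close r x y \<Longrightarrow> \<not> hits B q (1 / real (Suc i)) y"
          using dec[OF q(1), of i] unfolding decided_def by blast
        define t where "t = min r (1 / real (Suc i) / 2)"
        have t: "t > 0" "t \<le> r" "t < 1 / real (Suc i)" using r by (auto simp: t_def min_less_iff_disj field_simps)
        obtain H F1 where H: "B H" "lp H" "lp F1" "close t x F1" "close t (cj H F1) q" using ap[OF Q(2)[OF q(1)] qc(2) t(1)]
          by blast
        then have "hits B q (1 / real (Suc i)) F1" using t(3) unfolding hits_def by blast
        then show False using r(2)[OF H(3)] close_mono[OF H(4) t(2)] by blast
      qed
      then obtain H s' where H: "B H" "lp H" "s' < 1 / real (Suc i)" "close s' (cj H x) q" by (auto simp: hits_def)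
      have "close s (cj H x) y" using close_mono[OF close_trans[OF H(4) close_sym[OF qc(1)]], of s] H(3) i by simp
      then show ?thesis using H by blast
    qed
    show "orb_dense x"
      unfolding orb_dense_def
    proof (intro allI impI)
      fix y and s :: real assume y: "lp y" "s > 0"
      have dec: "decided (hits (\<lambda>_. True) q (1 / real (Suc i))) x" if "q \<in> Q" for i q
      proof -
        have "A2 (i, q) \<in> \<S>" using that unfolding \<S>_def by blast
        then show ?thesis using all by (auto simp: A2_def)
      qed
      have "\<exists>H. True \<and> lp H \<and> close s (cj H x) y"
        by (rule main[OF y dec zero_less_one]) (use glob[OF x] in auto)
      then show "\<exists>H. lp H \<and> close s (cj H x) y" by simp
    qed
    show "loc_dense x"
      unfolding loc_dense_def
    proof (intro allI impI)
      fix e :: real assume "e > 0"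
      obtain j where j: "1 / real (Suc j) < e" using nat_approx_posE[OF \<open>e > 0\<close>] by metis
      have "A3 j x" using all unfolding \<S>_def by blast
      then obtain r where r: "r > 0" "locally_transitive (1 / real (Suc j)) x r" by (auto simp: A3_def)
      have "\<exists>H. near_id e H \<and> close s (cj H x) y" if y: "lp y" "close (r/2) x y" "s > 0" for y s
      proof -
        have dec: "decided (hits (near_id (1 / real (Suc j))) q (1 / real (Suc i))) x" if "q \<in> Q" for i q
        proof -
          have "A1 (j, i, q) \<in> \<S>" using that unfolding \<S>_def by blast
          then show ?thesis using all by (auto simp: A1_def)
        qed
        have ap: "\<exists>H F1. near_id (1 / real (Suc j)) H \<and> lp H \<and> lp F1 \<and> close t x F1 \<and> close t (cj H F1) q" if q: "lp q"
          "close (r/2) y q" "t > 0" for q t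
        proof -
          have "close r x q" using close_trans[OF y(2) q(2)] by simp
          moreover have "close r x x" using close_refl r(1) by simp
          ultimately show ?thesis using r(2) x q unfolding locally_transitive_def by (metis near_id_def)
        qed
        have "\<exists>H. near_id (1 / real (Suc j)) H \<and> lp H \<and> close s (cj H x) y"
          by (rule main[OF y(1,3) dec half_gt_zero[OF r(1)] ap])
        then show ?thesis using close_mono[OF _ less_imp_le[OF j]] unfolding near_id_def by blast
      qed
      then show "\<exists>r>0. \<forall>y. lp y \<longrightarrow> close r x y \<longrightarrow> (\<forall>s>0. \<exists>H. near_id e H \<and> close s (cj H x) y)"
        using r(1) by (intro exI[of _ "r/2"]) auto
    qed
  qed
  ultimately show ?thesis using that by blast
qed

end

subsection \<open>Approximate conjugacy on intervals\<close>

lemma ihomeo_bound_cont: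
  assumes h: "ihomeo h u v u' v'" and "e > 0"
  obtains d where "d > 0" "\<And>x y. x \<in> {u..v} \<Longrightarrow> y \<in> {u..v} \<Longrightarrow> \<bar>x - y\<bar> \<le> d \<Longrightarrow> \<bar>h x - h y\<bar> \<le> e"
proof -
  have "uniformly_continuous_on {u..v} h" by (intro compact_uniformly_continuous ihomeo_continuous[OF h] compact_Icc)
  then obtain d where d: "d > 0" "\<And>x y. x \<in> {u..v} \<Longrightarrow> y \<in> {u..v} \<Longrightarrow> dist y x < d \<Longrightarrow> dist (h y) (h x) < e"
    using \<open>e > 0\<close> unfolding uniformly_continuous_on_def by metis
  show ?thesis
  proof (rule that[of "d/2"])
    fix x y assume "x \<in> {u..v}" "y \<in> {u..v}" "\<bar>x - y\<bar> \<le> d / 2"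
    then have "dist (h x) (h y) < e" using d(1) by (intro d(2)) (auto simp: dist_real_def)
    then show "\<bar>h x - h y\<bar> \<le> e" by (simp add: dist_real_def)
  qed (use d in simp)
qed

lemma conj_near_id_close:
  assumes B: "ihomeo B u v a b" and F: "ihomeo F u v u v" and ab: "u \<le> a" "b \<le> v"
    and sm: "\<And>w. w \<in> {u..v} \<Longrightarrow> \<bar>B w - w\<bar> \<le> d"
    and uc: "\<And>x y. x \<in> {u..v} \<Longrightarrow> y \<in> {u..v} \<Longrightarrow> \<bar>x - y\<bar> \<le> d \<Longrightarrow> \<bar>F x - F y\<bar> \<le> e"
    and x: "x \<in> {u..v}"
  shows "\<bar>B (F x) - F (B x)\<bar> \<le> d + e"
proof -
  have Bx: "B x \<in> {u..v}" using ihomeo_in[OF B x] ab by auto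
  have "\<bar>B (F x) - F x\<bar> \<le> d" using sm ihomeo_in[OF F x] by blast
  moreover have "\<bar>F (B x) - F x\<bar> \<le> e" using uc[OF Bx x] sm[OF x] by simp
  ultimately show ?thesis by linarith
qed

text \<open>Up to a small perturbation, \<open>F\<close> and \<open>G\<close> are conjugate: \<open>f\<close> is a tiny copy of \<open>G\<close> followed by
  a large copy of \<open>F\<close>, and \<open>g\<close> a large copy of \<open>G\<close> followed by a tiny copy of \<open>F\<close>.\<close>
lemma interval_conj_approx:
  assumes "u < v" "u' < v'" and F: "ihomeo F u v u v" and G: "ihomeo G u' v' u' v'" and "s > 0"
  shows "\<exists>f g H. ihomeo f u v u v \<and> ihomeo g u' v' u' v' \<and> ihomeo H u v u' v' \<and>
    (\<forall>x\<in>{u..v}. \<bar>f x - F x\<bar> \<le> s) \<and> (\<forall>x\<in>{u'..v'}. \<bar>g x - G x\<bar> \<le> s) \<and> (\<forall>x\<in>{u..v}. H (f x) = g (H x))"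
proof -
  obtain d1 where d1: "d1 > 0" "\<And>x y. x \<in> {u..v} \<Longrightarrow> y \<in> {u..v} \<Longrightarrow> \<bar>x - y\<bar> \<le> d1 \<Longrightarrow> \<bar>F x - F y\<bar> \<le> s/2"
    using ihomeo_bound_cont[OF F, of "s/2"] \<open>s > 0\<close> by (metis half_gt_zero)
  obtain d2 where d2: "d2 > 0" "\<And>x y. x \<in> {u'..v'} \<Longrightarrow> y \<in> {u'..v'} \<Longrightarrow> \<bar>x - y\<bar> \<le> d2 \<Longrightarrow> \<bar>G x - G y\<bar> \<le> s/2"
    using ihomeo_bound_cont[OF G, of "s/2"] \<open>s > 0\<close> by (metis half_gt_zero)
  define e1 e2 where "e1 = (v - u) / 2" and "e2 = (v' - u') / 2"
  have e12: "e1 > 0" "e2 > 0" using assms(1,2) by (auto simp: e1_def e2_def)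
  define d where "d = min (min d1 d2) (min (s/2) (min e1 e2))"
  have dl: "d > 0" "d \<le> d1" "d \<le> d2" "d \<le> s/2" "d \<le> e1" "d \<le> e2"
    using d1(1) d2(1) \<open>s > 0\<close> e12 by (auto simp: d_def)
  have "u + d < v" "u' < v' - d" using dl(5,6) assms(1,2) by (simp_all add: field_simps e1_def e2_def)
  note d = dl(1-4) this
  \<comment> \<open>\<open>A\<close> and \<open>D\<close> shrink the other interval to a piece of
    length \<open>d\<close>; \<open>B\<close> and \<open>C\<close> squeeze their own interval into
    the rest. Since \<open>H\<close> maps \<open>A z\<close> to \<open>C z\<close> and
    \<open>B z\<close> to \<open>D z\<close>, it matches the copies of \<open>G\<close> with each
    other and those of \<open>F\<close> with each other.\<close>
  define A where "A = stretch u' v' u (u + d)"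
  define B where "B = stretch u v (u + d) v"
  define C where "C = stretch u' v' u' (v' - d)"
  define D where "D = stretch u v (v' - d) v'"
  have A: "ihomeo A u' v' u (u + d)" and B: "ihomeo B u v (u + d) v" and C: "ihomeo C u' v' u' (v' - d)" and D:
    "ihomeo D u v (v' - d) v'"
    unfolding A_def B_def C_def D_def using d by (auto intro!: ihomeo_stretch)
  define A' where "A' = inv_into {u'..v'} A"
  define B' where "B' = inv_into {u..v} B"
  note A' = ihomeo_inv[OF A, folded A'_def] and B' = ihomeo_inv[OF B, folded B'_def]
  define f where "f = (\<lambda>x. if x \<le> u + d then A (G (A' x)) else B (F (B' x)))"
  define H where "H = (\<lambda>x. if x \<le> u + d then C (A' x) else D (B' x))"
  have f: "ihomeo f u v u v" unfolding f_def
    by (rule ihomeo_glue[OF ihomeo_comp[OF A ihomeo_comp[OF G A'(1)]] ihomeo_comp[OF B ihomeo_comp[OF F B'(1)]]]) (use d in auto)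
  have H: "ihomeo H u v u' v'" unfolding H_def
    by (rule ihomeo_glue[OF ihomeo_comp[OF C A'(1)] ihomeo_comp[OF D B'(1)]]) (use d in auto)
  define H' where "H' = inv_into {u..v} H"
  note H' = ihomeo_inv[OF H, folded H'_def]
  define g where "g = (\<lambda>y. H (f (H' y)))"
  have g: "ihomeo g u' v' u' v'" unfolding g_def by (rule ihomeo_comp[OF H ihomeo_comp[OF f H'(1)]])
  have comm: "H (f x) = g (H x)" if "x \<in> {u..v}" for x using H'(2) that by (simp add: g_def)
  have fA: "f (A z) = A (G z)" if "z \<in> {u'..v'}" for z
    using ihomeo_bounds[OF A, of z] A'(2)[of z] that by (simp add: f_def)
  \<comment> \<open>The pieces meet at \<open>u + d\<close>, which the definition of
    \<open>f\<close> assigns to the tiny copy. There \<open>z = u\<close> is fixed by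
    \<open>F\<close>, and both descriptions agree.\<close>
  have fB: "f (B z) = B (F z)" if z: "z \<in> {u..v}" for z
  proof (cases "B z \<le> u + d")
    case True
    then have "B z = u + d" using ihomeo_bounds[OF B, of z] z by auto
    then have "z = u" using ihomeo_left[OF B] inj_onD[OF ihomeo_inj[OF B], of z u] z by auto
    then have "F z = u" using ihomeo_left[OF F] assms(1) by simp
    moreover have "A' (u + d) = v'" using A'(2)[of v'] ihomeo_right[OF A] assms(2) by simp
    ultimately show ?thesis using \<open>B z = u + d\<close> \<open>z = u\<close> ihomeo_right[OF G] ihomeo_right[OF A] assms(2) by (simp add: f_def)
  next
    case False
    then show ?thesis using B'(2)[of z] z by (simp add: f_def)
  qed
  have HA: "H (A z) = C z" if "z \<in> {u'..v'}" for z
    using ihomeo_bounds[OF A, of z] A'(2)[of z] that by (simp add: H_def)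
  have HB: "H (B z) = D z" if z: "z \<in> {u..v}" for z
  proof (cases "B z \<le> u + d")
    case True
    then have "B z = u + d" using ihomeo_bounds[OF B, of z] z by auto
    then have "z = u" using ihomeo_left[OF B] inj_onD[OF ihomeo_inj[OF B], of z u] z by auto
    moreover have "A' (u + d) = v'" using A'(2)[of v'] ihomeo_right[OF A] assms(2) by simp
    ultimately show ?thesis using \<open>B z = u + d\<close> ihomeo_right[OF C] ihomeo_left[OF D] assms by (simp add: H_def)
  next
    case False
    then show ?thesis using B'(2)[of z] z by (simp add: H_def)
  qed
  \<comment> \<open>On the tiny piece \<open>f x\<close> and \<open>F x\<close> are both near the
    fixed end \<open>u\<close>; on the rest \<open>f\<close> is \<open>F\<close> conjugated by
    \<open>B\<close>, which is near the identity.\<close>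
  have "\<bar>f x - F x\<bar> \<le> s" if x: "x \<in> {u..v}" for x
  proof (cases "x \<le> u + d")
    case True
    have "f x \<in> {u..u + d}" using True x ihomeo_in[OF ihomeo_comp[OF A ihomeo_comp[OF G A'(1)]], of x] by (simp add: f_def)
    moreover have "u \<le> F x" using ihomeo_bounds[OF F, of x] x by simp
    moreover have "\<bar>F x - F u\<bar> \<le> s/2" using True x d by (intro d1(2)) auto
    moreover have "F u = u" using ihomeo_left[OF F] assms(1) by simp
    ultimately show ?thesis using d by auto
  next
    case False
    obtain z where "u \<le> z" "z \<le> v" "B z = x" by (rule ihomeo_obtain[OF B, of x]) (use x False in auto)
    then have z: "z \<in> {u..v}" "x = B z" by auto
    have "\<bar>B w - w\<bar> \<le> d" if "w \<in> {u..v}" for w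
    proof -
      define q where "q = (v - w) / (v - u)"
      have "B w - w = d * q" using assms(1) by (simp add: q_def B_def stretch_def field_simps)
      moreover have "0 \<le> q" "q \<le> 1" using that assms(1) by (auto simp: q_def)
      then have "0 \<le> d * q" "d * q \<le> d" using d(1) by (simp_all add: mult_left_le)
      ultimately show ?thesis by simp
    qed
    then have "\<bar>B (F z) - F (B z)\<bar> \<le> d + s/2"
      by (intro conj_near_id_close[OF B F]) (use d z d1(2) in auto)
    then show ?thesis using fB[OF z(1)] z(2) d by simp
  qed
  moreover have "\<bar>g y - G y\<bar> \<le> s" if y: "y \<in> {u'..v'}" for y
  proof (cases "y \<le> v' - d")
    case True
    obtain z where "u' \<le> z" "z \<le> v'" "C z = y" by (rule ihomeo_obtain[OF C, of y]) (use y True in auto)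
    then have z: "z \<in> {u'..v'}" "y = C z" by auto
    have "g y = C (G z)"
      using comm[of "A z"] HA[OF z(1)] HA[of "G z"] fA[OF z(1)] ihomeo_bounds[OF A, of z] ihomeo_in[OF G z(1)] z d by auto
    moreover have "\<bar>C w - w\<bar> \<le> d" if "w \<in> {u'..v'}" for w
    proof -
      define q where "q = (w - u') / (v' - u')"
      have "w - C w = d * q" using assms(2) by (simp add: q_def C_def stretch_def field_simps)
      moreover have "0 \<le> q" "q \<le> 1" using that assms(2) by (auto simp: q_def)
      then have "0 \<le> d * q" "d * q \<le> d" using d(1) by (simp_all add: mult_left_le)
      ultimately show ?thesis by simp
    qed
    then have "\<bar>C (G z) - G (C z)\<bar> \<le> d + s/2"
      by (intro conj_near_id_close[OF C G]) (use d z d2(2) in auto)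
    ultimately show ?thesis using z(2) d by simp
  next
    case False
    obtain z where "u \<le> z" "z \<le> v" "D z = y" by (rule ihomeo_obtain[OF D, of y]) (use y False in auto)
    then have z: "z \<in> {u..v}" "y = D z" by auto
    have "g y = D (F z)"
      using comm[of "B z"] HB[OF z(1)] HB[of "F z"] fB[OF z(1)] ihomeo_bounds[OF B, of z] ihomeo_in[OF F z(1)] z d by auto
    then have "g y \<in> {v' - d..v'}" using ihomeo_in[OF D] ihomeo_in[OF F z(1)] by metis
    moreover have "G y \<le> v'" using ihomeo_bounds[OF G, of y] y by simp
    moreover have "\<bar>G v' - G y\<bar> \<le> s/2" using False y d by (intro d2(2)) auto
    moreover have "G v' = v'" using ihomeo_right[OF G] assms(2) by simp
    ultimately show ?thesis using d by auto
  qed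
  ultimately show ?thesis using f g H comm by blast
qed

text \<open>The bound \<open>e\<close> on the displacement of \<open>H\<close> is independent of the
  accuracy \<open>s\<close>. As all maps respect the ends of the intervals, adjacent intervals can
  be joined.\<close>

definition approx_conj :: "real \<Rightarrow> (real \<Rightarrow> real) \<Rightarrow> (real \<Rightarrow> real) \<Rightarrow> real \<Rightarrow> real \<Rightarrow> real \<Rightarrow> real \<Rightarrow> bool" where
  "approx_conj e F G u v u' v' \<longleftrightarrow> (\<forall>s>0. \<exists>f g H. ihomeo f u v u v \<and> ihomeo g u' v' u' v' \<and> ihomeo H u v u' v' \<and>
    (\<forall>x\<in>{u..v}. \<bar>f x - F x\<bar> \<le> s) \<and> (\<forall>x\<in>{u'..v'}. \<bar>g x - G x\<bar> \<le> s) \<and>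
    (\<forall>x\<in>{u..v}. \<bar>H x - x\<bar> \<le> e \<and> H (f x) = g (H x)))"

text \<open>Both intervals lie in one of length at most \<open>e\<close>, so every map between them
  moves points by at most \<open>e\<close>, however it is chosen.\<close>

lemma approx_conj_small:
  assumes "u < v" "u' < v'" and F: "ihomeo F u v u v" and G: "ihomeo G u' v' u' v'"
    and e: "a \<le> u" "v \<le> b" "a \<le> u'" "v' \<le> b" "b - a \<le> e"
  shows "approx_conj e F G u v u' v'"
  unfolding approx_conj_def
proof (intro allI impI)
  fix s :: real assume "s > 0"
  obtain f g H where *: "ihomeo f u v u v" "ihomeo g u' v' u' v'" "ihomeo H u v u' v'"
    "\<forall>x\<in>{u..v}. \<bar>f x - F x\<bar> \<le> s" "\<forall>x\<in>{u'..v'}. \<bar>g x - G x\<bar> \<le> s" "\<forall>x\<in>{u..v}. H (f x) = g (H x)"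
    using interval_conj_approx[OF assms(1-4) \<open>s > 0\<close>] by blast
  have "\<bar>H x - x\<bar> \<le> e" if "x \<in> {u..v}" for x
    using ihomeo_in[OF *(3) that] that e by auto
  then show "\<exists>f g H. ihomeo f u v u v \<and> ihomeo g u' v' u' v' \<and> ihomeo H u v u' v' \<and>
    (\<forall>x\<in>{u..v}. \<bar>f x - F x\<bar> \<le> s) \<and> (\<forall>x\<in>{u'..v'}. \<bar>g x - G x\<bar> \<le> s) \<and>
    (\<forall>x\<in>{u..v}. \<bar>H x - x\<bar> \<le> e \<and> H (f x) = g (H x))" using * by blast
qed

lemma approx_conj_intro:
  assumes "ihomeo F u v u v" "ihomeo G u' v' u' v'" "ihomeo H u v u' v'"
    and "\<And>x. x \<in> {u..v} \<Longrightarrow> \<bar>H x - x\<bar> \<le> e \<and> H (F x) = G (H x)"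
  shows "approx_conj e F G u v u' v'"
  unfolding approx_conj_def
proof (intro allI impI)
  fix s :: real assume "s > 0"
  then show "\<exists>f g H. ihomeo f u v u v \<and> ihomeo g u' v' u' v' \<and> ihomeo H u v u' v' \<and>
    (\<forall>x\<in>{u..v}. \<bar>f x - F x\<bar> \<le> s) \<and> (\<forall>x\<in>{u'..v'}. \<bar>g x - G x\<bar> \<le> s) \<and>
    (\<forall>x\<in>{u..v}. \<bar>H x - x\<bar> \<le> e \<and> H (f x) = g (H x))" using assms
    by (intro exI[of _ F] exI[of _ G] exI[of _ H]) auto
qed

lemma approx_conj_glue:
  assumes 1: "approx_conj e F G u v u' v'" and 2: "approx_conj e F G v w v' w'" and o: "u \<le> v" "v \<le> w" "u' \<le> v'" "v' \<le> w'"
  shows "approx_conj e F G u w u' w'"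
  unfolding approx_conj_def
proof (intro allI impI)
  fix s :: real assume "s > 0"
  obtain f1 g1 H1 where 1: "ihomeo f1 u v u v" "ihomeo g1 u' v' u' v'" "ihomeo H1 u v u' v'"
    "\<forall>x\<in>{u..v}. \<bar>f1 x - F x\<bar> \<le> s" "\<forall>x\<in>{u'..v'}. \<bar>g1 x - G x\<bar> \<le> s" "\<forall>x\<in>{u..v}. \<bar>H1 x - x\<bar> \<le> e \<and> H1 (f1 x) = g1 (H1 x)"
    using 1 \<open>s > 0\<close> unfolding approx_conj_def by blast
  obtain f2 g2 H2 where 2: "ihomeo f2 v w v w" "ihomeo g2 v' w' v' w'" "ihomeo H2 v w v' w'"
    "\<forall>x\<in>{v..w}. \<bar>f2 x - F x\<bar> \<le> s" "\<forall>x\<in>{v'..w'}. \<bar>g2 x - G x\<bar> \<le> s" "\<forall>x\<in>{v..w}. \<bar>H2 x - x\<bar> \<le> e \<and> H2 (f2 x) = g2 (H2 x)"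
    using 2 \<open>s > 0\<close> unfolding approx_conj_def by blast
  define f g H where "f = (\<lambda>x. if x \<le> v then f1 x else f2 x)" and "g = (\<lambda>x. if x \<le> v' then g1 x else g2 x)" and
    "H = (\<lambda>x. if x \<le> v then H1 x else H2 x)"
  have "H (f x) = g (H x)" if x: "x \<in> {u..w}" for x
  proof (cases "x \<le> v")
    case True
    then have "f1 x \<le> v" "H1 x \<le> v'" using x ihomeo_bounds[OF 1(1), of x] ihomeo_bounds[OF 1(3), of x] by auto
    then show ?thesis using True 1(6) x by (simp add: f_def g_def H_def)
  next
    case False
    then have "f2 v < f2 x" "H2 v < H2 x" using x ihomeo_less[OF 2(1), of v x] ihomeo_less[OF 2(3), of v x] by auto
    then have "\<not> f2 x \<le> v" "\<not> H2 x \<le> v'" using ihomeo_left[OF 2(1)] ihomeo_left[OF 2(3)] o by auto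
    then show ?thesis using False 2(6) x by (simp add: f_def g_def H_def)
  qed
  moreover have "\<bar>H x - x\<bar> \<le> e" if "x \<in> {u..w}" for x using that 1(6) 2(6) by (simp add: H_def)
  moreover have "\<bar>f x - F x\<bar> \<le> s" if "x \<in> {u..w}" for x using that 1(4) 2(4) by (simp add: f_def)
  moreover have "\<bar>g x - G x\<bar> \<le> s" if "x \<in> {u'..w'}" for x using that 1(5) 2(5) by (simp add: g_def)
  moreover have "ihomeo f u w u w" "ihomeo g u' w' u' w'" "ihomeo H u w u' w'"
    unfolding f_def g_def H_def using 1 2 o by (auto intro: ihomeo_glue)
  ultimately show "\<exists>f g H. ihomeo f u w u w \<and> ihomeo g u' w' u' w' \<and> ihomeo H u w u' w' \<and>
    (\<forall>x\<in>{u..w}. \<bar>f x - F x\<bar> \<le> s) \<and> (\<forall>x\<in>{u'..w'}. \<bar>g x - G x\<bar> \<le> s) \<and>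
    (\<forall>x\<in>{u..w}. \<bar>H x - x\<bar> \<le> e \<and> H (f x) = g (H x))" by blast
qed

lemma int_seq_less:
  fixes q :: "int \<Rightarrow> real"
  assumes "\<And>k. q k < q (k + 1)" "i < j" shows "q i < q j"
  using assms(2) by (induction j rule: int_gr_induct) (use assms(1) order.strict_trans in blast)+

lemma int_seq_le:
  fixes q :: "int \<Rightarrow> real"
  assumes "\<And>k. q k < q (k + 1)" "i \<le> j" shows "q i \<le> q j"
  using int_seq_less[of q i j] assms by (cases "i = j") auto

lemma int_seq_cell:
  fixes q :: "int \<Rightarrow> real"
  assumes q: "\<And>k. q k < q (k + 1)" and "q i \<le> y" "y < q j" obtains k where "q k \<le> y" "y < q (k + 1)"
proof -
  have "\<exists>k. q k \<le> y \<and> y < q (k + 1)" if "y < q (i + int n)" for n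
    using that
  proof (induction n)
    case (Suc n)
    show ?case
    proof (cases "q (i + int n) \<le> y")
      case True
      then show ?thesis using Suc by (intro exI[of _ "i + int n"]) (auto simp: algebra_simps)
    qed (use Suc in auto)
  qed (use assms in auto)
  moreover have "i < j" using assms int_seq_le[of q j i] by (meson less_le_trans not_le order.trans)
  ultimately show ?thesis using that \<open>y < q j\<close> by (metis zless_iff_Suc_zadd)
qed

text \<open>The \<open>p k\<close> exhaust the line, but the \<open>q k\<close> need not: they are
  bounded in \<open>translation_chart\<close> and unbounded in
  \<open>pl_interpolation\<close>.\<close>

lemma cells_homeo:
  assumes c: "\<And>k::int. ihomeo F (p k) (p (k + 1)) (q k) (q (k + 1))" and p: "\<And>k. p k < p (k + 1)" and q: "\<And>k. q k < q (k + 1)"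
    and below: "\<And>y. \<exists>k. p k \<le> y" and above: "\<And>y. \<exists>k. y < p k"
  shows "strict_mono F" "range F = {y. (\<exists>i. q i \<le> y) \<and> (\<exists>j. y < q j)}"
proof -
  have cell: "\<exists>k. p k \<le> x \<and> x < p (k + 1)" for x
  proof -
    obtain i j where "p i \<le> x" "x < p j" using below above by blast
    then show ?thesis using int_seq_cell[of p, OF p] by metis
  qed
  have Fp: "F (p k) = q k" for k using ihomeo_left[OF c] p less_imp_le by blast
  show "strict_mono F"
  proof (rule strict_monoI)
    fix x y :: real assume "x < y"
    obtain k where k: "p k \<le> x" "x < p (k + 1)" using cell by blast
    obtain l where l: "p l \<le> y" "y < p (l + 1)" using cell by blast
    have "k \<le> l" using int_seq_le[of p "l + 1" k, OF p] k l \<open>x < y\<close> by linarith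
    show "F x < F y"
    proof (cases "k = l")
      case True
      then show ?thesis using ihomeo_less[OF c[of k], of x y] k l \<open>x < y\<close> by simp
    next
      case False
      have "F x < F (p (k + 1))" using ihomeo_less[OF c[of k], of x "p (k+1)"] k by simp
      also have "\<dots> = q (k + 1)" by (rule Fp)
      also have "\<dots> \<le> q l" using False \<open>k \<le> l\<close> by (intro int_seq_le q) simp
      also have "\<dots> \<le> F y" using ihomeo_bounds[OF c[of l], of y] l by simp
      finally show ?thesis .
    qed
  qed
  show "range F = {y. (\<exists>i. q i \<le> y) \<and> (\<exists>j. y < q j)}"
  proof (rule subset_antisym; rule subsetI)
    fix y assume "y \<in> range F"
    then obtain x where x: "y = F x" by blast
    obtain k where k: "p k \<le> x" "x < p (k + 1)" using cell by blast
    have "q k \<le> y" "F x < F (p (k + 1))" using ihomeo_bounds[OF c[of k], of x] ihomeo_less[OF c[of k], of x "p (k+1)"] k x by auto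
    then show "y \<in> {y. (\<exists>i. q i \<le> y) \<and> (\<exists>j. y < q j)}" using Fp x by auto
  next
    fix y assume "y \<in> {y. (\<exists>i. q i \<le> y) \<and> (\<exists>j. y < q j)}"
    then obtain i j where "q i \<le> y" "y < q j" by blast
    then obtain k where k: "q k \<le> y" "y < q (k + 1)" using int_seq_cell[of q, OF q] by metis
    obtain x where "F x = y" by (rule ihomeo_obtain[OF c[of k], of y]) (use k in auto)
    then show "y \<in> range F" by blast
  qed
qed

subsection \<open>Conjugacy between neighbouring fixed points\<close>

definition zpow :: "(real \<Rightarrow> real) \<Rightarrow> int \<Rightarrow> real \<Rightarrow> real" where
  "zpow f k = (if k \<ge> 0 then f ^^ nat k else rinv f ^^ nat (- k))"

lemma zpow_Suc: assumes "bij f" shows "zpow f (k + 1) x = f (zpow f k x)" "zpow f (k + 1) x = zpow f k (f x)"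
proof -
  have i: "f (rinv f y) = y" "rinv f (f y) = y" for y using assms by (auto simp: bij_is_surj surj_f_inv_f bij_is_inj)
  consider "k \<ge> 0" | "k = -1" | "k < -1" by linarith
  then have "zpow f (k + 1) x = f (zpow f k x) \<and> zpow f (k + 1) x = zpow f k (f x)"
  proof cases
    case 1
    then have "nat (k + 1) = Suc (nat k)" by simp
    then show ?thesis by (simp add: zpow_def funpow_swap1)
  next
    case 2
    then show ?thesis using i by (simp add: zpow_def)
  next
    case 3
    then have "nat (- k) = Suc (nat (- k - 1))" by simp
    moreover have "(rinv f ^^ Suc n) (f y) = (rinv f ^^ n) y" for n y using i by (simp add: funpow_Suc_right del: funpow.simps(2))
    moreover have "f ((rinv f ^^ Suc n) y) = (rinv f ^^ n) y" for n y using i by simp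
    ultimately show ?thesis using 3 by (simp add: zpow_def del: funpow.simps(2))
  qed
  then show "zpow f (k + 1) x = f (zpow f k x)" "zpow f (k + 1) x = zpow f k (f x)" by auto
qed

lemma zpow_0: "zpow f 0 x = x" by (simp add: zpow_def)

lemma zpow_strict_mono:
  assumes "strict_mono f" "surj f" shows "strict_mono (zpow f k)"
proof -
  have "strict_mono (g ^^ n)" if "strict_mono g" for g :: "real \<Rightarrow> real" and n
    by (induction n) (use that in \<open>auto simp: strict_mono_def\<close>)
  moreover have "strict_mono (rinv f)" using assms by (intro strict_monoI) (metis surj_f_inv_f strict_mono_less)
  ultimately show ?thesis using assms by (auto simp: zpow_def)
qed

lemma zpow_continuous:
  assumes "strict_mono f" "surj f" shows "continuous_on A (zpow f k)"
proof -
  have "surj (g ^^ n)" if "surj g" for g :: "real \<Rightarrow> real" and n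
    by (rule surj_fn[OF that])
  moreover have "surj (rinv f)" using assms by (metis inj_imp_surj_inv strict_mono_imp_inj_on)
  ultimately have "surj (zpow f k)" using assms by (auto simp: zpow_def)
  then show ?thesis using zpow_strict_mono[OF assms] strict_mono_surj_continuous by blast
qed

text \<open>The segment from \<open>c\<close> to \<open>f c\<close> is a fundamental domain, and the
  iterates of \<open>f\<close> carry it over the whole open interval. Its parametrisation is affine
  and explicit, so that the charts of two nearby maps with the same \<open>c\<close> can be
  compared.\<close>

lemma translation_chart:
  fixes f :: "real \<Rightarrow> real"
  assumes f: "strict_mono f" "surj f" and fp: "f b = b" "f a = a" and c: "b < c" "c < a"
    and pos: "\<And>x. b < x \<Longrightarrow> x < a \<Longrightarrow> x < f x"
  obtains \<psi> where "strict_mono \<psi>" "range \<psi> = {b<..<a}" "\<And>t. \<psi> (t + 1) = f (\<psi> t)"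
    "\<And>t. 0 \<le> t \<Longrightarrow> t \<le> 1 \<Longrightarrow> \<psi> t = c + t * (f c - c)"
proof -
  have bij: "bij f" using f by (simp add: bij_def strict_mono_imp_inj_on)
  note z = zpow_Suc[OF bij]
  define g where "g = rinv f"
  define q where "q = (\<lambda>k. zpow f k c)"
  have inb: "b < q k \<and> q k < a" for k
  proof (induction k rule: int_induct[where k = 0])
    case base then show ?case using c by (simp add: q_def zpow_0)
  next
    case (step1 i)
    then show ?case using strict_monoD[OF f(1), of b "q i"] strict_monoD[OF f(1), of "q i" a] fp z(1)[of i c] by (simp add: q_def)
  next
    case (step2 i)
    have "f (q (i - 1)) = q i" using z(1)[of "i - 1" c] by (simp add: q_def)
    then show ?case using step2 fp strict_mono_less[OF f(1), of b "q (i - 1)"] strict_mono_less[OF f(1), of "q (i - 1)" a] by simp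
  qed
  have qS: "q (k + 1) = f (q k)" for k using z(1) by (simp add: q_def)
  have q: "q k < q (k + 1)" for k using pos inb qS by simp
  have cont: "isCont f x" for x
    using strict_mono_surj_continuous[OF f, of UNIV] by (simp add: continuous_on_eq_continuous_at)
  \<comment> \<open>A common limit of orbit points and their successors is a fixed point, and there
    is none strictly between \<open>b\<close> and \<open>a\<close>. The index map \<open>h\<close>
    covers the forward and the backward orbit.\<close>
  have lim_fix: "l = b \<or> l = a" if "(\<lambda>n. q (h n)) \<longlonglongrightarrow> l" "(\<lambda>n. q (h n + 1)) \<longlonglongrightarrow> l" for l h
  proof -
    have "(\<lambda>n. f (q (h n))) \<longlonglongrightarrow> f l" using that(1) cont isCont_tendsto_compose by blast
    then have "f l = l" using that(2) LIMSEQ_unique by (simp add: qS)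
    moreover have "b \<le> l" "l \<le> a" using LIMSEQ_le_const[OF that(1)] LIMSEQ_le_const2[OF that(1)] inb less_imp_le by blast+
    ultimately show ?thesis using pos[of l] by force
  qed
  have up: "\<exists>k. y < q k" if "y < a" for y
  proof (rule ccontr)
    assume "\<nexists>k. y < q k"
    then have ub: "q k \<le> y" for k by (simp add: not_less)
    have "incseq (\<lambda>n. q (int n))"
    proof (rule incseq_SucI)
      fix n show "q (int n) \<le> q (int (Suc n))" using q[of "int n"] by (simp add: add.commute)
    qed
    then obtain l where l: "(\<lambda>n. q (int n)) \<longlonglongrightarrow> l" using incseq_convergent[of "\<lambda>n. q (int n)" y] ub by blast
    have "(\<lambda>n. q (int n + 1)) \<longlonglongrightarrow> l" using LIMSEQ_Suc[OF l] by (simp add: add.commute)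
    then have "l = b \<or> l = a" using lim_fix l by blast
    moreover have "l \<le> y" using LIMSEQ_le_const2[OF l] ub by blast
    moreover have "c \<le> l" using LIMSEQ_le_const[OF l] int_seq_le[of q 0, OF q] by (metis of_nat_0_le_iff q_def zpow_0)
    ultimately show False using that c by linarith
  qed
  have down: "\<exists>k. q k \<le> y" if "b < y" for y
  proof (rule ccontr)
    assume "\<nexists>k. q k \<le> y"
    then have lb: "y \<le> q k" for k by (metis linear)
    have "decseq (\<lambda>n. q (- int n))"
    proof (rule decseq_SucI)
      fix n show "q (- int (Suc n)) \<le> q (- int n)" using q[of "- int (Suc n)"] by simp
    qed
    then obtain l where l: "(\<lambda>n. q (- int n)) \<longlonglongrightarrow> l" using decseq_convergent[of "\<lambda>n. q (- int n)" y] lb by blast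
    have "(\<lambda>n. q (- int n - 1)) \<longlonglongrightarrow> l" using LIMSEQ_Suc[OF l]
      by (rule back_subst[of "\<lambda>f. f \<longlonglongrightarrow> l"]) (intro ext arg_cong[of _ _ q], simp)
    then have "l = b \<or> l = a" using lim_fix[of "\<lambda>n. - int n - 1"] l by simp
    moreover have "y \<le> l" using LIMSEQ_le_const[OF l] lb by blast
    moreover have "q (- int n) \<le> c" for n using int_seq_le[of q "- int n" 0, OF q] by (simp add: q_def zpow_0)
    then have "l \<le> c" using LIMSEQ_le_const2[OF l] by blast
    ultimately show False using that c by linarith
  qed
  define \<psi> where "\<psi> = (\<lambda>t. zpow f \<lfloor>t\<rfloor> (c + frac t * (f c - c)))"
  have fc: "c < f c" using pos c by simp
  have cellf: "\<psi> t = zpow f k (c + (t - of_int k) * (f c - c))" if "of_int k \<le> t" "t \<le> of_int (k + 1)" for k t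
  proof (cases "t = of_int (k + 1)")
    case True
    then have "\<psi> t = zpow f (k + 1) c" by (simp add: \<psi>_def)
    then show ?thesis using True z(2) by simp
  next
    case False
    then have "\<lfloor>t\<rfloor> = k" using that by linarith
    then show ?thesis by (simp add: \<psi>_def frac_def)
  qed
  have hc: "ihomeo \<psi> (of_int k) (of_int (k + 1)) (q k) (q (k + 1))" for k
  proof (rule iffD2[OF ihomeo_cong])
    show "\<psi> t = zpow f k (c + (t - of_int k) * (f c - c))" if "of_int k \<le> t" "t \<le> of_int (k + 1)" for t using cellf that by blast
    show "ihomeo (\<lambda>t. zpow f k (c + (t - of_int k) * (f c - c))) (of_int k) (of_int (k + 1)) (q k) (q (k + 1))"
    proof (rule ihomeoI)
      show "continuous_on {of_int k..of_int (k + 1)} (\<lambda>t. zpow f k (c + (t - of_int k) * (f c - c)))"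
        by (rule continuous_on_compose2[OF zpow_continuous[OF f, of UNIV]]) (auto intro!: continuous_intros)
      show "strict_mono_on {of_int k..of_int (k + 1)} (\<lambda>t. zpow f k (c + (t - of_int k) * (f c - c)))"
        using fc by (auto intro!: strict_mono_onI strict_monoD[OF zpow_strict_mono[OF f]])
    qed (use z(2) in \<open>auto simp: q_def\<close>)
  qed
  have ch: "strict_mono \<psi>" "range \<psi> = {y. (\<exists>i. q i \<le> y) \<and> (\<exists>j. y < q j)}"
  proof -
    have "\<exists>k::int. of_int k \<le> (y::real)" "\<exists>k::int. (y::real) < of_int k" for y by (metis floor_correct)+
    then show "strict_mono \<psi>" "range \<psi> = {y. (\<exists>i. q i \<le> y) \<and> (\<exists>j. y < q j)}"
      using cells_homeo[of \<psi> of_int q, OF hc _ q] by auto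
  qed
  have "range \<psi> = {b<..<a}"
    unfolding ch(2)
  proof (rule subset_antisym; rule subsetI)
    fix y assume "y \<in> {y. (\<exists>i. q i \<le> y) \<and> (\<exists>j. y < q j)}"
    then obtain i j where "q i \<le> y" "y < q j" by blast
    then show "y \<in> {b<..<a}" using inb[of i] inb[of j] by auto
  next
    fix y assume "y \<in> {b<..<a}"
    then show "y \<in> {y. (\<exists>i. q i \<le> y) \<and> (\<exists>j. y < q j)}" using up[of y] down[of y] by auto
  qed
  moreover have "\<psi> (t + 1) = f (\<psi> t)" for t
    using z(1) by (simp add: \<psi>_def frac_def)
  moreover have "\<psi> t = c + t * (f c - c)" if "0 \<le> t" "t \<le> 1" for t using cellf[of 0 t] that by (simp add: zpow_0)
  ultimately show ?thesis using that ch(1) by blast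
qed


lemma no_fixpoint_pos:
  fixes f :: "real \<Rightarrow> real"
  assumes f: "continuous_on UNIV f" and c: "b < c" "c < a" "c < f c" and nf: "\<And>x. b < x \<Longrightarrow> x < a \<Longrightarrow> f x \<noteq> x"
    and x: "b < x" "x < a"
  shows "x < f x"
proof (rule ccontr)
  assume "\<not> x < f x"
  then have "f x - x \<le> 0" by simp
  have cont: "continuous_on A (\<lambda>x. f x - x)" for A by (intro continuous_intros continuous_on_subset[OF f]) auto
  have "\<exists>z. b < z \<and> z < a \<and> f z - z = 0"
  proof (cases "x \<le> c")
    case True
    have "\<exists>z\<ge>x. z \<le> c \<and> f z - z = 0" by (rule IVT') (use True cont \<open>f x - x \<le> 0\<close> c in auto)
    then obtain z where "x \<le> z" "z \<le> c" "f z - z = 0" by blast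
    then show ?thesis using c x by (intro exI[of _ z]) auto
  next
    case False
    have "\<exists>z\<ge>c. z \<le> x \<and> f z - z = 0" by (rule IVT2') (use False cont \<open>f x - x \<le> 0\<close> c in auto)
    then obtain z where "c \<le> z" "z \<le> x" "f z - z = 0" by blast
    then show ?thesis using c x by (intro exI[of _ z]) auto
  qed
  then show False using nf by auto
qed

text \<open>\<open>u\<close> and \<open>v\<close> are \<open>d\<close>-pseudo-orbits of
  \<open>F\<close>. Orbits of maps \<open>d\<close>-close to \<open>F\<close> are of this kind, so
  orbits of two different maps are compared through \<open>F\<close>.\<close>

definition shadows :: "(real \<Rightarrow> real) \<Rightarrow> nat \<Rightarrow> real \<Rightarrow> real \<Rightarrow> bool" where
  "shadows F N d e \<longleftrightarrow> (\<forall>u v n. (\<forall>k. \<bar>u (Suc k) - F (u k)\<bar> \<le> d) \<longrightarrow> (\<forall>k. \<bar>v (Suc k) - F (v k)\<bar> \<le> d) \<longrightarrow>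
     \<bar>u 0 - v 0\<bar> \<le> 2 * d \<longrightarrow> n \<le> N \<longrightarrow> \<bar>u n - v n\<bar> \<le> e)"

lemma shadows_mono: "shadows F N d e \<Longrightarrow> d' \<le> d \<Longrightarrow> shadows F N d' e"
  unfolding shadows_def by (meson mult_left_mono order_trans zero_le_numeral)

text \<open>\<open>d\<close> is chosen backwards along the steps: one more step costs
  \<open>e / 2\<close> by uniform continuity and at most \<open>e / 4\<close> for each of the two
  deviations.\<close>

lemma shadows_ex:
  assumes F: "unif_cont F" and "e > 0" shows "\<exists>d>0. shadows F N d e"
  using \<open>e > 0\<close>
proof (induction N arbitrary: e)
  case 0
  have "shadows F 0 (e/2) e" unfolding shadows_def by auto
  then show ?case using 0 by (intro exI[of _ "e/2"]) auto
next
  case (Suc N)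
  obtain d0 where d0: "d0 > 0" "\<And>x y. \<bar>x - y\<bar> \<le> d0 \<Longrightarrow> \<bar>F x - F y\<bar> \<le> e/2" using unif_contE[OF F, of "e/2"] Suc.prems
    by (metis half_gt_zero)
  obtain d1 where d1: "d1 > 0" "shadows F N d1 (min d0 e)" using Suc.IH[of "min d0 e"] d0 Suc.prems by auto
  define d where "d = min d1 (e/4)"
  have d: "d > 0" "d \<le> d1" "d \<le> e/4" using d1 Suc.prems by (auto simp: d_def)
  have sh: "shadows F N d (min d0 e)" using shadows_mono[OF d1(2) d(2)] .
  have "\<bar>u n - v n\<bar> \<le> e" if uv: "\<forall>k. \<bar>u (Suc k) - F (u k)\<bar> \<le> d" "\<forall>k. \<bar>v (Suc k) - F (v k)\<bar> \<le> d" "\<bar>u 0 - v 0\<bar> \<le> 2 * d" "n \<le> Suc N"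
    for u v n
  proof -
    have IH: "\<bar>u m - v m\<bar> \<le> min d0 e" if "m \<le> N" for m using sh uv that unfolding shadows_def by blast
    show ?thesis
    proof (cases "n \<le> N")
      case True then show ?thesis using IH by auto
    next
      case False
      then have n: "n = Suc N" using uv by simp
      have "\<bar>F (u N) - F (v N)\<bar> \<le> e/2" using IH[of N] by (intro d0(2)) auto
      moreover have "\<bar>u (Suc N) - F (u N)\<bar> \<le> d" "\<bar>v (Suc N) - F (v N)\<bar> \<le> d" using uv by auto
      ultimately show ?thesis using d unfolding n by linarith
    qed
  qed
  then show ?case using d(1) unfolding shadows_def by blast
qed

text \<open>Maps close to \<open>F0\<close> are conjugate, by a homeomorphism close to the identity, between their fixed
  points bounding a region on which \<open>F0\<close> moves all points by a definite amount: an orbit needs at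
  most \<open>N\<close> steps to cross this region.\<close>
lemma gap_conj_pos:
  fixes f g P :: "real \<Rightarrow> real"
  assumes f: "strict_mono f" "surj f" and g: "strict_mono g" "surj g" and cl: "close d P f" "close d P g"
    and fp: "f b = b" "f a = a" "g b' = b'" "g a' = a'"
    and o: "b < c" "c \<le> c'" "c' < a" "b' < c" "c' < a'"
    and nf: "\<And>x. b < x \<Longrightarrow> x < a \<Longrightarrow> f x \<noteq> x" "\<And>x. b' < x \<Longrightarrow> x < a' \<Longrightarrow> g x \<noteq> x"
    and mv: "\<And>x. c \<le> x \<Longrightarrow> x \<le> c' \<Longrightarrow> x + 2 * \<kappa> \<le> P x" and \<kappa>: "\<kappa> > 0" "d \<le> \<kappa>" "c' - c \<le> real N * \<kappa>"
    and sh: "shadows P N d e"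
    and small: "c - b \<le> e" "c - b' \<le> e" "a - c' \<le> e" "a' - c' \<le> e"
  shows "\<exists>H. ihomeo H b a b' a' \<and> (\<forall>x\<in>{b..a}. \<bar>H x - x\<bar> \<le> e \<and> H (f x) = g (H x))"
proof -
  have step: "x + \<kappa> \<le> h x" if "c \<le> x" "x \<le> c'" "close d P h" for x h
    using mv[OF that(1,2)] closeD[OF that(3), of x] \<kappa> by linarith
  have fc: "c < f c" "c < g c" using step[of c f] step[of c g] o cl \<kappa> by auto
  have pf: "x < f x" if "b < x" "x < a" for x
    by (rule no_fixpoint_pos[OF strict_mono_surj_continuous[OF f], of b c a]) (use o fc nf that in auto)
  have pg: "x < g x" if "b' < x" "x < a'" for x
    by (rule no_fixpoint_pos[OF strict_mono_surj_continuous[OF g], of b' c a']) (use o fc nf that in auto)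
  obtain p where p: "strict_mono p" "range p = {b<..<a}" "\<And>t. p (t + 1) = f (p t)" "\<And>t. 0 \<le> t \<Longrightarrow> t \<le> 1 \<Longrightarrow> p t = c + t * (f c - c)"
    by (rule translation_chart[OF f fp(1,2), of c]) (use o pf in auto)
  obtain q where q: "strict_mono q" "range q = {b'<..<a'}" "\<And>t. q (t + 1) = g (q t)" "\<And>t. 0 \<le> t \<Longrightarrow> t \<le> 1 \<Longrightarrow> q t = c + t * (g c - c)"
    by (rule translation_chart[OF g fp(3,4), of c]) (use o pg in auto)
  define p' where "p' = rinv p"
  have p'p: "p' (p t) = t" for t using p(1) by (simp add: p'_def strict_mono_imp_inj_on)
  have pin: "b < p t" "p t < a" for t using p(2) by auto
  have qin: "b' < q t" "q t < a'" for t using q(2) by auto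
  have ex: "\<exists>t. x = p t" if "b < x" "x < a" for x
  proof -
    have "x \<in> range p" using that p(2) by simp
    then show ?thesis by blast
  qed
  \<comment> \<open>\<open>H\<close> matches the two translation charts. Both maps act as
    \<open>t \<mapsto> t + 1\<close> there, so \<open>H\<close> conjugates them.\<close>
  define H where "H = (\<lambda>x. if x \<le> b then b' else if a \<le> x then a' else q (p' x))"
  have Hp: "H (p t) = q t" for t using pin[of t] p'p by (simp add: H_def)
  have Hb: "H b = b'" "H a = a'" using o by (auto simp: H_def)
  have cases: "x = b \<or> x = a \<or> (\<exists>t. x = p t)" if "x \<in> {b..a}" for x using that ex[of x] by force
  have "strict_mono_on {b..a} H"
  proof (rule strict_mono_onI)
    fix x y assume xy: "x \<in> {b..a}" "y \<in> {b..a}" "x < y"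
    show "H x < H y"
      using cases[OF xy(1)] cases[OF xy(2)]
    proof (elim disjE exE)
      fix t u assume "x = p t" "y = p u"
      then show ?thesis using xy(3) strict_mono_less[OF p(1)] strict_mono_less[OF q(1)] Hp by simp
    qed (use xy Hp Hb qin o in auto)
  qed
  moreover have "H ` {b..a} = {b'..a'}"
  proof (rule subset_antisym; rule subsetI)
    fix y assume "y \<in> H ` {b..a}"
    then obtain x where "x \<in> {b..a}" "y = H x" by blast
    then show "y \<in> {b'..a'}" using cases[of x] Hb Hp qin o by (auto intro: less_imp_le)
  next
    fix y assume "y \<in> {b'..a'}"
    then consider "y = b'" | "y = a'" | "y \<in> range q" using q(2) by fastforce
    then show "y \<in> H ` {b..a}"
    proof cases
      case 1
      show ?thesis by (rule image_eqI[of _ _ b]) (use 1 Hb o in auto)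
    next
      case 2
      show ?thesis by (rule image_eqI[of _ _ a]) (use 2 Hb o in auto)
    next
      case 3
      then obtain t where "y = q t" by blast
      then show ?thesis by (intro image_eqI[of _ _ "p t"]) (use Hp pin in \<open>auto intro: less_imp_le\<close>)
    qed
  qed
  ultimately have "ihomeo H b a b' a'" by (simp add: ihomeo_def)
  moreover have "H (f x) = g (H x)" if "x \<in> {b..a}" for x
    using cases[OF that]
  proof (elim disjE exE)
    fix t assume "x = p t"
    then show ?thesis using Hp[of "t + 1"] Hp[of t] p(3) q(3) by simp
  qed (use fp Hb in auto)
  moreover have "\<bar>H x - x\<bar> \<le> e" if "x \<in> {b..a}" for x
    using cases[OF that]
  proof (elim disjE exE)
    fix t assume x: "x = p t"
    have p0: "p 0 = c" "q 0 = c" using p(4)[of 0] q(4)[of 0] by auto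
    \<comment> \<open>Up to time 0 both points are left of \<open>c\<close>, and from time
      \<open>N\<close> on both are right of \<open>c'\<close>, where the remaining intervals are
      short; in between shadowing applies. The second range may extend to \<open>N + 1\<close>,
      since only \<open>\<lfloor>t\<rfloor> \<le> N\<close> matters there.\<close>
    consider "t \<le> 0" | "0 \<le> t" "t < real N + 1" | "real N \<le> t" by linarith
    then show ?thesis
    proof cases
      case 1
      then have "p t \<le> c" "q t \<le> c" using p0 strict_mono_less_eq[OF p(1)] strict_mono_less_eq[OF q(1)] by metis+
      then show ?thesis using Hp x pin[of t] qin[of t] small by auto
    next
      case 2
      define n where "n = nat \<lfloor>t\<rfloor>"
      define u where "u = t - real n"
      have nu: "n \<le> N" "0 \<le> u" "u \<le> 1" "t = u + real n" using 2 unfolding n_def u_def by linarith+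
      have "p (u + real (Suc k)) = f (p (u + real k))" "q (u + real (Suc k)) = g (q (u + real k))" for k
        using p(3)[of "u + real k"] q(3)[of "u + real k"] by (simp_all add: algebra_simps)
      then have st: "\<bar>p (u + real (Suc k)) - P (p (u + real k))\<bar> \<le> d" "\<bar>q (u + real (Suc k)) - P (q (u + real k))\<bar> \<le> d" for k
        using closeD[OF cl(1), of "p (u + real k)"] closeD[OF cl(2), of "q (u + real k)"] by (simp_all add: abs_minus_commute)
      \<comment> \<open>Both charts start at \<open>c\<close> and are affine on the first unit of
        time, so at equal times they differ by at most \<open>\<bar>f c - g c\<bar>\<close>.\<close>
      have "\<bar>p (u + real 0) - q (u + real 0)\<bar> \<le> 2 * d"
      proof -
        have "p u - q u = u * (f c - g c)" using p(4)[of u] q(4)[of u] nu by (simp add: algebra_simps)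
        moreover have "\<bar>f c - g c\<bar> \<le> 2 * d" using closeD[OF cl(1), of c] closeD[OF cl(2), of c] by linarith
        moreover have "u * \<bar>f c - g c\<bar> \<le> \<bar>f c - g c\<bar>" using nu by (intro mult_left_le_one_le) auto
        ultimately show ?thesis using nu by (simp add: abs_mult)
      qed
      then have "\<bar>p (u + real n) - q (u + real n)\<bar> \<le> e"
        using sh[unfolded shadows_def, rule_format, of "\<lambda>k. p (u + real k)" "\<lambda>k. q (u + real k)" n] st nu by blast
      then show ?thesis using Hp x nu by (simp add: abs_minus_commute)
    next
      case 3
      \<comment> \<open>Every step gains at least \<open>\<kappa>\<close> until \<open>c'\<close> is
        passed, and \<open>N * \<kappa>\<close> covers the distance; beyond \<open>c'\<close> the
        orbit still increases.\<close>
      have reach: "c' \<le> w t"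
        if w: "strict_mono w" "w 0 = c" "\<And>t. w (t + 1) = h (w t)" and h: "close d P h" and ph: "\<And>t. w t < h (w t)" for w h
      proof -
        have "min c' (c + real n * \<kappa>) \<le> w (real n) \<and> c \<le> w (real n)" for n
        proof (induction n)
          case (Suc n)
          have "w (real (Suc n)) = h (w (real n))" using w(3)[of "real n"] by (simp add: add.commute)
          moreover have "w (real n) + \<kappa> \<le> h (w (real n))" if "w (real n) \<le> c'" using step[OF _ that h] Suc by simp
          moreover have "w (real n) < h (w (real n))" by (rule ph)
          moreover have "real (Suc n) * \<kappa> = real n * \<kappa> + \<kappa>" by (simp add: algebra_simps)
          ultimately show ?case using Suc by (cases "w (real n) \<le> c'") (simp_all add: min_le_iff_disj, linarith+)
        qed (use w(2) in auto)
        from this[of N] have "c' \<le> w (real N)" using \<kappa>(3) by auto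
        also have "\<dots> \<le> w t" using 3 strict_mono_less_eq[OF w(1)] by simp
        finally show ?thesis .
      qed
      have "c' \<le> p t" by (rule reach[of p f]) (use p cl pf pin in auto)
      moreover have "c' \<le> q t" by (rule reach[of q g]) (use q cl pg qin in auto)
      ultimately show ?thesis using Hp x pin[of t] qin[of t] small by auto
    qed
  qed (use Hb small o in auto)
  ultimately show ?thesis by blast
qed

text \<open>Motion to the left is reduced to motion to the right by conjugating everything with
  \<open>x \<mapsto> - x\<close>, which exchanges the ends and preserves pseudo-orbits.\<close>

lemma gap_conj:
  fixes f g P :: "real \<Rightarrow> real"
  assumes f: "strict_mono f" "surj f" and g: "strict_mono g" "surj g" and cl: "close d P f" "close d P g"
    and fp: "f b = b" "f a = a" "g b' = b'" "g a' = a'"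
    and o: "b < c" "c \<le> c'" "c' < a" "b' < c" "c' < a'"
    and nf: "\<And>x. b < x \<Longrightarrow> x < a \<Longrightarrow> f x \<noteq> x" "\<And>x. b' < x \<Longrightarrow> x < a' \<Longrightarrow> g x \<noteq> x"
    and mv: "(\<forall>x. c \<le> x \<longrightarrow> x \<le> c' \<longrightarrow> x + 2 * \<kappa> \<le> P x) \<or> (\<forall>x. c \<le> x \<longrightarrow> x \<le> c' \<longrightarrow> P x \<le> x - 2 * \<kappa>)"
    and \<kappa>: "\<kappa> > 0" "d \<le> \<kappa>" "c' - c \<le> real N * \<kappa>"
    and sh: "shadows P N d e"
    and small: "c - b \<le> e" "c - b' \<le> e" "a - c' \<le> e" "a' - c' \<le> e"
  shows "\<exists>H. ihomeo H b a b' a' \<and> (\<forall>x\<in>{b..a}. \<bar>H x - x\<bar> \<le> e \<and> H (f x) = g (H x))"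
  using mv
proof
  assume "\<forall>x. c \<le> x \<longrightarrow> x \<le> c' \<longrightarrow> x + 2 * \<kappa> \<le> P x"
  then show ?thesis by (intro gap_conj_pos[OF f g cl fp o nf _ \<kappa> sh small]) auto
next
  assume neg: "\<forall>x. c \<le> x \<longrightarrow> x \<le> c' \<longrightarrow> P x \<le> x - 2 * \<kappa>"
  define R where "R = (\<lambda>(h::real \<Rightarrow> real) x. - h (- x))"
  have R: "strict_mono (R h) \<and> surj (R h)" if "strict_mono h" "surj h" for h
  proof
    show "strict_mono (R h)" using that(1) by (auto simp: R_def strict_mono_def)
    show "surj (R h)" using that(2) unfolding R_def surj_def by (metis minus_minus)
  qed
  have Rcl: "close d (R P) (R h)" if "close d P h" for h
    using that by (auto simp: close_def R_def abs_minus_commute)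
  have Rsh: "shadows (R P) N d e"
    unfolding shadows_def
  proof (intro allI impI)
    fix u v :: "nat \<Rightarrow> real" and n
    assume uv: "\<forall>k. \<bar>u (Suc k) - R P (u k)\<bar> \<le> d" "\<forall>k. \<bar>v (Suc k) - R P (v k)\<bar> \<le> d" "\<bar>u 0 - v 0\<bar> \<le> 2 * d" "n \<le> N"
    have "\<bar>- u (Suc k) - P (- u k)\<bar> \<le> d" "\<bar>- v (Suc k) - P (- v k)\<bar> \<le> d" for k
      using uv(1)[rule_format, of k] uv(2)[rule_format, of k] unfolding R_def by linarith+
    moreover have "\<bar>- u 0 - - v 0\<bar> \<le> 2 * d" using uv(3) by linarith
    ultimately have "\<bar>- u n - - v n\<bar> \<le> e" using sh[unfolded shadows_def, rule_format, of "\<lambda>k. - u k" "\<lambda>k. - v k" n] uv(4) by blast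
    then show "\<bar>u n - v n\<bar> \<le> e" by linarith
  qed
  have "\<exists>H. ihomeo H (- a) (- b) (- a') (- b') \<and> (\<forall>x\<in>{- a..- b}. \<bar>H x - x\<bar> \<le> e \<and> H (R f x) = R g (H x))"
  proof (rule gap_conj_pos[where c = "- c'" and c' = "- c" and d = d and \<kappa> = \<kappa> and N = N and P = "R P"])
    show "x + 2 * \<kappa> \<le> R P x" if "- c' \<le> x" "x \<le> - c" for x
      using neg[rule_format, of "- x"] that by (simp add: R_def)
    show "R f x \<noteq> x" if "- a < x" "x < - b" for x using nf(1)[of "- x"] that by (auto simp: R_def)
    show "R g x \<noteq> x" if "- a' < x" "x < - b'" for x using nf(2)[of "- x"] that by (auto simp: R_def)
  qed (use R[OF f] R[OF g] Rcl[OF cl(1)] Rcl[OF cl(2)] Rsh fp o \<kappa> small in \<open>auto simp: R_def\<close>)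
  then obtain H where H: "ihomeo H (- a) (- b) (- a') (- b')" "\<And>x. x \<in> {- a..- b} \<Longrightarrow> \<bar>H x - x\<bar> \<le> e \<and> H (R f x) = R g (H x)"
    by blast
  have "ihomeo (R H) b a b' a'"
  proof (rule ihomeoI)
    show "strict_mono_on {b..a} (R H)" using ihomeo_less[OF H(1)] by (auto intro!: strict_mono_onI simp: R_def)
    show "continuous_on {b..a} (R H)" unfolding R_def
      by (intro continuous_intros continuous_on_compose2[OF ihomeo_continuous[OF H(1)]]) auto
  qed (use o ihomeo_left[OF H(1)] ihomeo_right[OF H(1)] in \<open>auto simp: R_def\<close>)
  moreover have "\<bar>R H x - x\<bar> \<le> e \<and> R H (f x) = g (R H x)" if "x \<in> {b..a}" for x
    using H(2)[of "- x"] that by (auto simp: R_def)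
  ultimately show ?thesis by blast
qed


subsection \<open>Local and global transitivity\<close>

text \<open>The point nearest to \<open>x\<close> among those within \<open>r\<close> of
  \<open>F x\<close>. It is built from strictly increasing maps by maximum and minimum, so it is
  strictly increasing, and it is the identity wherever \<open>F\<close> moves points by at most
  \<open>r\<close>.\<close>

definition clamp :: "real \<Rightarrow> (real \<Rightarrow> real) \<Rightarrow> real \<Rightarrow> real" where
  "clamp r F x = max (F x - r) (min (F x + r) x)"

lemma clamp_per_homeo:
  assumes F: "per_homeo L L F" and "r \<ge> 0" shows "per_homeo L L (clamp r F)"
proof -
  have m: "strict_mono F" and sj: "surj F" using F by (auto simp: per_homeo_def)
  have "strict_mono (clamp r F)"
  proof (rule strict_monoI)
    fix x y :: real assume "x < y"
    then show "clamp r F x < clamp r F y" using strict_monoD[OF m \<open>x < y\<close>] by (simp add: clamp_def max_def min_def)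
  qed
  moreover have "surj (clamp r F)"
  proof -
    have "\<exists>x. clamp r F x = y" for y
    proof -
      obtain x1 x2 where x: "F x1 = y + r" "F x2 = y - r" using sj by (metis surj_def)
      consider "y < x2" | "x1 < y" | "x2 \<le> y" "y \<le> x1" by linarith
      then show ?thesis
      proof cases
        case 1 then show ?thesis using x \<open>r \<ge> 0\<close> by (intro exI[of _ x2]) (simp add: clamp_def)
      next
        case 2 then show ?thesis using x by (intro exI[of _ x1]) (simp add: clamp_def)
      next
        case 3
        then have "F x2 \<le> F y" "F y \<le> F x1" using strict_mono_less_eq[OF m] by auto
        then show ?thesis using x by (intro exI[of _ y]) (simp add: clamp_def)
      qed
    qed
    then show ?thesis by (metis surjI)
  qed
  moreover have "clamp r F (- t) = - clamp r F t" for t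
    using F \<open>r \<ge> 0\<close> by (simp add: per_homeo_def clamp_def)
  moreover have "clamp r F (t + 2 * L) = clamp r F t + 2 * L" for t
    using F by (simp add: per_homeo_def clamp_def max_def min_def)
  ultimately show ?thesis by (simp add: per_homeo_def)
qed

lemma clamp_close: "r \<ge> 0 \<Longrightarrow> close r F (clamp r F)"
  by (auto simp: close_def clamp_def)

text \<open>An interval of fixed points and not a single one, so that the fixed points in a cell
  span a nondegenerate interval, as \<open>approx_conj_small\<close> requires.\<close>

definition fixes_nbhd :: "(real \<Rightarrow> real) \<Rightarrow> real \<Rightarrow> bool" where
  "fixes_nbhd f z \<longleftrightarrow> (\<exists>w>0. \<forall>x. \<bar>x - z\<bar> \<le> w \<longrightarrow> f x = x)"

lemma clamp_fixes_nbhd: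
  assumes "continuous_on UNIV F" "F z = z" "r > 0" shows "fixes_nbhd (clamp r F) z"
proof -
  have "continuous_on UNIV (\<lambda>x. F x - x)" by (intro continuous_intros assms)
  then obtain d where d: "d > 0" "\<And>x. dist x z < d \<Longrightarrow> dist (F x - x) (F z - z) < r"
    using \<open>r > 0\<close> unfolding continuous_on_iff by (metis UNIV_I)
  have "clamp r F x = x" if "\<bar>x - z\<bar> \<le> d/2" for x
  proof -
    have "\<bar>F x - x\<bar> < r" using d(2)[of x] that d(1) assms(2) by (simp add: dist_real_def)
    then show ?thesis by (simp add: clamp_def abs_if split: if_splits)
  qed
  then show ?thesis unfolding fixes_nbhd_def using d(1) by (intro exI[of _ "d/2"]) auto
qed

text \<open>\<open>a\<close> and \<open>b\<close> are the extreme fixed points in the cell. What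
  \<open>f\<close> does between them is left to \<open>approx_conj_small\<close>; outside there is
  no fixed point, as \<open>gap_conj\<close> requires.\<close>

lemma fix_cluster:
  fixes f :: "real \<Rightarrow> real"
  assumes f: "continuous_on UNIV f" and z: "u < z" "z < v" "fixes_nbhd f z" and uv: "f u \<noteq> u" "f v \<noteq> v"
  shows "\<exists>a b. u < a \<and> a < z \<and> z < b \<and> b < v \<and> f a = a \<and> f b = b \<and>
    (\<forall>x. u \<le> x \<longrightarrow> x < a \<longrightarrow> f x \<noteq> x) \<and> (\<forall>x. b < x \<longrightarrow> x \<le> v \<longrightarrow> f x \<noteq> x)"
proof -
  obtain w0 where w0: "w0 > 0" "\<And>x. \<bar>x - z\<bar> \<le> w0 \<Longrightarrow> f x = x" using z(3) unfolding fixes_nbhd_def by blast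
  define w where "w = min w0 (min (z - u) (v - z))"
  have w: "w > 0" "w \<le> w0" "w \<le> z - u" "w \<le> v - z" using w0 z by (auto simp: w_def)
  define Z where "Z = {x \<in> {u..v}. f x = x}"
  have "Z = {x \<in> {u..v}. f x - x = 0}" by (auto simp: Z_def)
  moreover have "closed {x \<in> {u..v}. f x - x = 0}"
    by (intro continuous_closed_preimage_constant continuous_intros continuous_on_subset[OF f]) auto
  moreover have "Z \<subseteq> {u..v}" by (auto simp: Z_def)
  ultimately have "compact Z" by (metis compact_Icc closed_Int_compact inf.absorb_iff1)
  have zin: "z - w \<in> Z" "z + w \<in> Z" using w w0(2) unfolding Z_def by auto
  obtain a where a: "a \<in> Z" "\<And>x. x \<in> Z \<Longrightarrow> a \<le> x" using compact_attains_inf[OF \<open>compact Z\<close>] zin by blast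
  obtain b where b: "b \<in> Z" "\<And>x. x \<in> Z \<Longrightarrow> x \<le> b" using compact_attains_sup[OF \<open>compact Z\<close>] zin by blast
  have "u < a" "b < v" using a(1) b(1) uv unfolding Z_def by (auto simp: less_le)
  moreover have "a < z" "z < b" using a(2)[OF zin(1)] b(2)[OF zin(2)] w(1) by auto
  moreover have "f a = a" "f b = b" using a b by (auto simp: Z_def)
  moreover have "f x \<noteq> x" if "u \<le> x" "x < a" for x using a(1) a(2)[of x] that by (force simp: Z_def)
  moreover have "f x \<noteq> x" if "b < x" "x \<le> v" for x using b(1) b(2)[of x] that by (force simp: Z_def)
  ultimately show ?thesis by (intro exI[of _ a] exI[of _ b]) simp
qed

text \<open>Half-integer multiples are symmetric about the multiples of \<open>s\<close> and avoid
  them. With \<open>s = L / N\<close> the grid is invariant under the reflections in 0 and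
  \<open>L\<close>, yet contains neither of these points, which every odd periodic map
  fixes.\<close>

definition node :: "real \<Rightarrow> int \<Rightarrow> real" where
  "node s i = (of_int i + 1/2) * s"

lemma node_step: "node s (i + 1) = node s i + s" by (simp add: node_def algebra_simps)

lemma node_less: "s > 0 \<Longrightarrow> i < j \<Longrightarrow> node s i < node s j" by (simp add: node_def)

lemma node_le: "s > 0 \<Longrightarrow> i \<le> j \<Longrightarrow> node s i \<le> node s j" by (simp add: node_def)

lemma node_cell:
  assumes "s > 0" obtains i where "node s i \<le> x" "x < node s (i + 1)"
proof -
  define i where "i = \<lfloor>x / s - 1/2\<rfloor>"
  have "of_int i \<le> x / s - 1/2" "x / s - 1/2 < of_int i + 1" unfolding i_def by linarith+
  then have "node s i \<le> x" "x < node s (i + 1)" using \<open>s > 0\<close> by (auto simp: node_def field_simps)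
  then show ?thesis using that by blast
qed

section \<open>Piecewise linear maps that move every grid point\<close>

lemma per_int_seq:
  fixes D :: "int \<Rightarrow> 'a"
  assumes "\<And>i. D (i + p) = D i" shows "D (i + k * p) = D i"
proof (induction k rule: int_induct[where k = 0])
  case (step1 k) then show ?case using assms[of "i + k * p"] by (simp add: algebra_simps)
next
  case (step2 k) then show ?case using assms[of "i + (k - 1) * p"] by (simp add: algebra_simps)
qed simp

text \<open>The conditions on \<open>v\<close> are those that oddness and the translation impose on
  the values at the nodes, the reflection exchanging the indices \<open>i\<close> and
  \<open>- 1 - i\<close>.\<close>

lemma pl_interpolation:
  fixes v :: "int \<Rightarrow> real"
  assumes "s > 0" "N > 0" and L: "L = real N * s" and v: "\<And>i. v i < v (i + 1)"
    and sym: "\<And>i. v (- 1 - i) = - v i" and per: "\<And>i. v (i + 2 * int N) = v i + 2 * L"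
  obtains F where "per_homeo L L F"
    "\<And>i x. node s i \<le> x \<Longrightarrow> x \<le> node s (i + 1) \<Longrightarrow> F x = v i + (x - node s i) / s * (v (i + 1) - v i)"
proof -
  define c where "c = (\<lambda>i x. v i + (x - node s i) / s * (v (i + 1) - v i))"
  define F where "F = (\<lambda>x. c \<lfloor>x / s - 1/2\<rfloor> x)"
  have F: "F x = c i x" if "node s i \<le> x" "x \<le> node s (i + 1)" for i x
  proof (cases "x = node s (i + 1)")
    case True
    then have "x / s - 1/2 = of_int (i + 1)" using \<open>s > 0\<close> by (simp add: node_def)
    then have "F x = c (i + 1) x" unfolding F_def by (simp only: floor_of_int)
    then show ?thesis using True \<open>s > 0\<close> by (simp add: c_def node_step)
  next
    case False
    then have "of_int i \<le> x / s - 1/2" "x / s - 1/2 < of_int i + 1" using that by (auto simp: node_def field_simps)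
    then have "\<lfloor>x / s - 1/2\<rfloor> = i" by linarith
    then show ?thesis by (simp add: F_def)
  qed
  have hc: "ihomeo F (node s i) (node s (i + 1)) (v i) (v (i + 1))" for i
  proof (rule iffD2[OF ihomeo_cong])
    show "F x = c i x" if "node s i \<le> x" "x \<le> node s (i + 1)" for x using F that by blast
    show "ihomeo (c i) (node s i) (node s (i + 1)) (v i) (v (i + 1))"
    proof (rule ihomeoI)
      show "strict_mono_on {node s i..node s (i + 1)} (c i)"
        unfolding c_def using v[of i] \<open>s > 0\<close> by (auto intro!: strict_mono_onI divide_strict_right_mono)
    qed (use \<open>s > 0\<close> in \<open>auto simp: c_def node_step intro!: continuous_intros\<close>)
  qed
  have cell: "\<exists>i. node s i \<le> x \<and> x < node s (i + 1)" for x
    by (rule node_cell[OF \<open>s > 0\<close>, of x]) blast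
  \<comment> \<open>\<open>v i - i * s\<close> is periodic in \<open>i\<close>; this makes
    \<open>v\<close> unbounded in both directions and so \<open>F\<close> surjective.\<close>
  have vk: "v (k * (2 * int N)) = v 0 + of_int k * (2 * L)" for k
    using per_int_seq[of "\<lambda>i. v i - of_int i * s" "2 * int N" 0 k] per by (simp add: L algebra_simps)
  have "L > 0" using assms by simp
  have vbelow: "\<exists>k. v k \<le> y" and vabove: "\<exists>k. y < v k" for y
  proof -
    obtain k :: int where "(y - v 0) / (2 * L) < of_int k" by (metis floor_correct)
    then have "y < v (k * (2 * int N))" using \<open>L > 0\<close> unfolding vk by (simp add: field_simps)
    then show "\<exists>k. y < v k" by blast
    obtain k :: int where "of_int k \<le> (y - v 0) / (2 * L)" by (metis floor_correct)
    then have "v (k * (2 * int N)) \<le> y" using \<open>L > 0\<close> unfolding vk by (simp add: field_simps)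
    then show "\<exists>k. v k \<le> y" by blast
  qed
  have "strict_mono F \<and> range F = {y. (\<exists>i. v i \<le> y) \<and> (\<exists>j. y < v j)}"
  proof -
    have "node s i < node s (i + 1)" for i using node_less[OF \<open>s > 0\<close>] by simp
    moreover have "\<exists>k. node s k \<le> y" "\<exists>k. y < node s k" for y using cell by blast+
    ultimately show ?thesis using cells_homeo[of F "node s" v, OF hc _ v] by blast
  qed
  then have "strict_mono F" "surj F" using vbelow vabove by auto
  moreover have "F (- x) = - F x" for x
  proof -
    obtain i where i: "node s i \<le> x" "x < node s (i + 1)" using cell by blast
    then have "node s (- 2 - i) \<le> - x" "- x \<le> node s (- 2 - i + 1)" by (auto simp: node_def algebra_simps)
    then have "F (- x) = c (- 2 - i) (- x)" by (rule F)
    moreover have "F x = c i x" using F i by auto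
    moreover have "v (- 2 - i) = - v (i + 1)" "v (- 2 - i + 1) = - v i"
    proof -
      have e: "- 2 - i = - 1 - (i + 1)" "- 2 - i + 1 = - 1 - i" by simp_all
      show "v (- 2 - i) = - v (i + 1)" unfolding e(1) by (rule sym)
      show "v (- 2 - i + 1) = - v i" unfolding e(2) by (rule sym)
    qed
    moreover have "- x - node s (- 2 - i) = node s i + s - x" by (simp add: node_def algebra_simps)
    ultimately have "F (- x) = - v (i + 1) + (node s i + s - x) / s * (v (i + 1) - v i)"
      "F x = v i + (x - node s i) / s * (v (i + 1) - v i)"
      by (simp_all add: c_def)
    moreover have "(node s i + s - x) / s = 1 - (x - node s i) / s" using \<open>s > 0\<close> by (simp add: field_simps)
    ultimately show ?thesis by (simp add: left_diff_distrib)
  qed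
  moreover have "F (x + 2 * L) = F x + 2 * L" for x
  proof -
    obtain i where i: "node s i \<le> x" "x < node s (i + 1)" using cell by blast
    have nd: "node s (j + 2 * int N) = node s j + 2 * L" for j by (simp add: node_def L algebra_simps)
    then have "node s (i + 2 * int N) \<le> x + 2 * L" "x + 2 * L \<le> node s (i + 2 * int N + 1)"
      using i nd[of "i + 1"] by (auto simp: algebra_simps)
    then have "F (x + 2 * L) = c (i + 2 * int N) (x + 2 * L)" by (rule F)
    moreover have "F x = c i x" using F i by auto
    moreover have "v (i + 2 * int N + 1) = v (i + 1) + 2 * L" using per[of "i + 1"] by (simp add: algebra_simps)
    ultimately show ?thesis using nd[of i] per[of i] by (simp add: c_def)
  qed
  ultimately have "per_homeo L L F" by (simp add: per_homeo_def)
  then show ?thesis using that F unfolding c_def by blast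
qed

lemma per_homeo_ends:
  assumes F: "per_homeo L M F" shows "F 0 = 0" "F L = M"
proof -
  have odd: "F (- t) = - F t" for t using F by (simp add: per_homeo_def)
  show "F 0 = 0" using odd[of 0] by simp
  have "F (- L + 2 * L) = F (- L) + 2 * M" using F by (simp only: per_homeo_def)
  then show "F L = M" using odd[of L] by simp
qed

lemma per_homeo_ihomeo: "per_homeo L M F \<Longrightarrow> L \<ge> 0 \<Longrightarrow> ihomeo F 0 L 0 M"
  using per_homeo_ends[of L M F] ihomeo_restrict[of F 0 L 0 M] by (simp add: per_homeo_def)

lemma per_homeo_displacement:
  assumes F: "per_homeo L L F" and "L > 0" shows "\<bar>F t - t\<bar> \<le> L"
proof -
  have "\<bar>F s - s\<bar> \<le> L" if "s \<in> {0..L}" for s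
    using ihomeo_in[OF per_homeo_ihomeo[OF F] that] that by auto
  then show ?thesis
    by (cases rule: fold_obtain[OF \<open>L > 0\<close>, of t]) (use per_homeo_fold[OF F] in \<open>auto simp: abs_minus_commute\<close>)
qed

context period_chain
begin

text \<open>The last condition holds for piecewise linear maps by convexity. It leaves only the
  cells with a change of sign as places for fixed points, of \<open>F\<close> and of all maps closer
  to it than \<open>2 * \<kappa>\<close>.\<close>

definition grid_moves :: "nat \<Rightarrow> nat \<Rightarrow> real \<Rightarrow> real \<Rightarrow> (real \<Rightarrow> real) \<Rightarrow> bool" where
  "grid_moves n N s \<kappa> F \<longleftrightarrow> ph n F \<and> N > 0 \<and> s = L n / real N \<and> \<kappa> > 0 \<and>
    (\<forall>i. F (node s i) \<ge> node s i + 2 * \<kappa> \<or> F (node s i) \<le> node s i - 2 * \<kappa>) \<and>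
    (\<forall>i x. node s i \<le> x \<longrightarrow> x \<le> node s (i + 1) \<longrightarrow>
       (F (node s i) > node s i \<longrightarrow> F (node s (i + 1)) > node s (i + 1) \<longrightarrow> F x \<ge> x + 2 * \<kappa>) \<and>
       (F (node s i) < node s i \<longrightarrow> F (node s (i + 1)) < node s (i + 1) \<longrightarrow> F x \<le> x - 2 * \<kappa>))"

lemma grid_moves_approx:
  assumes F: "lp F" and r: "r > 0" and e: "e > 0"
  obtains n N s \<kappa> F0 where "grid_moves n N s \<kappa> F0" "close r F F0" "s \<le> e"
proof -
  obtain n G where G: "ph n G" "close (r/2) F G" using lpE[OF F, of "r/2"] r by (metis half_gt_zero)
  have Gm: "strict_mono G" using G by (auto simp: per_homeo_def)
  define l where "l = L n"
  have l: "l > 0" using L_pos by (simp add: l_def)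
  obtain d where d: "d > 0" "\<And>x y. \<bar>x - y\<bar> \<le> d \<Longrightarrow> \<bar>G x - G y\<bar> \<le> r/4" using unif_contE[OF ph_unif_cont[OF G(1)], of "r/4"] r
    by (metis divide_pos_pos zero_less_numeral)
  obtain N where N: "max (l / e) (l / d) < real N" using reals_Archimedean2 by blast
  have "0 < l / e" using l e by simp
  then have N0: "N > 0" "real N > 0" using N by auto
  define s where "s = l / real N"
  have s: "s > 0" "s \<le> e" "s \<le> d" using N N0 l d(1) e by (auto simp: s_def field_simps)
  have ls: "l = real N * s" using N0 by (simp add: s_def)
  \<comment> \<open>Shrinking the displacement by the factor \<open>1 - \<theta>\<close> guarantees
    an increase of \<open>\<theta> * s\<close> over each cell, which absorbs the perturbation added
    below.\<close>
  define \<theta> where "\<theta> = min (1/2) (r / (8 * l))"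
  have \<theta>: "\<theta> > 0" "\<theta> \<le> 1/2" "\<theta> * l \<le> r/8" using r l by (auto simp: \<theta>_def min_def)
  \<comment> \<open>A perturbation with the symmetries of a displacement, odd and
    \<open>2 * l\<close>-periodic, that vanishes only at the multiples of \<open>l\<close> and hence
    at no node.\<close>
  define sn where "sn = (\<lambda>i. sin (pi * node s i / l))"
  have sn0: "sn i \<noteq> 0" for i
  proof
    assume "sn i = 0"
    then obtain k :: int where "pi * node s i / l = of_int k * pi" unfolding sn_def sin_zero_iff_int2 by blast
    then have "node s i = of_int k * l" using l by (simp add: field_simps)
    then have "(of_int i + 1/2) * s = (of_int k * real N) * s" by (simp add: node_def ls)
    then have "of_int i + 1/2 = of_int k * real N" using s(1) by simp
    then have "real_of_int (2 * i + 1) = real_of_int (2 * (k * int N))" by simp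
    then show False by presburger
  qed
  define D0 where "D0 = (\<lambda>i. (1 - \<theta>) * (G (node s i) - node s i))"
  \<comment> \<open>At each node exactly one multiple of \<open>sn\<close> cancels the displacement;
    up to the period these are finitely many multiples to avoid.\<close>
  define bad where "bad = (\<lambda>i. - D0 i / sn i) ` {0..<2 * int N}"
  \<comment> \<open>\<open>r / 16\<close> keeps the map close to \<open>G\<close>. With
    \<open>\<theta> * s / 4\<close> the perturbation varies by at most
    \<open>\<theta> * s / 2\<close> over a cell, so \<open>v\<close> remains increasing.\<close>
  define l0 where "l0 = min (r/16) (\<theta> * s / 4)"
  have "l0 > 0" using r \<theta> s by (simp add: l0_def)
  then have "infinite ({0<..<l0} - bad)" by (simp add: bad_def)
  then obtain la where la: "la \<in> {0<..<l0} - bad" by (metis finite.emptyI ex_in_conv)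
  then have la0: "la > 0" "la \<le> r/16" "la \<le> \<theta> * s / 4" by (auto simp: l0_def)
  define D where "D = (\<lambda>i. D0 i + la * sn i)"
  define v where "v = (\<lambda>i. node s i + D i)"
  have nd_per: "node s (i + 2 * int N) = node s i + 2 * l" for i by (simp add: node_def ls algebra_simps)
  have nd_sym: "node s (- 1 - i) = - node s i" for i by (simp add: node_def algebra_simps)
  have D_per: "D (i + 2 * int N) = D i" for i
  proof -
    have "G (node s i + 2 * l) = G (node s i) + 2 * l" using G(1) by (simp add: per_homeo_def l_def)
    moreover have "sn (i + 2 * int N) = sn i"
    proof -
      have "pi * (node s i + 2 * l) / l = pi * node s i / l + 2 * pi" using l by (simp add: field_simps)
      then show ?thesis unfolding sn_def nd_per by (simp only: sin_periodic)
    qed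
    ultimately show ?thesis by (simp add: D_def D0_def nd_per)
  qed
  have D_sym: "D (- 1 - i) = - D i" for i
  proof -
    have "G (- node s i) = - G (node s i)" using G(1) by (simp add: per_homeo_def)
    moreover have "sn (- 1 - i) = - sn i" by (simp add: sn_def nd_sym)
    ultimately show ?thesis by (simp add: D_def D0_def nd_sym algebra_simps)
  qed
  have D_fin: "D i \<in> D ` {0..<2 * int N}" for i
  proof -
    have "i = i mod (2 * int N) + (i div (2 * int N)) * (2 * int N)" by (rule mod_div_mult_eq[symmetric])
    then have "D i = D (i mod (2 * int N) + (i div (2 * int N)) * (2 * int N))" by (rule arg_cong)
    also have "\<dots> = D (i mod (2 * int N))" by (rule per_int_seq[of D, OF D_per])
    finally show ?thesis using N0(1) by simp
  qed
  have D0': "D i \<noteq> 0" for i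
  proof -
    have "D i \<noteq> 0" if "i \<in> {0..<2 * int N}" for i
    proof
      assume "D i = 0"
      then have "la = - D0 i / sn i" using sn0[of i] by (simp add: D_def field_simps)
      then show False using la that by (auto simp: bad_def)
    qed
    then show ?thesis using D_fin by (metis imageE)
  qed
  \<comment> \<open>Half of the smallest displacement at a node, which exists because one period has
    finitely many nodes.\<close>
  define \<kappa> where "\<kappa> = Min ((\<lambda>x. \<bar>x\<bar>) ` D ` {0..<2 * int N}) / 2"
  have ne: "D ` {0..<2 * int N} \<noteq> {}" using N0 by auto
  have \<kappa>: "\<kappa> > 0" using ne D0' by (auto simp: \<kappa>_def)
  have D\<kappa>: "2 * \<kappa> \<le> \<bar>D i\<bar>" for i using D_fin[of i] by (auto simp: \<kappa>_def)
  have sn1: "\<bar>la * sn i\<bar> \<le> la" for i using la0(1) by (simp add: sn_def abs_mult)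
  have vinc: "v i < v (i + 1)" for i
  proof -
    have "v (i + 1) - v i = (1 - \<theta>) * (G (node s (i + 1)) - G (node s i)) + \<theta> * s + (la * sn (i + 1) - la * sn i)"
      unfolding v_def D_def D0_def node_step by (simp add: algebra_simps)
    moreover have "G (node s i) < G (node s (i + 1))" using Gm s(1) by (simp add: strict_mono_less node_less)
    then have "0 \<le> (1 - \<theta>) * (G (node s (i + 1)) - G (node s i))" using \<theta> by simp
    ultimately show ?thesis using sn1[of i] sn1[of "i + 1"] la0 by linarith
  qed
  have vG: "\<bar>v i - G (node s i)\<bar> \<le> r/4" for i
  proof -
    have "v i - G (node s i) = \<theta> * (node s i - G (node s i)) + la * sn i" by (simp add: v_def D_def D0_def algebra_simps)
    moreover have "\<bar>node s i - G (node s i)\<bar> \<le> l" using per_homeo_displacement[OF G(1) L_pos]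
      by (simp add: l_def abs_minus_commute)
    then have "\<bar>\<theta> * (node s i - G (node s i))\<bar> \<le> \<theta> * l" using \<theta> by (simp add: abs_mult)
    ultimately show ?thesis using sn1[of i] la0 \<theta> by linarith
  qed
  have vsym: "v (- 1 - i) = - v i" for i by (simp add: v_def nd_sym D_sym)
  have vper: "v (i + 2 * int N) = v i + 2 * l" for i by (simp add: v_def nd_per D_per)
  obtain F0 where F0: "per_homeo l l F0" "\<And>i x. node s i \<le> x \<Longrightarrow> x \<le> node s (i + 1) \<Longrightarrow>
    F0 x = v i + (x - node s i) / s * (v (i + 1) - v i)"
    using pl_interpolation[of s N l v, OF s(1) N0(1) ls vinc vsym vper] by metis
  have F0v: "F0 (node s i) = v i" for i using F0(2)[of i "node s i"] s(1) by (simp add: node_step)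
  have conv: "F0 x - x = (1 - (x - node s i) / s) * D i + (x - node s i) / s * D (i + 1) \<and> 0 \<le> (x - node s i) / s \<and>
    (x - node s i) / s \<le> 1"
    if "node s i \<le> x" "x \<le> node s (i + 1)" for i x
  proof -
    define w where "w = (x - node s i) / s"
    have "F0 x = v i + w * (v (i + 1) - v i)" using F0(2) that by (simp add: w_def)
    moreover have "x = node s i + w * s" using s(1) by (simp add: w_def)
    moreover have "x \<le> node s i + s" using that by (simp add: node_step)
    then have "0 \<le> w" "w \<le> 1" using that s(1) by (auto simp: w_def)
    moreover have "v (i + 1) = node s i + s + D (i + 1)" by (simp add: v_def node_step)
    ultimately show ?thesis unfolding w_def[symmetric] by (simp add: v_def algebra_simps)
  qed
  have pos: "F0 (node s i) > node s i \<longleftrightarrow> D i \<ge> 2 * \<kappa>" "F0 (node s i) < node s i \<longleftrightarrow> D i \<le> - 2 * \<kappa>" for i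
    using D\<kappa>[of i] \<kappa> by (auto simp: F0v v_def)
  have "grid_moves n N s \<kappa> F0"
    unfolding grid_moves_def
  proof (intro conjI allI impI)
    show "F0 (node s i) \<ge> node s i + 2 * \<kappa> \<or> F0 (node s i) \<le> node s i - 2 * \<kappa>" for i
      using D\<kappa>[of i] by (auto simp: F0v v_def)
    fix i x assume x: "node s i \<le> x" "x \<le> node s (i + 1)"
    define w where "w = (x - node s i) / s"
    have c: "F0 x - x = (1 - w) * D i + w * D (i + 1)" "0 \<le> w" "w \<le> 1" using conv[OF x] by (auto simp: w_def)
    show "F0 x \<ge> x + 2 * \<kappa>" if "F0 (node s i) > node s i" "F0 (node s (i + 1)) > node s (i + 1)"
    proof -
      have "(1 - w) * (2 * \<kappa>) + w * (2 * \<kappa>) \<le> (1 - w) * D i + w * D (i + 1)"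
        using c that pos by (intro add_mono mult_left_mono) auto
      then show ?thesis using c(1) by (simp add: algebra_simps)
    qed
    show "F0 x \<le> x - 2 * \<kappa>" if "F0 (node s i) < node s i" "F0 (node s (i + 1)) < node s (i + 1)"
    proof -
      have "(1 - w) * D i + w * D (i + 1) \<le> (1 - w) * (- 2 * \<kappa>) + w * (- 2 * \<kappa>)"
        using c that pos by (intro add_mono mult_left_mono) auto
      then show ?thesis using c(1) by (simp add: algebra_simps)
    qed
  qed (use F0(1) N0 \<kappa> in \<open>auto simp: l_def s_def\<close>)
  moreover have "close (r/2) G F0"
    unfolding close_def
  proof
    fix x
    obtain i where x: "node s i \<le> x" "x \<le> node s (i + 1)" by (rule node_cell[OF s(1), of x]) auto
    have m0: "strict_mono F0" using F0(1) by (simp add: per_homeo_def)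
    have "v i \<le> F0 x" "F0 x \<le> v (i + 1)" using strict_mono_less_eq[OF m0] x F0v by metis+
    moreover have "G (node s i) \<le> G x" "G x \<le> G (node s (i + 1))" using strict_mono_less_eq[OF Gm] x by metis+
    moreover have "\<bar>G (node s (i + 1)) - G (node s i)\<bar> \<le> r/4" using s by (intro d(2)) (simp add: node_step)
    ultimately show "\<bar>G x - F0 x\<bar> \<le> r/2" using vG[of i] vG[of "i + 1"] by linarith
  qed
  then have "close r F F0" using close_trans[OF G(2)] by fastforce
  ultimately show ?thesis using that s(2) by blast
qed


section \<open>Conjugating two maps over a whole period\<close>

lemma grid_moves_signs:
  assumes "grid_moves n N s \<kappa> F"
  shows "F (node s i) > node s i \<longleftrightarrow> F (node s i) \<ge> node s i + 2 * \<kappa>" "F (node s i) < node s i \<longleftrightarrow> F (node s i) \<le> node s i - 2 * \<kappa>"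
    "F (node s i) < node s i \<longleftrightarrow> \<not> F (node s i) > node s i"
proof -
  have "\<kappa> > 0" "F (node s i) \<ge> node s i + 2 * \<kappa> \<or> F (node s i) \<le> node s i - 2 * \<kappa>" using assms unfolding grid_moves_def by blast+
  then show "F (node s i) > node s i \<longleftrightarrow> F (node s i) \<ge> node s i + 2 * \<kappa>"
    "F (node s i) < node s i \<longleftrightarrow> F (node s i) \<le> node s i - 2 * \<kappa>"
    "F (node s i) < node s i \<longleftrightarrow> \<not> F (node s i) > node s i" by auto
qed

text \<open>Reflection in \<open>k * L n\<close> exchanges the two nodes next to it and reverses
  displacements. So among any \<open>N\<close> consecutive cells there is a change of sign, which
  bounds the gaps by a constant of level \<open>n\<close>, whatever the level of the maps
  nearby.\<close>

lemma grid_moves_flip: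
  assumes "grid_moves n N s \<kappa> F"
  shows "F (node s (k * int N - 1)) > node s (k * int N - 1) \<longleftrightarrow> \<not> F (node s (k * int N)) > node s (k * int N)"
proof -
  have ph: "ph n F" and s: "L n = real N * s" using assms by (auto simp: grid_moves_def)
  have "node s (k * int N - 1) = - node s (k * int N) + of_int k * (2 * L n)" by (simp add: node_def s algebra_simps)
  then have "F (node s (k * int N - 1)) - node s (k * int N - 1) = - (F (node s (k * int N)) - node s (k * int N))"
    using per_homeo_fold(2)[OF ph, of "node s (k * int N)" k] by simp
  then show ?thesis using grid_moves_signs(3)[OF assms, of "k * int N"] by linarith
qed

lemma grid_moves_segment:
  assumes nc: "grid_moves n N s \<kappa> F" and "j \<le> i" and eq: "\<And>l. j \<le> l \<Longrightarrow> l \<le> i \<Longrightarrow> (F (node s (int l)) > node s (int l)) = S"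
    and x: "node s (int j) \<le> x" "x \<le> node s (int i)"
  shows "if S then x + 2 * \<kappa> \<le> F x else F x \<le> x - 2 * \<kappa>"
  using assms(2) eq x
proof (induction i rule: dec_induct)
  case base
  then show ?case using grid_moves_signs[OF nc, of "int j"] by (auto split: if_splits)
next
  case (step i)
  show ?case
  proof (cases "x \<le> node s (int i)")
    case True
    then show ?thesis using step by auto
  next
    case False
    then have x: "node s (int i) \<le> x" "x \<le> node s (int i + 1)" using step.prems by (auto simp: add.commute)
    have "(F (node s (int i)) > node s (int i)) = S" "(F (node s (int i + 1)) > node s (int i + 1)) = S"
      using step.prems(1)[of i] step.prems(1)[of "Suc i"] step.hyps by (auto simp: add.commute)
    then show ?thesis using nc[unfolded grid_moves_def] x grid_moves_signs(3)[OF nc, of "int i"] grid_moves_signs(3)[OF nc, of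
      "int i + 1"] by (auto split: if_splits)
  qed
qed

text \<open>All constants come from \<open>P\<close> at level \<open>n\<close>, while
  \<open>f\<close> and \<open>g\<close> may have any level \<open>m \<ge> n\<close>. Along
  \<open>{0..L m}\<close> clusters of fixed points, each inside one cell, alternate with gaps on
  which \<open>P\<close> moves points in one direction. Clusters are conjugated by
  \<open>approx_conj_small\<close>, gaps by \<open>gap_conj\<close>, and the pieces are
  glued.\<close>

lemma approx_conj_period:
  assumes nc: "grid_moves n N s \<kappa> P" and se: "s \<le> e" and d: "d \<le> \<kappa>" and K: "L n \<le> real K * \<kappa>" and sh: "shadows P K d e"
    and nm: "n \<le> m" and f: "ph m f" and g: "ph m g" and cl: "close d P f" "close d P g"
    and tf: "\<And>h i. h = f \<or> h = g \<Longrightarrow> (P (node s i) > node s i) \<noteq> (P (node s (i + 1)) > node s (i + 1)) \<Longrightarrow> \<exists>z. node s i < z \<and>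
      z < node s (i + 1) \<and> fixes_nbhd h z"
    and te: "\<And>h. h = f \<or> h = g \<Longrightarrow> fixes_nbhd h 0 \<and> fixes_nbhd h (L m)"
  shows "approx_conj e f g 0 (L m) 0 (L m)"
proof -
  have sn: "s = L n / real N" and N: "N > 0" and \<kappa>: "\<kappa> > 0" using nc by (auto simp: grid_moves_def)
  have s: "s > 0" using L_pos N sn by simp
  have ls: "L n = real N * s" using sn N by simp
  obtain M where M: "L m = real M * L n" using L_mult[OF nm] by blast
  then have M0: "M > 0" using L_pos[of m] by (cases "M = 0") auto
  define pos where "pos = (\<lambda>i. P (node s i) > node s i)"
  have sm: "strict_mono h" "surj h" "continuous_on UNIV h" if "h = f \<or> h = g" for h
    using f g that strict_mono_surj_continuous by (auto simp: per_homeo_def)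
  have clh: "close d P h" if "h = f \<or> h = g" for h using cl that by auto
  have nofix: "h x \<noteq> x" if "h = f \<or> h = g" "if S then x + 2 * \<kappa> \<le> P x else P x \<le> x - 2 * \<kappa>" for h S x
    using closeD[OF clh[OF that(1)], of x] that(2) d \<kappa> by (auto split: if_splits)
  have nofix_node: "h (node s i) \<noteq> node s i" if "h = f \<or> h = g" for h i
    using nofix[OF that, of "pos i" "node s i"] grid_moves_signs[OF nc, of i] by (auto simp: pos_def)
  have cluster: "\<exists>a b. node s i < a \<and> a < z \<and> z < b \<and> b < node s (i + 1) \<and> h a = a \<and> h b = b \<and>
      (\<forall>x. node s i \<le> x \<longrightarrow> x < a \<longrightarrow> h x \<noteq> x) \<and> (\<forall>x. b < x \<longrightarrow> x \<le> node s (i + 1) \<longrightarrow> h x \<noteq> x)"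
    if hz: "h = f \<or> h = g" "node s i < z" "z < node s (i + 1)" "fixes_nbhd h z" for h i z
    by (rule fix_cluster[OF sm(3)[OF hz(1)] hz(2-4) nofix_node[OF hz(1)] nofix_node[OF hz(1)]])
  have ih: "ihomeo h u v u v" if "h = f \<or> h = g" "h u = u" "h v = v" "u \<le> v" for h u v
    by (rule ihomeo_restrict[OF sm(1,2)[OF that(1)] that(4,2,3)])
  \<comment> \<open>\<open>b\<close> and \<open>b'\<close> end the latest clusters of
    \<open>f\<close> and \<open>g\<close>, in the cell just before node \<open>j\<close>. The sign
    is constant from node \<open>j\<close> to node \<open>i\<close>, so a gap is still open there;
    everything to its left is already conjugated.\<close>
  define Inv where "Inv = (\<lambda>i j b b'. j \<le> i \<and> 0 < b \<and> 0 < b' \<and> node s (int j - 1) < b \<and> b < node s (int j) \<and>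
     node s (int j - 1) < b' \<and> b' < node s (int j) \<and> f b = b \<and> g b' = b' \<and>
     (\<forall>x. b < x \<longrightarrow> x \<le> node s (int j) \<longrightarrow> f x \<noteq> x) \<and> (\<forall>x. b' < x \<longrightarrow> x \<le> node s (int j) \<longrightarrow> g x \<noteq> x) \<and>
     (\<forall>l. j \<le> l \<longrightarrow> l \<le> i \<longrightarrow> pos (int l) = pos (int i)) \<and> approx_conj e f g 0 b 0 b')"
  have gap: "approx_conj e f g 0 a 0 a'"
    if I: "Inv i j b b'" and a: "node s (int i) < a" "a < node s (int i + 1)" "f a = a" "\<And>x. node s (int i) \<le> x \<Longrightarrow> x < a \<Longrightarrow> f x \<noteq> x"
      and a': "node s (int i) < a'" "a' < node s (int i + 1)" "g a' = a'" "\<And>x. node s (int i) \<le> x \<Longrightarrow> x < a' \<Longrightarrow> g x \<noteq> x"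
        for i j b b' a a'
  proof -
    note I = I[unfolded Inv_def]
    have ji: "j \<le> i" using I by blast
    have Il: "pos (int l) = pos (int i)" if "j \<le> l" "l \<le> i" for l using I that by blast
    \<comment> \<open>\<open>k * N\<close> is the first multiple of \<open>N\<close> after
      \<open>j\<close>. If the run reached it, the sign would change between the nodes
      \<open>k * N - 1\<close> and \<open>k * N\<close>.\<close>
    have lt: "i < j + N"
    proof (rule ccontr)
      assume "\<not> i < j + N"
      define k where "k = j div N + 1"
      have "k * N = N * (j div N) + N" by (simp add: k_def algebra_simps)
      moreover have "N * (j div N) + j mod N = j" "j mod N < N" using N by auto
      ultimately have k: "j < k * N" "k * N \<le> j + N" by linarith+
      have "pos (int (k * N - 1)) = pos (int i)" "pos (int (k * N)) = pos (int i)"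
        by (rule Il; use k \<open>\<not> i < j + N\<close> in linarith)+
      moreover have "1 \<le> k * N" using k by linarith
      then have "int (k * N - 1) = int k * int N - 1" by (simp only: of_nat_diff of_nat_mult of_nat_1)
      ultimately show False using grid_moves_flip[OF nc, of "int k"] by (simp add: pos_def)
    qed
    have mv: "if pos (int i) then x + 2 * \<kappa> \<le> P x else P x \<le> x - 2 * \<kappa>" if "node s (int j) \<le> x" "x \<le> node s (int i)" for x
      proof -
      have "(P (node s (int l)) > node s (int l)) = pos (int i)" if "j \<le> l" "l \<le> i" for l
        using Il[OF that] by (simp only: pos_def)
      then show ?thesis by (rule grid_moves_segment[OF nc ji _ that])
    qed
    have nj: "node s (int j) \<le> node s (int i)" using node_le[OF s] ji by simp
    have njs: "node s (int j) = node s (int j - 1) + s" using node_step[of s "int j - 1"] by simp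
    have nis: "node s (int i + 1) = node s (int i) + s" by (rule node_step)
    have len: "node s (int i) - node s (int j) \<le> real K * \<kappa>"
    proof -
      have "node s (int i) - node s (int j) = (real i - real j) * s" by (simp add: node_def algebra_simps)
      also have "\<dots> \<le> real N * s" using lt s by (intro mult_right_mono) auto
      finally show ?thesis using K ls by simp
    qed
    have "\<exists>H. ihomeo H b a b' a' \<and> (\<forall>x\<in>{b..a}. \<bar>H x - x\<bar> \<le> e \<and> H (f x) = g (H x))"
    proof (rule gap_conj[where c = "node s (int j)" and c' = "node s (int i)" and P = P and d = d and N = K and \<kappa> = \<kappa>])
      show "f x \<noteq> x" if "b < x" "x < a" for x
        using I a(4) that nofix[of f, OF _ mv] by (meson linear)
      show "g x \<noteq> x" if "b' < x" "x < a'" for x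
        using I a'(4) that nofix[of g, OF _ mv] by (meson linear)
      show "(\<forall>x\<ge>node s (int j). x \<le> node s (int i) \<longrightarrow> x + 2 * \<kappa> \<le> P x) \<or> (\<forall>x\<ge>node s (int j). x \<le> node s (int i) \<longrightarrow> P x \<le> x - 2 * \<kappa>)"
        using mv by (cases "pos (int i)") auto
    qed (use sm cl I a a' \<kappa> d len sh nj njs nis se in auto)
    then obtain H where H: "ihomeo H b a b' a'" "\<And>x. x \<in> {b..a} \<Longrightarrow> \<bar>H x - x\<bar> \<le> e \<and> H (f x) = g (H x)" by blast
    have "approx_conj e f g b a b' a'"
      by (rule approx_conj_intro[OF _ _ H(1)]) (use H(2) I a a' nj in \<open>auto intro!: ih\<close>)
    then show ?thesis using I a a' nj by (intro approx_conj_glue[of e f g 0 b 0 b' a a']) auto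
  qed
  have cell_small: "approx_conj e f g u v u' v'"
    if "u < v" "u' < v'" "f u = u" "f v = v" "g u' = u'" "g v' = v'" "node s i \<le> u" "v \<le> node s (i + 1)" "node s i \<le> u'"
      "v' \<le> node s (i + 1)" for u v u' v' i
    by (rule approx_conj_small[of u v u' v' f g "node s i" "node s (i + 1)"]) (use that se node_step[of s i] in \<open>auto intro!: ih\<close>)
  have main: "i < N * M \<Longrightarrow> \<exists>j b b'. Inv i j b b'" for i
  proof (induction i)
    case 0
    \<comment> \<open>The first cluster surrounds 0, and only its right half lies in
      \<open>{0..L m}\<close>; the last one, around \<open>L m\<close>, contributes its left
      half.\<close>
    have n0: "node s (- 1) < 0" "0 < node s 0" using s by (auto simp: node_def)
    obtain a b where b: "0 < b" "b < node s 0" "f b = b" "\<forall>x. b < x \<longrightarrow> x \<le> node s 0 \<longrightarrow> f x \<noteq> x"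
      using cluster[of f "-1" 0] te[of f] n0 by auto
    obtain a' b' where b': "0 < b'" "b' < node s 0" "g b' = b'" "\<forall>x. b' < x \<longrightarrow> x \<le> node s 0 \<longrightarrow> g x \<noteq> x"
      using cluster[of g "-1" 0] te[of g] n0 by auto
    have "f 0 = 0" "g 0 = 0" using per_homeo_ends(1) f g by auto
    then have "approx_conj e f g 0 b 0 b'" using cell_small[of 0 b 0 b' "-1"] b b' n0 by auto
    then have "Inv 0 0 b b'" using b b' n0 by (auto simp: Inv_def)
    then show ?case by blast
  next
    case (Suc i)
    then obtain j b b' where I: "Inv i j b b'" by auto
    show ?case
    proof (cases "pos (int i) = pos (int (Suc i))")
      case True
      then have "pos (int l) = pos (int (Suc i))" if "j \<le> l" "l \<le> Suc i" for l
      proof (cases "l = Suc i")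
        case False
        then have "pos (int l) = pos (int i)" using that I unfolding Inv_def by (meson le_SucE)
        then show ?thesis using True by simp
      qed simp
      moreover have "j \<le> Suc i" using I unfolding Inv_def by linarith
      ultimately have "Inv (Suc i) j b b'" using I unfolding Inv_def by blast
      then show ?thesis by blast
    next
      case False
      then have fl: "(P (node s (int i)) > node s (int i)) \<noteq> (P (node s (int i + 1)) > node s (int i + 1))"
        by (simp add: pos_def add.commute)
      have pi: "0 < node s (int i)" using s by (simp add: node_def)
      obtain z where "node s (int i) < z" "z < node s (int i + 1)" "fixes_nbhd f z" using tf[OF _ fl] by blast
      from cluster[OF _ this] obtain a b1 where ab: "node s (int i) < a" "a < z" "z < b1" "b1 < node s (int i + 1)" "f a = a"
        "f b1 = b1"
         "\<forall>x. node s (int i) \<le> x \<longrightarrow> x < a \<longrightarrow> f x \<noteq> x" "\<forall>x. b1 < x \<longrightarrow> x \<le> node s (int i + 1) \<longrightarrow> f x \<noteq> x" by blast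
      then have a: "node s (int i) < a" "a < b1" "b1 < node s (int i + 1)" "f a = a" "f b1 = b1"
         "\<And>x. node s (int i) \<le> x \<Longrightarrow> x < a \<Longrightarrow> f x \<noteq> x" "\<And>x. b1 < x \<Longrightarrow> x \<le> node s (int i + 1) \<Longrightarrow> f x \<noteq> x"
        by auto
      obtain z where "node s (int i) < z" "z < node s (int i + 1)" "fixes_nbhd g z" using tf[OF _ fl] by blast
      from cluster[OF _ this] obtain a' b1' where ab: "node s (int i) < a'" "a' < z" "z < b1'" "b1' < node s (int i + 1)"
        "g a' = a'" "g b1' = b1'"
         "\<forall>x. node s (int i) \<le> x \<longrightarrow> x < a' \<longrightarrow> g x \<noteq> x" "\<forall>x. b1' < x \<longrightarrow> x \<le> node s (int i + 1) \<longrightarrow> g x \<noteq> x" by blast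
      then have a': "node s (int i) < a'" "a' < b1'" "b1' < node s (int i + 1)" "g a' = a'" "g b1' = b1'"
         "\<And>x. node s (int i) \<le> x \<Longrightarrow> x < a' \<Longrightarrow> g x \<noteq> x" "\<And>x. b1' < x \<Longrightarrow> x \<le> node s (int i + 1) \<Longrightarrow> g x \<noteq> x"
        by auto
      have "approx_conj e f g 0 a 0 a'" by (rule gap[OF I]) (use a a' in auto)
      moreover have "approx_conj e f g a b1 a' b1'" by (rule cell_small[of _ _ _ _ "int i"]) (use a a' in auto)
      ultimately have "approx_conj e f g 0 b1 0 b1'" by (rule approx_conj_glue) (use a a' pi in auto)
      then have "Inv (Suc i) (Suc i) b1 b1'" using a a' pi unfolding Inv_def by (auto simp: add.commute)
      then show ?thesis by blast
    qed
  qed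
  \<comment> \<open>The last node before \<open>L m\<close>, which is the midpoint of its
    cell.\<close>
  define i where "i = N * M - 1"
  have i: "i < N * M" "int i + 1 = int M * int N" "int i = int M * int N - 1" using N M0 by (auto simp: i_def of_nat_diff)
  obtain j b b' where I: "Inv i j b b'" using main[OF i(1)] by blast
  have pi: "0 < node s (int i)" using s by (simp add: node_def)
  have Lm: "node s (int i) < L m" "L m < node s (int i + 1)" 
  proof -
    have ri: "real_of_int (int i) = real M * real N - 1" using arg_cong[OF i(3), of real_of_int] by simp
    have "node s (int i) = L m - s / 2" unfolding node_def ri M ls by (simp add: algebra_simps)
    then show "node s (int i) < L m" "L m < node s (int i + 1)" using s node_step[of s "int i"] by auto
  qed
  have fx: "f (L m) = L m" "g (L m) = L m" using per_homeo_ends(2) f g by auto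
  have "fixes_nbhd f (L m)" using te by blast
  from cluster[OF disjI1[OF refl] Lm this] obtain a where a: "node s (int i) < a" "a < L m" "f a = a"
    "\<And>x. node s (int i) \<le> x \<Longrightarrow> x < a \<Longrightarrow> f x \<noteq> x"
    by blast
  have "fixes_nbhd g (L m)" using te by blast
  from cluster[OF disjI2[OF refl] Lm this] obtain a' where a': "node s (int i) < a'" "a' < L m" "g a' = a'"
    "\<And>x. node s (int i) \<le> x \<Longrightarrow> x < a' \<Longrightarrow> g x \<noteq> x"
    by blast
  have "approx_conj e f g 0 a 0 a'" by (rule gap[OF I]) (use a a' Lm in auto)
  moreover have "approx_conj e f g a (L m) a' (L m)" by (rule cell_small[of _ _ _ _ "int i"]) (use a a' Lm fx in auto)
  ultimately show ?thesis by (rule approx_conj_glue) (use a a' pi in auto)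
qed

text \<open>\<open>{0..L m}\<close> is a fundamental domain, so the estimates and the conjugacy
  equation carry over to the extensions by \<open>per_homeo_ext\<close>.\<close>

lemma approx_conj_extend:
  assumes G: "approx_conj e f g 0 (L m) 0 (L m)" and f: "ph m f" and g: "ph m g" and "t > 0"
  obtains F1 G1 H where "ph m F1" "ph m G1" "ph m H" "close t f F1" "close t g G1" "close e H (\<lambda>x. x)" "cj H F1 = G1"
proof -
  obtain f1 g1 h where *: "ihomeo f1 0 (L m) 0 (L m)" "ihomeo g1 0 (L m) 0 (L m)" "ihomeo h 0 (L m) 0 (L m)"
    "\<forall>x\<in>{0..L m}. \<bar>f1 x - f x\<bar> \<le> t" "\<forall>x\<in>{0..L m}. \<bar>g1 x - g x\<bar> \<le> t"
    "\<forall>x\<in>{0..L m}. \<bar>h x - x\<bar> \<le> e \<and> h (f1 x) = g1 (h x)"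
    using G[unfolded approx_conj_def, rule_format, OF \<open>t > 0\<close>] by (elim exE conjE) rule
  obtain F1 where F1: "ph m F1" "\<And>x. x \<in> {0..L m} \<Longrightarrow> F1 x = f1 x" using per_homeo_ext[OF L_pos L_pos *(1)] by metis
  obtain G1 where G1: "ph m G1" "\<And>x. x \<in> {0..L m} \<Longrightarrow> G1 x = g1 x" using per_homeo_ext[OF L_pos L_pos *(2)] by metis
  obtain H where H: "ph m H" "\<And>x. x \<in> {0..L m} \<Longrightarrow> H x = h x" using per_homeo_ext[OF L_pos L_pos *(3)] by metis
  have transfer: "close c A B" if "ph m A" "ph m B" "\<And>x. x \<in> {0..L m} \<Longrightarrow> \<bar>A x - B x\<bar> \<le> c" for A B c
    unfolding close_def
  proof
    fix x
    show "\<bar>A x - B x\<bar> \<le> c"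
      by (cases rule: fold_obtain[OF L_pos[of m], of x])
        (use that(3) per_homeo_fold[OF that(1)] per_homeo_fold[OF that(2)] in \<open>auto simp: abs_minus_commute\<close>)
  qed
  have id: "ph m (\<lambda>x. x)" by (auto simp: per_homeo_def strict_mono_def surj_def)
  have "close t f F1" "close t g G1" "close e H (\<lambda>x. x)"
    using * F1 G1 H by (auto intro!: transfer f g id simp: abs_minus_commute)
  \<comment> \<open>Distance 0 turns the conjugacy equation into an estimate, which transfers like
    the others.\<close>
  moreover have "close 0 (H \<circ> F1) (G1 \<circ> H)"
  proof (rule transfer)
    fix x assume x: "x \<in> {0..L m}"
    then have "f1 x \<in> {0..L m}" "h x \<in> {0..L m}" using ihomeo_in *(1,3) by blast+
    then show "\<bar>(H \<circ> F1) x - (G1 \<circ> H) x\<bar> \<le> 0" using x F1(2) G1(2) H(2) *(6) by simp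
  qed (use F1 G1 H ph_comp in auto)
  then have "H \<circ> F1 = G1 \<circ> H" by (auto simp: close_def fun_eq_iff)
  then have "cj H F1 = G1" using lpD(4)[OF ph_lp[OF H(1)]] by (auto simp: cj_def fun_eq_iff)
  ultimately show ?thesis using that F1(1) G1(1) H(1) by blast
qed

text \<open>The radius depends on \<open>P\<close> only, through \<open>\<kappa>\<close> and the
  shadowing constant for the \<open>K\<close> steps that cross one half-period; the levels of the
  maps to be conjugated enter afterwards.\<close>

lemma local_transitivity:
  assumes F: "lp F" and r: "r > 0" and e: "e > 0"
  shows "\<exists>F0 d. lp F0 \<and> d > 0 \<and> close r F F0 \<and> locally_transitive e F0 d"
proof -
  obtain n N s \<kappa> P where nc: "grid_moves n N s \<kappa> P" and FP: "close r F P" and se: "s \<le> e" by (rule grid_moves_approx[OF assms])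
  have phP: "ph n P" and \<kappa>: "\<kappa> > 0" using nc by (auto simp: grid_moves_def)
  obtain K :: nat where "L n / \<kappa> < real K" using reals_Archimedean2 by blast
  then have K: "L n \<le> real K * \<kappa>" using \<kappa> by (simp add: field_simps)
  obtain d0 where d0: "d0 > 0" "shadows P K d0 e" using shadows_ex[OF ph_unif_cont[OF phP] e] by blast
  define d where "d = min d0 \<kappa>"
  have d: "d > 0" "d \<le> \<kappa>" "shadows P K d e" using d0 \<kappa> shadows_mono[OF d0(2)] by (auto simp: d_def)
  have "locally_transitive e P (d/3)"
    unfolding locally_transitive_def
  proof (intro allI impI)
    fix F G and t :: real assume FG: "lp F" "lp G" "close (d/3) P F" "close (d/3) P G" and t: "t > 0"
    \<comment> \<open>\<open>c\<close> bounds both the passage to a periodic map and the clamping.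
      Three times \<open>d / 3\<close> keeps the clamped maps \<open>d\<close>-close to
      \<open>P\<close>, and the last third of \<open>t\<close> is left for
      \<open>approx_conj_extend\<close>.\<close>
    define c where "c = min (d/3) (t/3)"
    have c: "c > 0" "c \<le> d/3" "c \<le> t/3" using d t by (auto simp: c_def)
    obtain m1 f0 where f0: "ph m1 f0" "close c F f0" using lpE[OF FG(1) c(1)] by metis
    obtain m2 g0 where g0: "ph m2 g0" "close c G g0" using lpE[OF FG(2) c(1)] by metis
    define m where "m = max n (max m1 m2)"
    have m: "n \<le> m" "ph m f0" "ph m g0" using ph_level[of m1 m f0] ph_level[of m2 m g0] f0(1) g0(1) by (auto simp: m_def)
    have ph: "ph m (clamp c f0)" "ph m (clamp c g0)" using clamp_per_homeo m c by auto
    have thirds: "close d P (clamp c h0) \<and> close (t/3 + t/3) H (clamp c h0) \<and> close (2 * (d/3)) P h0" if "close (d/3) P H"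
      "close c H h0" for H h0
    proof -
      have cc: "close c h0 (clamp c h0)" using clamp_close c by simp
      have "close (d/3 + c) P h0" "close (c + c) H (clamp c h0)" using close_trans that cc by blast+
      moreover then have "close (d/3 + c + c) P (clamp c h0)" using close_trans cc by blast
      ultimately show ?thesis using c by (auto elim!: close_mono)
    qed
    note tF = thirds[OF FG(3) f0(2)] and tG = thirds[OF FG(4) g0(2)]
    have "approx_conj e (clamp c f0) (clamp c g0) 0 (L m) 0 (L m)"
    proof (rule approx_conj_period[OF nc se d(2) K d(3) m(1) ph])
      have cont: "continuous_on UNIV h0" if "h0 = f0 \<or> h0 = g0" for h0
        using that m strict_mono_surj_continuous by (auto simp: per_homeo_def)
      \<comment> \<open>\<open>h0\<close> is within \<open>2 * (d / 3)\<close> of \<open>P\<close>,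
        which is less than the displacement \<open>2 * \<kappa>\<close> at the nodes. So it has the
        signs of \<open>P\<close> there and a fixed point in every cell where they change; clamping
        widens this point to an interval.\<close>
      have pc: "\<exists>z. node s i < z \<and> z < node s (i + 1) \<and> fixes_nbhd (clamp c h0) z"
        if h0: "h0 = f0 \<or> h0 = g0" and fl: "(P (node s i) > node s i) \<noteq> (P (node s (i + 1)) > node s (i + 1))" for h0 i
      proof -
        have cl: "close (2 * (d/3)) P h0" using h0 tF tG by auto
        have sg: "(h0 (node s j) > node s j) = (P (node s j) > node s j)" "h0 (node s j) \<noteq> node s j" for j
          using closeD[OF cl, of "node s j"] grid_moves_signs[OF nc, of j] d \<kappa> by linarith+
        have "node s i \<le> node s (i + 1)" using nc L_pos[of n] by (intro node_le) (auto simp: grid_moves_def)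
        have ct: "continuous_on {node s i..node s (i + 1)} (\<lambda>x. h0 x - x)"
          by (intro continuous_intros continuous_on_subset[OF cont[OF h0]]) auto
        have "\<exists>z\<ge>node s i. z \<le> node s (i + 1) \<and> h0 z - z = 0"
        proof (cases "P (node s i) > node s i")
          case True
          then show ?thesis using sg[of i] sg[of "i + 1"] fl \<open>node s i \<le> node s (i + 1)\<close> ct by (intro IVT2') auto
        next
          case False
          then show ?thesis using sg[of i] sg[of "i + 1"] fl \<open>node s i \<le> node s (i + 1)\<close> ct by (intro IVT') auto
        qed
        then obtain z where z: "node s i \<le> z" "z \<le> node s (i + 1)" "h0 z = z" by auto
        then have "node s i < z" "z < node s (i + 1)" using sg(2)[of i] sg(2)[of "i + 1"] by (auto simp: less_le)
        moreover have "fixes_nbhd (clamp c h0) z" by (rule clamp_fixes_nbhd[OF cont[OF h0] z(3) c(1)])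
        ultimately show ?thesis by blast
      qed
      then show "\<exists>z>node s i. z < node s (i + 1) \<and> fixes_nbhd h z"
        if "h = clamp c f0 \<or> h = clamp c g0" "(node s i < P (node s i)) \<noteq> (node s (i + 1) < P (node s (i + 1)))" for h i
        using that by auto
      show "fixes_nbhd h 0 \<and> fixes_nbhd h (L m)" if "h = clamp c f0 \<or> h = clamp c g0" for h
        using that clamp_fixes_nbhd[OF cont _ c(1)] per_homeo_ends m by metis
    qed (use tF tG in auto)
    then obtain F1 G1 H where H: "ph m F1" "ph m G1" "ph m H" "close (t/3) (clamp c f0) F1" "close (t/3) (clamp c g0) G1"
      "close e H (\<lambda>x. x)" "cj H F1 = G1"
      by (rule approx_conj_extend[OF _ ph, of _ "t/3"]) (use t in auto)
    have "close (t/3 + t/3 + t/3) F F1" "close (t/3 + t/3 + t/3) G G1" using close_trans tF tG H(4,5) by blast+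
    then have "close t F F1" "close t (cj H F1) G" using H(7) close_sym by auto
    moreover have "near_id e H" using H ph_lp by (simp add: near_id_def)
    ultimately show "\<exists>H F1. near_id e H \<and> lp F1 \<and> close t F F1 \<and> close t (cj H F1) G" using ph_lp[OF H(1)] by blast
  qed
  then show ?thesis using ph_lp[OF phP] FP d(1) by (metis zero_less_divide_iff zero_less_numeral)
qed

text \<open>The conjugator may be large here, so a whole half-period \<open>{0..L m}\<close> serves
  as the single cell of \<open>approx_conj_small\<close>.\<close>

lemma global_transitivity:
  assumes F: "lp F" and G: "lp G" and t: "t > 0"
  shows "\<exists>H F1. lp H \<and> lp F1 \<and> close t F F1 \<and> close t (cj H F1) G"
proof -
  obtain m1 f0 where f0: "ph m1 f0" "close (t/2) F f0" using lpE[OF F, of "t/2"] t by (metis half_gt_zero)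
  obtain m2 g0 where g0: "ph m2 g0" "close (t/2) G g0" using lpE[OF G, of "t/2"] t by (metis half_gt_zero)
  define m where "m = max m1 m2"
  have m: "ph m f0" "ph m g0" using ph_level[of m1 m f0] ph_level[of m2 m g0] f0(1) g0(1) by (auto simp: m_def)
  have "approx_conj (L m) f0 g0 0 (L m) 0 (L m)"
    by (rule approx_conj_small[of _ _ _ _ _ _ 0 "L m"]) (use m L_pos in \<open>auto intro!: per_homeo_ihomeo less_imp_le\<close>)
  then obtain F1 G1 H where H: "ph m F1" "ph m G1" "ph m H" "close (t/2) f0 F1" "close (t/2) g0 G1" "cj H F1 = G1"
    by (rule approx_conj_extend[OF _ m, of _ "t/2"]) (use t in auto)
  have "close (t/2 + t/2) F F1" "close (t/2 + t/2) G G1" using close_trans f0 g0 H(4,5) by blast+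
  then have "close t F F1 \<and> close t (cj H F1) G" using H(6) close_sym by simp
  then show ?thesis using H(1,3) ph_lp by blast
qed

end

subsection \<open>Open maps of the interval\<close>

text \<open>What openness provides: local extrema have extreme values. Since \<open>a\<close> and
  \<open>b\<close> may lie outside \<open>{0..1}\<close>, this includes extrema at the ends of the
  domain.\<close>

definition extremal_at_ends :: "(real \<Rightarrow> real) \<Rightarrow> bool" where
  "extremal_at_ends g \<longleftrightarrow> continuous_on {0..1} g \<and> g ` {0..1} \<subseteq> {0..1} \<and>
     (\<forall>a b c. c \<in> {0..1} \<longrightarrow> a < c \<longrightarrow> c < b \<longrightarrow>
       ((\<forall>x\<in>{0..1}. a < x \<longrightarrow> x < b \<longrightarrow> g x \<le> g c) \<longrightarrow> g c = 1) \<and>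
       ((\<forall>x\<in>{0..1}. a < x \<longrightarrow> x < b \<longrightarrow> g c \<le> g x) \<longrightarrow> g c = 0))"

lemma open_interval_map_extremal:
  assumes "open_interval_map g" shows "extremal_at_ends g"
proof -
  have c: "continuous_on {0..1} g" "g ` {0..1} \<subseteq> {0..1}" and o: "open_map (top_of_set {0..1}) (top_of_set {0..1}) g"
    using assms by (auto simp: open_interval_map_def)
  have near: "\<exists>e>0. \<forall>y\<in>{0..1}. \<bar>y - g c\<bar> < e \<longrightarrow> (\<exists>x\<in>{0..1}. a < x \<and> x < b \<and> g x = y)" if "c \<in> {0..1}" "a < c" "c < b"
    for a b c :: real
  proof -
    have "openin (top_of_set {0..1}) ({0..1} \<inter> {a<..<b})" by (simp add: openin_open_Int)
    then have "openin (top_of_set {0..1}) (g ` ({0..1} \<inter> {a<..<b}))" using o by (simp add: open_map_def)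
    moreover have "g c \<in> g ` ({0..1} \<inter> {a<..<b})" using that by simp
    ultimately obtain e where "e > 0" "ball (g c) e \<inter> {0..1} \<subseteq> g ` ({0..1} \<inter> {a<..<b})"
      unfolding openin_contains_ball by blast
    have "\<exists>x\<in>{0..1}. a < x \<and> x < b \<and> g x = y" if "y \<in> {0..1}" "\<bar>y - g c\<bar> < e" for y
    proof -
      have "y \<in> ball (g c) e \<inter> {0..1}" using that by (auto simp: dist_real_def)
      then have "y \<in> g ` ({0..1} \<inter> {a<..<b})" using \<open>ball (g c) e \<inter> {0..1} \<subseteq> _\<close> by blast
      then show ?thesis by auto
    qed
    then show ?thesis using \<open>e > 0\<close> by blast
  qed
  have "g c = 1" if cab: "c \<in> {0..1}" "a < c" "c < b" and mx: "\<forall>x\<in>{0..1}. a < x \<longrightarrow> x < b \<longrightarrow> g x \<le> g c" for a b c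
  proof (rule ccontr)
    assume "g c \<noteq> 1"
    have gc: "0 \<le> g c" "g c < 1" using c(2) cab(1) \<open>g c \<noteq> 1\<close> by force+
    obtain e where e: "e > 0" "\<forall>y\<in>{0..1}. \<bar>y - g c\<bar> < e \<longrightarrow> (\<exists>x\<in>{0..1}. a < x \<and> x < b \<and> g x = y)" using near[OF cab] by blast
    define y where "y = min 1 (g c + e/2)"
    have "y \<in> {0..1}" "\<bar>y - g c\<bar> < e" "y > g c" using gc e(1) by (auto simp: y_def)
    then show False using e(2) mx by fastforce
  qed
  moreover have "g c = 0" if cab: "c \<in> {0..1}" "a < c" "c < b" and mx: "\<forall>x\<in>{0..1}. a < x \<longrightarrow> x < b \<longrightarrow> g c \<le> g x" for a b c
  proof (rule ccontr)
    assume "g c \<noteq> 0"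
    have gc: "0 < g c" "g c \<le> 1" using c(2) cab(1) \<open>g c \<noteq> 0\<close> by force+
    obtain e where e: "e > 0" "\<forall>y\<in>{0..1}. \<bar>y - g c\<bar> < e \<longrightarrow> (\<exists>x\<in>{0..1}. a < x \<and> x < b \<and> g x = y)" using near[OF cab] by blast
    define y where "y = max 0 (g c - e/2)"
    have "y \<in> {0..1}" "\<bar>y - g c\<bar> < e" "y < g c" using gc e(1) by (auto simp: y_def)
    then show False using e(2) mx by fastforce
  qed
  ultimately show ?thesis unfolding extremal_at_ends_def using c by blast
qed

lemma extremal_flip: assumes "extremal_at_ends g" shows "extremal_at_ends (\<lambda>x. 1 - g x)"
proof -
  have "continuous_on {0..1} (\<lambda>x. 1 - g x)" using assms by (auto simp: extremal_at_ends_def intro!: continuous_intros)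
  then show ?thesis using assms unfolding extremal_at_ends_def by auto
qed

lemma extremal_max: "extremal_at_ends g \<Longrightarrow> c \<in> {0..1} \<Longrightarrow> a < c \<Longrightarrow> c < b \<Longrightarrow> (\<And>x. 0 \<le> x \<Longrightarrow> x \<le> 1 \<Longrightarrow> a < x \<Longrightarrow> x < b \<Longrightarrow> g x \<le> g c) \<Longrightarrow> g c = 1"
  unfolding extremal_at_ends_def by (metis atLeastAtMost_iff)

lemma extremal_min: "extremal_at_ends g \<Longrightarrow> c \<in> {0..1} \<Longrightarrow> a < c \<Longrightarrow> c < b \<Longrightarrow> (\<And>x. 0 \<le> x \<Longrightarrow> x \<le> 1 \<Longrightarrow> a < x \<Longrightarrow> x < b \<Longrightarrow> g c \<le> g x) \<Longrightarrow> g c = 0"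
  unfolding extremal_at_ends_def by (metis atLeastAtMost_iff)

lemma extremal_range: "extremal_at_ends g \<Longrightarrow> 0 \<le> x \<Longrightarrow> x \<le> 1 \<Longrightarrow> 0 \<le> g x \<and> g x \<le> 1"
  unfolding extremal_at_ends_def by (force simp: image_subset_iff)

lemma extremal_attains:
  assumes g: "extremal_at_ends g" and ab: "0 \<le> a" "a \<le> b" "b \<le> 1"
  shows "\<exists>c d. a \<le> c \<and> c \<le> b \<and> (\<forall>x. a \<le> x \<longrightarrow> x \<le> b \<longrightarrow> g x \<le> g c) \<and> a \<le> d \<and> d \<le> b \<and> (\<forall>x. a \<le> x \<longrightarrow> x \<le> b \<longrightarrow> g d \<le> g x)"
proof -
  have c: "continuous_on {a..b} g" using g ab by (auto simp: extremal_at_ends_def intro: continuous_on_subset)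
  obtain c where "c \<in> {a..b}" "\<forall>x\<in>{a..b}. g x \<le> g c" using continuous_attains_sup[OF compact_Icc _ c] ab by auto
  moreover obtain d where "d \<in> {a..b}" "\<forall>x\<in>{a..b}. g d \<le> g x" using continuous_attains_inf[OF compact_Icc _ c] ab by auto
  ultimately show ?thesis by (intro exI[of _ c] exI[of _ d]) auto
qed

text \<open>If \<open>g 0\<close> were strictly between 0 and 1, so would be all values near 0. Then
  no point of \<open>[0, b)\<close> is a local extremum, so the maximum and the minimum over
  \<open>[0, b]\<close> are both at \<open>b\<close>; but then \<open>g\<close> is constant there
  and has an extremum at 0.\<close>

lemma extremal_start: assumes g: "extremal_at_ends g" shows "g 0 = 0 \<or> g 0 = 1"
proof (rule ccontr)
  assume n: "\<not> (g 0 = 0 \<or> g 0 = 1)"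
  have cont: "continuous_on {0..1} g" using g by (simp add: extremal_at_ends_def)
  define e where "e = min (g 0) (1 - g 0)"
  have "e > 0" using n extremal_range[OF g, of 0] by (auto simp: e_def)
  then obtain d where d: "d > 0" "\<And>x. x \<in> {0..1} \<Longrightarrow> dist x 0 < d \<Longrightarrow> dist (g x) (g 0) < e"
    using cont unfolding continuous_on_iff by (metis atLeastAtMost_iff order_refl zero_le_one)
  define b where "b = min 1 (d/2)"
  have b: "0 < b" "b \<le> 1" "b < d" using d by (auto simp: b_def)
  have in01: "0 < g x" "g x < 1" if "0 \<le> x" "x \<le> b" for x
    using d(2)[of x] that b unfolding e_def dist_real_def by auto
  obtain c c' where c: "0 \<le> c" "c \<le> b" "\<forall>x. 0 \<le> x \<longrightarrow> x \<le> b \<longrightarrow> g x \<le> g c" "0 \<le> c'" "c' \<le> b" "\<forall>x. 0 \<le> x \<longrightarrow> x \<le> b \<longrightarrow> g c' \<le> g x"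
    using extremal_attains[OF g order_refl less_imp_le[OF b(1)] b(2)] by blast
  have nomax: "\<not> (\<forall>x. 0 \<le> x \<longrightarrow> x \<le> b \<longrightarrow> g x \<le> g z)" if "0 \<le> z" "z < b" for z
  proof
    assume "\<forall>x. 0 \<le> x \<longrightarrow> x \<le> b \<longrightarrow> g x \<le> g z"
    then have "g z = 1" using that b by (intro extremal_max[OF g, of z "-1" b]) auto
    then show False using in01[of z] that by simp
  qed
  have nomin: "\<not> (\<forall>x. 0 \<le> x \<longrightarrow> x \<le> b \<longrightarrow> g z \<le> g x)" if "0 \<le> z" "z < b" for z
  proof
    assume "\<forall>x. 0 \<le> x \<longrightarrow> x \<le> b \<longrightarrow> g z \<le> g x"
    then have "g z = 0" using that b by (intro extremal_min[OF g, of z "-1" b]) auto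
    then show False using in01[of z] that by simp
  qed
  have "c = b" "c' = b" using nomax[of c] nomin[of c'] c by force+
  then have "g x = g b" if "0 \<le> x" "x \<le> b" for x using c(3,6) that by force
  then have "\<forall>x. 0 \<le> x \<longrightarrow> x \<le> b \<longrightarrow> g x \<le> g 0" using b by (metis order.refl less_imp_le)
  then show False using nomax[OF order_refl b(1)] by blast
qed

text \<open>\<open>y\<close> is the first point after \<open>x\<close> with value 1. Before it there
  is no local maximum, hence no return to 0, hence no local minimum either; so \<open>g\<close> is
  injective on the lap.\<close>

lemma extremal_lap_up:
  assumes g: "extremal_at_ends g" and x: "0 \<le> x" "x < 1" "g x = 0"
  obtains y where "x < y" "y \<le> 1" "ihomeo g x y 0 1"
proof -
  have cont: "continuous_on {0..1} g" using g by (simp add: extremal_at_ends_def)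
  define Y where "Y = {y \<in> {x..1}. g y = 1}"
  obtain c where c: "x \<le> c" "c \<le> 1" "\<And>t. x \<le> t \<Longrightarrow> t \<le> 1 \<Longrightarrow> g t \<le> g c"
    using extremal_attains[OF g x(1) less_imp_le[OF x(2)] order_refl] by metis
  \<comment> \<open>The maximum has to lie to the right of \<open>x\<close>. If it is attained at
    \<open>x\<close>, then \<open>g\<close> is at most 0 from there on, and the end point 1 is a
    maximum as well.\<close>
  define c0 where "c0 = (if c = x then 1 else c)"
  have "g t \<le> g c0" if "x \<le> t" "t \<le> 1" for t
    using c(3)[OF that] x extremal_range[OF g, of 1] by (auto simp: c0_def)
  then have "g c0 = 1" using extremal_max[OF g, of c0 x 2] c x by (auto simp: c0_def split: if_splits)
  then have "c0 \<in> Y" using c by (auto simp: Y_def c0_def)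
  have "closed Y" unfolding Y_def
    by (rule continuous_closed_preimage_constant) (use x in \<open>auto intro: continuous_on_subset[OF cont]\<close>)
  moreover have "Y \<subseteq> {x..1}" by (auto simp: Y_def)
  ultimately have "compact Y" by (metis compact_Icc closed_Int_compact inf.absorb_iff1)
  then obtain y where y: "y \<in> Y" "\<And>t. t \<in> Y \<Longrightarrow> y \<le> t" using compact_attains_inf[of Y] \<open>c0 \<in> Y\<close> by (metis empty_iff)
  have yy: "x < y" "y \<le> 1" "g y = 1" using y(1) x by (auto simp: Y_def less_le)
  have lt1: "g t \<noteq> 1" if "x \<le> t" "t < y" for t using y(2)[of t] that yy by (auto simp: Y_def)
  have nomax: "\<not> (\<forall>t. a \<le> t \<longrightarrow> t \<le> b \<longrightarrow> g t \<le> g c)" if "x \<le> a" "a < c" "c < b" "b \<le> y" for a b c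
  proof
    assume "\<forall>t. a \<le> t \<longrightarrow> t \<le> b \<longrightarrow> g t \<le> g c"
    then have "g c = 1" using that x yy by (intro extremal_max[OF g, of c a b]) auto
    then show False using lt1[of c] that by auto
  qed
  have pos: "g t \<noteq> 0" if t: "x < t" "t \<le> y" for t
  proof
    assume "g t = 0"
    have "t \<le> 1" using t yy by simp
    obtain c where c: "x \<le> c" "c \<le> t" "\<And>u. x \<le> u \<Longrightarrow> u \<le> t \<Longrightarrow> g u \<le> g c"
      using extremal_attains[OF g x(1) less_imp_le[OF t(1)] \<open>t \<le> 1\<close>] by metis
    have "c = x \<or> c = t" using nomax[of x c t] c t by force
    then have "g u \<le> 0" if "x \<le> u" "u \<le> t" for u using c(3)[OF that] x \<open>g t = 0\<close> by auto
    moreover have "0 \<le> g ((x + t)/2)" using extremal_range[OF g, of "(x+t)/2"] x t yy by auto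
    ultimately have "\<forall>u. x \<le> u \<longrightarrow> u \<le> t \<longrightarrow> g u \<le> g ((x + t)/2)" by force
    then show False using nomax[of x "(x+t)/2" t] t by auto
  qed
  have nomin: "\<not> (\<forall>t. a \<le> t \<longrightarrow> t \<le> b \<longrightarrow> g c \<le> g t)" if "x \<le> a" "a < c" "c < b" "b \<le> y" for a b c
  proof
    assume "\<forall>t. a \<le> t \<longrightarrow> t \<le> b \<longrightarrow> g c \<le> g t"
    then have "g c = 0" using that x yy by (intro extremal_min[OF g, of c a b]) auto
    then show False using pos[of c] that by auto
  qed
  have ne: "g a \<noteq> g b" if ab: "x \<le> a" "a < b" "b \<le> y" for a b
  proof
    assume eq: "g a = g b"
    have ab': "0 \<le> a" "a \<le> b" "b \<le> 1" using ab x yy by auto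
    obtain c d where cd: "a \<le> c" "c \<le> b" "\<forall>x. a \<le> x \<longrightarrow> x \<le> b \<longrightarrow> g x \<le> g c" "a \<le> d" "d \<le> b" "\<forall>x. a \<le> x \<longrightarrow> x \<le> b \<longrightarrow> g d \<le> g x"
      using extremal_attains[OF g ab'] by blast
    have "c = a \<or> c = b" using nomax[of a c b] cd ab by force
    moreover have "d = a \<or> d = b" using nomin[of a d b] cd ab by force
    ultimately have const: "g t = g a" if "a \<le> t" "t \<le> b" for t using cd(3,6) eq that by (metis order_antisym)
    then have "\<forall>t. a \<le> t \<longrightarrow> t \<le> b \<longrightarrow> g t \<le> g ((a + b)/2)"
    proof (intro allI impI)
      fix t assume "a \<le> t" "t \<le> b"
      then have "g t = g a" by (rule const)
      moreover have "g ((a + b)/2) = g a" by (rule const) (use ab in auto)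
      ultimately show "g t \<le> g ((a + b)/2)" by simp
    qed
    moreover have "a < (a + b)/2" "(a + b)/2 < b" using ab by auto
    ultimately show False using nomax[OF ab(1) _ _ ab(3)] by blast
  qed
  have "inj_on g {x..y}"
  proof (rule inj_onI)
    fix a b assume "a \<in> {x..y}" "b \<in> {x..y}" "g a = g b"
    then show "a = b" using ne[of a b] ne[of b a] by (metis atLeastAtMost_iff linorder_neqE_linordered_idom)
  qed
  moreover have cxy: "continuous_on {x..y} g" using x yy by (auto intro: continuous_on_subset[OF cont])
  ultimately have "strict_mono_on {x..y} g \<or> strict_antimono_on {x..y} g"
    using injective_eq_monotone_map[of "{x..y}" g] by (simp add: is_interval_cc)
  moreover have "\<not> strict_antimono_on {x..y} g"
  proof
    assume A: "strict_antimono_on {x..y} g"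
    have "g y < g x" using monotone_onD[OF A, of x y] yy by auto
    then show False using x yy by simp
  qed
  ultimately have "strict_mono_on {x..y} g" by blast
  then have "ihomeo g x y 0 1" using ihomeoI[of x y g 0 1] cxy x yy by simp
  then show ?thesis using that yy by blast
qed

text \<open>Laps are collected from the left. On each of them \<open>q\<close> grows by 1, and
  \<open>c = g 0\<close> records whether the first lap rises or falls. Since \<open>g\<close>
  changes by 1 over a lap, its length is at least \<open>w\<close>, so finitely many laps reach the
  end.\<close>

lemma extremal_structure:
  assumes g: "extremal_at_ends g"
  obtains k q c where "k \<ge> 1" "c = 0 \<or> c = (1::real)" "ihomeo q 0 1 0 (real k)" "\<And>x. 0 \<le> x \<Longrightarrow> x \<le> 1 \<Longrightarrow> g x = zig (q x + c)"
proof -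
  define c where "c = g 0"
  have c: "c = 0 \<or> c = 1" using extremal_start[OF g] by (simp add: c_def)
  define St where "St = (\<lambda>x k q. 0 \<le> x \<and> x \<le> 1 \<and> ihomeo q 0 x 0 (real k) \<and> (\<forall>t. 0 \<le> t \<longrightarrow> t \<le> x \<longrightarrow> g t = zig (q t + c)))"
  have "continuous_on {0..1} g" using g by (simp add: extremal_at_ends_def)
  then have "uniformly_continuous_on {0..1} g" by (simp add: compact_uniformly_continuous)
  then obtain w where w: "w > 0" "\<And>x y. x \<in> {0..1} \<Longrightarrow> y \<in> {0..1} \<Longrightarrow> dist y x < w \<Longrightarrow> dist (g y) (g x) < 1"
    unfolding uniformly_continuous_on_def by (metis zero_less_one)
  have step: "\<exists>y q'. St y (Suc k) q' \<and> y \<ge> x + w" if S: "St x k q" and x1: "x < 1" for x k q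
  proof -
    note S = S[unfolded St_def]
    have q: "ihomeo q 0 x 0 (real k)" using S by blast
    have x: "0 \<le> x" using S by blast
    have gx: "g x = zig (real k + c)" using S ihomeo_right[OF q x] by simp
    have kc: "zig (real k + c) = 0 \<or> zig (real k + c) = 1"
      using c zig_of_nat[of k] zig_of_nat[of "Suc k"] by (auto simp: add.commute split: if_split_asm)
    \<comment> \<open>A falling lap of \<open>g\<close> is a rising lap of
      \<open>1 - g\<close>.\<close>
    define s where "s = (if g x = 0 then g else (\<lambda>t. 1 - g t))"
    have "extremal_at_ends s" "s x = 0" using g extremal_flip[OF g] gx kc by (auto simp: s_def)
    then obtain y where y: "x < y" "y \<le> 1" "ihomeo s x y 0 1" using extremal_lap_up x x1 by metis
    define q' where "q' = (\<lambda>t. if t \<le> x then q t else real k + s t)"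
    have "ihomeo (\<lambda>t. real k + s t) x y (real k) (real (Suc k))"
      using ihomeo_less[OF y(3)] ihomeo_continuous[OF y(3)] ihomeo_left[OF y(3)] ihomeo_right[OF y(3)] y(1)
      by (intro ihomeoI) (auto intro!: strict_mono_onI continuous_intros)
    then have "ihomeo q' 0 y 0 (real (Suc k))" unfolding q'_def using ihomeo_glue[OF q] x y by auto
    moreover have "g t = zig (q' t + c)" if t: "0 \<le> t" "t \<le> y" for t
    proof (cases "t \<le> x")
      case True
      then show ?thesis using S t by (simp add: q'_def)
    next
      case False
      have s01: "0 \<le> s t" "s t \<le> 1" using ihomeo_bounds[OF y(3), of t] False t by auto
      obtain j :: int where j: "real k + c = of_int j" using c by (metis of_int_1 of_int_add of_int_of_nat_eq add_0_right)
      show ?thesis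
      proof (cases "even j")
        case True
        then have "g x = 0" using gx j zig_of_int[of j] by simp
        moreover obtain i where "j = 2 * i" using True by blast
        then have e: "real k + s t + c = s t + 2 * of_int i" using j by simp
        have "zig (real k + s t + c) = s t" unfolding e zig_shift using s01 by (rule zig_ident)
        ultimately show ?thesis using False by (simp add: q'_def s_def)
      next
        case odd: False
        then have "g x = 1" using gx j zig_of_int[of j] by simp
        moreover obtain i where "j = 2 * i + 1" using odd oddE by blast
        then have e: "real k + s t + c = 2 * of_int (i + 1) - (1 - s t)" using j by simp
        have "zig (real k + s t + c) = 1 - s t" unfolding e zig_reflect using s01 by (intro zig_ident) auto
        ultimately show ?thesis using False by (simp add: q'_def s_def)
      qed
    qed
    moreover have "y \<ge> x + w"
    proof (rule ccontr)
      assume "\<not> y \<ge> x + w"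
      then have "dist (g y) (g x) < 1" using x y by (intro w(2)) (auto simp: dist_real_def)
      moreover have "\<bar>s y - s x\<bar> = 1" using ihomeo_left[OF y(3)] ihomeo_right[OF y(3)] y(1) by simp
      then have "\<bar>g y - g x\<bar> = 1" by (auto simp: s_def split: if_splits)
      ultimately show False by (simp add: dist_real_def)
    qed
    ultimately show ?thesis using x y unfolding St_def by (intro exI[of _ y] exI[of _ q']) auto
  qed
  have "\<exists>x k q. St x k q \<and> (x = 1 \<or> x \<ge> real n * w)" for n
  proof (induction n)
    case 0
    have "St 0 0 (\<lambda>_. 0)" unfolding St_def using c by (auto simp: ihomeo_def strict_mono_on_def c_def)
    then show ?case by (intro exI[of _ 0]) auto
  next
    case (Suc n)
    then obtain x k q where S: "St x k q" "x = 1 \<or> x \<ge> real n * w" by blast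
    show ?case
    proof (cases "x = 1")
      case True then show ?thesis using S by blast
    next
      case False
      then have "x < 1" using S(1) by (simp add: St_def)
      then obtain y q' where "St y (Suc k) q'" "y \<ge> x + w" using step[OF S(1)] by blast
      moreover have "real (Suc n) * w = real n * w + w" by (simp add: algebra_simps)
      ultimately show ?thesis using S(2) False by (intro exI[of _ y] exI[of _ "Suc k"] exI[of _ q']) auto
    qed
  qed
  moreover obtain n :: nat where "1 / w < real n" using reals_Archimedean2 by blast
  then have "1 < real n * w" using w(1) by (simp add: field_simps)
  ultimately obtain x k q where "St x k q" "x = 1 \<or> 1 < x" by (metis order_less_le_trans)
  then have S: "St x k q" "x = 1" by (auto simp: St_def)
  have "k \<ge> 1"
  proof (rule ccontr)
    assume "\<not> k \<ge> 1"
    then have "k = 0" by simp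
    then have "ihomeo q 0 1 0 0" using S by (simp add: St_def)
    then show False using ihomeo_less[of q 0 1 0 0 0 1] ihomeo_bounds[of q 0 1 0 0 0] ihomeo_bounds[of q 0 1 0 0 1] by simp
  qed
  then show ?thesis using that[OF _ c, of k q] S by (auto simp: St_def)
qed


lemma zig_lap_point:
  fixes j :: nat
  shows "zig (real j + t) = (if even j then zig t else zig (1 + t))"
proof (cases "even j")
  case True
  then obtain i where "j = 2 * i" by blast
  then have e: "real j + t = t + 2 * of_int (int i)" by simp
  show ?thesis unfolding e zig_shift using True by simp
next
  case False
  then obtain i where "j = 2 * i + 1" using oddE by blast
  then have e: "real j + t = 1 + t + 2 * of_int (int i)" by simp
  show ?thesis unfolding e zig_shift using False by simp
qed

text \<open>The turning points of \<open>zig \<circ> (q + c)\<close> are forced to be break points of every partition into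
  intervals of monotonicity.\<close>
lemma interval_degree_zig:
  assumes q: "ihomeo q 0 1 0 (real k)" and k: "k \<ge> 1" and c: "c = 0 \<or> c = (1::real)"
    and g: "\<And>x. 0 \<le> x \<Longrightarrow> x \<le> 1 \<Longrightarrow> g x = zig (q x + c)"
  shows "interval_degree g = k"
proof -
  define x where "x = (\<lambda>j::nat. inv_into {0..1} q (real j))"
  note inv = ihomeo_inv[OF q]
  have xq: "q (x j) = real j" "0 \<le> x j" "x j \<le> 1" if "j \<le> k" for j
    using inv(3)[of "real j"] ihomeo_bounds[OF inv(1), of "real j"] that by (auto simp: x_def)
  have xless: "x i < x j" if "i < j" "j \<le> k" for i j
    using ihomeo_less[OF inv(1), of "real i" "real j"] that by (auto simp: x_def)
  have x0: "x 0 = 0" "x k = 1" using ihomeo_left[OF inv(1)] ihomeo_right[OF inv(1)] by (auto simp: x_def)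
  have val: "g t = (if even j = (c = 0) then q t - real j else 1 - (q t - real j)) \<and> 0 \<le> q t - real j \<and> q t - real j \<le> 1"
    if t: "x j \<le> t" "t \<le> x (Suc j)" and j: "j < k" for j t
  proof -
    have t01: "0 \<le> t" "t \<le> 1" using t xq[of j] xq[of "Suc j"] j by auto
    have "q (x j) \<le> q t" "q t \<le> q (x (Suc j))"
      using ihomeo_le[OF q, of "x j" t] ihomeo_le[OF q, of t "x (Suc j)"] t xq[of j] xq[of "Suc j"] j by auto
    then have u: "0 \<le> q t - real j" "q t - real j \<le> 1" using xq[of j] xq[of "Suc j"] j by auto
    have "g t = zig (real j + ((q t - real j) + c))" using g t01 by simp
    moreover have z0: "zig (q t - real j) = q t - real j" using u by (rule zig_ident)
    moreover have z1: "zig (1 + (q t - real j)) = 1 - (q t - real j)"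
    proof -
      have "1 + (q t - real j) = 2 * of_int 1 - (1 - (q t - real j))" by simp
      then have "zig (1 + (q t - real j)) = zig (1 - (q t - real j))" by (simp only: zig_reflect)
      then show ?thesis using u by (simp add: zig_ident)
    qed
    moreover have "zig (1 + (q t - real j + 1)) = q t - real j"
    proof -
      have "1 + (q t - real j + 1) = (q t - real j) + 2 * of_int 1" by simp
      then show ?thesis using z0 by (simp only: zig_shift)
    qed
    ultimately have "g t = (if even j = (c = 0) then q t - real j else 1 - (q t - real j))"
      using c unfolding zig_lap_point by (auto simp: add.commute)
    then show ?thesis using u by blast
  qed
  have qmono: "q s \<le> q t" "s < t \<Longrightarrow> q s < q t" if "0 \<le> s" "s \<le> t" "t \<le> 1" for s t
    using ihomeo_le[OF q, of s t] ihomeo_less[OF q, of s t] that by auto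
  define ok where "ok = (\<lambda>k' (i :: nat \<Rightarrow> real). i 0 = 0 \<and> i k' = 1 \<and>
        (\<forall>j<k'. i j < i (Suc j) \<and> (mono_on {i j .. i (Suc j)} g \<or> antimono_on {i j .. i (Suc j)} g)))"
  have "ok k x"
    unfolding ok_def
  proof (intro conjI allI impI x0)
    fix j assume j: "j < k"
    then show "x j < x (Suc j)" by (intro xless) auto
    have in01: "0 \<le> t" "t \<le> 1" if "x j \<le> t" "t \<le> x (Suc j)" for t using that xq[of j] xq[of "Suc j"] j by auto
    show "mono_on {x j .. x (Suc j)} g \<or> antimono_on {x j .. x (Suc j)} g"
    proof (cases "even j = (c = 0)")
      case True
      then have "mono_on {x j .. x (Suc j)} g"
        using val[OF _ _ j] qmono(1) in01 by (auto simp: mono_on_def)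
      then show ?thesis by blast
    next
      case False
      then have "antimono_on {x j .. x (Suc j)} g"
        using val[OF _ _ j] qmono(1) in01 by (auto simp: monotone_on_def)
      then show ?thesis by blast
    qed
  qed
  moreover have "k \<le> k'" if ok: "ok k' i" for k' i
  proof -
    have i0: "i 0 = 0" "i k' = 1" and ij: "\<And>j. j < k' \<Longrightarrow> i j < i (Suc j)"
      and mo: "\<And>j. j < k' \<Longrightarrow> mono_on {i j .. i (Suc j)} g \<or> antimono_on {i j .. i (Suc j)} g" using ok by (auto simp: ok_def)
    have k'0: "k' > 0" using i0 by (cases k') auto
    have cover: "\<exists>l<k'. i l \<le> t \<and> t < i (Suc l)" if "0 \<le> t" "t < 1" for t
    proof -
      define l where "l = (LEAST l. t < i l)"
      have ex: "t < i k'" using i0 that by simp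
      have l: "t < i l" "l \<le> k'" unfolding l_def using LeastI[of "\<lambda>l. t < i l" k'] Least_le[of "\<lambda>l. t < i l" k'] ex by auto
      have "l \<noteq> 0" using l i0 that by (cases l) auto
      then obtain m where m: "l = Suc m" by (cases l) auto
      have "\<not> t < i m" using not_less_Least[of m "\<lambda>l. t < i l"] m unfolding l_def by simp
      then show ?thesis using l m by (intro exI[of _ m]) auto
    qed
    have "x j \<in> i ` {1..<k'}" if j: "1 \<le> j" "j < k" for j
    proof -
      have xj: "0 < x j" "x j < 1" using xless[of 0 j] xless[of j k] x0 j by auto
      then obtain l where l: "l < k'" "i l \<le> x j" "x j < i (Suc l)" using cover[of "x j"] by auto
      have "i l = x j"
      proof (rule ccontr)
        assume "i l \<noteq> x j"
        then have lt: "i l < x j" using l by simp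
        obtain j' where j': "j = Suc j'" using j by (cases j) auto
        \<comment> \<open>\<open>s\<close> and \<open>t\<close> lie on either side of the turning
          point \<open>x j\<close>, in the same interval of the partition and in the two adjacent
          laps. There \<open>g\<close> is strictly smaller at both, or strictly larger at both, than
          at \<open>x j\<close>.\<close>
        define s t where "s = max (i l) (x j')" and "t = min (i (Suc l)) (x (Suc j))"
        have st: "s < x j" "x j < t" "i l \<le> s" "t \<le> i (Suc l)" "x j' \<le> s" "t \<le> x (Suc j)"
          using lt l xless[of j' j] xless[of j "Suc j"] j j' by (auto simp: s_def t_def)
        have b: "0 \<le> x j'" "x (Suc j) \<le> 1" using xq[of j'] xq[of "Suc j"] j j' by auto
        have vs: "g s = (if even j' = (c = 0) then q s - real j' else 1 - (q s - real j'))" using val[of j' s] st j j' by auto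
        have vx: "g (x j) = (if even j' = (c = 0) then 1 else 0)" using val[of j' "x j"] xq[of j] xless[of j' j] j j' by auto
        have vt: "g t = (if even j = (c = 0) then q t - real j else 1 - (q t - real j))" using val[of j t] st j by auto
        have "q s < real j" "real j < q t" using qmono(2)[of s "x j"] qmono(2)[of "x j" t] st b xq[of j] j by auto
        then have "(g s < g (x j) \<and> g t < g (x j)) \<or> (g s > g (x j) \<and> g t > g (x j))"
          using vs vx vt j' by (auto split: if_splits)
        moreover have "s \<in> {i l .. i (Suc l)}" "x j \<in> {i l .. i (Suc l)}" "t \<in> {i l .. i (Suc l)}" using st by auto
        moreover have "s \<le> x j" "x j \<le> t" using st by auto
        ultimately show False using mo[OF l(1)] unfolding monotone_on_def by (meson not_less)
      qed
      moreover have "l \<noteq> 0" using \<open>i l = x j\<close> i0 xj by (cases l) auto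
      ultimately show ?thesis using l(1) by (intro image_eqI[of _ _ l]) auto
    qed
    then have "x ` {1..<k} \<subseteq> i ` {1..<k'}" by auto
    moreover have "inj_on x {1..<k}"
    proof (rule inj_onI)
      fix a b assume "a \<in> {1..<k}" "b \<in> {1..<k}" "x a = x b"
      then show "a = b" using xless[of a b] xless[of b a] by (cases a b rule: linorder_cases) auto
    qed
    ultimately have "card {1..<k} \<le> card {1..<k'}"
      by (metis card_image card_image_le card_mono finite_atLeastLessThan finite_imageI order_trans)
    then show ?thesis using k'0 by auto
  qed
  ultimately have "(LEAST k. \<exists>i. ok k i) = k" by (intro Least_equality) auto
  then show ?thesis unfolding interval_degree_def ok_def .
qed

text \<open>Openness follows from the continuous inverse branches \<open>br j\<close>: the image of
  \<open>U\<close> is the union of its preimages under them.\<close>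

lemma open_interval_map_zig:
  assumes q: "ihomeo q 0 1 0 (real k)" and k: "k \<ge> 1"
  shows "open_interval_map (\<lambda>x. zig (q x))"
proof -
  define g where "g = (\<lambda>x. zig (q x))"
  define q' where "q' = inv_into {0..1} q"
  note inv = ihomeo_inv[OF q, folded q'_def]
  have gc: "continuous_on {0..1} g" unfolding g_def by (intro continuous_intros ihomeo_continuous[OF q])
  have g01: "g ` {0..1} \<subseteq> {0..1}" by (auto simp: g_def)
  define br where "br = (\<lambda>(j::nat) y. q' (if even j then real j + y else real j + 1 - y))"
  have brange: "0 \<le> (if even j then real j + y else real j + 1 - y)" "(if even j then real j + y else real j + 1 - y) \<le> real k"
    if "j < k" "0 \<le> y" "y \<le> 1" for j y
  proof -
    have "real j + 1 \<le> real k" using that(1) by linarith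
    then show "0 \<le> (if even j then real j + y else real j + 1 - y)" "(if even j then real j + y else real j + 1 - y) \<le> real k"
      using that by auto
  qed
  have br01: "0 \<le> br j y" "br j y \<le> 1" if "j < k" "0 \<le> y" "y \<le> 1" for j y
    using ihomeo_bounds[OF inv(1) brange[OF that]] by (auto simp: br_def)
  have gbr: "g (br j y) = y" if "j < k" "0 \<le> y" "y \<le> 1" for j y
  proof -
    have qb: "q (br j y) = (if even j then real j + y else real j + 1 - y)" using inv(3)[OF brange[OF that]] by (simp add: br_def)
    show ?thesis
    proof (cases "even j")
      case True
      then show ?thesis using qb that zig_lap_point[of j y] by (simp add: g_def zig_ident)
    next
      case False
      have "zig (real (Suc j) + - y) = zig (- y)" using zig_lap_point[of "Suc j" "- y"] False by simp
      then have "zig (real j + 1 - y) = zig y" by (simp add: algebra_simps)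
      then show ?thesis using qb that False by (simp add: g_def zig_ident)
    qed
  qed
  have brg: "\<exists>j<k. br j (g x) = x" if x: "0 \<le> x" "x \<le> 1" for x
  proof -
    have qx: "0 \<le> q x" "q x \<le> real k" using ihomeo_bounds[OF q x] by auto
    define j where "j = (if q x = real k then k - 1 else nat \<lfloor>q x\<rfloor>)"
    have j: "j < k" "real j \<le> q x" "q x \<le> real j + 1"
    proof -
      have "j < k \<and> real j \<le> q x \<and> q x \<le> real j + 1"
      proof (cases "q x = real k")
        case True then show ?thesis using k by (simp add: j_def)
      next
        case False
        then have "q x < real k" using qx by simp
        then have "nat \<lfloor>q x\<rfloor> < k \<and> real (nat \<lfloor>q x\<rfloor>) \<le> q x \<and> q x \<le> real (nat \<lfloor>q x\<rfloor>) + 1" using qx(1) by linarith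
        then show ?thesis by (simp add: j_def)
      qed
      then show "j < k" "real j \<le> q x" "q x \<le> real j + 1" by auto
    qed
    have "q x = real j + (q x - real j)" by simp
    then have "g x = (if even j then zig (q x - real j) else zig (1 + (q x - real j)))" unfolding g_def by (metis zig_lap_point)
    moreover have "zig (q x - real j) = q x - real j" using j by (intro zig_ident) auto
    moreover have "zig (1 + (q x - real j)) = 1 - (q x - real j)"
    proof -
      have "1 + (q x - real j) = 2 * of_int 1 - (1 - (q x - real j))" by simp
      then have "zig (1 + (q x - real j)) = zig (1 - (q x - real j))" by (simp only: zig_reflect)
      then show ?thesis using j by (simp add: zig_ident)
    qed
    ultimately have "br j (g x) = q' (q x)" by (simp add: br_def)
    then show ?thesis using inv(2)[OF x] j(1) by auto
  qed
  have brc: "continuous_on {0..1} (br j)" if "j < k" for j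
  proof -
    have "continuous_on {0..1} (\<lambda>y. if even j then real j + y else real j + 1 - y)"
      by (cases "even j") (auto intro!: continuous_intros)
    then show ?thesis unfolding br_def
    proof (rule continuous_on_compose2[OF ihomeo_continuous[OF inv(1)]])
      show "(\<lambda>y. if even j then real j + y else real j + 1 - y) ` {0..1} \<subseteq> {0..real k}"
      proof (rule image_subsetI)
        fix y :: real assume "y \<in> {0..1}"
        then show "(if even j then real j + y else real j + 1 - y) \<in> {0..real k}" using brange[OF that, of y] by simp
      qed
    qed
  qed
  have "openin (top_of_set {0..1}) (g ` U)" if U: "openin (top_of_set {0..1}) U" for U
  proof -
    have U01: "U \<subseteq> {0..1}" using U openin_imp_subset by blast
    have "g ` U = (\<Union>j\<in>{..<k}. {0..1} \<inter> br j -` U)"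
    proof (rule subset_antisym; rule subsetI)
      fix y assume "y \<in> g ` U"
      then obtain x where x: "x \<in> U" "y = g x" by blast
      then have x01: "0 \<le> x" "x \<le> 1" using U01 by auto
      then obtain j where "j < k" "br j (g x) = x" using brg[OF x01] by blast
      moreover have "g x \<in> {0..1}" using x01 by (auto simp: g_def)
      ultimately have "j \<in> {..<k} \<and> y \<in> {0..1} \<inter> br j -` U" using x by simp
      then show "y \<in> (\<Union>j\<in>{..<k}. {0..1} \<inter> br j -` U)" by blast
    next
      fix y assume "y \<in> (\<Union>j\<in>{..<k}. {0..1} \<inter> br j -` U)"
      then obtain j where "j < k" "y \<in> {0..1}" "br j y \<in> U" by auto
      then show "y \<in> g ` U" using gbr[of j y] by (intro image_eqI[of _ _ "br j y"]) auto
    qed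
    moreover have "openin (top_of_set {0..1}) ({0..1} \<inter> br j -` U)" if "j < k" for j
      by (rule continuous_openin_preimage[OF brc[OF that] _ U]) (use br01[OF that] in auto)
    then have "openin (top_of_set {0..1}) (\<Union>j\<in>{..<k}. {0..1} \<inter> br j -` U)" by (intro openin_Union) auto
    ultimately show ?thesis by simp
  qed
  then show ?thesis using gc g01 unfolding open_interval_map_def g_def[symmetric] open_map_def by auto
qed

subsection \<open>The arc component of the end point\<close>

locale universal_knaster =
  fixes p :: "nat \<Rightarrow> nat"
  assumes prime_seq: "universal_prime_sequence p"
begin

definition P :: "nat \<Rightarrow> real" where "P n = real (\<Prod>i=1..n. p i)"

definition \<phi> :: "real \<Rightarrow> nat \<Rightarrow> real" where "\<phi> t = (\<lambda>n. zig (t / P n))"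

abbreviation K :: "(nat \<Rightarrow> real) set" where "K \<equiv> knaster p"

lemma p_ge_2: "n \<ge> 1 \<Longrightarrow> p n \<ge> 2"
  using prime_seq unfolding universal_prime_sequence_def by (simp add: prime_ge_2_nat)

lemma P_0: "P 0 = 1" by (simp add: P_def)

lemma P_Suc: "P (Suc n) = P n * real (p (Suc n))" by (simp add: P_def)

lemma P_ge: "P n \<ge> 2 ^ n"
proof (induction n)
  case (Suc n)
  have "0 \<le> P n" unfolding P_def by (rule of_nat_0_le_iff)
  then have "2 ^ n * 2 \<le> P n * real (p (Suc n))" using Suc p_ge_2[of "Suc n"] by (intro mult_mono) auto
  then show ?case by (simp add: P_Suc)
qed (simp add: P_0)

lemma P_pos: "P n > 0"
  using P_ge[of n] by (meson less_le_trans zero_less_numeral zero_less_power)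

lemma P_mult: "n \<le> m \<Longrightarrow> \<exists>k::nat. P m = real k * P n"
proof (induction m rule: dec_induct)
  case base then show ?case by (intro exI[of _ 1]) simp
next
  case (step m)
  then obtain k :: nat where "P m = real k * P n" by blast
  then show ?case by (intro exI[of _ "k * p (Suc m)"]) (simp add: P_Suc)
qed

sublocale period_chain P
  by unfold_locales (use P_pos P_mult in auto)

lemma P_unbounded: "\<exists>n. x < P n"
proof -
  obtain n where "x < 2 ^ n" using real_arch_pow[of 2 x] by auto
  then show ?thesis using P_ge[of n] by (intro exI[of _ n]) auto
qed

lemma P_mono: "n \<le> m \<Longrightarrow> P n \<le> P m"
proof (induction m rule: dec_induct)
  case (step m)
  have "P m * 1 \<le> P m * real (p (Suc m))" using p_ge_2[of "Suc m"] P_pos[of m] by (intro mult_left_mono) auto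
  then show ?case using step by (simp add: P_Suc)
qed simp

lemma knaster_iff: "x \<in> K \<longleftrightarrow> (\<forall>n. 0 \<le> x n \<and> x n \<le> 1) \<and> (\<forall>n. zig (real (p (Suc n)) * x (Suc n)) = x n)"
proof -
  have "(\<forall>n\<ge>1. tent_map (p n) (x n) = x (n - 1)) \<longleftrightarrow> (\<forall>n. zig (real (p (Suc n)) * x (Suc n)) = x n)"
    unfolding tent_map_zig by (metis One_nat_def Suc_le_mono Suc_pred diff_Suc_1 le0 less_eq_Suc_le)
  then show ?thesis unfolding knaster_def by auto
qed

lemma knaster_01: "x \<in> K \<Longrightarrow> 0 \<le> x n \<and> x n \<le> 1" by (simp add: knaster_iff)

lemma knaster_lower:
  assumes x: "x \<in> K" and "n \<le> m" shows "x n = zig (P m / P n * x m)"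
  using assms(2)
proof (induction m rule: dec_induct)
  case base
  then show ?case using knaster_01[OF x, of n] P_pos[of n] by (simp add: zig_ident)
next
  case (step m)
  obtain k :: nat where k: "P m = real k * P n" using P_mult step by blast
  then have kk: "P m / P n = real k" using P_pos[of n] by simp
  have "x m = zig (real (p (Suc m)) * x (Suc m))" using x by (simp add: knaster_iff)
  then have "x n = zig (real k * zig (real (p (Suc m)) * x (Suc m)))" using step kk by simp
  also have "\<dots> = zig (real k * (real (p (Suc m)) * x (Suc m)))" by (rule zig_mult)
  also have "real k * (real (p (Suc m)) * x (Suc m)) = P (Suc m) / P n * x (Suc m)" by (simp add: P_Suc kk[symmetric])
  finally show ?case .
qed

lemma \<phi>_in: "\<phi> t \<in> K"
proof -
  have "zig (real (p (Suc n)) * zig (t / P (Suc n))) = zig (t / P n)" for n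
    using p_ge_2[of "Suc n"] by (simp add: zig_mult P_Suc)
  then show ?thesis by (simp add: knaster_iff \<phi>_def)
qed

lemma \<phi>_minus: "\<phi> (- t) = \<phi> t" by (simp add: \<phi>_def)

lemma \<phi>_abs: "\<phi> \<bar>t\<bar> = \<phi> t" by (cases "t \<ge> 0") (auto simp: \<phi>_minus)

lemma \<phi>_0th: "\<phi> t 0 = zig t" by (simp add: \<phi>_def P_0)

lemma \<phi>_inj: assumes "0 \<le> s" "0 \<le> t" "\<phi> s = \<phi> t" shows "s = t"
proof -
  obtain n where n: "max s t < P n" using P_unbounded by blast
  have "zig (s / P n) = zig (t / P n)" using assms(3) by (metis \<phi>_def)
  then have "s / P n = t / P n" using n assms by (simp add: zig_ident)
  then show ?thesis using P_pos[of n] by simp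
qed

lemma \<phi>_coord: "0 \<le> t \<Longrightarrow> t \<le> 1 \<Longrightarrow> \<phi> (t * P n) n = t"
  using P_pos[of n] by (simp add: \<phi>_def zig_ident)

lemma \<phi>_approx:
  assumes x: "x \<in> K" and "n \<le> m" shows "\<phi> (x m * P m) n = x n"
  using knaster_lower[OF assms] by (simp add: \<phi>_def algebra_simps)

section \<open>The product metric and the density of the half-line\<close>

lemma dist_fun_upper:
  fixes x y :: "nat \<Rightarrow> real"
  assumes "\<And>n. \<bar>x n - y n\<bar> \<le> d" shows "dist x y \<le> 2 * d"
proof -
  have s2: "summable (\<lambda>n. (1/2)^n * d)" by (intro summable_mult2 summable_geometric) simp
  have "dist x y = (\<Sum>n. (1/2)^n * min (dist (x (from_nat n)) (y (from_nat n))) 1)" by (rule dist_fun_def)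
  also have "\<dots> \<le> (\<Sum>n. (1/2)^n * d)"
  proof (rule suminf_le)
    show "(1/2)^n * min (dist (x (from_nat n)) (y (from_nat n))) 1 \<le> (1/2)^n * d" for n
      using assms[of "from_nat n"] by (intro mult_left_mono) (auto simp: dist_real_def)
    show "summable (\<lambda>n. (1/2)^n * min (dist (x (from_nat n)) (y (from_nat n))) 1)"
      by (rule summable_comparison_test'[of "\<lambda>n. (1/2)^n"]) auto
  qed (rule s2)
  also have "\<dots> = (\<Sum>n. (1/2)^n) * d" using suminf_mult2[of "\<lambda>n. (1/2::real)^n" d] by simp
  also have "(\<Sum>n. (1/2::real)^n) = 2" by (subst suminf_geometric) auto
  finally show ?thesis .
qed

lemma dist_coord:
  fixes x y :: "nat \<Rightarrow> real"
  assumes "e > 0" obtains d where "d > 0" "\<And>x y :: nat \<Rightarrow> real. dist x y < d \<Longrightarrow> \<bar>x n - y n\<bar> < e"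
proof -
  have bound: "(1/2)^(to_nat n) * min \<bar>x n - y n\<bar> 1 \<le> dist x y" for x y :: "nat \<Rightarrow> real"
  proof -
    have "summable (\<lambda>k. (1/2)^k * min (dist (x (from_nat k)) (y (from_nat k))) 1)"
      by (rule summable_comparison_test'[of "\<lambda>n. (1/2)^n"]) auto
    from sum_le_suminf[OF this, of "{to_nat n}"] show ?thesis by (simp add: dist_fun_def dist_real_def)
  qed
  show ?thesis
  proof (rule that[of "(1/2)^(to_nat n) * min e 1"])
    fix x y :: "nat \<Rightarrow> real" assume "dist x y < (1/2)^(to_nat n) * min e 1"
    then have "(1/2)^(to_nat n) * min \<bar>x n - y n\<bar> 1 < (1/2)^(to_nat n) * min e 1" using bound[of x y] by linarith
    then show "\<bar>x n - y n\<bar> < e" by (auto split: if_splits)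
  qed (use assms in simp)
qed

lemma \<phi>_dist: "dist (\<phi> s) (\<phi> t) \<le> 2 * \<bar>s - t\<bar>"
proof (rule dist_fun_upper)
  fix n
  have "1 \<le> P n" using P_mono[of 0 n] P_0 by simp
  have "\<bar>zig (s / P n) - zig (t / P n)\<bar> \<le> \<bar>s / P n - t / P n\<bar>" by (rule zig_lipschitz)
  also have "\<dots> = \<bar>s - t\<bar> / P n" using P_pos[of n] by (simp add: diff_divide_distrib[symmetric])
  also have "\<dots> \<le> \<bar>s - t\<bar> / 1" using \<open>1 \<le> P n\<close> by (intro divide_left_mono) auto
  finally show "\<bar>\<phi> s n - \<phi> t n\<bar> \<le> \<bar>s - t\<bar>" by (simp add: \<phi>_def)
qed

lemma coord_continuous: "continuous_on A (\<lambda>x :: nat \<Rightarrow> real. x n)"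
  by (rule continuous_on_product_then_coordinatewise[OF continuous_on_id])

lemma \<phi>_continuous: "continuous_on A \<phi>"
  unfolding continuous_on_iff
proof (intro ballI allI impI)
  fix t and e :: real assume "e > 0"
  have "dist (\<phi> s) (\<phi> t) < e" if "dist s t < e / 2" for s
    using \<phi>_dist[of s t] that by (simp add: dist_real_def)
  then show "\<exists>d>0. \<forall>s\<in>A. dist s t < d \<longrightarrow> dist (\<phi> s) (\<phi> t) < e" using \<open>e > 0\<close> by (intro exI[of _ "e/2"]) auto
qed

text \<open>The coordinates of \<open>\<phi> (x m * P m)\<close> up to level \<open>m\<close> agree
  with those of \<open>x\<close>; so the half-line is dense.\<close>

lemma knaster_limit:
  assumes "x \<in> K" shows "(\<lambda>m. \<phi> (x m * P m)) \<longlonglongrightarrow> x"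
proof -
  have "(\<lambda>m. \<phi> (x m * P m) n) \<longlonglongrightarrow> x n" for n
    by (rule tendsto_eventually) (use \<phi>_approx[OF assms] in \<open>auto simp: eventually_sequentially\<close>)
  then have "limitin (product_topology (\<lambda>_. euclidean) UNIV) (\<lambda>m. \<phi> (x m * P m)) x sequentially"
    by (simp add: limitin_componentwise)
  then show ?thesis by (simp add: euclidean_product_topology)
qed

lemma knaster_closed: "closed K"
proof -
  have "K = (\<Inter>n. {x. 0 \<le> x n} \<inter> {x. x n \<le> 1} \<inter> {x. zig (real (p (Suc n)) * x (Suc n)) = x n})"
    by (auto simp: knaster_iff)
  moreover have "closed ({x. 0 \<le> x n} \<inter> {x. x n \<le> 1} \<inter> {x :: nat \<Rightarrow> real. zig (real (p (Suc n)) * x (Suc n)) = x n})" for n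
    by (intro closed_Int closed_Collect_le closed_Collect_eq continuous_intros coord_continuous)
  ultimately show ?thesis by (metis (no_types, lifting) closed_INT)
qed

lemma knaster_compact: "compact K"
proof -
  have "compactin (product_topology (\<lambda>_. euclidean) UNIV) (PiE UNIV (\<lambda>_::nat. {0..1::real}))"
    by (simp add: compactin_PiE)
  then have "compact (PiE UNIV (\<lambda>_::nat. {0..1::real}))"
    by (simp add: euclidean_product_topology)
  moreover have "K \<subseteq> PiE UNIV (\<lambda>_::nat. {0..1::real})" by (auto simp: knaster_def)
  ultimately show ?thesis using knaster_closed compact_Int_closed by (metis inf.absorb_iff2)
qed

lemma agree_on_dense:
  fixes f g :: "(nat \<Rightarrow> real) \<Rightarrow> 'a :: t2_space"
  assumes "continuous_on K f" "continuous_on K g" "\<And>t. f (\<phi> t) = g (\<phi> t)" "x \<in> K"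
  shows "f x = g x"
proof -
  have "(\<lambda>m. f (\<phi> (x m * P m))) \<longlonglongrightarrow> f x"
    by (rule continuous_on_tendsto_compose[OF assms(1) knaster_limit[OF assms(4)]]) (use assms \<phi>_in in auto)
  moreover have "(\<lambda>m. g (\<phi> (x m * P m))) \<longlonglongrightarrow> g x"
    by (rule continuous_on_tendsto_compose[OF assms(2) knaster_limit[OF assms(4)]]) (use assms \<phi>_in in auto)
  ultimately show ?thesis using assms(3) LIMSEQ_unique by auto
qed

lemma bound_on_dense:
  fixes f g :: "(nat \<Rightarrow> real) \<Rightarrow> 'a :: metric_space"
  assumes "continuous_on K f" "continuous_on K g" "\<And>t. dist (f (\<phi> t)) (g (\<phi> t)) \<le> d" "x \<in> K"
  shows "dist (f x) (g x) \<le> d"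
proof -
  have "(\<lambda>m. f (\<phi> (x m * P m))) \<longlonglongrightarrow> f x"
    by (rule continuous_on_tendsto_compose[OF assms(1) knaster_limit[OF assms(4)]]) (use assms \<phi>_in in auto)
  moreover have "(\<lambda>m. g (\<phi> (x m * P m))) \<longlonglongrightarrow> g x"
    by (rule continuous_on_tendsto_compose[OF assms(2) knaster_limit[OF assms(4)]]) (use assms \<phi>_in in auto)
  ultimately have "(\<lambda>m. dist (f (\<phi> (x m * P m))) (g (\<phi> (x m * P m)))) \<longlonglongrightarrow> dist (f x) (g x)" by (rule tendsto_dist)
  then show ?thesis using assms(3) by (intro LIMSEQ_le_const2) auto
qed

text \<open>The coordinate \<open>w 0\<close> of a path is uniformly continuous and equals \<open>zig (P m * w m)\<close>; this bounds
  \<open>P m * w m\<close> independently of \<open>m\<close>, so that from some level on the path stays away from \<open>1\<close> and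
  is determined by that level.\<close>
lemma path_lift:
  fixes w :: "real \<Rightarrow> nat \<Rightarrow> real"
  assumes w: "continuous_on {0..c} w" "\<And>t. t \<in> {0..c} \<Longrightarrow> w t \<in> K" "w 0 = \<phi> 0" and c: "0 \<le> c"
  obtains r where "continuous_on {0..c} r" "r 0 = 0" "\<And>t. t \<in> {0..c} \<Longrightarrow> 0 \<le> r t \<and> w t = \<phi> (r t)"
proof -
  have wc: "continuous_on {0..c} (\<lambda>t. w t n)" for n
    by (rule continuous_on_compose2[OF coord_continuous[of UNIV n] w(1)]) auto
  have w01: "0 \<le> w t n" "w t n \<le> 1" if "t \<in> {0..c}" for t n using knaster_01 w(2) that by auto
  have w0: "w 0 n = 0" for n using w(3) by (simp add: \<phi>_def)
  have "uniformly_continuous_on {0..c} (\<lambda>t. w t 0)" using wc by (simp add: compact_uniformly_continuous)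
  then obtain e where e: "e > 0" "\<And>s t. s \<in> {0..c} \<Longrightarrow> t \<in> {0..c} \<Longrightarrow> dist t s < e \<Longrightarrow> dist (w t 0) (w s 0) < 1"
    unfolding uniformly_continuous_on_def by (metis zero_less_one)
  \<comment> \<open>Growth by 2 would pass two consecutive integers. There the coordinate at level
    0, which is \<open>zig\<close> of \<open>P m * w t m\<close>, takes the values 0 and 1, within a
    time shorter than \<open>e\<close>.\<close>
  have var: "P m * w t m < P m * w s m + 2" if st: "0 \<le> s" "s \<le> t" "t \<le> c" "t - s < e" for s t m
  proof (rule ccontr)
    define v where "v = (\<lambda>t. P m * w t m)"
    assume "\<not> P m * w t m < P m * w s m + 2"
    then have big: "v s + 2 \<le> v t" by (simp add: v_def)
    have vc: "continuous_on {s..t} v" unfolding v_def using st by (intro continuous_intros continuous_on_subset[OF wc]) auto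
    define k where "k = \<lceil>v s\<rceil>"
    have k: "v s \<le> of_int k" "of_int (k + 1) \<le> v t" "of_int k \<le> v t" "v s \<le> of_int (k + 1)" using big unfolding k_def by linarith+
    have att: "\<exists>u. s \<le> u \<and> u \<le> t \<and> v u = y" if "v s \<le> y" "y \<le> v t" for y
      using IVT'[of v s y t] that st(2) vc by blast
    obtain u1 where u1: "s \<le> u1" "u1 \<le> t" "v u1 = of_int k" using att k by blast
    obtain u2 where u2: "s \<le> u2" "u2 \<le> t" "v u2 = of_int (k + 1)" using att k by blast
    have z: "w u 0 = zig (v u)" if "s \<le> u" "u \<le> t" for u
      using knaster_lower[OF w(2), of u 0 m] that st by (simp add: P_0 v_def)
    have "\<bar>w u1 0 - w u2 0\<bar> = 1" unfolding z[OF u1(1,2)] z[OF u2(1,2)] u1(3) u2(3) zig_of_int by auto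
    moreover have "dist (w u1 0) (w u2 0) < 1" using u1 u2 st by (intro e(2)) (auto simp: dist_real_def)
    ultimately show False by (simp add: dist_real_def)
  qed
  have bnd: "P m * w t m \<le> 2 * real n" if "0 \<le> t" "t \<le> c" "t \<le> real n * (e/2)" for t n m
    using that
  proof (induction n arbitrary: t)
    case 0
    then show ?case using w0 by simp
  next
    case (Suc n)
    define s where "s = max 0 (t - e/2)"
    have s: "0 \<le> s" "s \<le> t" "t - s < e" "s \<le> real n * (e/2)" 
    proof -
      have "real (Suc n) * (e/2) = real n * (e/2) + e/2" "0 \<le> real n * (e/2)" using e(1) by (auto simp: field_simps)
      then have "t - e/2 \<le> real n * (e/2)" using Suc.prems by linarith
      then show "s \<le> real n * (e/2)" using \<open>0 \<le> real n * (e/2)\<close> unfolding s_def by (rule max.boundedI[rotated])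
      show "0 \<le> s" "s \<le> t" "t - s < e" using Suc.prems e(1) unfolding s_def by auto
    qed
    then have "P m * w s m \<le> 2 * real n" using Suc by auto
    then show ?case using var[OF s(1,2) Suc.prems(2) s(3), of m] by simp
  qed
  obtain n :: nat where "c / (e/2) < real n" using reals_Archimedean2 by blast
  then have n: "c \<le> real n * (e/2)" using e(1) by (simp add: field_simps)
  \<comment> \<open>At this level the bound on the path keeps the coordinate below 1.\<close>
  obtain M where M: "2 * real n < P M" using P_unbounded by blast
  have M1: "w t M < 1" if "t \<in> {0..c}" for t
  proof -
    have "P M * w t M \<le> 2 * real n" using bnd[of t n M] n that by auto
    then have "P M * w t M < P M * 1" using M by linarith
    then show ?thesis using P_pos[of M] by (simp only: mult_less_cancel_left_pos)
  qed
  have up: "\<forall>t\<in>{0..c}. w t m = P M * w t M / P m \<and> w t m < 1" if "M \<le> m" for m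
    using that
  proof (induction m rule: dec_induct)
    case base
    then show ?case using M1 P_pos[of M] by simp
  next
    case (step m)
    define q where "q = real (p (Suc m))"
    have q: "q \<ge> 2" using p_ge_2[of "Suc m"] by (simp add: q_def)
    have zq: "zig (q * w t (Suc m)) = w t m" if "t \<in> {0..c}" for t using w(2)[OF that] by (simp add: knaster_iff q_def)
    \<comment> \<open>If the lifted coordinate reached 1 at the next level, the coordinate at level
      \<open>m\<close> would equal 1 at that moment.\<close>
    have lt: "q * w t (Suc m) < 1" if t: "t \<in> {0..c}" for t
    proof (rule ccontr)
      assume "\<not> q * w t (Suc m) < 1"
      moreover have "continuous_on {0..t} (\<lambda>t. q * w t (Suc m))" using t
        by (intro continuous_intros continuous_on_subset[OF wc]) auto
      ultimately obtain u where u: "0 \<le> u" "u \<le> t" "q * w u (Suc m) = 1"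
        using IVT'[of "\<lambda>t. q * w t (Suc m)" 0 1 t] w0 t by auto
      then have "w u m = 1" using zq[of u] t by auto
      moreover have "w u m < 1" using step.IH u(1,2) t by (meson atLeastAtMost_iff order_trans)
      ultimately show False by simp
    qed
    show ?case
    proof
      fix t assume t: "t \<in> {0..c}"
      have "0 \<le> q * w t (Suc m)" using w01[OF t] q by simp
      then have "q * w t (Suc m) = w t m" using zq[OF t] lt[OF t] by (simp add: zig_ident)
      moreover have "w t m = P M * w t M / P m" using step.IH t by blast
      ultimately have "w t (Suc m) = P M * w t M / P (Suc m)" using q P_pos[of m]
        by (simp add: P_Suc q_def[symmetric] field_simps)
      moreover have "1 * w t (Suc m) \<le> q * w t (Suc m)" using q w01[OF t] by (intro mult_right_mono) auto
      ultimately show "w t (Suc m) = P M * w t M / P (Suc m) \<and> w t (Suc m) < 1" using lt[OF t] by simp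
    qed
  qed
  show ?thesis
  proof (rule that[of "\<lambda>t. P M * w t M"])
    show "continuous_on {0..c} (\<lambda>t. P M * w t M)" by (intro continuous_intros wc)
    show "P M * w 0 M = 0" using w0 by simp
    fix t assume t: "t \<in> {0..c}"
    have "w t n = zig (P M * w t M / P n)" for n
    proof (cases "n \<le> M")
      case True
      then show ?thesis using knaster_lower[OF w(2)[OF t] True] by simp
    next
      case False
      then have "w t n = P M * w t M / P n" using up[of n] t by simp
      then show ?thesis using w01[OF t, of n] by (simp add: zig_ident)
    qed
    then have "w t = \<phi> (P M * w t M)" unfolding \<phi>_def by (rule ext)
    moreover have "0 \<le> P M * w t M" using w01[OF t, of M] P_pos[of M] by simp
    ultimately show "0 \<le> P M * w t M \<and> w t = \<phi> (P M * w t M)" by blast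
  qed
qed

lemma two_in_sequence: "\<exists>n\<ge>m. p (Suc n) = 2"
proof -
  have "infinite {n. n \<ge> 1 \<and> p n = 2}" using prime_seq two_is_prime_nat unfolding universal_prime_sequence_def by blast
  then obtain n where "n > m" "n \<ge> 1" "p n = 2" unfolding infinite_nat_iff_unbounded by blast
  then show ?thesis by (intro exI[of _ "n - 1"]) auto
qed

text \<open>Moving all coordinates with speeds \<open>1 / P n\<close> gives a path on both sides of
  \<open>y\<close>. It is injective near 0 because some coordinate of \<open>y\<close> lies strictly
  between 0 and 1. Otherwise all of them are 0 or 1, and each is 0 since a bonding map of degree 2
  occurs above it; then \<open>y\<close> is the end point.\<close>

lemma arc_through:
  assumes y: "y \<in> K" "y \<noteq> \<phi> 0"
  shows "\<exists>(a :: real \<Rightarrow> nat \<Rightarrow> real) d. d > 0 \<and> continuous_on UNIV a \<and> a 0 = y \<and> (\<forall>s. a s \<in> K) \<and> inj_on a {-d..d}"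
proof -
  \<comment> \<open>Real preimages of the coordinates under \<open>zig\<close>, compatible modulo 2
    with the bonding maps; the sign that \<open>zig\<close> leaves open is chosen level by
    level.\<close>
  have "\<exists>\<theta>. \<forall>n. zig (\<theta> n) = y n \<and> (\<exists>k::int. real (p (Suc n)) * \<theta> (Suc n) = \<theta> n + 2 * of_int k)"
  proof (rule dependent_nat_choice)
    show "\<exists>\<theta>. zig \<theta> = y 0" using knaster_01[OF y(1), of 0] zig_ident by blast
    fix \<theta> n assume th: "zig \<theta> = y n"
    have yS: "zig (y (Suc n)) = y (Suc n)" using knaster_01[OF y(1)] by (simp add: zig_ident)
    have "zig (real (p (Suc n)) * y (Suc n)) = zig \<theta>" using y(1) th by (simp add: knaster_iff)
    then show "\<exists>\<theta>'. zig \<theta>' = y (Suc n) \<and> (\<exists>k::int. real (p (Suc n)) * \<theta>' = \<theta> + 2 * of_int k)"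
    proof (cases rule: zig_eq_cases)
      case (1 k)
      then show ?thesis using yS by blast
    next
      case (2 k)
      then have "real (p (Suc n)) * - y (Suc n) = \<theta> + 2 * of_int (- k)" by simp
      then show ?thesis using yS zig_minus by metis
    qed
  qed
  then obtain \<theta> where \<theta>: "\<And>n. zig (\<theta> n) = y n" "\<And>n. \<exists>k::int. real (p (Suc n)) * \<theta> (Suc n) = \<theta> n + 2 * of_int k" by blast
  define a where "a = (\<lambda>s n. zig (\<theta> n + s / P n))"
  have aK: "a s \<in> K" for s
  proof -
    have "zig (real (p (Suc n)) * a s (Suc n)) = a s n" for n
    proof -
      obtain k :: int where k: "real (p (Suc n)) * \<theta> (Suc n) = \<theta> n + 2 * of_int k" using \<theta>(2) by blast
      have "real (p (Suc n)) * (\<theta> (Suc n) + s / P (Suc n)) = (\<theta> n + s / P n) + 2 * of_int k"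
        using k p_ge_2[of "Suc n"] by (simp add: P_Suc algebra_simps)
      then show ?thesis unfolding a_def zig_mult by (simp only: zig_shift)
    qed
    then show ?thesis by (simp add: knaster_iff a_def)
  qed
  have "\<exists>m. y m \<noteq> 0 \<and> y m \<noteq> 1"
  proof (rule ccontr)
    assume "\<nexists>m. y m \<noteq> 0 \<and> y m \<noteq> 1"
    then have y01: "y m = 0 \<or> y m = 1" for m by blast
    have "y m = 0" for m
    proof -
      obtain n where n: "n \<ge> m" "p (Suc n) = 2" using two_in_sequence by blast
      have "zig (real (p (Suc n)) * y (Suc n)) = y n" using y(1) unfolding knaster_iff by blast
      then have "zig (2 * y (Suc n)) = y n" by (simp add: n(2))
      moreover have "zig (2 * y (Suc n)) = 0" using y01[of "Suc n"] zig_of_nat[of 2] by auto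
      ultimately show ?thesis using knaster_lower[OF y(1) n(1)] by simp
    qed
    then show False using y(2) by (auto simp: \<phi>_def)
  qed
  then obtain m where m: "0 < y m" "y m < 1" using knaster_01[OF y(1)] by (metis order_le_less)
  define u where "u = min (y m) (1 - y m)"
  have u: "u > 0" "u \<le> y m" "u \<le> 1 - y m" using m by (auto simp: u_def)
  define d where "d = P m * u"
  have d: "d > 0" using u P_pos[of m] by (simp add: d_def)
  have sc: "\<bar>s / P m\<bar> \<le> u" if "s \<in> {-d..d}" for s
    using that P_pos[of m] by (auto simp: d_def field_simps)
  have am: "(\<forall>s\<in>{-d..d}. a s m = y m + s / P m) \<or> (\<forall>s\<in>{-d..d}. a s m = y m - s / P m)"
  proof (cases rule: zig_decomp[of "\<theta> m"])
    case (1 k)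
    have "a s m = y m + s / P m" if "s \<in> {-d..d}" for s
    proof -
      have "\<theta> m + s / P m = (y m + s / P m) + 2 * of_int k" using 1 \<theta>(1) by simp
      then have "a s m = zig (y m + s / P m)" unfolding a_def by (simp only: zig_shift)
      also have "\<dots> = y m + s / P m" by (intro zig_ident) (use sc[OF that] u in linarith)+
      finally show ?thesis .
    qed
    then show ?thesis by blast
  next
    case (2 k)
    have "a s m = y m - s / P m" if "s \<in> {-d..d}" for s
    proof -
      have "\<theta> m + s / P m = 2 * of_int k - (y m - s / P m)" using 2 \<theta>(1) by simp
      then have "a s m = zig (y m - s / P m)" unfolding a_def by (simp only: zig_reflect)
      also have "\<dots> = y m - s / P m" by (intro zig_ident) (use sc[OF that] u in linarith)+
      finally show ?thesis .
    qed
    then show ?thesis by blast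
  qed
  have "inj_on a {-d..d}"
  proof (rule inj_onI)
    fix s t assume st: "s \<in> {-d..d}" "t \<in> {-d..d}" "a s = a t"
    from am have "s / P m = t / P m"
    proof
      assume A: "\<forall>s\<in>{-d..d}. a s m = y m + s / P m"
      show ?thesis using A[rule_format, OF st(1)] A[rule_format, OF st(2)] st(3) by auto
    next
      assume A: "\<forall>s\<in>{-d..d}. a s m = y m - s / P m"
      show ?thesis using A[rule_format, OF st(1)] A[rule_format, OF st(2)] st(3) by auto
    qed
    then show "s = t" using P_pos[of m] by simp
  qed
  moreover have "continuous_on UNIV a" unfolding a_def
    by (intro continuous_on_coordinatewise_then_product continuous_intros) (use P_pos in \<open>metis less_irrefl\<close>)
  moreover have "a 0 = y" using \<theta>(1) by (auto simp: a_def)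
  ultimately show ?thesis using aK d by blast
qed


text \<open>The two halves of a two-sided arc through \<open>f (\<phi> 0)\<close> would be mapped back by \<open>g\<close> to two arcs
  that leave the end point along the same half-line.\<close>
lemma homeo_fixes_end:
  assumes f: "\<And>x. x \<in> K \<Longrightarrow> f x \<in> K" and g: "continuous_on K g" "\<And>x. x \<in> K \<Longrightarrow> g x \<in> K"
    and gf: "\<And>x. x \<in> K \<Longrightarrow> g (f x) = x" and fg: "\<And>x. x \<in> K \<Longrightarrow> f (g x) = x"
  shows "f (\<phi> 0) = \<phi> 0"
proof (rule ccontr)
  assume ne: "f (\<phi> 0) \<noteq> \<phi> 0"
  obtain a :: "real \<Rightarrow> nat \<Rightarrow> real" and d where a: "d > 0" "continuous_on UNIV a" "a 0 = f (\<phi> 0)" "\<forall>s. a s \<in> K" "inj_on a {-d..d}"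
    using arc_through[OF f[OF \<phi>_in] ne] by blast
  have lift: "\<exists>r. continuous_on {0..d} r \<and> r 0 = 0 \<and> (\<forall>t\<in>{0..d}. 0 \<le> r t \<and> g (a (c * t)) = \<phi> (r t))" for c :: real
  proof -
    have gc: "continuous_on {0..d} (\<lambda>t. g (a (c * t)))"
      by (rule continuous_on_compose2[OF g(1)], rule continuous_on_compose2[OF a(2)]) (use a(4) in \<open>auto\<close>)
    moreover have "g (a (c * 0)) = \<phi> 0" using a(3) gf[OF \<phi>_in] by simp
    ultimately obtain r where "continuous_on {0..d} r" "r 0 = 0" "\<And>t. t \<in> {0..d} \<Longrightarrow> 0 \<le> r t \<and> g (a (c * t)) = \<phi> (r t)"
      using path_lift[OF gc g(2)[OF a(4)[rule_format]] _ less_imp_le[OF a(1)]] by blast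
    then show ?thesis by blast
  qed
  obtain r1 where r1: "continuous_on {0..d} r1" "r1 0 = 0" "\<forall>t\<in>{0..d}. 0 \<le> r1 t \<and> g (a (1 * t)) = \<phi> (r1 t)" using lift[of 1]
    by blast
  obtain r2 where r2: "continuous_on {0..d} r2" "r2 0 = 0" "\<forall>t\<in>{0..d}. 0 \<le> r2 t \<and> g (a (- 1 * t)) = \<phi> (r2 t)" using lift[of "-1"]
    by blast
  have ga: "s = t" if "s \<in> {-d..d}" "t \<in> {-d..d}" "g (a s) = g (a t)" for s t
    using that fg a(4,5) by (metis inj_onD)
  have pos: "r1 d > 0" "r2 d > 0"
  proof -
    have "r1 d \<noteq> 0"
    proof
      assume "r1 d = 0"
      then have "g (a d) = g (a 0)" using r1 a(1) by (metis atLeastAtMost_iff less_imp_le mult_1 order_refl)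
      then show False using ga[of d 0] a(1) by auto
    qed
    moreover have "r2 d \<noteq> 0"
    proof
      assume "r2 d = 0"
      then have "g (a (- 1 * d)) = g (a (- 1 * 0))" using r2 a(1) by (metis atLeastAtMost_iff less_imp_le order_refl)
      then show False using ga[of "-d" 0] a(1) by auto
    qed
    moreover have "0 \<le> r1 d" "0 \<le> r2 d" using r1 r2 a(1) by auto
    ultimately show "r1 d > 0" "r2 d > 0" by auto
  qed
  define v where "v = min (r1 d) (r2 d)"
  obtain s1 where s1: "0 \<le> s1" "s1 \<le> d" "r1 s1 = v" using IVT'[of r1 0 v d] r1 pos a(1) by (auto simp: v_def)
  obtain s2 where s2: "0 \<le> s2" "s2 \<le> d" "r2 s2 = v" using IVT'[of r2 0 v d] r2 pos a(1) by (auto simp: v_def)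
  have "g (a s1) = g (a (- s2))" using r1(3)[rule_format, of s1] r2(3)[rule_format, of s2] s1 s2 by simp
  then have "s1 = - s2" using ga[of s1 "- s2"] s1 s2 by auto
  then have "s1 = 0" using s1 s2 by simp
  then show False using s1 r1 pos by (simp add: v_def)
qed

text \<open>The lifts over the intervals \<open>{0..c}\<close> fit together because
  \<open>\<phi>\<close> is injective on the half-line. The result is continuous, injective and
  nonnegative with value 0 at 0, hence increasing.\<close>

lemma homeo_lift:
  assumes f: "continuous_on K f" "\<And>x. x \<in> K \<Longrightarrow> f x \<in> K" and g: "continuous_on K g" "\<And>x. x \<in> K \<Longrightarrow> g x \<in> K"
    and gf: "\<And>x. x \<in> K \<Longrightarrow> g (f x) = x" and fg: "\<And>x. x \<in> K \<Longrightarrow> f (g x) = x"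
  obtains F where "continuous_on {0..} F" "strict_mono_on {0..} F" "F 0 = 0" "\<And>t. 0 \<le> t \<Longrightarrow> 0 \<le> F t \<and> f (\<phi> t) = \<phi> (F t)"
proof -
  have f0: "f (\<phi> 0) = \<phi> 0" by (rule homeo_fixes_end[OF f(2) g gf fg])
  define F where "F = (\<lambda>t. SOME r. 0 \<le> r \<and> f (\<phi> t) = \<phi> r)"
  have lift: "\<exists>r. continuous_on {0..c} r \<and> (\<forall>t\<in>{0..c}. 0 \<le> r t \<and> f (\<phi> t) = \<phi> (r t))" if c0: "0 \<le> c" for c
  proof -
    have fc: "continuous_on {0..c} (\<lambda>t. f (\<phi> t))"
      by (rule continuous_on_compose2[OF f(1) \<phi>_continuous]) (use \<phi>_in in auto)
    obtain r where "continuous_on {0..c} r" "r 0 = 0" "\<And>t. t \<in> {0..c} \<Longrightarrow> 0 \<le> r t \<and> f (\<phi> t) = \<phi> (r t)"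
      using path_lift[OF fc f(2)[OF \<phi>_in] f0 c0] by blast
    then show ?thesis by blast
  qed
  have F: "0 \<le> F t \<and> f (\<phi> t) = \<phi> (F t)" if "0 \<le> t" for t
  proof -
    have "\<exists>r. 0 \<le> r \<and> f (\<phi> t) = \<phi> r" using lift[OF that] that by auto
    then show ?thesis unfolding F_def by (rule someI_ex)
  qed
  have Fr: "F t = r t" if "t \<in> {0..c}" "\<forall>t\<in>{0..c}. 0 \<le> r t \<and> f (\<phi> t) = \<phi> (r t)" for r t c
    using F[of t] that \<phi>_inj by auto
  have Fc: "continuous_on {0..c} F" if c0: "0 \<le> c" for c
  proof -
    obtain r where "continuous_on {0..c} r" "\<forall>t\<in>{0..c}. 0 \<le> r t \<and> f (\<phi> t) = \<phi> (r t)" using lift[OF c0] by blast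
    then show ?thesis using Fr continuous_on_eq by (metis (no_types, lifting))
  qed
  have F0: "F 0 = 0" using F[of 0] f0 \<phi>_inj[of "F 0" 0] by simp
  have Finj: "s = t" if "0 \<le> s" "0 \<le> t" "F s = F t" for s t
  proof -
    have "f (\<phi> s) = f (\<phi> t)" using F that by metis
    then have "\<phi> s = \<phi> t" using gf \<phi>_in by metis
    then show ?thesis using \<phi>_inj that by blast
  qed
  have "strict_mono_on {0..} F"
  proof (rule strict_mono_onI)
    fix s t :: real assume st: "s \<in> {0..}" "t \<in> {0..}" "s < t"
    show "F s < F t"
    proof (rule ccontr)
      assume "\<not> F s < F t"
      moreover have "F s \<noteq> F t" using Finj[of s t] st by auto
      ultimately have lt: "F t < F s" by simp
      have "0 \<le> F t" using F st by auto
      then have "\<exists>u\<ge>0. u \<le> s \<and> F u = F t" using lt st F0 Fc[of s] by (intro IVT') auto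
      then obtain u where "0 \<le> u" "u \<le> s" "F u = F t" by blast
      then show False using Finj[of u t] st by auto
    qed
  qed
  moreover have "continuous_on {0..} F"
    unfolding continuous_on_eq_continuous_within
  proof
    fix t :: real assume t: "t \<in> {0..}"
    have "continuous (at t within {0..t+1}) F" using Fc[of "t+1"] t by (simp add: continuous_on_eq_continuous_within)
    moreover have "at t within {0..} = at t within {0..t+1}"
      by (rule at_within_nhd[of t "{..<t+1}"]) auto
    ultimately show "continuous (at t within {0..}) F" by (simp add: continuous_within)
  qed
  ultimately show ?thesis using that F F0 by blast
qed

subsection \<open>Degree-one homeomorphisms and their lifts\<close>

text \<open>Seen from the half-line, \<open>g\<close> at level \<open>n\<close> is
  \<open>zig\<close> of an increasing map that takes the period \<open>2 * P n\<close> to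
  \<open>2 * k\<close>. The quotient of degrees thus becomes the mean slope of this map.\<close>

lemma open_map_lift:
  assumes "open_interval_map g"
  shows "\<exists>k \<Gamma> c. k \<ge> 1 \<and> (c = 0 \<or> c = (1::real)) \<and> per_homeo (P n) (real k) \<Gamma> \<and> (\<forall>t. g (\<phi> t n) = zig (\<Gamma> t + c)) \<and>
    interval_degree g = k"
proof -
  obtain k q c where k: "k \<ge> 1" and c: "c = 0 \<or> c = (1::real)" and q: "ihomeo q 0 1 0 (real k)" and g:
    "\<And>x. 0 \<le> x \<Longrightarrow> x \<le> 1 \<Longrightarrow> g x = zig (q x + c)"
    using extremal_structure[OF open_interval_map_extremal[OF assms]] by metis
  have "ihomeo (\<lambda>t. t / P n) 0 (P n) 0 1"
    by (rule ihomeoI) (use P_pos[of n] in \<open>auto intro!: strict_mono_onI divide_strict_right_mono continuous_intros\<close>)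
  then have hq: "ihomeo (\<lambda>t. q (t / P n)) 0 (P n) 0 (real k)" by (rule ihomeo_comp[OF q])
  have k0: "0 < real k" using k by simp
  obtain \<Gamma> where \<Gamma>: "per_homeo (P n) (real k) \<Gamma>" "\<And>t. t \<in> {0..P n} \<Longrightarrow> \<Gamma> t = q (t / P n)"
    using per_homeo_ext[OF P_pos k0 hq] by blast
  have "g (\<phi> t n) = zig (\<Gamma> t + c)" for t
  proof (cases rule: fold_obtain[OF P_pos[of n], of t])
    case (1 j s)
    have s: "0 \<le> s / P n" "s / P n \<le> 1" using 1(1) P_pos[of n] by auto
    have e1: "t / P n = s / P n + 2 * of_int j" using 1(2) P_pos[of n] by (simp add: field_simps)
    have "\<phi> t n = s / P n" unfolding \<phi>_def e1 zig_shift using s by (rule zig_ident)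
    moreover have e2: "\<Gamma> t + c = (q (s / P n) + c) + 2 * of_int (j * int k)" unfolding 1(2) per_homeo_fold[OF \<Gamma>(1)]
      using \<Gamma>(2)[OF 1(1)] by simp
    ultimately show ?thesis unfolding e2 zig_shift using g[OF s] by simp
  next
    case (2 j s)
    have s: "0 \<le> s / P n" "s / P n \<le> 1" using 2(1) P_pos[of n] by auto
    have e1: "t / P n = 2 * of_int j - s / P n" using 2(2) P_pos[of n] by (simp add: field_simps)
    have "\<phi> t n = s / P n" unfolding \<phi>_def e1 zig_reflect using s by (rule zig_ident)
    moreover have "\<Gamma> t = - q (s / P n) + of_int j * (2 * real k)" unfolding 2(2) per_homeo_fold(2)[OF \<Gamma>(1), of s j]
      using \<Gamma>(2)[OF 2(1)] by simp
    then have e2: "\<Gamma> t + c = 2 * of_int (j * int k + (if c = 0 then 0 else 1)) - (q (s / P n) + c)" using c by auto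
    ultimately show ?thesis unfolding e2 zig_reflect using g[OF s] by simp
  qed
  moreover have "interval_degree g = k" by (rule interval_degree_zig[OF q k c g])
  ultimately show ?thesis using k c \<Gamma>(1) by blast
qed

lemma per_homeo_mono:
  assumes "per_homeo A B F" shows "mono_on S F" "continuous_on S F"
  using assms strict_mono_surj_continuous by (auto simp: per_homeo_def mono_on_def strict_mono_less_eq)

text \<open>Below the threshold 1/4 the values under \<open>zig\<close> determine the lifts up to
  \<open>3 * e < 1\<close>. At the common period \<open>2 * P n * P m\<close> both lifts take
  integer values, which therefore coincide, and with them the mean slopes.\<close>

lemma lifts_compare:
  assumes F: "per_homeo (P n) (real k) F" and G: "per_homeo (P m) (real l) G"
    and c: "c = 0 \<or> c = (1::real)" "d = 0 \<or> d = (1::real)" and e: "e < 1/4"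
    and close: "\<And>t. \<bar>zig (F t + c) - zig (G t + d)\<bar> \<le> e"
  shows "c = d" "close (3 * e) F G" "real k / P n = real l / P m"
proof -
  have F0: "F 0 = 0" "G 0 = 0" using per_homeo_ends(1) F G by auto
  show cd: "c = d" using close[of 0] F0 c e by auto
  have half: "\<bar>F t - G t\<bar> \<le> 3 * e" if "0 \<le> t" for t
  proof -
    have "\<bar>(F t + c) - (G t + c)\<bar> \<le> 3 * e"
    proof (rule monotone_zig_close[where a = 0 and b = t and F = "\<lambda>t. F t + c" and G = "\<lambda>t. G t + c"])
      show "mono_on {0..t} (\<lambda>t. F t + c)" "mono_on {0..t} (\<lambda>t. G t + c)"
        using per_homeo_mono(1)[OF F, of "{0..t}"] per_homeo_mono(1)[OF G, of "{0..t}"] by (auto simp: mono_on_def)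
    qed (use F0 e close cd that per_homeo_mono(2)[OF F] per_homeo_mono(2)[OF G] in \<open>auto intro!: continuous_intros\<close>)
    then show ?thesis by simp
  qed
  show cl: "close (3 * e) F G"
    unfolding close_def
  proof
    fix t
    have "F (- t) = - F t" "G (- t) = - G t" using F G by (auto simp: per_homeo_def)
    then show "\<bar>F t - G t\<bar> \<le> 3 * e" using half[of t] half[of "- t"] by (cases "t \<ge> 0") auto
  qed
  show "real k / P n = real l / P m"
  proof (rule ccontr)
    define N M where "N = (\<Prod>i=1..n. p i)" and "M = (\<Prod>i=1..m. p i)"
    have NM: "P n = real N" "P m = real M" by (auto simp: P_def N_def M_def)
    assume "real k / P n \<noteq> real l / P m"
    then have "real k * real M \<noteq> real l * real N" using P_pos[of n] P_pos[of m] by (simp add: NM field_simps)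
    then have "k * M \<noteq> l * N" by (metis of_nat_mult)
    then have ne: "\<bar>int (k * M) - int (l * N)\<bar> \<ge> 1" by linarith
    have Ft: "F (of_int (int M) * (2 * P n)) = of_int (int M) * (2 * real k)" using per_homeo_shift[OF F, of 0 "int M"] F0 by simp
    have "G (of_int (int N) * (2 * P m)) = of_int (int N) * (2 * real l)" using per_homeo_shift[OF G, of 0 "int N"] F0 by simp
    moreover have "of_int (int M) * (2 * P n) = of_int (int N) * (2 * P m)" by (simp add: NM)
    ultimately have Gt: "G (of_int (int M) * (2 * P n)) = of_int (int N) * (2 * real l)" by (simp only:)
    define a where "a = real (k * M) - real (l * N)"
    have "of_int (int M) * (2 * real k) - of_int (int N) * (2 * real l) = 2 * a" by (simp add: a_def)
    then have "\<bar>2 * a\<bar> \<le> 3 * e" using closeD[OF cl, of "of_int (int M) * (2 * P n)"] unfolding Ft Gt by (simp only:)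
    then have "\<bar>a\<bar> < 1" using e by linarith
    then have "\<bar>real (k * M) - real (l * N)\<bar> < 1" unfolding a_def .
    moreover have "real (k * M) - real (l * N) = of_int (int (k * M) - int (l * N))" by simp
    ultimately have "\<bar>real_of_int (int (k * M) - int (l * N))\<bar> < 1" by metis
    then show False using ne by linarith
  qed
qed

lemma sup_dist_bound:
  assumes f: "\<And>x. x \<in> K \<Longrightarrow> f x \<in> K" and g: "open_interval_map g" and x: "x \<in> K"
  shows "\<bar>g (x n) - f x 0\<bar> \<le> (SUP x\<in>K. \<bar>g (x n) - f x 0\<bar>)"
proof (rule cSUP_upper[OF x])
  have "\<bar>g (x n) - f x 0\<bar> \<le> 1" if "x \<in> K" for x
  proof -
    have "g (x n) \<in> {0..1}" using g knaster_01[OF that, of n] by (auto simp: open_interval_map_def)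
    then show ?thesis using knaster_01[OF f[OF that], of 0] by auto
  qed
  then show "bdd_above ((\<lambda>x. \<bar>g (x n) - f x 0\<bar>) ` K)" by (intro bdd_aboveI2)
qed

lemma knaster_degree_unique:
  assumes f: "\<And>x. x \<in> K \<Longrightarrow> f x \<in> K" and q: "has_knaster_degree p f q" "has_knaster_degree p f q'"
  shows "q = q'"
proof -
  obtain g where g: "\<And>n. open_interval_map (g n)" "(\<lambda>n. SUP x\<in>K. \<bar>g n (x n) - f x 0\<bar>) \<longlonglongrightarrow> 0"
    "(\<lambda>n. real (interval_degree (g n)) / real (\<Prod>i=1..n. p i)) \<longlonglongrightarrow> q" using q(1) unfolding has_knaster_degree_def by blast
  obtain h where h: "\<And>n. open_interval_map (h n)" "(\<lambda>n. SUP x\<in>K. \<bar>h n (x n) - f x 0\<bar>) \<longlonglongrightarrow> 0"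
    "(\<lambda>n. real (interval_degree (h n)) / real (\<Prod>i=1..n. p i)) \<longlonglongrightarrow> q'" using q(2) unfolding has_knaster_degree_def by blast
  \<comment> \<open>Two approximants within 1/16 of \<open>f\<close> are within 1/8 of each other,
    below the threshold of \<open>lifts_compare\<close>; so the two quotients agree from some level
    on.\<close>
  have "eventually (\<lambda>n. (SUP x\<in>K. \<bar>g n (x n) - f x 0\<bar>) < 1/16) sequentially"
    "eventually (\<lambda>n. (SUP x\<in>K. \<bar>h n (x n) - f x 0\<bar>) < 1/16) sequentially"
    using order_tendstoD(2)[OF g(2), of "1/16"] order_tendstoD(2)[OF h(2), of "1/16"] by auto
  then have "eventually (\<lambda>n. real (interval_degree (g n)) / real (\<Prod>i=1..n. p i) = real (interval_degree (h n)) / real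
    (\<Prod>i=1..n. p i)) sequentially"
  proof eventually_elim
    case (elim n)
    obtain k \<Gamma> c where G: "c = 0 \<or> c = (1::real)" "per_homeo (P n) (real k) \<Gamma>" "\<forall>t. g n (\<phi> t n) = zig (\<Gamma> t + c)"
      "interval_degree (g n) = k"
      using open_map_lift[OF g(1), of n n] by blast
    obtain l \<Delta> d where H: "d = 0 \<or> d = (1::real)" "per_homeo (P n) (real l) \<Delta>" "\<forall>t. h n (\<phi> t n) = zig (\<Delta> t + d)"
      "interval_degree (h n) = l"
      using open_map_lift[OF h(1), of n n] by blast
    have sb: "\<bar>h (x n) - f x 0\<bar> \<le> (SUP x\<in>K. \<bar>h (x n) - f x 0\<bar>)" if "x \<in> K" "open_interval_map h" for h x
      by (rule sup_dist_bound[OF f that(2,1)])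
    have "\<bar>zig (\<Gamma> t + c) - zig (\<Delta> t + d)\<bar> \<le> 1/8" for t
      using sb[OF \<phi>_in[of t] g(1)[of n]] sb[OF \<phi>_in[of t] h(1)[of n]] elim unfolding G(3)[rule_format] H(3)[rule_format]
        by linarith
    then have "real k / P n = real l / P n" by (intro lifts_compare(3)[OF G(2) H(2) G(1) H(1), of "1/8"]) auto
    then show ?case using G(4) H(4) by (simp add: P_def)
  qed
  then have "(\<lambda>n. real (interval_degree (h n)) / real (\<Prod>i=1..n. p i)) \<longlonglongrightarrow> q" using g(3) by (rule Lim_transform_eventually[rotated])
  then show ?thesis using h(3) LIMSEQ_unique by blast
qed

text \<open>The approximants of \<open>f\<close> unfold to maps of mean slope
  \<open>k n / P n\<close>, constant from \<open>N\<close> on by \<open>lifts_compare\<close>. As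
  the limit is 1, they are maps of level \<open>n\<close>, and they converge uniformly to the lift
  of \<open>f\<close>. The inverses are handled by the uniform continuity of
  \<open>rinv F\<close>.\<close>

lemma homeo_lift_lp:
  assumes f: "continuous_on K f" "\<And>x. x \<in> K \<Longrightarrow> f x \<in> K" and g: "continuous_on K g" "\<And>x. x \<in> K \<Longrightarrow> g x \<in> K"
    and gf: "\<And>x. x \<in> K \<Longrightarrow> g (f x) = x" and fg: "\<And>x. x \<in> K \<Longrightarrow> f (g x) = x"
    and deg: "has_knaster_degree p f 1"
  shows "\<exists>F. lp F \<and> (\<forall>t. f (\<phi> t) = \<phi> (F t))"
proof -
  obtain F0 where F0: "continuous_on {0..} F0" "strict_mono_on {0..} F0" "F0 0 = 0" "\<And>t. 0 \<le> t \<Longrightarrow> 0 \<le> F0 t \<and> f (\<phi> t) = \<phi> (F0 t)"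
    using homeo_lift[OF f g gf fg] by blast
  obtain h where h: "\<And>n. open_interval_map (h n)" "(\<lambda>n. SUP x\<in>K. \<bar>h n (x n) - f x 0\<bar>) \<longlonglongrightarrow> 0"
    "(\<lambda>n. real (interval_degree (h n)) / real (\<Prod>i=1..n. p i)) \<longlonglongrightarrow> 1" using deg unfolding has_knaster_degree_def by blast
  define S where "S = (\<lambda>n. SUP x\<in>K. \<bar>h n (x n) - f x 0\<bar>)"
  have Slim: "S \<longlonglongrightarrow> 0" using h(2) by (simp add: S_def)
  have Sb: "\<bar>h n (x n) - f x 0\<bar> \<le> S n" if "x \<in> K" for x n
    unfolding S_def by (rule sup_dist_bound[where f = f, OF f(2) h(1) that])
  have "\<exists>G. \<forall>n. (case G n of (k, \<Gamma>, c) \<Rightarrow> (c = 0 \<or> c = (1::real)) \<and> per_homeo (P n) (real k) \<Gamma> \<and>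
    (\<forall>t. h n (\<phi> t n) = zig (\<Gamma> t + c)) \<and> interval_degree (h n) = k)"
  proof (rule choice, rule allI)
    fix n
    obtain k \<Gamma> c where "c = 0 \<or> c = (1::real)" "per_homeo (P n) (real k) \<Gamma>" "\<forall>t. h n (\<phi> t n) = zig (\<Gamma> t + c)"
      "interval_degree (h n) = k"
      using open_map_lift[OF h(1), of n n] by blast
    then show "\<exists>y. case y of (k, \<Gamma>, c) \<Rightarrow> (c = 0 \<or> c = (1::real)) \<and> per_homeo (P n) (real k) \<Gamma> \<and>
      (\<forall>t. h n (\<phi> t n) = zig (\<Gamma> t + c)) \<and> interval_degree (h n) = k"
      by (intro exI[of _ "(k, \<Gamma>, c)"]) simp
  qed
  then obtain G where G: "\<And>n. (case G n of (k, \<Gamma>, c) \<Rightarrow> (c = 0 \<or> c = (1::real)) \<and> per_homeo (P n) (real k) \<Gamma> \<and>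
    (\<forall>t. h n (\<phi> t n) = zig (\<Gamma> t + c)) \<and> interval_degree (h n) = k)" by blast
  define k \<Gamma> c where "k = (\<lambda>n. fst (G n))" and "\<Gamma> = (\<lambda>n. fst (snd (G n)))" and "c = (\<lambda>n. snd (snd (G n)))"
  have c: "c n = 0 \<or> c n = 1" and ph0: "per_homeo (P n) (real (k n)) (\<Gamma> n)" and hz: "h n (\<phi> t n) = zig (\<Gamma> n t + c n)" and dk:
    "interval_degree (h n) = k n" for n t
    using G[of n] by (auto simp: k_def \<Gamma>_def c_def split: prod.splits)
  obtain N where N: "\<And>n. n \<ge> N \<Longrightarrow> S n < 1/16" using order_tendstoD(2)[OF Slim, of "1/16"] by (auto simp: eventually_sequentially)
  have near: "\<bar>zig (\<Gamma> n t + c n) - f (\<phi> t) 0\<bar> \<le> S n" for n t using Sb[OF \<phi>_in[of t], of n] hz by simp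
  have ratio: "real (k n) / P n = real (k N) / P N" if "n \<ge> N" for n
  proof (rule lifts_compare(3)[OF ph0 ph0 c c, of "1/8"])
    show "\<bar>zig (\<Gamma> n t + c n) - zig (\<Gamma> N t + c N)\<bar> \<le> 1/8" for t
      using near[of n t] near[of N t] N[OF that] N[of N] by linarith
  qed simp
  have "(\<lambda>n. real (k n) / P n) \<longlonglongrightarrow> 1" using h(3) by (simp add: dk P_def)
  moreover have "(\<lambda>n. real (k n) / P n) \<longlonglongrightarrow> real (k N) / P N"
  proof (rule tendsto_eventually)
    show "eventually (\<lambda>n. real (k n) / P n = real (k N) / P N) sequentially"
      unfolding eventually_sequentially using ratio by blast
  qed
  ultimately have kN: "real (k N) / P N = 1" using LIMSEQ_unique by blast
  have kP: "real (k n) = P n" if "n \<ge> N" for n using ratio[OF that] kN by simp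
  have ph: "ph n (\<Gamma> n)" if "n \<ge> N" for n using ph0[of n] kP[OF that] by simp
  have f0: "f (\<phi> 0) = \<phi> 0" using F0(4)[of 0] F0(3) by simp
  have c0: "c n = 0" if "n \<ge> N" for n
  proof -
    have "\<bar>zig (c n) - 0\<bar> \<le> S n" using near[of n 0] f0 per_homeo_ends(1)[OF ph0] by (simp add: \<phi>_0th)
    then show ?thesis using c[of n] N[OF that] by auto
  qed
  \<comment> \<open>As \<open>\<phi>\<close> is even, \<open>f\<close> leaves the sign on the
    negative half-line open; the odd extension fits the oddness of
    \<open>\<Gamma> n\<close>.\<close>
  define F where "F = (\<lambda>t. if t \<ge> 0 then F0 t else - F0 (- t))"
  have F0pos: "0 \<le> F0 t" if "0 \<le> t" for t using F0(4) that by blast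
  have F0less: "F0 s < F0 t" if "0 \<le> s" "s < t" for s t using strict_mono_onD[OF F0(2), of s t] that by simp
  have odd: "F (- t) = - F t" for t using F0(3) by (auto simp: F_def)
  have fF: "f (\<phi> t) = \<phi> (F t)" for t
    using F0(4)[of t] F0(4)[of "- t"] by (cases "t \<ge> 0") (simp_all add: F_def \<phi>_minus)
  have half: "\<bar>F t - \<Gamma> n t\<bar> \<le> 3 * S n" if "0 \<le> t" "n \<ge> N" for t n
  proof -
    have "\<bar>F0 t - \<Gamma> n t\<bar> \<le> 3 * S n"
    proof (rule monotone_zig_close[where a = 0 and b = t and F = F0 and G = "\<Gamma> n"])
      show "mono_on {0..t} F0" using strict_mono_on_imp_mono_on[OF F0(2)] by (auto simp: mono_on_def)
      show "continuous_on {0..t} F0" using F0(1) by (rule continuous_on_subset) auto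
      show "\<bar>zig (F0 x) - zig (\<Gamma> n x)\<bar> \<le> S n" if "x \<in> {0..t}" for x
        using near[of n x] F0(4)[of x] that c0[OF \<open>n \<ge> N\<close>] by (simp add: \<phi>_0th)
      show "S n < 1/4" using N[OF that(2)] by simp
      show "F0 0 = \<Gamma> n 0" using F0(3) per_homeo_ends(1)[OF ph0] by simp
    qed (use that per_homeo_mono[OF ph0] in auto)
    then show ?thesis using that by (simp add: F_def)
  qed
  have cl: "close (3 * S n) F (\<Gamma> n)" if "n \<ge> N" for n
    unfolding close_def
  proof
    fix t
    have "\<Gamma> n (- t) = - \<Gamma> n t" using ph0[of n] by (simp add: per_homeo_def)
    then show "\<bar>F t - \<Gamma> n t\<bar> \<le> 3 * S n" using half[of t n] half[of "- t" n] odd[of t] that by (cases "t \<ge> 0") auto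
  qed
  have sm: "strict_mono F"
  proof (rule strict_monoI)
    fix s t :: real assume "s < t"
    consider "0 \<le> s" | "s < 0" "0 \<le> t" | "t < 0" by linarith
    then show "F s < F t"
    proof cases
      case 1 then show ?thesis using F0less[of s t] \<open>s < t\<close> by (simp add: F_def)
    next
      case 2 then show ?thesis using F0less[of 0 "- s"] F0(3) F0pos[of t] by (simp add: F_def)
    next
      case 3 then show ?thesis using F0less[of "- t" "- s"] \<open>s < t\<close> by (simp add: F_def)
    qed
  qed
  \<comment> \<open>Surjectivity comes from \<open>\<Gamma> N\<close>: where this map equals
    \<open>y + 1\<close>, the lift is above \<open>y\<close>, because the two differ by less than
    3/16.\<close>
  have sjp: "\<exists>x. F x = y" if "0 \<le> y" for y
  proof -
    obtain b where b: "\<Gamma> N b = y + 1" using ph0[of N] by (metis per_homeo_def surjD)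
    have "\<Gamma> N 0 < \<Gamma> N b" using b that per_homeo_ends(1)[OF ph0[of N]] by simp
    then have b0: "0 < b" using ph0[of N] by (simp add: per_homeo_def strict_mono_less)
    then have "y \<le> F0 b" using half[of b N] b N[of N] by (simp add: F_def)
    then have "\<exists>x\<ge>0. x \<le> b \<and> F0 x = y" using F0(3) that b0 continuous_on_subset[OF F0(1), of "{0..b}"] by (intro IVT') auto
    then show ?thesis by (auto simp: F_def)
  qed
  have sj: "surj F"
  proof -
    have "\<exists>x. F x = y" for y
    proof (cases "0 \<le> y")
      case False
      then obtain x where "F x = - y" using sjp[of "- y"] by auto
      then have "F (- x) = y" using odd by simp
      then show ?thesis by blast
    qed (rule sjp)
    then show ?thesis by (metis surjI)
  qed
  have FI: "F (rinv F t) = t" "rinv F (F t) = t" for t using sj sm by (auto simp: surj_f_inv_f strict_mono_imp_inj_on)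
  have gF: "g (\<phi> t) = \<phi> (rinv F t)" for t
  proof -
    have "f (\<phi> (rinv F t)) = \<phi> t" using fF FI by simp
    then show ?thesis using gf[OF \<phi>_in] by metis
  qed
  \<comment> \<open>Uniform continuity of \<open>g\<close> on the compact \<open>K\<close> controls
    only \<open>zig (rinv F t)\<close>. Since \<open>rinv F\<close> maps intervals onto intervals,
    \<open>zig_small_variation\<close> turns this into control of \<open>rinv F t\<close>.\<close>
  have uc: "unif_cont (rinv F)"
    unfolding unif_cont_def
  proof (intro allI impI)
    fix e :: real assume "e > 0"
    define e1 where "e1 = min (e/4) (1/8)"
    have e1: "e1 > 0" "e1 \<le> e/4" "e1 < 1/4" using \<open>e > 0\<close> by (auto simp: e1_def)
    obtain d0 where d0: "d0 > 0" "\<And>x y :: nat \<Rightarrow> real. dist x y < d0 \<Longrightarrow> \<bar>x 0 - y 0\<bar> < e1" using dist_coord[OF e1(1), of 0] by blast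
    have "uniformly_continuous_on K g" using g(1) knaster_compact by (rule compact_uniformly_continuous)
    then obtain d where d: "d > 0" "\<And>x y. x \<in> K \<Longrightarrow> y \<in> K \<Longrightarrow> dist y x < d \<Longrightarrow> dist (g y) (g x) < d0"
      using d0(1) unfolding uniformly_continuous_on_def by metis
    have osc: "\<bar>zig (rinv F s) - zig (rinv F t)\<bar> \<le> e1" if "\<bar>s - t\<bar> \<le> d/4" for s t
    proof -
      have "2 * \<bar>s - t\<bar> < d" using that d(1) by simp
      then have "dist (\<phi> s) (\<phi> t) < d" using \<phi>_dist[of s t] by (rule le_less_trans[rotated])
      then have "dist (g (\<phi> s)) (g (\<phi> t)) < d0" using d(2) \<phi>_in by blast
      then show ?thesis using d0(2)[of "g (\<phi> s)" "g (\<phi> t)"] unfolding gF \<phi>_0th by simp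
    qed
    have mono: "rinv F s \<le> rinv F t" if "s \<le> t" for s t using strict_mono_less_eq[OF sm] FI that by metis
    have main: "\<bar>rinv F s - rinv F t\<bar> \<le> e" if st: "s \<le> t" "\<bar>s - t\<bar> \<le> d/4" for s t
    proof -
      have "rinv F t - rinv F s \<le> 4 * e1"
      proof (rule zig_small_variation[OF e1(3) mono[OF st(1)]])
        fix x assume x: "x \<in> {rinv F s..rinv F t}"
        then have "F (rinv F s) \<le> F x" "F x \<le> F (rinv F t)" using strict_mono_less_eq[OF sm] by auto
        then have "\<bar>F x - s\<bar> \<le> d/4" using st FI by simp
        then show "\<bar>zig x - zig (rinv F s)\<bar> \<le> e1" using osc[of "F x" s] FI by simp
      qed
      then show ?thesis using mono[OF st(1)] e1(2) by simp
    qed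
    have "\<bar>rinv F s - rinv F t\<bar> \<le> e" if "\<bar>s - t\<bar> \<le> d/4" for s t
      using main[of s t] main[of t s] that by (cases "s \<le> t") auto
    then show "\<exists>d>0. \<forall>x y. \<bar>x - y\<bar> \<le> d \<longrightarrow> \<bar>rinv F x - rinv F y\<bar> \<le> e" using d(1) by (intro exI[of _ "d/4"]) auto
  qed
  have "\<exists>n H. ph n H \<and> close e F H \<and> close e (rinv F) (rinv H)" if "e > 0" for e
  proof -
    obtain d where d: "d > 0" "\<And>x y. \<bar>x - y\<bar> \<le> d \<Longrightarrow> \<bar>rinv F x - rinv F y\<bar> \<le> e" using unif_contE[OF uc \<open>e > 0\<close>] by metis
    define r where "r = min e d / 3"
    have r: "r > 0" "3 * r \<le> e" "3 * r \<le> d" using d(1) \<open>e > 0\<close> by (auto simp: r_def)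
    obtain M where M: "\<And>n. n \<ge> M \<Longrightarrow> S n < r" using order_tendstoD(2)[OF Slim r(1)] by (auto simp: eventually_sequentially)
    define n where "n = max N M"
    have n: "n \<ge> N" "S n < r" using M[of n] by (auto simp: n_def)
    have c1: "close e F (\<Gamma> n)" "close d F (\<Gamma> n)" using close_mono[OF cl[OF n(1)]] n(2) r by auto
    have "close e (rinv F) (rinv (\<Gamma> n))"
      unfolding close_def
    proof
      fix y
      have y: "\<Gamma> n (rinv (\<Gamma> n) y) = y" using lpD(4)[OF ph_lp[OF ph[OF n(1)]]] .
      have "\<bar>y - F (rinv (\<Gamma> n) y)\<bar> \<le> d" using closeD[OF c1(2), of "rinv (\<Gamma> n) y"] y by (simp add: abs_minus_commute)
      then show "\<bar>rinv F y - rinv (\<Gamma> n) y\<bar> \<le> e" using d(2) FI by metis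
    qed
    then show ?thesis using ph[OF n(1)] c1(1) by blast
  qed
  then have "lp F" using sm sj unfolding lp_def by blast
  then show ?thesis using fF by blast
qed


section \<open>From lifts back to homeomorphisms of degree one\<close>

lemma approximants:
  assumes F: "lp F"
  obtains G where "\<And>n. ph n (G n)" "\<And>e. e > 0 \<Longrightarrow> \<exists>N. \<forall>n\<ge>N. close e F (G n)"
proof -
  \<comment> \<open>\<open>lp\<close> gives approximants at uncontrolled levels. At each level
    \<open>n\<close> the best accuracy \<open>1 / k\<close> is taken, with \<open>k \<le> n\<close>
    to keep the maximum finite; \<open>k = 0\<close> demands nothing and is met by the
    identity.\<close>
  define B where "B = (\<lambda>n k. k \<le> n \<and> (k = 0 \<or> (\<exists>H. ph n H \<and> close (1 / real k) F H)))"
  define m where "m = (\<lambda>n. GREATEST k. B n k)"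
  have B0: "B n 0" for n by (simp add: B_def)
  have Bm: "B n (m n)" for n unfolding m_def by (rule GreatestI_nat[of "B n" 0 n]) (auto simp: B_def)
  have mmax: "k \<le> m n" if "B n k" for n k unfolding m_def by (rule Greatest_le_nat[of "B n" k n, OF that]) (auto simp: B_def)
  have id: "ph n (\<lambda>x. x)" for n by (auto simp: per_homeo_def strict_mono_def)
  have "\<exists>H. ph n H \<and> (m n = 0 \<or> close (1 / real (m n)) F H)" for n using Bm[of n] id[of n] unfolding B_def by blast
  then obtain G where G: "\<And>n. ph n (G n)" "\<And>n. m n = 0 \<or> close (1 / real (m n)) F (G n)" by metis
  have "\<exists>N. \<forall>n\<ge>N. close e F (G n)" if e0: "e > 0" for e
  proof -
    obtain k where k: "1 / real (Suc k) < e" using nat_approx_posE[OF e0] by metis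
    obtain l H where H: "ph l H" "close (1 / real (Suc k)) F H" using lpE[OF F, of "1 / real (Suc k)"]
      by (metis of_nat_0_less_iff zero_less_Suc zero_less_divide_1_iff)
    have "close e F (G n)" if n: "n \<ge> max l (Suc k)" for n
    proof -
      have "B n (Suc k)" using n H ph_level[of l n H] by (auto simp: B_def)
      then have mk: "Suc k \<le> m n" by (rule mmax)
      then have "close (1 / real (m n)) F (G n)" using G(2)[of n] by auto
      moreover have "1 / real (m n) \<le> 1 / real (Suc k)" using mk by (intro divide_left_mono) auto
      ultimately show ?thesis using k close_mono by (meson less_imp_le order_trans)
    qed
    then show ?thesis by blast
  qed
  then show ?thesis using that G(1) by blast
qed

text \<open>\<open>t\<close> and \<open>\<phi> t n * P n\<close> differ by a translation by a
  multiple of \<open>2 * P n\<close> and possibly a sign. \<open>G\<close> is equivariant under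
  these, and dividing by \<open>P j\<close> leaves even integers, which \<open>zig\<close>
  ignores.\<close>

lemma level_map:
  assumes G: "ph n G" and "j \<le> n"
  shows "zig (G t / P j) = zig (G (\<phi> t n * P n) / P j)"
proof -
  obtain k :: nat where k: "P n = real k * P j" using P_mult[OF \<open>j \<le> n\<close>] by blast
  show ?thesis
  proof (cases rule: fold_obtain[OF P_pos[of n], of t])
    case (1 i s)
    have s: "0 \<le> s / P n" "s / P n \<le> 1" using 1(1) P_pos[of n] by auto
    have e1: "t / P n = s / P n + 2 * of_int i" using 1(2) P_pos[of n] by (simp add: field_simps)
    have "\<phi> t n = s / P n" unfolding \<phi>_def e1 zig_shift using s by (rule zig_ident)
    then have "\<phi> t n * P n = s" using P_pos[of n] by simp
    moreover have "G t / P j = G s / P j + 2 * of_int (i * int k)"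
      unfolding 1(2) per_homeo_fold(1)[OF G, of s i] using P_pos[of j] by (simp add: k field_simps)
    ultimately show ?thesis by (simp only: zig_shift)
  next
    case (2 i s)
    have s: "0 \<le> s / P n" "s / P n \<le> 1" using 2(1) P_pos[of n] by auto
    have e1: "t / P n = 2 * of_int i - s / P n" using 2(2) P_pos[of n] by (simp add: field_simps)
    have "\<phi> t n = s / P n" unfolding \<phi>_def e1 zig_reflect using s by (rule zig_ident)
    then have "\<phi> t n * P n = s" using P_pos[of n] by simp
    moreover have "G t / P j = 2 * of_int (i * int k) - G s / P j"
      unfolding 2(2) per_homeo_fold(2)[OF G, of s i] using P_pos[of j] by (simp add: k field_simps)
    ultimately show ?thesis by (simp only: zig_reflect)
  qed
qed

text \<open>Uniform continuity in the metric of \<open>K\<close>, for which distant points of the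
  half-line can be close. It holds because \<open>F\<close> is a uniform limit of periodic maps,
  whose coordinates factor through \<open>\<phi> t n\<close> by \<open>level_map\<close>.\<close>

lemma lift_coord_unif_cont:
  assumes F: "lp F" and "e > 0"
  obtains d where "d > 0" "\<And>s t. dist (\<phi> s) (\<phi> t) < d \<Longrightarrow> \<bar>zig (F s / P j) - zig (F t / P j)\<bar> < e"
proof -
  obtain n0 G where G0: "ph n0 G" "close (e/4) F G" using lpE[OF F, of "e/4"] \<open>e > 0\<close> by (metis divide_pos_pos zero_less_numeral)
  define n where "n = max n0 j"
  have G: "ph n G" "j \<le> n" using ph_level[OF _ G0(1), of n] by (auto simp: n_def)
  define w where "w = (\<lambda>x. zig (G (x * P n) / P j))"
  have "continuous_on UNIV G" using G(1) strict_mono_surj_continuous by (simp add: per_homeo_def)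
  then have "continuous_on {0..1} (\<lambda>x. G (x * P n))"
    by (rule continuous_on_compose2) (auto intro!: continuous_intros)
  then have "continuous_on {0..1} w" unfolding w_def
    using P_pos[of j] by (intro continuous_on_zig continuous_on_divide continuous_on_const) auto
  then have "uniformly_continuous_on {0..1} w" by (simp add: compact_uniformly_continuous)
  then obtain d1 where d1: "d1 > 0" "\<And>x y. x \<in> {0..1} \<Longrightarrow> y \<in> {0..1} \<Longrightarrow> dist y x < d1 \<Longrightarrow> dist (w y) (w x) < e/4"
    using \<open>e > 0\<close> unfolding uniformly_continuous_on_def by (metis divide_pos_pos zero_less_numeral)
  obtain d where d: "d > 0" "\<And>x y :: nat \<Rightarrow> real. dist x y < d \<Longrightarrow> \<bar>x n - y n\<bar> < d1" using dist_coord[OF d1(1), of n] by blast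
  have "1 \<le> P j" using P_mono[of 0 j] P_0 by simp
  have FG: "\<bar>zig (F t / P j) - zig (G t / P j)\<bar> \<le> e/4" for t
  proof -
    have "\<bar>zig (F t / P j) - zig (G t / P j)\<bar> \<le> \<bar>F t / P j - G t / P j\<bar>" by (rule zig_lipschitz)
    also have "\<dots> = \<bar>F t - G t\<bar> / P j" using P_pos[of j] by (simp add: diff_divide_distrib[symmetric])
    also have "\<dots> \<le> \<bar>F t - G t\<bar> / 1" using \<open>1 \<le> P j\<close> by (intro divide_left_mono) auto
    finally show ?thesis using closeD[OF G0(2), of t] by simp
  qed
  have "\<bar>zig (F s / P j) - zig (F t / P j)\<bar> < e" if "dist (\<phi> s) (\<phi> t) < d" for s t
  proof -
    have "\<bar>\<phi> s n - \<phi> t n\<bar> < d1" using d(2) that by blast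
    then have "dist (w (\<phi> s n)) (w (\<phi> t n)) < e/4" using knaster_01[OF \<phi>_in] by (intro d1(2)) (auto simp: dist_real_def)
    moreover have "w (\<phi> s n) = zig (G s / P j)" "w (\<phi> t n) = zig (G t / P j)" using level_map[OF G, of s] level_map[OF G, of t]
      by (simp_all only: w_def)
    ultimately show ?thesis using FG[of s] FG[of t] unfolding dist_real_def by linarith
  qed
  then show ?thesis using that d(1) by blast
qed

lemma lp_extension:
  assumes F: "lp F"
  shows "\<exists>f. continuous_on K f \<and> (\<forall>x\<in>K. f x \<in> K) \<and> (\<forall>t. f (\<phi> t) = \<phi> (F t))"
proof -
  \<comment> \<open>Both \<open>t\<close> and \<open>- t\<close> are preimages of
    \<open>\<phi> t\<close>; \<open>k\<phi>\<close> below shows that the choice does not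
    matter.\<close>
  define \<psi> where "\<psi> = (\<lambda>x. SOME t. \<phi> t = x)"
  have \<psi>: "\<phi> (\<psi> (\<phi> t)) = \<phi> t" for t unfolding \<psi>_def by (rule someI_ex) blast
  define k where "k = (\<lambda>j x. zig (F (\<psi> x) / P j))"
  have k\<phi>: "k j (\<phi> t) = zig (F t / P j)" for j t
  proof (rule ccontr)
    assume "k j (\<phi> t) \<noteq> zig (F t / P j)"
    then have "\<bar>zig (F (\<psi> (\<phi> t)) / P j) - zig (F t / P j)\<bar> > 0" by (simp add: k_def)
    then show False using lift_coord_unif_cont[OF F, of "\<bar>zig (F (\<psi> (\<phi> t)) / P j) - zig (F t / P j)\<bar>" j] \<psi>[of t]
      by (metis dist_self less_irrefl)
  qed
  have uc: "uniformly_continuous_on (range \<phi>) (k j)" for j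
    unfolding uniformly_continuous_on_def
  proof (intro allI impI)
    fix e :: real assume "e > 0"
    obtain d where d: "d > 0" "\<And>s t. dist (\<phi> s) (\<phi> t) < d \<Longrightarrow> \<bar>zig (F s / P j) - zig (F t / P j)\<bar> < e"
      using lift_coord_unif_cont[OF F \<open>e > 0\<close>, of j] by blast
    have "dist (k j y) (k j x) < e" if xy: "x \<in> range \<phi>" "y \<in> range \<phi>" "dist y x < d" for x y
    proof -
      obtain s t where "y = \<phi> s" "x = \<phi> t" using xy by blast
      then show ?thesis using d(2)[of s t] xy(3) by (simp add: k\<phi> dist_real_def)
    qed
    then show "\<exists>d>0. \<forall>x\<in>range \<phi>. \<forall>y\<in>range \<phi>. dist y x < d \<longrightarrow> dist (k j y) (k j x) < e" using d(1) by blast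
  qed
  have "\<exists>E. \<forall>j. uniformly_continuous_on (closure (range \<phi>)) (E j) \<and> (\<forall>x\<in>range \<phi>. k j x = E j x)"
    by (rule choice, rule allI) (rule uniformly_continuous_on_extension_on_closure[OF uc], blast)
  then obtain E where E: "\<And>j. uniformly_continuous_on (closure (range \<phi>)) (E j)" "\<And>j x. x \<in> range \<phi> \<Longrightarrow> k j x = E j x" by blast
  have sub: "K \<subseteq> closure (range \<phi>)"
  proof
    fix x assume "x \<in> K"
    then show "x \<in> closure (range \<phi>)"
      unfolding closure_sequential using knaster_limit[of x] by (intro exI[of _ "\<lambda>m. \<phi> (x m * P m)"]) auto
  qed
  define f where "f = (\<lambda>x j. E j x)"
  have fc: "continuous_on K f" unfolding f_def
    by (intro continuous_on_coordinatewise_then_product) (use E(1) sub uniformly_continuous_imp_continuous continuous_on_subset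
      in blast)
  have f\<phi>: "f (\<phi> t) = \<phi> (F t)" for t
    unfolding f_def \<phi>_def[of "F t"] using E(2)[of "\<phi> t"] k\<phi> by (intro ext) simp
  have "f x \<in> K" if x: "x \<in> K" for x
  proof -
    have "(\<lambda>m. f (\<phi> (x m * P m))) \<longlonglongrightarrow> f x"
      by (rule continuous_on_tendsto_compose[OF fc knaster_limit[OF x] x]) (use \<phi>_in in auto)
    moreover have "f (\<phi> (x m * P m)) \<in> K" for m unfolding f\<phi> by (rule \<phi>_in)
    ultimately show ?thesis using closed_sequentially[OF knaster_closed, of "\<lambda>m. f (\<phi> (x m * P m))" "f x"] by simp
  qed
  then show ?thesis using fc f\<phi> by blast
qed

text \<open>The approximant of level \<open>n\<close> descends to an open map \<open>g n\<close> of
  degree exactly \<open>P n\<close>, so the quotient is 1 at every level.\<close>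

lemma lift_degree:
  assumes F: "lp F" and f: "continuous_on K f" "\<And>x. x \<in> K \<Longrightarrow> f x \<in> K" "\<And>t. f (\<phi> t) = \<phi> (F t)"
  shows "has_knaster_degree p f 1"
proof -
  obtain G where G: "\<And>n. ph n (G n)" "\<And>e. e > 0 \<Longrightarrow> \<exists>N. \<forall>n\<ge>N. close e F (G n)" using approximants[OF F] by metis
  define q where "q = (\<lambda>n x. G n (x * P n))"
  define N where "N = (\<lambda>n. \<Prod>i=1..n. p i)"
  have NP: "P n = real (N n)" for n by (simp add: P_def N_def)
  have N1: "N n \<ge> 1" for n using P_pos[of n] by (simp add: NP)
  have q: "ihomeo (q n) 0 1 0 (real (N n))" for n
  proof -
    have "ihomeo (\<lambda>x. x * P n) 0 1 0 (P n)"
      by (rule ihomeoI) (use P_pos[of n] in \<open>auto intro!: strict_mono_onI continuous_intros\<close>)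
    then show ?thesis unfolding q_def using ihomeo_comp[OF per_homeo_ihomeo[OF G(1)[of n] less_imp_le[OF P_pos]]]
      by (simp add: NP)
  qed
  define g where "g = (\<lambda>n x. zig (q n x))"
  have o: "open_interval_map (g n)" for n unfolding g_def by (rule open_interval_map_zig[OF q N1])
  have dg: "interval_degree (g n) = N n" for n
    by (rule interval_degree_zig[OF q N1, of 0]) (auto simp: g_def)
  have gc: "continuous_on {0..1} (g n)" for n unfolding g_def by (intro continuous_intros ihomeo_continuous[OF q])
  have fc: "continuous_on K (\<lambda>x. f x 0)"
    by (rule continuous_on_compose2[OF coord_continuous[of UNIV 0] f(1)]) auto
  have gn: "continuous_on K (\<lambda>x. g n (x n))" for n
    by (rule continuous_on_compose2[OF gc coord_continuous]) (use knaster_01 in auto)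
  have bound: "\<bar>g n (x n) - f x 0\<bar> \<le> e" if cl: "close e F (G n)" and x: "x \<in> K" for n x e
  proof -
    have "dist (g n (\<phi> t n)) (f (\<phi> t) 0) \<le> e" for t
    proof -
      have "g n (\<phi> t n) = zig (G n t)" using level_map[OF G(1)[of n], of 0 t] by (simp add: g_def q_def P_0)
      moreover have "f (\<phi> t) 0 = zig (F t)" by (simp add: f(3) \<phi>_0th)
      ultimately show ?thesis using zig_lipschitz[of "G n t" "F t"] closeD[OF cl, of t] by (simp add: dist_real_def)
    qed
    then show ?thesis using bound_on_dense[OF gn fc _ x] by (simp add: dist_real_def)
  qed
  have "(\<lambda>n. SUP x\<in>K. \<bar>g n (x n) - f x 0\<bar>) \<longlonglongrightarrow> 0"
  proof (rule LIMSEQ_I)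
    fix e :: real assume "e > 0"
    then obtain M where M: "\<forall>n\<ge>M. close (e/2) F (G n)" using G(2)[of "e/2"] by auto
    have "norm ((SUP x\<in>K. \<bar>g n (x n) - f x 0\<bar>) - 0) < e" if "n \<ge> M" for n
    proof -
      have "(SUP x\<in>K. \<bar>g n (x n) - f x 0\<bar>) \<le> e/2"
        using \<phi>_in bound[OF M[rule_format, OF that]] by (intro cSUP_least) blast+
      moreover have "\<bar>g n (\<phi> 0 n) - f (\<phi> 0) 0\<bar> \<le> (SUP x\<in>K. \<bar>g n (x n) - f x 0\<bar>)"
        by (rule sup_dist_bound[OF f(2) o \<phi>_in])
      ultimately show ?thesis using \<open>e > 0\<close> by (simp add: abs_less_iff)
    qed
    then show "\<exists>M. \<forall>n\<ge>M. norm ((SUP x\<in>K. \<bar>g n (x n) - f x 0\<bar>) - 0) < e" by blast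
  qed
  moreover have "(\<lambda>n. real (interval_degree (g n)) / real (\<Prod>i=1..n. p i)) \<longlonglongrightarrow> 1"
  proof -
    have NN: "(\<Prod>i=1..n. p i) = N n" for n by (simp add: N_def)
    have "real (N n) / real (N n) = 1" for n using N1[of n] by simp
    then show ?thesis unfolding dg NN by simp
  qed
  ultimately show ?thesis unfolding has_knaster_degree_def using o by blast
qed

lemma degree_eq_1:
  assumes f: "\<And>x. x \<in> K \<Longrightarrow> f x \<in> K"
  shows "knaster_degree p f = 1 \<longleftrightarrow> has_knaster_degree p f 1"
proof
  assume d: "knaster_degree p f = 1"
  \<comment> \<open>The default value 0 differs from 1, so some degree exists.\<close>
  then obtain q where q: "has_knaster_degree p f q" unfolding knaster_degree_def by (metis zero_neq_one)
  then have "(THE q. has_knaster_degree p f q) = q" using knaster_degree_unique[of f, OF f] by blast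
  then have "q = 1" using d q unfolding knaster_degree_def by (metis (mono_tags, lifting))
  then show "has_knaster_degree p f 1" using q by simp
next
  assume q: "has_knaster_degree p f 1"
  then have "(THE q. has_knaster_degree p f q) = 1" using knaster_degree_unique[of f, OF f] by blast
  then show "knaster_degree p f = 1" using q unfolding knaster_degree_def by auto
qed

lemma homeos_inverse:
  assumes "f \<in> knaster_homeos p"
  obtains g where "continuous_on K f" "\<And>x. x \<in> K \<Longrightarrow> f x \<in> K" "continuous_on K g" "\<And>x. x \<in> K \<Longrightarrow> g x \<in> K"
    "\<And>x. x \<in> K \<Longrightarrow> g (f x) = x" "\<And>x. x \<in> K \<Longrightarrow> f (g x) = x"
proof -
  have "homeomorphic_map (top_of_set K) (top_of_set K) f" using assms by (simp add: knaster_homeos_def)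
  then obtain g where "homeomorphic_maps (top_of_set K) (top_of_set K) f g" unfolding homeomorphic_map_maps by blast
  then show ?thesis using that[of g] unfolding homeomorphic_maps_def by auto
qed

lemma homeos1_lift:
  assumes "f \<in> knaster_homeos1 p"
  obtains F where "lp F" "\<And>t. f (\<phi> t) = \<phi> (F t)"
proof -
  have h: "f \<in> knaster_homeos p" "knaster_degree p f = 1" using assms by (auto simp: knaster_homeos1_def)
  obtain g where g: "continuous_on K f" "\<And>x. x \<in> K \<Longrightarrow> f x \<in> K" "continuous_on K g" "\<And>x. x \<in> K \<Longrightarrow> g x \<in> K"
    "\<And>x. x \<in> K \<Longrightarrow> g (f x) = x" "\<And>x. x \<in> K \<Longrightarrow> f (g x) = x" using homeos_inverse[OF h(1)] by blast
  have "has_knaster_degree p f 1" using degree_eq_1[of f, OF g(2)] h(2) by simp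
  then show ?thesis using homeo_lift_lp[OF g] that by blast
qed

lemma lp_homeos1:
  assumes F: "lp F"
  obtains f where "f \<in> knaster_homeos1 p" "\<And>t. f (\<phi> t) = \<phi> (F t)"
proof -
  obtain e where e: "continuous_on K e" "\<forall>x\<in>K. e x \<in> K" "\<forall>t. e (\<phi> t) = \<phi> (F t)" using lp_extension[OF F] by blast
  obtain e' where e': "continuous_on K e'" "\<forall>x\<in>K. e' x \<in> K" "\<forall>t. e' (\<phi> t) = \<phi> (rinv F t)" using lp_extension[OF lp_inv[OF F]]
    by blast
  have c: "continuous_on K (\<lambda>x. e' (e x))" "continuous_on K (\<lambda>x. e (e' x))"
    by (rule continuous_on_compose2[OF e'(1) e(1)], use e in auto) (rule continuous_on_compose2[OF e(1) e'(1)], use e' in auto)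
  have inv1: "e' (e x) = x" if "x \<in> K" for x
    by (rule agree_on_dense[OF c(1) continuous_on_id _ that]) (simp add: e(3) e'(3) lpD[OF F])
  have inv2: "e (e' x) = x" if "x \<in> K" for x
    by (rule agree_on_dense[OF c(2) continuous_on_id _ that]) (simp add: e(3) e'(3) lpD[OF F])
  \<comment> \<open>Elements of \<open>Bij K\<close> are undefined outside \<open>K\<close>, hence
    the restriction.\<close>
  define f where "f = restrict e K"
  have fK: "f x = e x" if "x \<in> K" for x using that by (simp add: f_def)
  have fc: "continuous_on K f" using e(1) fK by (metis continuous_on_cong)
  have "homeomorphic_maps (top_of_set K) (top_of_set K) f e'"
    unfolding homeomorphic_maps_def using fc e'(1,2) e(2) inv1 inv2 fK by auto
  then have hm: "homeomorphic_map (top_of_set K) (top_of_set K) f" unfolding homeomorphic_map_maps by blast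
  have "bij_betw f K K"
    by (rule bij_betw_byWitness[of _ e']) (use inv1 inv2 fK e(2) e'(2) in auto)
  then have "f \<in> Bij K" unfolding Bij_def f_def by auto
  then have kh: "f \<in> knaster_homeos p" using hm by (simp add: knaster_homeos_def)
  have ff: "f x \<in> K" if "x \<in> K" for x using fK e(2) that by simp
  have f\<phi>: "f (\<phi> t) = \<phi> (F t)" for t using fK[OF \<phi>_in] e(3) by simp
  have "has_knaster_degree p f 1" by (rule lift_degree[OF F fc ff f\<phi>])
  then have "f \<in> knaster_homeos1 p" using kh degree_eq_1[of f, OF ff] by (simp add: knaster_homeos1_def)
  then show ?thesis using that f\<phi> by blast
qed

subsection \<open>The comeager conjugacy class\<close>

lemma homeos1_continuous:
  assumes "f \<in> knaster_homeos1 p" shows "continuous_on K f" "\<And>x. x \<in> K \<Longrightarrow> f x \<in> K" "f \<in> extensional K" "f \<in> Bij K"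
proof -
  have h: "f \<in> knaster_homeos p" using assms by (simp add: knaster_homeos1_def)
  then show "f \<in> Bij K" by (simp add: knaster_homeos_def)
  then show "f \<in> extensional K" by (simp add: Bij_def)
  show "continuous_on K f" "\<And>x. x \<in> K \<Longrightarrow> f x \<in> K" using homeos_inverse[OF h] by blast+
qed

lemma lift_determines:
  assumes "f \<in> knaster_homeos1 p" "g \<in> knaster_homeos1 p" "\<And>t. f (\<phi> t) = g (\<phi> t)"
  shows "f = g"
proof (rule extensionalityI[OF homeos1_continuous(3)[OF assms(1)] homeos1_continuous(3)[OF assms(2)]])
  fix x assume "x \<in> K"
  then show "f x = g x" using agree_on_dense homeos1_continuous(1) assms by blast
qed

text \<open>\<open>\<phi>\<close> identifies only \<open>t\<close> with \<open>- t\<close>, and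
  increasing maps that fix 0 preserve the sign.\<close>

lemma lift_unique:
  assumes F: "lp F" "lp G" and eq: "\<And>t. \<phi> (F t) = \<phi> (G t)" shows "F = G"
proof
  fix t
  have pos: "F t = G t" if "0 \<le> t" for t
  proof -
    have "0 \<le> F t" "0 \<le> G t" using lpD(1) F lp_0 that by (metis strict_mono_less_eq)+
    then show ?thesis using \<phi>_inj eq by blast
  qed
  show "F t = G t" using pos[of t] pos[of "- t"] lp_odd F by (cases "t \<ge> 0") (auto, metis minus_minus neg_equal_iff_equal)
qed

lemma lift_close:
  assumes f: "f \<in> knaster_homeos1 p" "g \<in> knaster_homeos1 p"
    and F: "\<And>t. f (\<phi> t) = \<phi> (F t)" "\<And>t. g (\<phi> t) = \<phi> (G t)" and cl: "close d F G" and x: "x \<in> K"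
  shows "dist (f x) (g x) \<le> 2 * d"
proof (rule bound_on_dense[OF homeos1_continuous(1)[OF f(1)] homeos1_continuous(1)[OF f(2)] _ x])
  fix t
  have "dist (\<phi> (F t)) (\<phi> (G t)) \<le> 2 * \<bar>F t - G t\<bar>" by (rule \<phi>_dist)
  then show "dist (f (\<phi> t)) (g (\<phi> t)) \<le> 2 * d" using closeD[OF cl, of t] F by simp
qed

text \<open>The converse of \<open>lift_close\<close>: the coordinate 0 of
  \<open>\<phi> (F t)\<close> is \<open>zig (F t)\<close>, from which
  \<open>monotone_zig_close\<close> recovers \<open>F\<close>. So the uniform topologies on
  homeomorphisms and on lifts correspond.\<close>

lemma close_lift:
  assumes "e > 0"
  obtains d where "d > 0" "\<And>F G. lp F \<Longrightarrow> lp G \<Longrightarrow> (\<And>t. dist (\<phi> (F t)) (\<phi> (G t)) < d) \<Longrightarrow> close e F G"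
proof -
  define e1 where "e1 = min (e/3) (1/8)"
  have e1: "e1 > 0" "3 * e1 \<le> e" "e1 < 1/4" using assms by (auto simp: e1_def)
  obtain d where d: "d > 0" "\<And>x y :: nat \<Rightarrow> real. dist x y < d \<Longrightarrow> \<bar>x 0 - y 0\<bar> < e1" using dist_coord[OF e1(1), of 0] by blast
  have "close e F G" if F: "lp F" "lp G" and c: "\<And>t. dist (\<phi> (F t)) (\<phi> (G t)) < d" for F G
  proof -
    have z: "\<bar>zig (F t) - zig (G t)\<bar> \<le> e1" for t using d(2)[OF c[of t]] by (simp add: \<phi>_0th)
    have mono: "mono_on S H" if "lp H" for H S using lpD(1)[OF that] by (auto simp: mono_on_def strict_mono_less_eq)
    have half: "\<bar>F t - G t\<bar> \<le> 3 * e1" if "0 \<le> t" for t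
      by (rule monotone_zig_close[where a = 0 and b = t and F = F and G = G])
        (use F mono lp_continuous lp_0[OF F(1)] lp_0[OF F(2)] e1 z that in auto)
    have "\<bar>F t - G t\<bar> \<le> 3 * e1" for t
      using half[of t] half[of "- t"] lp_odd[OF F(1), of t] lp_odd[OF F(2), of t] by (cases "t \<ge> 0") auto
    then show ?thesis using e1(2) order_trans unfolding close_def by blast
  qed
  then show ?thesis using that d(1) by blast
qed

abbreviation X :: "((nat \<Rightarrow> real) \<Rightarrow> nat \<Rightarrow> real) topology" where "X \<equiv> knaster_homeos1_topology p"

definition CM :: "((nat \<Rightarrow> real) \<Rightarrow> nat \<Rightarrow> real) metric" where
  "CM = cfunspace (top_of_set K) euclidean_metric"

lemma X_eq: "X = subtopology (mtopology_of CM) (knaster_homeos1 p)"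
  by (simp add: knaster_homeos1_topology_def CM_def)

lemma homeos1_mspace: "knaster_homeos1 p \<subseteq> mspace CM"
  using topspace_knaster_homeos1_topology[of p] unfolding X_eq by (metis inf_le1 topspace_mtopology_of topspace_subtopology)

lemma CM_dist_le:
  assumes "f \<in> knaster_homeos1 p" "g \<in> knaster_homeos1 p"
  shows "mdist CM f g \<le> d \<longleftrightarrow> (\<forall>x\<in>K. dist (f x) (g x) \<le> d)"
proof -
  have "K \<noteq> {}" using \<phi>_in by blast
  then show ?thesis using cfunspace_mdist_le[of f "top_of_set K" euclidean_metric g d] assms homeos1_mspace
    unfolding CM_def by auto
qed

lemma openin_X:
  "openin X S \<longleftrightarrow> S \<subseteq> knaster_homeos1 p \<and> (\<forall>f\<in>S. \<exists>r>0. \<forall>g\<in>knaster_homeos1 p. mdist CM f g < r \<longrightarrow> g \<in> S)"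
proof -
  define m where "m = submetric CM (knaster_homeos1 p)"
  have ms: "mspace m = knaster_homeos1 p" "mdist m = mdist CM" using homeos1_mspace by (auto simp: m_def)
  interpret M: Metric_space "mspace m" "mdist m" by (rule Metric_space_mspace_mdist)
  have X: "X = M.mtopology" unfolding X_eq m_def[symmetric] mtopology_of_submetric[symmetric] by (simp add: mtopology_of_def)
  have o: "openin M.mtopology S \<longleftrightarrow> S \<subseteq> mspace m \<and> (\<forall>f. f \<in> S \<longrightarrow> (\<exists>r>0. M.mball f r \<subseteq> S))"
    by (rule M.openin_mtopology)
  have b: "M.mball f r \<subseteq> S \<longleftrightarrow> (\<forall>g\<in>knaster_homeos1 p. mdist CM f g < r \<longrightarrow> g \<in> S)" if "f \<in> mspace m" for f r
    using that unfolding M.mball_def unfolding ms by blast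
  then show ?thesis unfolding X o ms(1)[symmetric] by blast
qed

definition lift :: "((nat \<Rightarrow> real) \<Rightarrow> nat \<Rightarrow> real) \<Rightarrow> real \<Rightarrow> real" where
  "lift f = (SOME F. lp F \<and> (\<forall>t. f (\<phi> t) = \<phi> (F t)))"

lemma lift: assumes "f \<in> knaster_homeos1 p" shows "lp (lift f)" "f (\<phi> t) = \<phi> (lift f t)"
proof -
  have "\<exists>F. lp F \<and> (\<forall>t. f (\<phi> t) = \<phi> (F t))" using homeos1_lift[OF assms] by blast
  then have "lp (lift f) \<and> (\<forall>t. f (\<phi> t) = \<phi> (lift f t))" unfolding lift_def by (rule someI_ex)
  then show "lp (lift f)" "f (\<phi> t) = \<phi> (lift f t)" by auto
qed

lemma lift_eqI:
  assumes "f \<in> knaster_homeos1 p" "lp F" "\<And>t. f (\<phi> t) = \<phi> (F t)" shows "lift f = F"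
  using lift_unique lift[OF assms(1)] assms by metis

lemma open_lift:
  assumes "open_pred A" shows "openin X {f \<in> knaster_homeos1 p. A (lift f)}"
  unfolding openin_X
proof (intro conjI ballI)
  fix f assume "f \<in> {f \<in> knaster_homeos1 p. A (lift f)}"
  then have f: "f \<in> knaster_homeos1 p" "A (lift f)" by auto
  obtain r where r: "r > 0" "\<And>y. lp y \<Longrightarrow> close r (lift f) y \<Longrightarrow> A y" using assms lift(1)[OF f(1)] f(2) unfolding open_pred_def
    by metis
  obtain d where d: "d > 0" "\<And>F G. lp F \<Longrightarrow> lp G \<Longrightarrow> (\<And>t. dist (\<phi> (F t)) (\<phi> (G t)) < d) \<Longrightarrow> close r F G" using close_lift[OF r(1)]
    by blast
  have "A (lift g)" if g: "g \<in> knaster_homeos1 p" "mdist CM f g < d" for g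
  proof -
    have le: "dist (f x) (g x) \<le> mdist CM f g" if "x \<in> K" for x using CM_dist_le[OF f(1) g(1)] that by blast
    have "dist (\<phi> (lift f t)) (\<phi> (lift g t)) < d" for t
      using le[OF \<phi>_in[of t]] g(2) unfolding lift(2)[OF f(1)] lift(2)[OF g(1)] by linarith
    then show ?thesis by (intro r(2) d(2) lift(1) f g)
  qed
  then show "\<exists>r>0. \<forall>g\<in>knaster_homeos1 p. mdist CM f g < r \<longrightarrow> g \<in> {f \<in> knaster_homeos1 p. A (lift f)}" using d(1) by blast
qed auto

lemma nowhere_dense_lift:
  assumes A: "open_pred A" "dense_pred A" shows "nowhere_dense_in X {f \<in> knaster_homeos1 p. \<not> A (lift f)}"
proof -
  define N where "N = {f \<in> knaster_homeos1 p. \<not> A (lift f)}"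
  have top: "topspace X = knaster_homeos1 p" by (rule topspace_knaster_homeos1_topology)
  have "topspace X - N = {f \<in> knaster_homeos1 p. A (lift f)}" by (auto simp: top N_def)
  then have "closedin X N" using open_lift[OF A(1)] by (simp add: closedin_def top N_def)
  then have "X closure_of N = N" by (rule closure_of_closedin)
  moreover have "X interior_of N = {}"
    unfolding interior_of_eq_empty
  proof (intro allI impI)
    fix T assume T: "openin X T \<and> T \<subseteq> N"
    show "T = {}"
    proof (rule ccontr)
      assume "T \<noteq> {}"
      then obtain f where f: "f \<in> T" by blast
      then obtain r where r: "r > 0" "\<forall>g\<in>knaster_homeos1 p. mdist CM f g < r \<longrightarrow> g \<in> T" using T unfolding openin_X by blast
      have fh: "f \<in> knaster_homeos1 p" using f T by (auto simp: N_def)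
      \<comment> \<open>\<open>lift_close\<close> doubles the distance, and
        \<open>2 * (r / 4)\<close> is still below \<open>r\<close>.\<close>
      obtain y where y: "lp y" "close (r/4) (lift f) y" "A y" using A(2) lift(1)[OF fh] r(1) unfolding dense_pred_def
        by (metis divide_pos_pos zero_less_numeral)
      obtain g where g: "g \<in> knaster_homeos1 p" "\<And>t. g (\<phi> t) = \<phi> (y t)" using lp_homeos1[OF y(1)] by metis
      have "dist (f x) (g x) \<le> 2 * (r/4)" if "x \<in> K" for x
        by (rule lift_close[OF fh g(1) lift(2)[OF fh] g(2) y(2) that])
      then have "mdist CM f g \<le> 2 * (r/4)" using CM_dist_le[OF fh g(1)] by blast
      then have "g \<in> T" using r g(1) by auto
      then have "\<not> A (lift g)" using T by (auto simp: N_def)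
      then show False using lift_eqI[OF g(1) y(1) g(2)] y(3) by simp
    qed
  qed
  ultimately show ?thesis unfolding nowhere_dense_in_def by (auto simp: top N_def)
qed

lemma nowhere_dense_subset:
  assumes "nowhere_dense_in Y S" "T \<subseteq> S" shows "nowhere_dense_in Y T"
proof -
  have "Y interior_of (Y closure_of T) \<subseteq> Y interior_of (Y closure_of S)"
    by (intro interior_of_mono closure_of_mono assms)
  then show ?thesis using assms by (auto simp: nowhere_dense_in_def)
qed

definition conj_by :: "((nat \<Rightarrow> real) \<Rightarrow> nat \<Rightarrow> real) \<Rightarrow> ((nat \<Rightarrow> real) \<Rightarrow> nat \<Rightarrow> real) \<Rightarrow> (nat \<Rightarrow> real) \<Rightarrow> nat \<Rightarrow> real" where
  "conj_by u h = inv\<^bsub>BijGroup K\<^esub> h \<otimes>\<^bsub>BijGroup K\<^esub> u \<otimes>\<^bsub>BijGroup K\<^esub> h"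

text \<open>Membership is shown by comparison with the homeomorphism that \<open>lp_homeos1\<close>
  constructs from the conjugated lift: both agree on the dense half-line. In the product the inverse
  of \<open>h\<close> stands on the left, so the lift is conjugated by
  \<open>rinv (lift h)\<close>.\<close>

lemma conj_by:
  assumes u: "u \<in> knaster_homeos1 p" and h: "h \<in> knaster_homeos1 p"
  shows "conj_by u h \<in> knaster_homeos1 p" "lift (conj_by u h) = cj (rinv (lift h)) (lift u)"
proof -
  have hh: "h \<in> knaster_homeos p" using h by (simp add: knaster_homeos1_def)
  obtain g where g: "continuous_on K h" "\<And>x. x \<in> K \<Longrightarrow> h x \<in> K" "continuous_on K g" "\<And>x. x \<in> K \<Longrightarrow> g x \<in> K"
    "\<And>x. x \<in> K \<Longrightarrow> g (h x) = x" "\<And>x. x \<in> K \<Longrightarrow> h (g x) = x" using homeos_inverse[OF hh] by blast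
  have hB: "h \<in> Bij K" "u \<in> Bij K" using homeos1_continuous(4) u h by auto
  have inj: "inj_on h K" using hB(1) by (simp add: Bij_def bij_betw_def)
  have hi: "inv_into K h x = g x" if "x \<in> K" for x
    using inv_into_f_f[OF inj g(4)[OF that]] g(6)[OF that] by simp
  have iB: "(\<lambda>x\<in>K. inv_into K h x) \<in> Bij K" using hB(1) by (rule restrict_inv_into_Bij)
  have e: "conj_by u h = compose K (compose K (\<lambda>x\<in>K. inv_into K h x) u) h"
    using hB iB compose_Bij[OF iB hB(2)] unfolding conj_by_def inv_BijGroup[OF hB(1)] by (simp add: BijGroup_def)
  have uK: "u x \<in> K" if "x \<in> K" for x using homeos1_continuous(2)[OF u] that by blast
  have w: "conj_by u h x = g (u (h x))" if "x \<in> K" for x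
    unfolding e using that g(2) uK hi by (simp add: compose_def)
  have "continuous_on K (\<lambda>x. u (h x))"
    by (rule continuous_on_compose2[OF homeos1_continuous(1)[OF u] g(1)]) (use g(2) in auto)
  then have "continuous_on K (\<lambda>x. g (u (h x)))"
    by (rule continuous_on_compose2[OF g(3)]) (use g(2) uK in auto)
  then have wc: "continuous_on K (conj_by u h)" using w by (metis (no_types, lifting) continuous_on_cong)
  have we: "conj_by u h \<in> extensional K" unfolding e by (rule compose_extensional)
  note H = lift[OF h] and U = lift[OF u]
  have gl: "g (\<phi> t) = \<phi> (rinv (lift h) t)" for t
  proof -
    have "h (\<phi> (rinv (lift h) t)) = \<phi> t" using H(2) lpD(4)[OF H(1)] by simp
    then show ?thesis using g(5)[OF \<phi>_in] by metis
  qed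
  have wl: "conj_by u h (\<phi> t) = \<phi> (cj (rinv (lift h)) (lift u) t)" for t
    unfolding w[OF \<phi>_in] H(2) U(2) gl cj_def using inv_inv_eq[OF lpD(3)[OF H(1)]] by simp
  have cl: "lp (cj (rinv (lift h)) (lift u))" by (intro lp_cj lp_inv H U)
  obtain w' where w': "w' \<in> knaster_homeos1 p" "\<And>t. w' (\<phi> t) = \<phi> (cj (rinv (lift h)) (lift u) t)" using lp_homeos1[OF cl] by metis
  have "conj_by u h = w'"
  proof (rule extensionalityI[OF we homeos1_continuous(3)[OF w'(1)]])
    fix x assume "x \<in> K"
    then show "conj_by u h x = w' x" using agree_on_dense[OF wc homeos1_continuous(1)[OF w'(1)]] wl w'(2) by simp
  qed
  then show ch: "conj_by u h \<in> knaster_homeos1 p" using w'(1) by simp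
  show "lift (conj_by u h) = cj (rinv (lift h)) (lift u)" by (rule lift_eqI[OF ch cl wl])
qed

lemma comeager_conjugacy_class:
  "\<exists>u\<in>knaster_homeos1 p. comeager_in X {conj_by u h | h. h \<in> knaster_homeos1 p}"
proof -
  obtain \<S> where S: "countable \<S>" "\<And>A. A \<in> \<S> \<Longrightarrow> open_pred A \<and> dense_pred A"
    "\<And>x. lp x \<Longrightarrow> (\<And>A. A \<in> \<S> \<Longrightarrow> A x) \<Longrightarrow> loc_dense x \<and> orb_dense x"
    using generic_family[OF local_transitivity global_transitivity] by blast
  obtain y where y: "lp y" "\<And>A. A \<in> \<S> \<Longrightarrow> A y" using baire_point[OF S(1,2)] by blast
  have yd: "loc_dense y" "orb_dense y" using S(3)[OF y(1)] y(2) by auto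
  obtain u where u: "u \<in> knaster_homeos1 p" "\<And>t. u (\<phi> t) = \<phi> (y t)" using lp_homeos1[OF y(1)] by metis
  have lu: "lift u = y" by (rule lift_eqI[OF u(1) y(1) u(2)])
  define C where "C = {conj_by u h | h. h \<in> knaster_homeos1 p}"
  have C: "C \<subseteq> knaster_homeos1 p" using conj_by(1)[OF u(1)] by (auto simp: C_def)
  have top: "topspace X = knaster_homeos1 p" by (rule topspace_knaster_homeos1_topology)
  \<comment> \<open>\<open>meager_in\<close> asks for an exact union, so the part inside the class
    is removed from each nowhere dense set.\<close>
  define N where "N = (\<lambda>A. {f \<in> knaster_homeos1 p. \<not> A (lift f)} - C)"
  have "f \<in> C" if f: "f \<in> knaster_homeos1 p" "\<And>A. A \<in> \<S> \<Longrightarrow> A (lift f)" for f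
  proof -
    have lf: "lp (lift f)" by (rule lift(1)[OF f(1)])
    have "loc_dense (lift f)" using S(3)[OF lf] f(2) by blast
    then obtain g where g: "lp g" "cj g y = lift f" using conjugate_if_dense[OF y(1) yd lf] by blast
    \<comment> \<open>As the class uses \<open>h\<close> on the right and its inverse on the left,
      \<open>h\<close> has to lift to the inverse of \<open>g\<close>.\<close>
    obtain h where h: "h \<in> knaster_homeos1 p" "\<And>t. h (\<phi> t) = \<phi> (rinv g t)" using lp_homeos1[OF lp_inv[OF g(1)]] by metis
    have lh: "lift h = rinv g" by (rule lift_eqI[OF h(1) lp_inv[OF g(1)] h(2)])
    have "lift (conj_by u h) = lift f"
      unfolding conj_by(2)[OF u(1) h(1)] lh lu inv_inv_eq[OF lpD(3)[OF g(1)]] by (rule g(2))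
    then have "conj_by u h = f"
      by (intro lift_determines[OF conj_by(1)[OF u(1) h(1)] f(1)]) (simp add: lift(2)[OF conj_by(1)[OF u(1) h(1)]]
        lift(2)[OF f(1)])
    then show ?thesis using h(1) by (auto simp: C_def)
  qed
  then have "topspace X - C = \<Union> (N ` \<S>)" unfolding top N_def by blast
  moreover have "nowhere_dense_in X (N A)" if "A \<in> \<S>" for A
    unfolding N_def by (rule nowhere_dense_subset[OF nowhere_dense_lift]) (use S(2)[OF that] in auto)
  ultimately have "meager_in X (topspace X - C)" unfolding meager_in_def using S(1) by (intro exI[of _ "N ` \<S>"]) auto
  then have "comeager_in X C" unfolding comeager_in_def using C top by simp
  then show ?thesis using u(1) unfolding C_def by blast
qed

end

theorem theorem5p3:
  fixes p :: "nat \<Rightarrow> nat"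
  assumes "universal_prime_sequence p"
  shows "\<exists>u \<in> knaster_homeos1 p.
           comeager_in (knaster_homeos1_topology p)
             {inv\<^bsub>BijGroup (knaster p)\<^esub> h \<otimes>\<^bsub>BijGroup (knaster p)\<^esub> u \<otimes>\<^bsub>BijGroup (knaster p)\<^esub> h
               | h. h \<in> knaster_homeos1 p}"
proof -
  interpret universal_knaster p by unfold_locales (rule assms)
  show ?thesis using comeager_conjugacy_class unfolding conj_by_def .
qed

end
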